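(* Let $\mathfrak{S}\subset[0,\infty)$ be an arbitrary closed set with $0\in\mathfrak{S}$. Let $(s_k)_{k\in\mathbb{N}}$ be a sequence of positive real numbers whose set of accumulation points in $\mathbb{R}$ is $\mathfrak{S}\setminus\{0\}$ if $0$ is an isolated point of $\mathfrak{S}$, and is $\mathfrak{S}$ otherwise. Let $(d_k)_{k\in\mathbb{N}}$ be a sequence of positive numbers such that $$s_k<(\pi/d_k)^2\quad (k\in\mathbb{N}),\qquad \sum_{k\in\mathbb{N}}d_k<\infty .$$ Let $(q_k)_{k\in\mathbb{N}}$ be a sequence of positive numbers such that the second eigenvalue of the operator $\mathbf{A}_{q_k,\mathcal{I}_k}$ satisfies $$\lambda_2(\mathbf{A}_{q_k,\mathcal{I}_k})=s_k,\qquad k\in\mathbb{N},$$ and let $(p_k)_{k\in\mathbb{N}}$ be a sequence of positive numbers such that $$\rho_k:=\max\left\{\frac{1}{p_kd_k},\ \frac{1}{p_kd_{k+1}}\right\}\to0\quad\text{as }k\to\infty .$$ Then the self-adjoint Schr\"odinger operator $A_{p,q}$ in $\mathsf{L}^2(a,b)$ with $\delta'$-interactions of strengths $(q_k)_{k\in\mathbb{N}}$ at the points $(y_k)_{k\in\mathbb{N}}$ and of strengths $(p_k)_{k\in\mathbb{N}}$ at the points $(x_k)_{k\in\mathbb{N}}$ satisfies $$\sigma_{\mathrm{ess}}(A_{p,q})=\mathfrak{S}.$$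
   Context: Accumulation points of a sequence are the limits of its convergent subsequences (so a value repeated infinitely often is an accumulation point). For a self-adjoint operator $A$, the discrete spectrum consists of the isolated points of $\sigma(A)$ that are eigenvalues of finite multiplicity, and $\sigma_{\mathrm{ess}}(A)$ is the complement of the discrete spectrum in $\sigma(A)$. Given a summable sequence $(d_k)_{k\in\mathbb{N}}$ of positive numbers, put $$x_0=0,\quad x_k=x_{k-1}+d_k,\quad y_k=\frac{x_{k-1}+x_k}{2},\quad \mathcal{I}_k=(x_{k-1},x_k)\quad(k\in\mathbb{N}),\qquad a=0,\quad b=\sum_{k\in\mathbb{N}}d_k .$$ For $q_k\in(0,\infty)$ let $\mathbf{A}_{q_k,\mathcal{I}_k}$ be the nonnegative self-adjoint operator in $\mathsf{L}^2(\mathcal{I}_k)$ associated, via the first representation theorem, with the densely defined, nonnegative, closed form $$\mathbf{a}_{q_k,\mathcal{I}_k}[\mathbf{u},\mathbf{v}]=\int_{\mathcal{I}_k}\mathbf{u}'\,\overline{\mathbf{v}'}\,\mathrm{d}x+\frac1{q_k}\bigl(\mathbf{u}(y_k+0)-\mathbf{u}(y_k-0)\bigr)\overline{\bigl(\mathbf{v}(y_k+0)-\mathbf{v}(y_k-0)\bigr)},\quad \mathrm{dom}(\mathbf{a}_{q_k,\mathcal{I}_k})=\mathsf{H}^1(\mathcal{I}_k\setminus\{y_k\}),$$ where $\mathbf{u}'$ is the derivative on $\mathcal{I}_k\setminus\{y_k\}$. Its spectrum is purely discrete, and $\lambda_j(\mathbf{A}_{q_k,\mathcal{I}_k})$, $j\in\mathbb{N}$,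 denote its eigenvalues counted with multiplicities and ordered nondecreasingly. For sequences $p=(p_k)_{k\in\mathbb{N}}$, $q=(q_k)_{k\in\mathbb{N}}$ of positive numbers, the operator $A_{p,q}$ is the nonnegative self-adjoint operator in $\mathsf{L}^2(a,b)$ associated, via the first representation theorem, with the densely defined, nonnegative, closed form $$\mathfrak{a}_{p,q}[u,v]=\sum_{k\in\mathbb{N}}\mathbf{a}_{q_k,\mathcal{I}_k}[\mathbf{u}_k,\mathbf{v}_k]+\sum_{k\in\mathbb{N}}\frac1{p_k}\bigl(u(x_k+0)-u(x_k-0)\bigr)\overline{\bigl(v(x_k+0)-v(x_k-0)\bigr)},$$ $$\mathrm{dom}(\mathfrak{a}_{p,q})=\bigl\{u\in\mathsf{L}^2(a,b):\ \mathbf{u}_k\in\mathsf{H}^1(\mathcal{I}_k\setminus\{y_k\})\ \text{for all }k\in\mathbb{N},\ \mathfrak{a}_{p,q}[u,u]<\infty\bigr\},$$ where $\mathbf{u}_k$ denotes the restriction of $u$ to $\mathcal{I}_k$. *)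

theory Defs
  imports "HOL-Analysis.Analysis"
begin

section \<open>Operators in \<open>L\<^sup>2(M)\<close>\<close>

text \<open>
  Elements of \<open>L\<^sup>2(M)\<close> are represented by functions, equality in \<open>L\<^sup>2(M)\<close> is equality
  almost everywhere. An operator is represented by the set of all pairs \<open>(u, f)\<close> of representatives
  such that \<open>u\<close> is in its domain and is mapped to \<open>f\<close>; this set is closed under changes of
  \<open>u\<close> and \<open>f\<close> on null sets. The inner product is linear in its first argument.
\<close>

definition L2 :: "'a measure \<Rightarrow> ('a \<Rightarrow> complex) set" where
  "L2 M = {u \<in> borel_measurable M. integrable M (\<lambda>x. (cmod (u x))\<^sup>2)}"

definition l2_inner :: "'a measure \<Rightarrow> ('a \<Rightarrow> complex) \<Rightarrow> ('a \<Rightarrow> complex) \<Rightarrow> complex" where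
  "l2_inner M u v = (LINT x|M. u x * cnj (v x))"

definition l2_norm :: "'a measure \<Rightarrow> ('a \<Rightarrow> complex) \<Rightarrow> real" where
  "l2_norm M u = sqrt (LINT x|M. (cmod (u x))\<^sup>2)"

type_synonym 'a l2_operator = "(('a \<Rightarrow> complex) \<times> ('a \<Rightarrow> complex)) set"

text \<open>
  The operator associated with a form \<open>a\<close> with domain \<open>D\<close> by the first representation theorem:
  \<open>u \<in> dom(A)\<close> and \<open>A u = f\<close> iff \<open>u \<in> D\<close>, \<open>f \<in> L\<^sup>2(M)\<close> and \<open>a[u,v] = (f,v)\<close> for all \<open>v \<in> D\<close>.
\<close>

definition form_operator ::
  "'a measure \<Rightarrow> ('a \<Rightarrow> complex) set \<Rightarrow> (('a \<Rightarrow> complex) \<Rightarrow> ('a \<Rightarrow> complex) \<Rightarrow> complex)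
    \<Rightarrow> 'a l2_operator" where
  "form_operator M D a = {(u, f). u \<in> D \<and> f \<in> L2 M \<and> (\<forall>v\<in>D. a u v = l2_inner M f v)}"

text \<open>\<open>z\<close> is in the resolvent set iff \<open>A - z\<close> is onto \<open>L\<^sup>2(M)\<close> and one-to-one with bounded inverse.\<close>

definition resolvent_set :: "'a measure \<Rightarrow> 'a l2_operator \<Rightarrow> complex set" where
  "resolvent_set M A = {z.
     (\<forall>g\<in>L2 M. \<exists>(u, f)\<in>A. AE x in M. f x - z * u x = g x) \<and>
     (\<exists>C. \<forall>(u, f)\<in>A. l2_norm M u \<le> C * l2_norm M (\<lambda>x. f x - z * u x))}"

definition spectrum :: "'a measure \<Rightarrow> 'a l2_operator \<Rightarrow> complex set" where
  "spectrum M A = - resolvent_set M A"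

definition eigenspace :: "'a l2_operator \<Rightarrow> complex \<Rightarrow> ('a \<Rightarrow> complex) set" where
  "eigenspace A z = {u. (u, \<lambda>x. z * u x) \<in> A}"

definition is_eigenvalue :: "'a measure \<Rightarrow> 'a l2_operator \<Rightarrow> complex \<Rightarrow> bool" where
  "is_eigenvalue M A z \<longleftrightarrow> (\<exists>u\<in>eigenspace A z. \<not> (AE x in M. u x = 0))"

definition ae_independent :: "'a measure \<Rightarrow> nat \<Rightarrow> (nat \<Rightarrow> 'a \<Rightarrow> complex) \<Rightarrow> bool" where
  "ae_independent M n e \<longleftrightarrow>
     (\<forall>c. (AE x in M. (\<Sum>i<n. c i * e i x) = 0) \<longrightarrow> (\<forall>i<n. c i = 0))"

definition ae_dim :: "'a measure \<Rightarrow> ('a \<Rightarrow> complex) set \<Rightarrow> enat" where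
  "ae_dim M V = Sup {enat n |n. \<exists>e. (\<forall>i<n. e i \<in> V) \<and> ae_independent M n e}"

definition multiplicity_eigval :: "'a measure \<Rightarrow> 'a l2_operator \<Rightarrow> complex \<Rightarrow> enat" where
  "multiplicity_eigval M A z = ae_dim M (eigenspace A z)"

definition discrete_spectrum :: "'a measure \<Rightarrow> 'a l2_operator \<Rightarrow> complex set" where
  "discrete_spectrum M A = {z. z isolated_in spectrum M A \<and> is_eigenvalue M A z \<and>
     multiplicity_eigval M A z < \<infinity>}"

definition essential_spectrum :: "'a measure \<Rightarrow> 'a l2_operator \<Rightarrow> complex set" where
  "essential_spectrum M A = spectrum M A - discrete_spectrum M A"

text \<open>
  \<open>lam 1 \<le> lam 2 \<le> \<dots>\<close> is the list of all eigenvalues, each repeated according to its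
  multiplicity; numbers that are not eigenvalues have multiplicity \<open>0\<close>. The value \<open>lam 0\<close> is
  irrelevant.
\<close>

definition eigenvalue_sequence :: "'a measure \<Rightarrow> 'a l2_operator \<Rightarrow> (nat \<Rightarrow> real) \<Rightarrow> bool" where
  "eigenvalue_sequence M A lam \<longleftrightarrow> mono_on {1..} lam \<and>
     (\<forall>z. finite {j. 1 \<le> j \<and> complex_of_real (lam j) = z} \<and>
          multiplicity_eigval M A z = enat (card {j. 1 \<le> j \<and> complex_of_real (lam j) = z}))"

definition is_nth_eigenvalue :: "'a measure \<Rightarrow> 'a l2_operator \<Rightarrow> nat \<Rightarrow> real \<Rightarrow> bool" where
  "is_nth_eigenvalue M A j t \<longleftrightarrow> (\<exists>lam. eigenvalue_sequence M A lam \<and> lam j = t)"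


section \<open>Sobolev spaces and traces in one dimension\<close>

text \<open>
  Weak derivatives on an open set \<open>\<Omega> \<subseteq> \<real>\<close>, tested with continuously differentiable functions with
  compact support in \<open>\<Omega>\<close> (as in Brezis, ``Functional Analysis, Sobolev Spaces and PDE'', Section 8.2).
\<close>

definition test_functions :: "real set \<Rightarrow> (real \<Rightarrow> real) set" where
  "test_functions \<Omega> = {\<phi>. \<phi> C1_differentiable_on UNIV \<and>
     compact (closure {x. \<phi> x \<noteq> 0}) \<and> closure {x. \<phi> x \<noteq> 0} \<subseteq> \<Omega>}"

definition is_weak_deriv :: "real set \<Rightarrow> (real \<Rightarrow> complex) \<Rightarrow> (real \<Rightarrow> complex) \<Rightarrow> bool" where
  "is_weak_deriv \<Omega> u g \<longleftrightarrow> (\<forall>\<phi>\<in>test_functions \<Omega>.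
     (LINT x|lebesgue_on \<Omega>. deriv \<phi> x *\<^sub>R u x) = - (LINT x|lebesgue_on \<Omega>. \<phi> x *\<^sub>R g x))"

definition H1 :: "real set \<Rightarrow> (real \<Rightarrow> complex) set" where
  "H1 \<Omega> = {u \<in> L2 (lebesgue_on \<Omega>). \<exists>g\<in>L2 (lebesgue_on \<Omega>). is_weak_deriv \<Omega> u g}"

text \<open>The derivative is determined up to null sets for \<open>u \<in> H1 \<Omega>\<close>.\<close>

definition weak_deriv :: "real set \<Rightarrow> (real \<Rightarrow> complex) \<Rightarrow> real \<Rightarrow> complex" where
  "weak_deriv \<Omega> u = (SOME g. g \<in> L2 (lebesgue_on \<Omega>) \<and> is_weak_deriv \<Omega> u g)"

text \<open>
  The traces \<open>u(y+0)\<close> and \<open>u(y-0)\<close>: one-sided limits at \<open>y\<close> of a representative of \<open>u\<close>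
  for which the limit exists. The limit does not depend on the representative.
\<close>

definition trace_right :: "(real \<Rightarrow> complex) \<Rightarrow> real \<Rightarrow> complex" where
  "trace_right u y = (THE l. \<exists>w. (AE x in lebesgue. w x = u x) \<and> (w \<longlongrightarrow> l) (at_right y))"

definition trace_left :: "(real \<Rightarrow> complex) \<Rightarrow> real \<Rightarrow> complex" where
  "trace_left u y = (THE l. \<exists>w. (AE x in lebesgue. w x = u x) \<and> (w \<longlongrightarrow> l) (at_left y))"

definition trace_jump :: "(real \<Rightarrow> complex) \<Rightarrow> real \<Rightarrow> complex" where
  "trace_jump u y = trace_right u y - trace_left u y"


section \<open>Schroedinger operators with \<open>\<delta>'\<close>-interactions\<close>

text \<open>The form and the operator on an interval \<open>(l, r)\<close> with a single interaction at its midpoint.\<close>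

definition punctured :: "real \<Rightarrow> real \<Rightarrow> real set" where
  "punctured l r = {l<..<r} - {(l + r) / 2}"

definition cell_form ::
  "real \<Rightarrow> real \<Rightarrow> real \<Rightarrow> (real \<Rightarrow> complex) \<Rightarrow> (real \<Rightarrow> complex) \<Rightarrow> complex" where
  "cell_form q l r u v =
     (LINT x|lebesgue_on (punctured l r).
        weak_deriv (punctured l r) u x * cnj (weak_deriv (punctured l r) v x))
     + complex_of_real (1 / q) * (trace_jump u ((l + r) / 2) * cnj (trace_jump v ((l + r) / 2)))"

definition cell_operator :: "real \<Rightarrow> real \<Rightarrow> real \<Rightarrow> real l2_operator" where
  "cell_operator q l r =
     form_operator (lebesgue_on {l<..<r}) (H1 (punctured l r)) (cell_form q l r)"

text \<open>
  All sequences are indexed from \<open>0\<close>: with \<open>node d 0 = 0\<close>, the \<open>k\<close>-th interval is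
  \<open>(node d k, node d (Suc k))\<close> and has length \<open>d k\<close>; the strength \<open>q k\<close> belongs to its midpoint
  and the strength \<open>p k\<close> to its right endpoint \<open>node d (Suc k)\<close>.
\<close>

definition node :: "(nat \<Rightarrow> real) \<Rightarrow> nat \<Rightarrow> real" where
  "node d k = (\<Sum>i<k. d i)"

definition right_end :: "(nat \<Rightarrow> real) \<Rightarrow> real" where
  "right_end d = (\<Sum>k. d k)"

definition dprime_form ::
  "(nat \<Rightarrow> real) \<Rightarrow> (nat \<Rightarrow> real) \<Rightarrow> (nat \<Rightarrow> real) \<Rightarrow> (real \<Rightarrow> complex) \<Rightarrow> (real \<Rightarrow> complex) \<Rightarrow> complex"
where
  "dprime_form d p q u v =
     (\<Sum>k. cell_form (q k) (node d k) (node d (Suc k)) u v)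
     + (\<Sum>k. complex_of_real (1 / p k)
           * (trace_jump u (node d (Suc k)) * cnj (trace_jump v (node d (Suc k)))))"

text \<open>
  The condition \<open>a[u,u] < \<infinity>\<close> means that both series, which have nonnegative terms if \<open>u = v\<close>,
  converge.
\<close>

definition dprime_form_dom ::
  "(nat \<Rightarrow> real) \<Rightarrow> (nat \<Rightarrow> real) \<Rightarrow> (nat \<Rightarrow> real) \<Rightarrow> (real \<Rightarrow> complex) set" where
  "dprime_form_dom d p q = {u \<in> L2 (lebesgue_on {0<..<right_end d}).
     (\<forall>k. u \<in> H1 (punctured (node d k) (node d (Suc k)))) \<and>
     summable (\<lambda>k. cell_form (q k) (node d k) (node d (Suc k)) u u) \<and>
     summable (\<lambda>k. complex_of_real (1 / p k)
           * (trace_jump u (node d (Suc k)) * cnj (trace_jump u (node d (Suc k)))))}"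

definition dprime_operator ::
  "(nat \<Rightarrow> real) \<Rightarrow> (nat \<Rightarrow> real) \<Rightarrow> (nat \<Rightarrow> real) \<Rightarrow> real l2_operator" where
  "dprime_operator d p q =
     form_operator (lebesgue_on {0<..<right_end d}) (dprime_form_dom d p q) (dprime_form d p q)"


section \<open>Accumulation points of sequences\<close>

definition accumulation_points :: "(nat \<Rightarrow> real) \<Rightarrow> real set" where
  "accumulation_points s = {l. \<exists>r. strict_mono r \<and> (s \<circ> r) \<longlonglongrightarrow> l}"

end

theory Submission
  imports Defs "HOL-Library.Function_Algebras"
begin

text \<open>
  Without the interactions at the points \<open>x\<^sub>k\<close> the operator is the orthogonal sum of the cell
  operators. A cell of length \<open>d\<^sub>k\<close> has the eigenvalues \<open>0\<close> and \<open>s\<^sub>k\<close>, and all the others are at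
  least \<open>16 / d\<^sub>k\<^sup>2\<close>, which tends to infinity. By the trace inequality on a cell, the coupling
  at \<open>x\<^sub>k\<close> is bounded by a multiple of \<open>\<rho>\<^sub>k\<close> times the energy of the two adjacent cells. Hence
  for \<open>\<lambda> > 0\<close> that is not an accumulation point of \<open>s\<close> the form of \<open>A - \<lambda>\<close> satisfies an inf-sup
  inequality up to finitely many continuous functionals: in the far cells one tests \<open>u\<close> against
  the function with the sign of its components below \<open>\<lambda>\<close> reversed, and in the remaining cells
  one uses compactness. Such an inequality excludes \<open>\<lambda>\<close> from the essential spectrum. Conversely, the
  eigenfunctions of the cells, extended by zero, form a singular sequence at \<open>0\<close> and at every
  accumulation point of \<open>s\<close>.
\<close>

section \<open>Semi-inner product spaces of functions\<close>

text \<open>The essential spectrum is defined by isolation and multiplicity, so a singular sequence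
  alone only puts a point into the spectrum. If that point were in the discrete spectrum, its
  isolation would give a spectral gap, and the gap turns an orthonormal sequence of approximate
  eigenvectors into arbitrarily many independent eigenvectors. Since functions stand for their
  classes, norms are seminorms, and operators such as the resolvent are linear only up to elements
  of norm \<open>0\<close>. The scale \<open>16 / d^2\<close> comes from Poincare's inequality on
  half a cell, with the constant \<open>h^2 / 4\<close> and \<open>h = d / 2\<close>;
  \<open>pi < 4\<close> keeps \<open>s_k\<close> below it. The square of a trace on a cell is at
  most \<open>(4 |u|^2 + d^2 |u'|^2) / d\<close>; divided by \<open>p_k\<close>, this produces
  \<open>rho_k\<close>. The point \<open>0\<close> comes from the constants on the cells, whether or
  not \<open>s_k\<close> accumulates there, so an isolated \<open>0\<close> may be left out of the
  accumulation points.\<close>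

definition cscale :: "complex \<Rightarrow> ('a \<Rightarrow> complex) \<Rightarrow> 'a \<Rightarrow> complex" where
  "cscale c u = (\<lambda>x. c * u x)"

lemma cscale_apply [simp]: "cscale c u x = c * u x"
  by (simp add: cscale_def)

lemma cscale_minus_one: "cscale (-1) u = - u"
  by (simp add: fun_eq_iff)

text \<open>Positivity without definiteness: functions that agree almost everywhere are different
  elements here, so \<open>nrm\<close> is a seminorm and \<open>nrm (u - v) = 0\<close> takes the
  place of equality.\<close>

locale semi_inner =
  fixes V :: "('a \<Rightarrow> complex) set" and ip :: "('a \<Rightarrow> complex) \<Rightarrow> ('a \<Rightarrow> complex) \<Rightarrow> complex"
  assumes zero_mem [simp]: "0 \<in> V"
    and add_mem [simp]: "u \<in> V \<Longrightarrow> v \<in> V \<Longrightarrow> u + v \<in> V"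
    and scale_mem [simp]: "u \<in> V \<Longrightarrow> cscale c u \<in> V"
    and ip_add: "u \<in> V \<Longrightarrow> v \<in> V \<Longrightarrow> w \<in> V \<Longrightarrow> ip (u + v) w = ip u w + ip v w"
    and ip_scale: "u \<in> V \<Longrightarrow> w \<in> V \<Longrightarrow> ip (cscale c u) w = c * ip u w"
    and ip_cnj: "u \<in> V \<Longrightarrow> v \<in> V \<Longrightarrow> cnj (ip u v) = ip v u"
    and ip_pos: "u \<in> V \<Longrightarrow> 0 \<le> Re (ip u u)"
begin

definition nrm :: "('a \<Rightarrow> complex) \<Rightarrow> real" where
  "nrm u = sqrt (Re (ip u u))"

lemma minus_mem [simp]: "u \<in> V \<Longrightarrow> - u \<in> V"
  using scale_mem[of u "-1"] by (simp add: cscale_minus_one)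

lemma diff_mem [simp]: "u \<in> V \<Longrightarrow> v \<in> V \<Longrightarrow> u - v \<in> V"
  by (metis add_mem minus_mem add.commute uminus_add_conv_diff)

lemma sum_mem: "(\<And>i. i \<in> I \<Longrightarrow> f i \<in> V) \<Longrightarrow> sum f I \<in> V"
  by (induction I rule: infinite_finite_induct) auto

lemma ip_minus: "u \<in> V \<Longrightarrow> w \<in> V \<Longrightarrow> ip (- u) w = - ip u w"
  using ip_scale[of u w "-1"] by (simp add: cscale_minus_one)

lemma ip_diff: "u \<in> V \<Longrightarrow> v \<in> V \<Longrightarrow> w \<in> V \<Longrightarrow> ip (u - v) w = ip u w - ip v w"
  using ip_add[of u "- v" w] by (simp add: ip_minus)

lemma ip_zero [simp]: "w \<in> V \<Longrightarrow> ip 0 w = 0"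
  using ip_diff[of 0 0 w] by simp

lemma ip_zero_right [simp]: "w \<in> V \<Longrightarrow> ip w 0 = 0"
  using ip_cnj[of 0 w] by simp

lemma ip_add_right: "u \<in> V \<Longrightarrow> v \<in> V \<Longrightarrow> w \<in> V \<Longrightarrow> ip w (u + v) = ip w u + ip w v"
  by (metis add_mem complex_cnj_add ip_add ip_cnj)

lemma ip_scale_right: "u \<in> V \<Longrightarrow> w \<in> V \<Longrightarrow> ip w (cscale c u) = cnj c * ip w u"
  by (metis complex_cnj_mult ip_cnj ip_scale scale_mem)

lemma ip_minus_right: "u \<in> V \<Longrightarrow> w \<in> V \<Longrightarrow> ip w (- u) = - ip w u"
  by (metis complex_cnj_minus ip_cnj ip_minus minus_mem)

lemma ip_diff_right: "u \<in> V \<Longrightarrow> v \<in> V \<Longrightarrow> w \<in> V \<Longrightarrow> ip w (u - v) = ip w u - ip w v"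
  by (metis complex_cnj_diff diff_mem ip_cnj ip_diff)

lemma ip_sum: "(\<And>i. i \<in> I \<Longrightarrow> f i \<in> V) \<Longrightarrow> w \<in> V \<Longrightarrow> ip (sum f I) w = (\<Sum>i\<in>I. ip (f i) w)"
  by (induction I rule: infinite_finite_induct) (auto simp: ip_add sum_mem)

lemma ip_sum_right: "(\<And>i. i \<in> I \<Longrightarrow> f i \<in> V) \<Longrightarrow> w \<in> V \<Longrightarrow> ip w (sum f I) = (\<Sum>i\<in>I. ip w (f i))"
  by (induction I rule: infinite_finite_induct) (auto simp: ip_add_right sum_mem)

lemmas ip_simps = ip_add ip_scale ip_minus ip_diff ip_add_right ip_scale_right ip_minus_right
  ip_diff_right

lemma ip_Im [simp]: "u \<in> V \<Longrightarrow> Im (ip u u) = 0"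
  using ip_cnj[of u u] by (simp add: complex_eq_iff)

lemma Re_ip_commute: "u \<in> V \<Longrightarrow> v \<in> V \<Longrightarrow> Re (ip u v) = Re (ip v u)"
  using ip_cnj[of u v] by (simp add: complex_eq_iff)

lemma nrm_nonneg [simp]: "u \<in> V \<Longrightarrow> 0 \<le> nrm u"
  by (simp add: nrm_def ip_pos)

lemma nrm_power2: "u \<in> V \<Longrightarrow> (nrm u)\<^sup>2 = Re (ip u u)"
  by (simp add: nrm_def ip_pos)

lemma ip_self: "u \<in> V \<Longrightarrow> ip u u = complex_of_real ((nrm u)\<^sup>2)"
  by (simp add: nrm_power2 complex_eq_iff)

lemma nrm_zero [simp]: "nrm 0 = 0"
  by (simp add: nrm_def)

lemma nrm_scale: "u \<in> V \<Longrightarrow> nrm (cscale c u) = cmod c * nrm u"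
proof -
  assume u: "u \<in> V"
  have "ip (cscale c u) (cscale c u) = (c * cnj c) * ip u u"
    using u by (simp add: ip_simps)
  also have "\<dots> = complex_of_real ((cmod c)\<^sup>2 * (nrm u)\<^sup>2)"
    using u by (simp add: ip_self complex_norm_square[symmetric])
  finally have "nrm (cscale c u) = sqrt ((cmod c * nrm u)\<^sup>2)"
    unfolding nrm_def[of "cscale c u"] by (simp add: power_mult_distrib)
  then show ?thesis using u by simp
qed

lemma nrm_minus [simp]: "u \<in> V \<Longrightarrow> nrm (- u) = nrm u"
  using nrm_scale[of u "-1"] by (simp add: cscale_minus_one)

lemma nrm_minus_commute: "u \<in> V \<Longrightarrow> v \<in> V \<Longrightarrow> nrm (u - v) = nrm (v - u)"
  using nrm_minus[of "u - v"] by simp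

lemma nrm_add_power2:
  "u \<in> V \<Longrightarrow> v \<in> V \<Longrightarrow> (nrm (u + v))\<^sup>2 = (nrm u)\<^sup>2 + 2 * Re (ip u v) + (nrm v)\<^sup>2"
  by (simp add: nrm_power2 ip_simps Re_ip_commute[of v u])

lemma nrm_diff_power2:
  "u \<in> V \<Longrightarrow> v \<in> V \<Longrightarrow> (nrm (u - v))\<^sup>2 = (nrm u)\<^sup>2 - 2 * Re (ip u v) + (nrm v)\<^sup>2"
  using nrm_add_power2[of u "- v"] by (simp add: ip_simps)

lemma parallelogram:
  "u \<in> V \<Longrightarrow> v \<in> V \<Longrightarrow> (nrm (u + v))\<^sup>2 + (nrm (u - v))\<^sup>2 = 2 * (nrm u)\<^sup>2 + 2 * (nrm v)\<^sup>2"
  by (simp add: nrm_add_power2 nrm_diff_power2)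

lemma cauchy_schwarz_Re:
  assumes "u \<in> V" "v \<in> V" shows "\<bar>Re (ip u v)\<bar> \<le> nrm u * nrm v"
proof -
  have *: "0 \<le> (nrm u)\<^sup>2 + 2 * t * Re (ip u v) + t\<^sup>2 * (nrm v)\<^sup>2" for t
    using nrm_add_power2[of u "cscale (complex_of_real t) v"] assms
      zero_le_power2[of "nrm (u + cscale (complex_of_real t) v)"]
    by (simp add: ip_simps nrm_scale power_mult_distrib mult.assoc)
  have "(Re (ip u v))\<^sup>2 \<le> (nrm u)\<^sup>2 * (nrm v)\<^sup>2"
  proof (cases "nrm v = 0")
    case False
    let ?t = "- Re (ip u v) / (nrm v)\<^sup>2"
    from False have "0 < (nrm v)\<^sup>2" by simp
    moreover have "(nrm u)\<^sup>2 + 2 * ?t * Re (ip u v) + ?t\<^sup>2 * (nrm v)\<^sup>2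
        = (nrm u)\<^sup>2 - (Re (ip u v))\<^sup>2 / (nrm v)\<^sup>2"
      using False by (simp add: power2_eq_square field_simps)
    ultimately show ?thesis using *[of ?t] by (simp add: field_simps)
  next
    \<comment> \<open>A seminorm may vanish on a nonzero \<open>v\<close>, so this case is not
      trivial. The polynomial in \<open>*\<close> is affine in \<open>t\<close>, and the chosen
      \<open>t\<close> gives it the value \<open>-1\<close>.\<close>
    case True
    have "Re (ip u v) = 0"
    proof (rule ccontr)
      assume "Re (ip u v) \<noteq> 0"
      then show False
        using *[of "- ((nrm u)\<^sup>2 + 1) / (2 * Re (ip u v))"] True by (simp add: field_simps)
    qed
    then show ?thesis using True by simp
  qed
  then have "(Re (ip u v))\<^sup>2 \<le> (nrm u * nrm v)\<^sup>2" by (simp add: power_mult_distrib)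
  then show ?thesis using assms abs_le_square_iff[of "Re (ip u v)" "nrm u * nrm v"] by simp
qed

lemma cauchy_schwarz:
  assumes u: "u \<in> V" and v: "v \<in> V" shows "cmod (ip u v) \<le> nrm u * nrm v"
proof (cases "ip u v = 0")
  case False
  \<comment> \<open>The phase \<open>z\<close> makes \<open>ip (cscale z u) v\<close> real and
    nonnegative, which reduces the claim to the real part.\<close>
  define z where "z = cnj (ip u v) / cmod (ip u v)"
  have z: "cmod z = 1" "z * ip u v = cmod (ip u v)"
    using False by (auto simp: z_def norm_divide field_simps complex_norm_square[symmetric] power2_eq_square)
  have "cmod (ip u v) = Re (ip (cscale z u) v)" using u v z(2) by (simp add: ip_simps)
  also have "\<dots> \<le> nrm u * nrm v"
    using cauchy_schwarz_Re[of "cscale z u" v] u v z(1) by (simp add: nrm_scale)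
  finally show ?thesis .
qed (use u v in simp)

lemma nrm_triangle:
  assumes "u \<in> V" "v \<in> V" shows "nrm (u + v) \<le> nrm u + nrm v"
proof -
  have "(nrm (u + v))\<^sup>2 \<le> (nrm u + nrm v)\<^sup>2"
    using cauchy_schwarz_Re[OF assms] assms
    by (simp add: nrm_add_power2 power2_sum)
  then show ?thesis using assms by (metis add_nonneg_nonneg nrm_nonneg power2_le_imp_le)
qed

lemma nrm_triangle_diff:
  "u \<in> V \<Longrightarrow> v \<in> V \<Longrightarrow> nrm (u - v) \<le> nrm u + nrm v"
  using nrm_triangle[of u "- v"] by simp

lemma nrm_triangle3:
  "u \<in> V \<Longrightarrow> v \<in> V \<Longrightarrow> w \<in> V \<Longrightarrow> nrm (u - w) \<le> nrm (u - v) + nrm (v - w)"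
  using nrm_triangle[of "u - v" "v - w"] by simp

lemma nrm_diff_ge: "u \<in> V \<Longrightarrow> v \<in> V \<Longrightarrow> nrm u - nrm v \<le> nrm (u - v)"
  using nrm_triangle[of "u - v" v] by simp

lemma nrm_cong:
  assumes "u \<in> V" "v \<in> V" "nrm (u - v) = 0" shows "nrm u = nrm v"
  using nrm_diff_ge[of u v] nrm_diff_ge[of v u] nrm_minus_commute[of u v] assms by simp

lemma ip_cong:
  assumes "u \<in> V" "v \<in> V" "w \<in> V" "nrm (u - v) = 0" shows "ip u w = ip v w"
  using cauchy_schwarz[of "u - v" w] assms by (simp add: ip_diff)

text \<open>Test with \<open>u - v\<close> itself. Identities between values of operators are
  obtained in this way, since adjointness determines these values only up to norm
  \<open>0\<close>.\<close>

lemma nrm_zero_if_weak_eq: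
  assumes "u \<in> V" "v \<in> V" "\<And>w. w \<in> V \<Longrightarrow> ip u w = ip v w" shows "nrm (u - v) = 0"
  using assms(3)[of "u - v"] assms by (simp add: nrm_def ip_diff)

lemma nrm_sum: "(\<And>i. i \<in> I \<Longrightarrow> f i \<in> V) \<Longrightarrow> nrm (sum f I) \<le> (\<Sum>i\<in>I. nrm (f i))"
proof (induction I rule: infinite_finite_induct)
  case (insert x F)
  have "nrm (f x + sum f F) \<le> nrm (f x) + nrm (sum f F)"
    using insert.prems by (intro nrm_triangle sum_mem) auto
  also have "nrm (sum f F) \<le> (\<Sum>i\<in>F. nrm (f i))"
    using insert by blast
  finally show ?case
    by (simp only: sum.insert[OF insert.hyps])
qed simp_all

definition cauchy_seq :: "(nat \<Rightarrow> 'a \<Rightarrow> complex) \<Rightarrow> bool" where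
  "cauchy_seq f \<longleftrightarrow> (\<forall>e>0. \<exists>N. \<forall>m\<ge>N. \<forall>n\<ge>N. nrm (f m - f n) < e)"

lemma tendsto_ip:
  assumes "\<And>n. f n \<in> V" "u \<in> V" "v \<in> V" "(\<lambda>n. nrm (f n - u)) \<longlonglongrightarrow> 0"
  shows "(\<lambda>n. ip (f n) v) \<longlonglongrightarrow> ip u v"
proof -
  have "(\<lambda>n. ip (f n) v - ip u v) \<longlonglongrightarrow> 0"
  proof (rule Lim_null_comparison)
    show "\<forall>\<^sub>F n in sequentially. norm (ip (f n) v - ip u v) \<le> nrm (f n - u) * nrm v"
      using cauchy_schwarz[of "f _ - u" v] assms by (intro always_eventually) (simp add: ip_diff)
    show "(\<lambda>n. nrm (f n - u) * nrm v) \<longlonglongrightarrow> 0"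
      using tendsto_mult_right[OF assms(4), of "nrm v"] by simp
  qed
  then show ?thesis by (simp add: LIM_zero_iff)
qed

lemma tendsto_nrm:
  assumes "\<And>n. f n \<in> V" "u \<in> V" "(\<lambda>n. nrm (f n - u)) \<longlonglongrightarrow> 0"
  shows "(\<lambda>n. nrm (f n)) \<longlonglongrightarrow> nrm u"
proof -
  have "(\<lambda>n. nrm (f n) - nrm u) \<longlonglongrightarrow> 0"
  proof (rule Lim_null_comparison[OF _ assms(3)])
    show "\<forall>\<^sub>F n in sequentially. norm (nrm (f n) - nrm u) \<le> nrm (f n - u)"
    proof (intro always_eventually allI)
      fix n
      show "norm (nrm (f n) - nrm u) \<le> nrm (f n - u)"
        using nrm_diff_ge[of "f n" u] nrm_diff_ge[of u "f n"] nrm_minus_commute[of u "f n"]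
          assms(1)[of n] assms(2) by simp
    qed
  qed
  then show ?thesis by (simp add: LIM_zero_iff)
qed

end

lemma semi_inner_subset:
  assumes "semi_inner V ip" "W \<subseteq> V" "0 \<in> W" "\<And>u v. u \<in> W \<Longrightarrow> v \<in> W \<Longrightarrow> u + v \<in> W"
    "\<And>c u. u \<in> W \<Longrightarrow> cscale c u \<in> W"
  shows "semi_inner W ip"
proof -
  interpret semi_inner V ip by fact
  have [simp]: "u \<in> W \<Longrightarrow> u \<in> V" for u using assms(2) by blast
  show ?thesis by unfold_locales (use assms in \<open>simp_all add: ip_simps ip_cnj ip_pos\<close>)
qed

lemma semi_inner_add:
  assumes "semi_inner V ip" "semi_inner V ip'"
  shows "semi_inner V (\<lambda>u v. ip u v + ip' u v)"
proof -
  interpret A: semi_inner V ip by fact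
  interpret B: semi_inner V ip' by fact
  show ?thesis
    by unfold_locales (simp_all add: A.ip_simps B.ip_simps A.ip_cnj B.ip_cnj A.ip_pos B.ip_pos algebra_simps)
qed

lemma semi_inner_scale:
  assumes "semi_inner V ip" "0 \<le> c"
  shows "semi_inner V (\<lambda>u v. complex_of_real c * ip u v)"
proof -
  interpret A: semi_inner V ip by fact
  show ?thesis
    by unfold_locales (use assms(2) in \<open>simp_all add: A.ip_simps A.ip_cnj A.ip_pos algebra_simps\<close>)
qed

section \<open>Riesz representation and solvability in complete spaces\<close>

locale semi_hilbert = semi_inner +
  assumes complete: "(\<And>n. f n \<in> V) \<Longrightarrow> cauchy_seq f \<Longrightarrow> \<exists>u\<in>V. (\<lambda>n. nrm (f n - u)) \<longlonglongrightarrow> 0"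
begin

text \<open>The representing element minimises \<open>F u = (nrm u)^2 - 2 * Re (L u)\<close>; the
  vanishing first variation at the minimum is the representation. This direct argument needs neither
  quotients nor orthogonal complements.\<close>

lemma riesz:
  fixes L :: "('a \<Rightarrow> complex) \<Rightarrow> complex"
  assumes add: "\<And>u v. u \<in> V \<Longrightarrow> v \<in> V \<Longrightarrow> L (u + v) = L u + L v"
    and scale: "\<And>c u. u \<in> V \<Longrightarrow> L (cscale c u) = c * L u"
    and bd: "\<And>u. u \<in> V \<Longrightarrow> cmod (L u) \<le> C * nrm u"
  obtains w where "w \<in> V" "\<And>u. u \<in> V \<Longrightarrow> L u = ip u w"
proof -
  define F where "F u = (nrm u)\<^sup>2 - 2 * Re (L u)" for u
  define I where "I = Inf (F ` V)"
  have Fbd: "- C\<^sup>2 \<le> F u" if "u \<in> V" for u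
  proof -
    have "Re (L u) \<le> C * nrm u" using bd[OF that] abs_Re_le_cmod[of "L u"] by linarith
    moreover have "0 \<le> (nrm u - C)\<^sup>2" by simp
    ultimately show ?thesis unfolding F_def by (simp add: power2_diff algebra_simps)
  qed
  then have bdd: "bdd_below (F ` V)" by (auto simp: bdd_below_def)
  have I_le: "I \<le> F u" if "u \<in> V" for u
    unfolding I_def by (rule cInf_lower[OF _ bdd]) (use that in auto)
  have "\<exists>u\<in>V. F u < I + 1 / real (Suc n)" for n
  proof -
    have "I < I + 1 / real (Suc n)" by simp
    then show ?thesis
      using cInf_less_iff[of "F ` V" "I + 1 / real (Suc n)"] bdd zero_mem unfolding I_def by blast
  qed
  then obtain f where f: "\<And>n. f n \<in> V" "\<And>n. F (f n) < I + 1 / real (Suc n)" by metis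
  \<comment> \<open>The parallelogram law is uniform convexity of \<open>F\<close>: if two points
    almost minimise, so does their midpoint, and hence they are close.\<close>
  have Fmid: "(nrm (u - v))\<^sup>2 = 2 * F u + 2 * F v - 4 * F (cscale (1/2) (u + v))"
    if "u \<in> V" "v \<in> V" for u v
  proof -
    have "cmod (1/2) = 1/2" by (simp add: norm_divide)
    then have "4 * F (cscale (1/2) (u + v)) = (nrm (u + v))\<^sup>2 - 4 * Re (L u) - 4 * Re (L v)"
      using that unfolding F_def by (simp add: nrm_scale scale add power_mult_distrib power2_eq_square field_simps)
    then show ?thesis using parallelogram[OF that] unfolding F_def by simp
  qed
  have cau: "(nrm (f m - f n))\<^sup>2 \<le> 2 / real (Suc m) + 2 / real (Suc n)" for m n
  proof -
    have "I \<le> F (cscale (1/2) (f m + f n))" using I_le f(1) by simp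
    then have "(nrm (f m - f n))\<^sup>2 \<le> 2 * (1 / real (Suc m)) + 2 * (1 / real (Suc n))"
      using Fmid[OF f(1)[of m] f(1)[of n]] f(2)[of m] f(2)[of n] by linarith
    then show ?thesis by simp
  qed
  have "cauchy_seq f"
    unfolding cauchy_seq_def
  proof (intro allI impI)
    fix e :: real assume e: "e > 0"
    obtain N where N: "4 / e\<^sup>2 < real N" using reals_Archimedean2 by blast
    have "nrm (f m - f n) < e" if "m \<ge> N" "n \<ge> N" for m n
    proof -
      have *: "2 / real (Suc k) < e\<^sup>2 / 2" if "k \<ge> N" for k
      proof -
        have "4 / e\<^sup>2 < real (Suc k)" using N that by linarith
        then show ?thesis using e by (simp add: field_simps)
      qed
      have "(nrm (f m - f n))\<^sup>2 < e\<^sup>2" using cau[of m n] *[of m] *[of n] that by linarith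
      then show ?thesis using e by (simp add: power2_less_imp_less)
    qed
    then show "\<exists>N. \<forall>m\<ge>N. \<forall>n\<ge>N. nrm (f m - f n) < e" by blast
  qed
  from complete[OF f(1) this] obtain w where w: "w \<in> V" "(\<lambda>n. nrm (f n - w)) \<longlonglongrightarrow> 0" by blast
  have "F w = I"
  proof (rule antisym)
    have Ldiff: "L (u - v) = L u - L v" if "u \<in> V" "v \<in> V" for u v
      using add[of "u - v" v] that by simp
    have Llim: "(\<lambda>n. L (f n)) \<longlonglongrightarrow> L w"
    proof -
      have "(\<lambda>n. L (f n) - L w) \<longlonglongrightarrow> 0"
      proof (rule Lim_null_comparison)
        show "\<forall>\<^sub>F n in sequentially. norm (L (f n) - L w) \<le> C * nrm (f n - w)"
          using bd[of "f _ - w"] f(1) w(1) by (intro always_eventually) (simp add: Ldiff)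
        show "(\<lambda>n. C * nrm (f n - w)) \<longlonglongrightarrow> 0" using tendsto_mult_left[OF w(2), of C] by simp
      qed
      then show ?thesis by (simp add: LIM_zero_iff)
    qed
    have "(\<lambda>n. F (f n)) \<longlonglongrightarrow> F w"
      unfolding F_def by (intro tendsto_intros Llim tendsto_nrm f w)
    moreover have "(\<lambda>n. I + 1 / real (Suc n)) \<longlonglongrightarrow> I + 0"
      by (intro tendsto_intros LIMSEQ_Suc lim_1_over_n)
    ultimately show "F w \<le> I"
      using f(2) by (intro LIMSEQ_le[of "\<lambda>n. F (f n)" "F w" "\<lambda>n. I + 1 / real (Suc n)" I]) (auto intro: less_imp_le)
  qed (use I_le w in auto)
  have re: "Re (L v) = Re (ip v w)" if v: "v \<in> V" for v
  proof -
    define D where "D = Re (ip v w) - Re (L v)"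
    have "0 \<le> 2 * t * D + t\<^sup>2 * (nrm v)\<^sup>2" for t
    proof -
      have "F (w + cscale (complex_of_real t) v)
          = F w + 2 * t * D + t\<^sup>2 * (nrm v)\<^sup>2"
        using v w(1) ip_cnj[OF v w(1), symmetric] unfolding F_def D_def
        by (simp add: nrm_add_power2 nrm_scale ip_simps add scale power_mult_distrib algebra_simps)
      then show ?thesis using I_le[of "w + cscale (complex_of_real t) v"] v w(1) \<open>F w = I\<close> by simp
    qed
    note * = this
    have "D = 0"
    proof (rule ccontr)
      assume "D \<noteq> 0"
      have "0 < 1 + (nrm v)\<^sup>2" by (simp add: add_pos_nonneg)
      have gen: "2 * (- D / N) * D + (- D / N)\<^sup>2 * M = - (D\<^sup>2 / N) * (2 - M / N)" if "N \<noteq> 0" for N M :: real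
        using that by (simp add: power2_eq_square field_simps)
      \<comment> \<open>The minimiser of the quadratic polynomial would be
        \<open>- D / (nrm v)^2\<close>; adding \<open>1\<close> to the denominator covers
        \<open>nrm v = 0\<close> and keeps the value negative.\<close>
      let ?t = "- D / (1 + (nrm v)\<^sup>2)"
      have "2 * ?t * D + ?t\<^sup>2 * (nrm v)\<^sup>2 = - (D\<^sup>2 / (1 + (nrm v)\<^sup>2)) * (2 - (nrm v)\<^sup>2 / (1 + (nrm v)\<^sup>2))"
        using gen[of "1 + (nrm v)\<^sup>2" "(nrm v)\<^sup>2"] \<open>0 < 1 + (nrm v)\<^sup>2\<close> by simp
      moreover have "(nrm v)\<^sup>2 / (1 + (nrm v)\<^sup>2) \<le> 1" using \<open>0 < 1 + (nrm v)\<^sup>2\<close> by (simp add: field_simps)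
      then have "0 < 2 - (nrm v)\<^sup>2 / (1 + (nrm v)\<^sup>2)" by linarith
      then have "0 < (D\<^sup>2 / (1 + (nrm v)\<^sup>2)) * (2 - (nrm v)\<^sup>2 / (1 + (nrm v)\<^sup>2))"
        using \<open>D \<noteq> 0\<close> \<open>0 < 1 + (nrm v)\<^sup>2\<close> by (intro mult_pos_pos[of "_ / _"]) simp_all
      ultimately have "2 * ?t * D + ?t\<^sup>2 * (nrm v)\<^sup>2 < 0" by simp
      with *[of ?t] show False by linarith
    qed
    then show ?thesis by (simp add: D_def)
  qed
  \<comment> \<open>The real parts at \<open>v\<close> and at \<open>cscale \<i> v\<close> together
    determine the complex value.\<close>
  have "L v = ip v w" if v: "v \<in> V" for v
    using re[OF v] re[of "cscale \<i> v"] v w(1) by (simp add: complex_eq_iff scale ip_simps)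
  with w(1) that show ?thesis by blast
qed

text \<open>Riesz for the inner product \<open>ip (B u) (B v)\<close>, which is complete because
  \<open>B\<close> is bounded above and below. The representer \<open>w\<close> of
  \<open>u \<mapsto> ip (B u) x\<close> makes \<open>x - B w\<close> orthogonal to the range of
  \<open>B\<close>; hence \<open>x - B w\<close> lies in the kernel of the adjoint
  \<open>B'\<close>, where every element has norm \<open>0\<close>.\<close>

lemma surjI:
  assumes B: "\<And>u. u \<in> V \<Longrightarrow> B u \<in> V" and B': "\<And>u. u \<in> V \<Longrightarrow> B' u \<in> V"
    and adj: "\<And>u v. u \<in> V \<Longrightarrow> v \<in> V \<Longrightarrow> ip (B u) v = ip u (B' v)"
    and c: "0 < c" "\<And>u. u \<in> V \<Longrightarrow> c * nrm u \<le> nrm (B u)"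
    and C: "\<And>u. u \<in> V \<Longrightarrow> nrm (B u) \<le> C * nrm u"
    and inj: "\<And>u. u \<in> V \<Longrightarrow> nrm (B' u) = 0 \<Longrightarrow> nrm u = 0"
    and x: "x \<in> V"
  obtains u where "u \<in> V" "nrm (x - B u) = 0"
proof -
  let ?ip = "\<lambda>u v. ip (B u) (B v)"
  have adj': "ip (B' u) v = ip u (B v)" if "u \<in> V" "v \<in> V" for u v
    using adj[OF that(2,1)] that B B' by (metis ip_cnj)
  interpret S: semi_inner V ?ip
  proof (unfold_locales, goal_cases)
    case (4 u v w) then show ?case by (simp add: adj B B' ip_add)
  next
    case (5 u w c) then show ?case by (simp add: adj B B' ip_scale)
  next
    case (6 u v) then show ?case by (simp add: B ip_cnj)
  next
    case (7 u) then show ?case by (simp add: B ip_pos)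
  qed simp_all
  have nS: "S.nrm u = nrm (B u)" if "u \<in> V" for u
    by (simp add: S.nrm_def nrm_def)
  interpret S: semi_hilbert V ?ip
  proof
    fix f assume f: "\<And>n. f n \<in> V" "S.cauchy_seq f"
    have "cauchy_seq f"
      unfolding cauchy_seq_def
    proof (intro allI impI)
      fix e :: real assume "0 < e"
      then have "0 < c * e" using c by simp
      then obtain N where N: "\<forall>m\<ge>N. \<forall>n\<ge>N. S.nrm (f m - f n) < c * e"
        using f(2) unfolding S.cauchy_seq_def by blast
      have "nrm (f m - f n) < e" if "m \<ge> N" "n \<ge> N" for m n
      proof -
        have "c * nrm (f m - f n) < c * e"
          using N[rule_format, OF that] c(2)[of "f m - f n"] f(1) by (simp add: nS)
        then show ?thesis using c(1) by simp
      qed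
      then show "\<exists>N. \<forall>m\<ge>N. \<forall>n\<ge>N. nrm (f m - f n) < e" by blast
    qed
    then obtain u where u: "u \<in> V" "(\<lambda>n. nrm (f n - u)) \<longlonglongrightarrow> 0" using complete[of f] f(1) by blast
    have "(\<lambda>n. S.nrm (f n - u)) \<longlonglongrightarrow> 0"
    proof (rule Lim_null_comparison)
      show "\<forall>\<^sub>F n in sequentially. norm (S.nrm (f n - u)) \<le> C * nrm (f n - u)"
        using C[of "f _ - u"] f(1) u(1) B by (intro always_eventually) (simp add: nS)
      show "(\<lambda>n. C * nrm (f n - u)) \<longlonglongrightarrow> 0" using tendsto_mult_left[OF u(2), of C] by simp
    qed
    with u(1) show "\<exists>u\<in>V. (\<lambda>n. S.nrm (f n - u)) \<longlonglongrightarrow> 0" by blast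
  qed
  obtain w where w: "w \<in> V" "\<And>u. u \<in> V \<Longrightarrow> ip (B u) x = ip (B u) (B w)"
  proof (rule S.riesz[of "\<lambda>u. ip (B u) x" "nrm x"])
    show "cmod (ip (B u) x) \<le> nrm x * S.nrm u" if "u \<in> V" for u
      using cauchy_schwarz[of "B u" x] that x B by (simp add: nS mult.commute)
  qed (use x B B' in \<open>simp_all add: adj ip_add ip_scale\<close>)
  have "nrm (x - B w) = 0"
  proof (rule inj)
    have "ip (B' (x - B w)) (B' (x - B w)) = ip (x - B w) (B (B' (x - B w)))"
      using w x B B' by (simp add: adj')
    also have "\<dots> = cnj (ip (B (B' (x - B w))) (x - B w))" using w x B B' by (simp add: ip_cnj)
    also have "\<dots> = 0" using w x B B' w(2)[of "B' (x - B w)"] by (simp add: ip_diff_right)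
    finally show "nrm (B' (x - B w)) = 0" by (simp add: nrm_def)
  qed (use x w B in auto)
  then show ?thesis using that w(1) by blast
qed

end

section \<open>Bounded self-adjoint operators\<close>

text \<open>Symmetry implies linearity up to elements of norm \<open>0\<close>. This is the sense of
  linearity available for operators whose values are chosen representatives, such as the resolvent
  below.\<close>

locale self_adjoint = semi_inner +
  fixes T :: "('a \<Rightarrow> complex) \<Rightarrow> 'a \<Rightarrow> complex"
  assumes T_mem [simp]: "u \<in> V \<Longrightarrow> T u \<in> V"
    and T_adj: "u \<in> V \<Longrightarrow> v \<in> V \<Longrightarrow> ip (T u) v = ip u (T v)"
begin

lemma nrm_T_diff:
  assumes "u \<in> V" "v \<in> V" shows "nrm (T (u - v) - (T u - T v)) = 0"
  by (rule nrm_zero_if_weak_eq) (use assms in \<open>simp_all add: T_adj ip_diff\<close>)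

text \<open>Factor \<open>T^2 - t^2\<close> as \<open>(T - t) (T + t)\<close>; the factorisation
  holds up to norm \<open>0\<close>, and the two lower bounds multiply.\<close>

lemma square_lower_bound:
  assumes c1: "\<And>h. h \<in> V \<Longrightarrow> c1 * nrm h \<le> nrm (T h - cscale (complex_of_real t) h)" "0 \<le> c1"
    and c2: "\<And>h. h \<in> V \<Longrightarrow> c2 * nrm h \<le> nrm (T h + cscale (complex_of_real t) h)"
    and h: "h \<in> V"
  shows "c1 * c2 * nrm h \<le> nrm (T (T h) - cscale (complex_of_real (t\<^sup>2)) h)"
proof -
  let ?y = "T h + cscale (complex_of_real t) h"
  have "nrm (T ?y - cscale (complex_of_real t) ?y - (T (T h) - cscale (complex_of_real (t\<^sup>2)) h)) = 0"
    by (rule nrm_zero_if_weak_eq)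
      (use h in \<open>simp_all add: T_adj ip_simps power2_eq_square algebra_simps\<close>)
  then have "nrm (T ?y - cscale (complex_of_real t) ?y) = nrm (T (T h) - cscale (complex_of_real (t\<^sup>2)) h)"
    using h by (intro nrm_cong) simp_all
  moreover have "c1 * (c2 * nrm h) \<le> c1 * nrm ?y"
    using c2[OF h] c1(2) by (rule mult_left_mono)
  moreover have "c1 * nrm ?y \<le> nrm (T ?y - cscale (complex_of_real t) ?y)"
    using c1(1)[of ?y] h by simp
  ultimately show ?thesis by (simp add: mult.assoc)
qed

text \<open>A gap \<open>(-m, m)\<close> of the spectrum yields the sharp lower bound
  \<open>m\<close>. Let \<open>\<tau>\<close> be the best constant in
  \<open>\<tau> * nrm h \<le> nrm (T h)\<close>. If \<open>\<tau> < m\<close>, then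
  \<open>T^2 - \<tau>^2\<close> is bounded below as a product of two such operators and its
  quadratic form is nonnegative; together this makes the form strictly positive, so that
  \<open>\<tau>\<close> could be enlarged.\<close>

lemma gap_lower_bound:
  assumes C: "\<And>h. h \<in> V \<Longrightarrow> nrm (T h) \<le> C * nrm h"
    and gap: "\<And>t. \<bar>t\<bar> < m \<Longrightarrow> \<exists>c>0. \<forall>h\<in>V. c * nrm h \<le> nrm (T h - cscale (complex_of_real t) h)"
    and h: "h \<in> V"
  shows "m * nrm h \<le> nrm (T h)"
proof (rule ccontr)
  assume less: "\<not> m * nrm h \<le> nrm (T h)"
  then have "0 < nrm h"
    using h by (metis T_mem mult_zero_right nrm_nonneg order_le_less)
  let ?Q = "(\<lambda>h. nrm (T h) / nrm h) ` {h \<in> V. 0 < nrm h}"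
  define \<tau> where "\<tau> = Inf ?Q"
  have ne: "?Q \<noteq> {}" using h \<open>0 < nrm h\<close> by blast
  have bdd: "bdd_below ?Q" by (intro bdd_belowI2[of _ 0]) simp
  have \<tau>0: "0 \<le> \<tau>" unfolding \<tau>_def using ne by (intro cInf_greatest) auto
  have \<tau>le: "\<tau> * nrm u \<le> nrm (T u)" if "u \<in> V" for u
  proof (cases "nrm u = 0")
    case False
    then have "0 < nrm u" using that by (simp add: order_less_le)
    then have "\<tau> \<le> nrm (T u) / nrm u"
      unfolding \<tau>_def using that by (intro cInf_lower bdd) auto
    then show ?thesis using \<open>0 < nrm u\<close> by (simp add: field_simps)
  qed (use that in simp)
  have "\<tau> \<le> nrm (T h) / nrm h"
    unfolding \<tau>_def using h \<open>0 < nrm h\<close> by (intro cInf_lower bdd) auto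
  also have "\<dots> < m" using less \<open>0 < nrm h\<close> by (simp add: field_simps)
  finally have "\<tau> < m" .
  obtain c1 where c1: "c1 > 0" "\<And>h. h \<in> V \<Longrightarrow> c1 * nrm h \<le> nrm (T h - cscale (complex_of_real \<tau>) h)"
    using gap[of \<tau>] \<tau>0 \<open>\<tau> < m\<close> by auto
  obtain c2 where c2: "c2 > 0" "\<And>h. h \<in> V \<Longrightarrow> c2 * nrm h \<le> nrm (T h - cscale (complex_of_real (-\<tau>)) h)"
    using gap[of "-\<tau>"] \<tau>0 \<open>\<tau> < m\<close> by auto
  have neg: "T h - cscale (complex_of_real (-\<tau>)) h = T h + cscale (complex_of_real \<tau>) h" for h
    by (simp add: fun_eq_iff)
  have c2': "c2 * nrm h \<le> nrm (T h + cscale (complex_of_real \<tau>) h)" if "h \<in> V" for h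
    using c2(2)[OF that] unfolding neg .
  let ?P = "\<lambda>u. T (T u) - cscale (complex_of_real (\<tau>\<^sup>2)) u"
  have P: "c1 * c2 * nrm u \<le> nrm (?P u)" if "u \<in> V" for u
    using c1 c2' that by (intro square_lower_bound) auto
  \<comment> \<open>\<open>q\<close> is the quadratic form of \<open>T^2 - \<tau>^2\<close>,
    nonnegative by the choice of \<open>\<tau>\<close>, so that Cauchy-Schwarz applies to
    it.\<close>
  define q where "q u v = ip (T u) (T v) - complex_of_real (\<tau>\<^sup>2) * ip u v" for u v
  interpret Q: semi_inner V q
  proof (unfold_locales, goal_cases)
    case (4 u v w) then show ?case by (simp add: q_def T_adj ip_add algebra_simps)
  next
    case (5 u w c) then show ?case by (simp add: q_def T_adj ip_scale algebra_simps)
  next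
    case (6 u v) then show ?case by (simp add: q_def ip_cnj)
  next
    case (7 u)
    have "(\<tau> * nrm u)\<^sup>2 \<le> (nrm (T u))\<^sup>2" using \<tau>le[OF 7] \<tau>0 7 by (intro power_mono) auto
    then show ?case using 7 by (simp add: q_def nrm_power2 power_mult_distrib)
  qed simp_all
  define C' where "C' = max C 1"
  have C': "C' > 0" "\<And>h. h \<in> V \<Longrightarrow> nrm (T h) \<le> C' * nrm h"
  proof -
    fix h assume "h \<in> V"
    then have "C * nrm h \<le> C' * nrm h" by (intro mult_right_mono) (auto simp: C'_def)
    then show "nrm (T h) \<le> C' * nrm h" using C[OF \<open>h \<in> V\<close>] by linarith
  qed (simp add: C'_def)
  define \<kappa> where "\<kappa> = (c1 * c2 / C')\<^sup>2"
  have "\<kappa> > 0" using c1 c2 C' by (simp add: \<kappa>_def)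
  have key: "(\<tau>\<^sup>2 + \<kappa>) * (nrm u)\<^sup>2 \<le> (nrm (T u))\<^sup>2" if u: "u \<in> V" for u
  proof -
    \<comment> \<open>With \<open>v = (T^2 - \<tau>^2) u\<close> one has
      \<open>q u v = (nrm v)^2\<close>. Cauchy-Schwarz for \<open>q\<close> and
      \<open>q v v \<le> (C' * nrm v)^2\<close> then bound \<open>nrm v\<close> by
      \<open>C' * Q.nrm u\<close>, while \<open>P\<close> bounds it from below.\<close>
    let ?v = "?P u"
    have v: "?v \<in> V" using u by simp
    have "q u ?v = ip ?v ?v"
      using u by (simp add: q_def T_adj ip_diff ip_scale)
    then have "(nrm ?v)\<^sup>2 = cmod (q u ?v)"
      using v by (simp add: ip_self norm_power)
    also have "\<dots> \<le> Q.nrm u * Q.nrm ?v" using u v by (rule Q.cauchy_schwarz)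
    also have "\<dots> \<le> Q.nrm u * (C' * nrm ?v)"
    proof (intro mult_left_mono)
      have "(Q.nrm ?v)\<^sup>2 \<le> (nrm (T ?v))\<^sup>2"
        using v \<tau>0 by (simp only: Q.nrm_power2 q_def) (simp add: nrm_power2 ip_pos)
      also have "\<dots> \<le> (C' * nrm ?v)\<^sup>2" using C'(2)[OF v] v by (intro power_mono) auto
      finally show "Q.nrm ?v \<le> C' * nrm ?v"
        using v C'(1) by (intro power2_le_imp_le[of "Q.nrm ?v"]) simp_all
    qed (use u in simp)
    finally have "(nrm ?v)\<^sup>2 \<le> Q.nrm u * (C' * nrm ?v)" .
    then have "nrm ?v \<le> C' * Q.nrm u"
    proof (cases "nrm ?v = 0")
      case False
      then have "0 < nrm ?v" using nrm_nonneg[OF v] by linarith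
      moreover have "nrm ?v * nrm ?v \<le> (C' * Q.nrm u) * nrm ?v"
        using \<open>(nrm ?v)\<^sup>2 \<le> Q.nrm u * (C' * nrm ?v)\<close> unfolding power2_eq_square by (simp only: mult_ac)
      ultimately show ?thesis by (rule mult_right_le_imp_le[rotated])
    qed (use u C'(1) in simp)
    then have "c1 * c2 * nrm u \<le> C' * Q.nrm u" using P[OF u] by linarith
    then have "c1 * c2 / C' * nrm u \<le> Q.nrm u" using C'(1) by (simp add: field_simps)
    then have "(c1 * c2 / C' * nrm u)\<^sup>2 \<le> (Q.nrm u)\<^sup>2"
      using u c1 c2 C' by (intro power_mono) auto
    also have "(Q.nrm u)\<^sup>2 = (nrm (T u))\<^sup>2 - \<tau>\<^sup>2 * (nrm u)\<^sup>2"
      using u by (simp only: Q.nrm_power2 q_def) (simp add: nrm_power2)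
    finally have "(c1 * c2 / C' * nrm u)\<^sup>2 \<le> (nrm (T u))\<^sup>2 - \<tau>\<^sup>2 * (nrm u)\<^sup>2" .
    moreover have "(c1 * c2 / C' * nrm u)\<^sup>2 = \<kappa> * (nrm u)\<^sup>2"
      by (simp only: \<kappa>_def power_mult_distrib)
    ultimately show ?thesis by (simp add: algebra_simps)
  qed
  have "sqrt (\<tau>\<^sup>2 + \<kappa>) \<le> Inf ?Q"
  proof (rule cInf_greatest[OF ne])
    fix x assume "x \<in> ?Q"
    then obtain u where u: "u \<in> V" "0 < nrm u" "x = nrm (T u) / nrm u" by blast
    have "(sqrt (\<tau>\<^sup>2 + \<kappa>) * nrm u)\<^sup>2 \<le> (nrm (T u))\<^sup>2"
      using key[OF u(1)] \<open>\<kappa> > 0\<close> by (simp add: power_mult_distrib)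
    then have "sqrt (\<tau>\<^sup>2 + \<kappa>) * nrm u \<le> nrm (T u)"
      using u by (intro power2_le_imp_le[of "sqrt (\<tau>\<^sup>2 + \<kappa>) * nrm u"]) simp_all
    then show "sqrt (\<tau>\<^sup>2 + \<kappa>) \<le> x"
      using u by (simp add: pos_le_divide_eq)
  qed
  then have "sqrt (\<tau>\<^sup>2 + \<kappa>) \<le> \<tau>" by (fold \<tau>_def)
  moreover have "\<tau> < sqrt (\<tau>\<^sup>2 + \<kappa>)"
    using \<open>\<kappa> > 0\<close> \<tau>0 by (intro real_less_rsqrt) simp
  ultimately show False by simp
qed

text \<open>
  If \<open>0\<close> is isolated in the spectrum of \<open>T\<close>, then \<open>T\<^sup>2\<close> has the spectral gap \<open>(0, r\<^sup>2)\<close>, so that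
  no spectral theorem is needed.
\<close>

lemma isolated_zero_lower_bound:
  assumes C: "\<And>h. h \<in> V \<Longrightarrow> nrm (T h) \<le> C * nrm h"
    and iso: "\<And>t. 0 < \<bar>t\<bar> \<Longrightarrow> \<bar>t\<bar> < r \<Longrightarrow>
      \<exists>c>0. \<forall>h\<in>V. c * nrm h \<le> nrm (T h - cscale (complex_of_real t) h)"
    and r: "0 < r" and h: "h \<in> V"
  shows "r * nrm (T h) \<le> nrm (T (T h))"
proof -
  \<comment> \<open>Subtracting half of \<open>r^2\<close> centres the gap \<open>(0, r^2)\<close>
    of \<open>T^2\<close> at the origin, where \<open>gap_lower_bound\<close> applies.\<close>
  define m where "m = r\<^sup>2 / 2"
  let ?L = "\<lambda>h. T (T h) - cscale (complex_of_real m) h"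
  interpret L: self_adjoint V ip ?L
    by unfold_locales (simp_all add: ip_simps T_adj)
  have "0 < m" using r by (simp add: m_def)
  have lower: "m * nrm h \<le> nrm (?L h)"
  proof (rule L.gap_lower_bound)
    fix u assume u: "u \<in> V"
    have "nrm (?L u) \<le> nrm (T (T u)) + nrm (cscale (complex_of_real m) u)"
      using u by (intro nrm_triangle_diff) simp_all
    moreover have "nrm (T (T u)) \<le> \<bar>C\<bar> * (\<bar>C\<bar> * nrm u)"
    proof -
      have "nrm (T (T u)) \<le> C * nrm (T u)" using C[of "T u"] u by simp
      also have "\<dots> \<le> \<bar>C\<bar> * nrm (T u)" using u by (intro mult_right_mono) simp_all
      also have "\<dots> \<le> \<bar>C\<bar> * (\<bar>C\<bar> * nrm u)"
        using C[OF u] mult_right_mono[of C "\<bar>C\<bar>" "nrm u", OF abs_ge_self] u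
        by (intro mult_left_mono) simp_all
      finally show ?thesis .
    qed
    ultimately show "nrm (?L u) \<le> (\<bar>C\<bar> * \<bar>C\<bar> + m) * nrm u"
      using u \<open>0 < m\<close> by (simp add: nrm_scale algebra_simps)
  next
    fix t :: real assume t: "\<bar>t\<bar> < m"
    \<comment> \<open>Since \<open>0 < m + t < r^2\<close>, both \<open>s\<close> and
      \<open>-s\<close> are points at which \<open>iso\<close> gives a lower bound, and
      \<open>T^2 - s^2\<close> is the operator in question.\<close>
    define s where "s = sqrt (m + t)"
    have s2: "s\<^sup>2 = m + t" using t by (simp add: s_def)
    have "0 < s" "s < r"
    proof -
      show "0 < s" using t by (simp add: s_def)
      have "s\<^sup>2 < r\<^sup>2" using t r unfolding s2 by (simp add: m_def)
      then show "s < r" using r by (simp add: power2_less_imp_less)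
    qed
    obtain c1 where c1: "c1 > 0" "\<And>h. h \<in> V \<Longrightarrow> c1 * nrm h \<le> nrm (T h - cscale (complex_of_real s) h)"
      using iso[of s] \<open>0 < s\<close> \<open>s < r\<close> by auto
    obtain c2 where c2: "c2 > 0" "\<And>h. h \<in> V \<Longrightarrow> c2 * nrm h \<le> nrm (T h - cscale (complex_of_real (-s)) h)"
      using iso[of "-s"] \<open>0 < s\<close> \<open>s < r\<close> by auto
    have neg: "T h - cscale (complex_of_real (-s)) h = T h + cscale (complex_of_real s) h" for h
      by (simp add: fun_eq_iff)
    have c2': "c2 * nrm h \<le> nrm (T h + cscale (complex_of_real s) h)" if "h \<in> V" for h
      using c2(2)[OF that] unfolding neg .
    have eq: "?L h - cscale (complex_of_real t) h = T (T h) - cscale (complex_of_real (s\<^sup>2)) h" for h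
      by (simp add: fun_eq_iff s2 algebra_simps)
    have "c1 * c2 * nrm u \<le> nrm (?L u - cscale (complex_of_real t) u)" if "u \<in> V" for u
      unfolding eq using c1 c2' that by (intro square_lower_bound) auto
    then show "\<exists>c>0. \<forall>h\<in>V. c * nrm h \<le> nrm (?L h - cscale (complex_of_real t) h)"
      using c1 c2 by (intro exI[of _ "c1 * c2"]) simp
  qed (rule h)
  \<comment> \<open>Expanding the square cancels \<open>(m * nrm h)^2\<close> on both sides and
    leaves \<open>2 * m = r^2\<close> as the factor of \<open>(nrm (T h))^2\<close>.\<close>
  have "(m * nrm h)\<^sup>2 \<le> (nrm (?L h))\<^sup>2"
    using lower \<open>0 < m\<close> h by (intro power_mono) simp_all
  also have "(nrm (?L h))\<^sup>2 = (nrm (T (T h)))\<^sup>2 - 2 * m * (nrm (T h))\<^sup>2 + (m * nrm h)\<^sup>2"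
    using h \<open>0 < m\<close>
    by (subst nrm_diff_power2)
      (simp_all add: ip_scale_right nrm_scale power_mult_distrib T_adj[of "T h" h] nrm_power2[of "T h"])
  finally have "(r * nrm (T h))\<^sup>2 \<le> (nrm (T (T h)))\<^sup>2"
    by (simp add: m_def power_mult_distrib)
  then show ?thesis using h r by (intro power2_le_imp_le[of "r * nrm (T h)"]) simp_all
qed

end

locale bounded_self_adjoint = semi_hilbert + self_adjoint +
  fixes C :: real
  assumes T_bounded: "u \<in> V \<Longrightarrow> nrm (T u) \<le> C * nrm u"
begin

text \<open>By \<open>low\<close>, \<open>T\<close> is bounded below by \<open>r\<close> on its
  range, hence on the closure \<open>M\<close> of the range. Split \<open>u\<close> into its
  projection \<open>w\<close> onto \<open>M\<close> and a remainder \<open>p\<close> orthogonal to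
  the range: then \<open>T p\<close> has norm \<open>0\<close>, and \<open>r * nrm w\<close> is at
  most \<open>nrm (T w) = nrm (T u)\<close>.\<close>

lemma kernel_approximation:
  assumes low: "\<And>h. h \<in> V \<Longrightarrow> r * nrm (T h) \<le> nrm (T (T h))" and r: "0 < r" and u: "u \<in> V"
  obtains p where "p \<in> V" "nrm (T p) = 0" "r * nrm (u - p) \<le> nrm (T u)"
proof -
  define M where "M = {x \<in> V. \<forall>e>0. \<exists>f\<in>V. nrm (x - T f) < e}"
  have M_V [simp]: "x \<in> V" if "x \<in> M" for x using that by (simp add: M_def)
  have T_M: "T x \<in> M" if "x \<in> V" for x
    using that unfolding M_def by (intro CollectI conjI allI impI bexI[of _ x]) simp_all
  \<comment> \<open>\<open>T\<close> respects sums and multiples only up to norm \<open>0\<close>;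
    distances to \<open>T f\<close> may therefore be computed with any weakly equal
    \<open>g\<close>.\<close>
  have weak: "nrm (w - T f) = nrm (w - g)" if "w \<in> V" "f \<in> V" "g \<in> V" "\<And>v. v \<in> V \<Longrightarrow> ip (T f) v = ip g v" for w f g
  proof (rule nrm_cong)
    show "nrm (w - T f - (w - g)) = 0"
      by (rule nrm_zero_if_weak_eq) (use that in \<open>simp_all add: ip_diff\<close>)
  qed (use that in simp_all)
  interpret M: semi_inner M ip
  proof (rule semi_inner_subset)
    show "semi_inner V ip" by (rule semi_inner_axioms)
    show "0 \<in> M" unfolding M_def
    proof (intro CollectI conjI allI impI)
      fix e :: real assume "e > 0"
      have "nrm (0 - T 0) = nrm (0 - 0 :: 'a \<Rightarrow> complex)" by (rule weak) (simp_all add: T_adj)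
      then show "\<exists>f\<in>V. nrm (0 - T f) < e" using \<open>e > 0\<close> by (intro bexI[of _ 0]) simp_all
    qed simp
    show "x + y \<in> M" if xy: "x \<in> M" "y \<in> M" for x y
      unfolding M_def
    proof (intro CollectI conjI allI impI)
      fix e :: real assume "e > 0"
      then obtain f g where fg: "f \<in> V" "g \<in> V" "nrm (x - T f) < e / 2" "nrm (y - T g) < e / 2"
        using xy half_gt_zero[OF \<open>e > 0\<close>] unfolding M_def by blast
      have eq: "x + y - (T f + T g) = (x - T f) + (y - T g)" by (simp add: algebra_simps)
      have "nrm (x + y - T (f + g)) = nrm ((x - T f) + (y - T g))"
        unfolding eq[symmetric] by (rule weak) (use xy fg in \<open>simp_all add: T_adj ip_add\<close>)
      also have "\<dots> \<le> nrm (x - T f) + nrm (y - T g)"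
        using xy fg by (intro nrm_triangle) simp_all
      also have "\<dots> < e" using fg by simp
      finally show "\<exists>f\<in>V. nrm (x + y - T f) < e" using add_mem[OF fg(1,2)] by blast
    qed (use xy in simp)
    show "cscale c x \<in> M" if x: "x \<in> M" for c x
      unfolding M_def
    proof (intro CollectI conjI allI impI)
      fix e :: real assume "e > 0"
      then have "0 < e / (cmod c + 1)" by (simp add: add_nonneg_pos)
      then obtain f where f: "f \<in> V" "nrm (x - T f) < e / (cmod c + 1)"
        using x unfolding M_def by blast
      have eq: "cscale c x - cscale c (T f) = cscale c (x - T f)"
        by (simp add: fun_eq_iff algebra_simps)
      have "nrm (cscale c x - T (cscale c f)) = nrm (cscale c (x - T f))"
        unfolding eq[symmetric] by (rule weak) (use x f in \<open>simp_all add: T_adj ip_scale\<close>)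
      also have "\<dots> = cmod c * nrm (x - T f)" using x f by (simp add: nrm_scale)
      also have "\<dots> \<le> (cmod c + 1) * nrm (x - T f)" using x f by (intro mult_right_mono) simp_all
      also have "\<dots> < e"
      proof -
        have "0 < cmod c + 1" by (simp add: add_nonneg_pos)
        then show ?thesis using f(2) by (simp only: pos_less_divide_eq mult.commute)
      qed
      finally show "\<exists>f\<in>V. nrm (cscale c x - T f) < e" using f(1) scale_mem by blast
    qed (use x in simp)
  qed (use M_V in blast)
  interpret M: semi_hilbert M ip
  proof
    fix f :: "nat \<Rightarrow> 'a \<Rightarrow> complex" assume f: "\<And>n. f n \<in> M" "cauchy_seq f"
    obtain x where x: "x \<in> V" "(\<lambda>n. nrm (f n - x)) \<longlonglongrightarrow> 0"
      using complete[of f] f by auto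
    have "x \<in> M" unfolding M_def
    proof (intro CollectI conjI allI impI)
      fix e :: real assume "e > 0"
      then obtain n where "norm (nrm (f n - x) - 0) < e / 2"
        using LIMSEQ_D[OF x(2) half_gt_zero] by blast
      then have n: "nrm (f n - x) < e / 2" by simp
      obtain g where g: "g \<in> V" "nrm (f n - T g) < e / 2"
        using f(1)[of n] half_gt_zero[OF \<open>e > 0\<close>] unfolding M_def by blast
      have "nrm (x - T g) \<le> nrm (x - f n) + nrm (f n - T g)"
        using x f g by (intro nrm_triangle3) simp_all
      then show "\<exists>f\<in>V. nrm (x - T f) < e"
        using n g nrm_minus_commute[of x "f n"] x f by (intro bexI[of _ g]) simp_all
    qed (use x in simp)
    with x show "\<exists>u\<in>M. (\<lambda>n. nrm (f n - u)) \<longlonglongrightarrow> 0" by blast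
  qed
  \<comment> \<open>Riesz on the complete subspace \<open>M\<close> supplies the orthogonal
    projection \<open>w\<close> of \<open>u\<close>.\<close>
  obtain w where w: "w \<in> M" "\<And>v. v \<in> M \<Longrightarrow> ip v u = ip v w"
    using M.riesz[of "\<lambda>v. ip v u" "nrm u"] u cauchy_schwarz[of _ u]
    by (auto simp: ip_simps mult.commute)
  define p where "p = u - w"
  have p: "p \<in> V" using u w by (simp add: p_def)
  have "ip (T p) (T p) = ip (T (T p)) p" using p by (simp add: T_adj)
  also have "\<dots> = 0" using w(2)[of "T (T p)"] T_M p u w(1) by (simp add: p_def ip_diff_right)
  finally have Tp: "nrm (T p) = 0" by (simp add: nrm_def)
  have Tdiff: "nrm (T x - T y) \<le> \<bar>C\<bar> * nrm (x - y)" if "x \<in> V" "y \<in> V" for x y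
  proof -
    have "nrm (T x - T y) = nrm (T (x - y))"
      using nrm_T_diff[OF that] nrm_cong[of "T (x - y)" "T x - T y"] that by simp
    also have "\<dots> \<le> C * nrm (x - y)" using that by (intro T_bounded) simp
    also have "\<dots> \<le> \<bar>C\<bar> * nrm (x - y)" using that by (intro mult_right_mono) simp_all
    finally show ?thesis .
  qed
  have rw: "r * nrm w \<le> nrm (T w)"
  proof (rule field_le_epsilon)
    fix e :: real assume "e > 0"
    then have "0 < e / (r + \<bar>C\<bar>)" using r by simp
    then obtain f where f: "f \<in> V" "nrm (w - T f) < e / (r + \<bar>C\<bar>)"
      using w unfolding M_def by blast
    have "r * nrm w \<le> r * (nrm (T f) + nrm (w - T f))"
      using nrm_triangle[of "T f" "w - T f"] f w r by (intro mult_left_mono) simp_all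
    also have "\<dots> \<le> nrm (T (T f)) + r * nrm (w - T f)" using low[OF f(1)] by (simp add: algebra_simps)
    finally have "r * nrm w \<le> nrm (T (T f)) + r * nrm (w - T f)" .
    moreover have "nrm (T (T f)) \<le> nrm (T w) + nrm (T (T f) - T w)"
      using nrm_triangle[of "T w" "T (T f) - T w"] f w by simp
    moreover have "nrm (T (T f) - T w) \<le> \<bar>C\<bar> * nrm (w - T f)"
      using Tdiff[of "T f" w] f w nrm_minus_commute[of "T f" w] by simp
    ultimately have "r * nrm w \<le> nrm (T w) + (r + \<bar>C\<bar>) * nrm (w - T f)"
      by (simp add: algebra_simps)
    moreover have "(r + \<bar>C\<bar>) * nrm (w - T f) \<le> e"
      using f(2) r by (simp add: field_simps)
    ultimately show "r * nrm w \<le> nrm (T w) + e" by simp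
  qed
  have "nrm (T w) \<le> nrm (T u)"
  proof -
    have "nrm (T w) = nrm (T (u - p))" by (simp add: p_def)
    also have "\<dots> = nrm (T u - T p)" using nrm_T_diff[of u p] u p by (intro nrm_cong) simp_all
    also have "\<dots> \<le> nrm (T u) + nrm (T p)" using u p by (intro nrm_triangle_diff) simp_all
    finally show ?thesis using Tp by simp
  qed
  with rw have "r * nrm (u - p) \<le> nrm (T u)" by (simp add: p_def)
  with p Tp that show ?thesis by blast
qed

end

section \<open>Finite-dimensional auxiliary facts\<close>

text \<open>Gaussian elimination: a pivot \<open>x0\<close> removes one equation and one unknown,
  which preserves the excess of unknowns.\<close>

lemma homogeneous_system_solution:
  fixes a :: "'x \<Rightarrow> 'i \<Rightarrow> complex"
  assumes "finite I" "finite X" "card I < card X"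
  shows "\<exists>c. (\<exists>x\<in>X. c x \<noteq> 0) \<and> (\<forall>j\<in>I. (\<Sum>x\<in>X. c x * a x j) = 0)"
  using assms
proof (induction I arbitrary: X a rule: finite_induct)
  case empty
  then show ?case by (intro exI[of _ "\<lambda>_. 1"]) (auto simp: card_gt_0_iff)
next
  case (insert j0 F)
  show ?case
  proof (cases "\<forall>x\<in>X. a x j0 = 0")
    case True
    then show ?thesis using insert.IH[of X a] insert.prems insert.hyps by auto
  next
    case False
    then obtain x0 where x0: "x0 \<in> X" "a x0 j0 \<noteq> 0" by blast
    define Y where "Y = X - {x0}"
    have Y: "finite Y" "X = insert x0 Y" "x0 \<notin> Y" using x0 insert.prems by (auto simp: Y_def)
    then obtain c where c: "\<exists>x\<in>Y. c x \<noteq> 0"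
        "\<forall>j\<in>F. (\<Sum>x\<in>Y. c x * (a x j - a x j0 / a x0 j0 * a x0 j)) = 0"
      using insert.IH[of Y "\<lambda>x j. a x j - a x j0 / a x0 j0 * a x0 j"] insert.prems insert.hyps by auto
    \<comment> \<open>The value at the pivot is forced by equation \<open>j0\<close>; with it, the
      sum for any \<open>j\<close> becomes the eliminated sum.\<close>
    define c' where "c' = c(x0 := - (\<Sum>x\<in>Y. c x * a x j0) / a x0 j0)"
    have c'Y: "(\<Sum>x\<in>Y. c' x * b x) = (\<Sum>x\<in>Y. c x * b x)" for b
      using Y by (intro sum.cong) (auto simp: c'_def)
    have "(\<Sum>x\<in>X. c' x * a x j) = 0" if "j \<in> insert j0 F" for j
    proof -
      have "(\<Sum>x\<in>X. c' x * a x j) = c' x0 * a x0 j + (\<Sum>x\<in>Y. c x * a x j)"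
        using Y by (simp add: c'Y)
      also have "\<dots> = (\<Sum>x\<in>Y. c x * (a x j - a x j0 / a x0 j0 * a x0 j))"
        by (simp add: c'_def sum_subtractf algebra_simps sum_distrib_left sum_divide_distrib)
      also have "\<dots> = 0" using that c(2) x0 by auto
      finally show ?thesis .
    qed
    moreover have "\<exists>x\<in>X. c' x \<noteq> 0" using c(1) Y by (auto simp: c'_def)
    ultimately show ?thesis by blast
  qed
qed

lemma bounded_family_convergent_subseq:
  fixes x :: "nat \<Rightarrow> 'i \<Rightarrow> complex"
  assumes "finite I" "\<And>i. i \<in> I \<Longrightarrow> bounded (range (\<lambda>n. x n i))"
  shows "\<exists>r. strict_mono (r :: nat \<Rightarrow> nat) \<and> (\<forall>i\<in>I. convergent (\<lambda>n. x (r n) i))"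
  using assms
proof (induction I rule: finite_induct)
  case empty
  then show ?case by (intro exI[of _ id]) (simp add: strict_mono_def)
next
  case (insert j F)
  then obtain r where r: "strict_mono (r :: nat \<Rightarrow> nat)" "\<forall>i\<in>F. convergent (\<lambda>n. x (r n) i)" by blast
  have "bounded (range (\<lambda>n. x (r n) j))"
    using insert.prems[of j] by (rule bounded_subset) auto
  then obtain l r' where r': "strict_mono (r' :: nat \<Rightarrow> nat)" "((\<lambda>n. x (r n) j) \<circ> r') \<longlonglongrightarrow> l"
    using bounded_imp_convergent_subsequence by blast
  have "convergent (\<lambda>n. x (r (r' n)) i)" if "i \<in> insert j F" for i
  proof (cases "i = j")
    case True
    then show ?thesis using r'(2) by (auto simp: convergent_def o_def)
  next
    case False
    then have "convergent (\<lambda>n. x (r n) i)" using r(2) that by blast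
    from convergent_subseq_convergent[OF this r'(1)] show ?thesis by (simp add: o_def)
  qed
  then show ?case
    using strict_mono_o[OF r(1) r'(1)] by (intro exI[of _ "r \<circ> r'"]) (simp add: o_def)
qed

section \<open>Operators associated with closed nonnegative forms\<close>

text \<open>Closedness of the form is encoded as completeness of \<open>D\<close> in the norm of
  \<open>a + ip\<close>.\<close>

locale closed_form = H: semi_hilbert V ip + D: semi_hilbert D "\<lambda>u v. a u v + ip u v"
  for V :: "('a \<Rightarrow> complex) set" and ip and D :: "('a \<Rightarrow> complex) set" and a +
  assumes D_V [simp]: "u \<in> D \<Longrightarrow> u \<in> V" and a_pos: "u \<in> D \<Longrightarrow> 0 \<le> Re (a u u)"
begin

lemma semi_inner_form: "semi_inner D a"
proof (unfold_locales, goal_cases)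
  case (4 u v w) then show ?case using D.ip_add[of u v w] by (simp add: H.ip_add)
next
  case (5 u w c) then show ?case using D.ip_scale[of u w c] by (simp add: H.ip_scale algebra_simps)
next
  case (6 u v) then show ?case using D.ip_cnj[of u v] by (simp add: H.ip_cnj)
qed (simp_all add: a_pos)

sublocale A: semi_inner D a
  by (rule semi_inner_form)

lemma D_nrm_power2: "u \<in> D \<Longrightarrow> (D.nrm u)\<^sup>2 = Re (a u u) + (H.nrm u)\<^sup>2"
  by (simp add: D.nrm_power2 H.nrm_power2)

lemma H_nrm_le: "u \<in> D \<Longrightarrow> H.nrm u \<le> D.nrm u"
  using D_nrm_power2[of u] a_pos[of u] by (intro power2_le_imp_le[of "H.nrm u"]) simp_all

definition op :: "(('a \<Rightarrow> complex) \<times> ('a \<Rightarrow> complex)) set" where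
  "op = {(u, f). u \<in> D \<and> f \<in> V \<and> (\<forall>v\<in>D. a u v = ip f v)}"

lemma opI: "u \<in> D \<Longrightarrow> f \<in> V \<Longrightarrow> (\<And>v. v \<in> D \<Longrightarrow> a u v = ip f v) \<Longrightarrow> (u, f) \<in> op"
  by (simp add: op_def)

lemma opD: "(u, f) \<in> op \<Longrightarrow> u \<in> D" "(u, f) \<in> op \<Longrightarrow> f \<in> V"
    "(u, f) \<in> op \<Longrightarrow> v \<in> D \<Longrightarrow> a u v = ip f v"
  by (auto simp: op_def)

lemma op_scale: "(u, f) \<in> op \<Longrightarrow> (cscale c u, cscale c f) \<in> op"
  by (simp add: op_def A.ip_scale H.ip_scale)

text \<open>The resolvent at \<open>-1\<close>, chosen up to elements of norm \<open>0\<close>.\<close>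

definition R :: "('a \<Rightarrow> complex) \<Rightarrow> 'a \<Rightarrow> complex" where
  "R f = (SOME u. u \<in> D \<and> (\<forall>v\<in>D. a u v + ip u v = ip f v))"

lemma R:
  assumes "f \<in> V"
  shows R_D [simp]: "R f \<in> D" and R_eq: "v \<in> D \<Longrightarrow> a (R f) v + ip (R f) v = ip f v"
proof -
  obtain w where w: "w \<in> D" "\<And>v. v \<in> D \<Longrightarrow> ip v f = a v w + ip v w"
  proof (rule D.riesz[of "\<lambda>v. ip v f" "H.nrm f"])
    show "cmod (ip u f) \<le> H.nrm f * D.nrm u" if "u \<in> D" for u
    proof -
      have "cmod (ip u f) \<le> H.nrm u * H.nrm f" using that assms by (intro H.cauchy_schwarz) simp_all
      also have "\<dots> \<le> D.nrm u * H.nrm f"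
        using H_nrm_le[OF that] assms by (intro mult_right_mono) simp_all
      finally show ?thesis by (simp add: mult.commute)
    qed
  qed (use assms in \<open>simp_all add: H.ip_simps\<close>)
  have "a w v + ip w v = ip f v" if "v \<in> D" for v
  proof -
    have "a w v + ip w v = cnj (a v w + ip v w)" using that w(1) by (simp add: H.ip_cnj A.ip_cnj)
    also have "\<dots> = cnj (ip v f)" using w(2)[OF that] by simp
    finally show ?thesis using that assms by (simp add: H.ip_cnj)
  qed
  with w(1) have "\<exists>u. u \<in> D \<and> (\<forall>v\<in>D. a u v + ip u v = ip f v)" by blast
  from someI_ex[OF this] show "R f \<in> D" "v \<in> D \<Longrightarrow> a (R f) v + ip (R f) v = ip f v"
    by (auto simp: R_def)
qed

lemma R_V [simp]: "f \<in> V \<Longrightarrow> R f \<in> V"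
  by simp

lemma R_op: "f \<in> V \<Longrightarrow> (R f, f - R f) \<in> op"
  using R_eq[of f] by (intro opI) (simp_all add: H.ip_diff eq_diff_eq)

lemma R_adj:
  assumes "f \<in> V" "g \<in> V" shows "ip (R f) g = ip f (R g)"
proof -
  have "ip f (R g) = a (R f) (R g) + ip (R f) (R g)" using R_eq[of f "R g"] assms by simp
  also have "\<dots> = cnj (a (R g) (R f) + ip (R g) (R f))" using assms by (simp add: A.ip_cnj H.ip_cnj)
  also have "\<dots> = cnj (ip g (R f))" using R_eq[of g "R f"] assms by simp
  finally show ?thesis using assms by (simp add: H.ip_cnj)
qed

lemma D_nrm_R: assumes "f \<in> V" shows "D.nrm (R f) \<le> H.nrm f"
proof -
  have "(D.nrm (R f))\<^sup>2 = Re (ip f (R f))"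
    using assms R_eq[of f "R f"] by (simp add: D.nrm_power2)
  also have "\<dots> \<le> H.nrm f * H.nrm (R f)"
    using H.cauchy_schwarz_Re[of f "R f"] assms by simp
  also have "\<dots> \<le> H.nrm f * D.nrm (R f)"
    using H_nrm_le[of "R f"] assms by (intro mult_left_mono) simp_all
  finally have "D.nrm (R f) * D.nrm (R f) \<le> H.nrm f * D.nrm (R f)" by (simp add: power2_eq_square)
  moreover have "0 \<le> D.nrm (R f)" using assms by simp
  ultimately show ?thesis
    using assms mult_right_le_imp_le[of "D.nrm (R f)" "D.nrm (R f)" "H.nrm f"]
    by (cases "D.nrm (R f) = 0") (simp_all add: order_less_le)
qed

lemma H_nrm_R: "f \<in> V \<Longrightarrow> H.nrm (R f) \<le> H.nrm f"
  using D_nrm_R[of f] H_nrm_le[of "R f"] by simp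

text \<open>If \<open>A\<close> denotes the operator of the form, \<open>R\<close> is
  \<open>(A + 1)^-1\<close> and \<open>B z\<close> is the bounded operator
  \<open>(A - z) (A + 1)^-1\<close>. It has the solvability properties of \<open>A - z\<close>, and
  for real \<open>z\<close> it is symmetric.\<close>

definition B :: "complex \<Rightarrow> ('a \<Rightarrow> complex) \<Rightarrow> 'a \<Rightarrow> complex" where
  "B z h = h - cscale (1 + z) (R h)"

lemma B_V [simp]: "h \<in> V \<Longrightarrow> B z h \<in> V"
  by (simp add: B_def)

lemma B_adj: "f \<in> V \<Longrightarrow> g \<in> V \<Longrightarrow> ip (B z f) g = ip f (B (cnj z) g)"
  by (simp add: B_def H.ip_simps R_adj)

lemma B_bound: "h \<in> V \<Longrightarrow> H.nrm (B z h) \<le> (1 + cmod (1 + z)) * H.nrm h"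
proof -
  assume h: "h \<in> V"
  have "H.nrm (B z h) \<le> H.nrm h + H.nrm (cscale (1 + z) (R h))"
    unfolding B_def using h by (intro H.nrm_triangle_diff) simp_all
  moreover have "H.nrm (cscale (1 + z) (R h)) \<le> cmod (1 + z) * H.nrm h"
    using h by (simp add: H.nrm_scale mult_left_mono H_nrm_R)
  ultimately show ?thesis by (simp add: algebra_simps)
qed

lemma B_eq: "B z h = (h - R h) - cscale z (R h)"
  by (simp add: B_def fun_eq_iff algebra_simps)

definition lower_bound :: "complex \<Rightarrow> real \<Rightarrow> bool" where
  "lower_bound z c \<longleftrightarrow> 0 < c \<and> (\<forall>(u, f)\<in>op. c * H.nrm u \<le> H.nrm (f - cscale z u))"

lemma lower_boundD: "lower_bound z c \<Longrightarrow> 0 < c"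
    "lower_bound z c \<Longrightarrow> (u, f) \<in> op \<Longrightarrow> c * H.nrm u \<le> H.nrm (f - cscale z u)"
  by (auto simp: lower_bound_def)

text \<open>Write \<open>h = B z h + (1 + z) R h\<close>. Since \<open>B z h\<close> is
  \<open>A - z\<close> applied to \<open>R h\<close>, the second summand is controlled by the
  first.\<close>

lemma B_lower_bound:
  assumes "lower_bound z c" "h \<in> V"
  shows "H.nrm h \<le> (1 + cmod (1 + z) / c) * H.nrm (B z h)"
proof -
  have 1: "H.nrm (R h) \<le> H.nrm (B z h) / c"
    using lower_boundD(2)[OF assms(1) R_op[OF assms(2)]] lower_boundD(1)[OF assms(1)]
    by (simp add: B_eq field_simps)
  have "h = B z h + cscale (1 + z) (R h)" by (simp add: B_def)
  then have "H.nrm h \<le> H.nrm (B z h) + H.nrm (cscale (1 + z) (R h))"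
    using H.nrm_triangle[of "B z h" "cscale (1 + z) (R h)"] assms by simp
  also have "\<dots> = H.nrm (B z h) + cmod (1 + z) * H.nrm (R h)" using assms by (simp add: H.nrm_scale)
  also have "\<dots> \<le> H.nrm (B z h) + cmod (1 + z) * (H.nrm (B z h) / c)"
    using 1 by (intro add_left_mono mult_left_mono) simp_all
  finally show ?thesis by (simp add: algebra_simps)
qed

text \<open>The adjoint of \<open>B z\<close> is \<open>B (cnj z)\<close>; the bound at
  \<open>z\<close> makes the range closed and the bound at \<open>cnj z\<close> makes it
  dense.\<close>

lemma resolvent_onto:
  assumes z: "lower_bound z c" and z': "lower_bound (cnj z) c'" and g: "g \<in> V"
  obtains u f where "(u, f) \<in> op" "H.nrm (f - cscale z u - g) = 0"
proof -
  have "0 < 1 + cmod (1 + z) / c" using lower_boundD(1)[OF z] by (simp add: add_pos_nonneg)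
  obtain h where h: "h \<in> V" "H.nrm (g - B z h) = 0"
  proof (rule H.surjI[of "B z" "B (cnj z)" "1 / (1 + cmod (1 + z) / c)" "1 + cmod (1 + z)" g])
    show "1 / (1 + cmod (1 + z) / c) * H.nrm u \<le> H.nrm (B z u)" if "u \<in> V" for u
      using B_lower_bound[OF z that] \<open>0 < 1 + cmod (1 + z) / c\<close>
      by (simp add: pos_divide_le_eq mult.commute)
    show "H.nrm u = 0" if "u \<in> V" "H.nrm (B (cnj z) u) = 0" for u
    proof (rule antisym)
      show "H.nrm u \<le> 0" using B_lower_bound[OF z' that(1)] that(2) by simp
    qed (use that in simp)
  qed (use g B_bound B_adj \<open>0 < 1 + cmod (1 + z) / c\<close> in auto)
  have "H.nrm ((h - R h) - cscale z (R h) - g) = 0"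
    using h g H.nrm_minus_commute[of g "B z h"] by (simp add: B_eq)
  with that R_op[OF h(1)] show ?thesis by blast
qed

lemma op_ip_real:
  assumes "(u, f) \<in> op"
  shows "ip (f - cscale z u) u = complex_of_real (Re (a u u)) - z * complex_of_real ((H.nrm u)\<^sup>2)"
proof -
  have "ip f u = a u u" using assms opD by metis
  moreover have "Im (a u u) = 0" using assms opD(1) by simp
  ultimately show ?thesis
    using assms by (simp add: opD H.ip_diff H.ip_scale H.ip_self complex_eq_iff)
qed

text \<open>\<open>ip (f - cscale z u) u\<close> equals \<open>a u u - z * (nrm u)^2\<close> with
  real \<open>a u u \<ge> 0\<close>. So its modulus is at least the absolute imaginary part of
  \<open>z\<close>, or minus the real part if \<open>z\<close> is negative, times the squared
  norm.\<close>

lemma lower_bound_outside: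
  assumes "Im z \<noteq> 0 \<or> Re z < 0"
  shows "\<exists>c. lower_bound z c"
proof -
  define c where "c = (if Im z \<noteq> 0 then \<bar>Im z\<bar> else - Re z)"
  have "0 < c" using assms by (auto simp: c_def)
  have "c * H.nrm u \<le> H.nrm (f - cscale z u)" if uf: "(u, f) \<in> op" for u f
  proof -
    have u: "u \<in> V" "f \<in> V" using opD[OF uf] by auto
    have "c * (H.nrm u)\<^sup>2 \<le> cmod (ip (f - cscale z u) u)"
    proof (cases "Im z = 0")
      case False
      have "Im (ip (f - cscale z u) u) = - Im z * (H.nrm u)\<^sup>2"
        using op_ip_real[OF uf, of z] by simp
      then show ?thesis
        using False abs_Im_le_cmod[of "ip (f - cscale z u) u"] by (simp add: c_def abs_mult)
    next
      case True
      have "Re (ip (f - cscale z u) u) = Re (a u u) - Re z * (H.nrm u)\<^sup>2"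
        using op_ip_real[OF uf, of z] by simp
      then show ?thesis
        using True a_pos[OF opD(1)[OF uf]] complex_Re_le_cmod[of "ip (f - cscale z u) u"]
        by (simp add: c_def)
    qed
    also have "\<dots> \<le> H.nrm (f - cscale z u) * H.nrm u" using u by (intro H.cauchy_schwarz) simp_all
    finally have *: "(c * H.nrm u) * H.nrm u \<le> H.nrm (f - cscale z u) * H.nrm u"
      by (simp add: power2_eq_square mult.assoc)
    show ?thesis
    proof (cases "H.nrm u = 0")
      case False
      then have "0 < H.nrm u" using H.nrm_nonneg[OF u(1)] by linarith
      with * show ?thesis by (rule mult_right_le_imp_le)
    qed (use u in simp)
  qed
  then show ?thesis using \<open>0 < c\<close> unfolding lower_bound_def by blast
qed

subsection \<open>Points outside the essential spectrum\<close>

text \<open>An inf-sup form of Garding's inequality, up to finitely many functionals.\<close>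

definition garding :: "real \<Rightarrow> 'i set \<Rightarrow> ('i \<Rightarrow> 'a \<Rightarrow> complex) \<Rightarrow> real \<Rightarrow> real \<Rightarrow> bool" where
  "garding l I \<phi> c C \<longleftrightarrow> finite I \<and> 0 < c \<and> (\<forall>i\<in>I. \<phi> i \<in> V) \<and>
     (\<forall>u\<in>D. \<exists>v\<in>D. H.nrm v \<le> H.nrm u \<and>
        c * (D.nrm u)\<^sup>2 \<le> Re (a u v - complex_of_real l * ip u v) + C * (\<Sum>i\<in>I. (cmod (ip u (\<phi> i)))\<^sup>2))"

text \<open>The functionals of a normalised sequence are bounded, so they converge along a
  subsequence. Applied to differences, the inequality makes the subsequence Cauchy in the form norm:
  the test function \<open>v\<close> depends on the difference, but its norm is at most
  \<open>2\<close>, so it pairs with the residuals to something small.\<close>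

lemma garding_compactness:
  assumes G: "garding l I \<phi> c C"
    and uf: "\<And>n. (u n, f n) \<in> op" and nu: "\<And>n. H.nrm (u n) = 1"
    and lim: "(\<lambda>n. H.nrm (f n - cscale (complex_of_real l) (u n))) \<longlonglongrightarrow> 0"
  obtains r w where "strict_mono (r :: nat \<Rightarrow> nat)" "(w, cscale (complex_of_real l) w) \<in> op"
    "H.nrm w = 1" "(\<lambda>n. H.nrm (u (r n) - w)) \<longlonglongrightarrow> 0"
proof -
  define h where "h n = f n - cscale (complex_of_real l) (u n)" for n
  have [simp]: "u n \<in> D" "f n \<in> V" for n using opD[OF uf[of n]] by auto
  have [simp]: "h n \<in> V" for n by (simp add: h_def)
  have I: "finite I" "0 < c" "\<And>i. i \<in> I \<Longrightarrow> \<phi> i \<in> V" using G by (auto simp: garding_def)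
  have au: "a (u n) v - complex_of_real l * ip (u n) v = ip (h n) v" if "v \<in> D" for n v
    using opD(3)[OF uf that] that by (simp add: h_def H.ip_diff H.ip_scale)
  have "bounded (range (\<lambda>n. ip (u n) (\<phi> i)))" if "i \<in> I" for i
    unfolding bounded_iff
  proof (intro exI[of _ "H.nrm (\<phi> i)"] ballI)
    fix x assume "x \<in> range (\<lambda>n. ip (u n) (\<phi> i))"
    then obtain n where "x = ip (u n) (\<phi> i)" by blast
    then show "norm x \<le> H.nrm (\<phi> i)"
      using H.cauchy_schwarz[of "u n" "\<phi> i"] I(3)[OF that] nu[of n] by simp
  qed
  then obtain r where r: "strict_mono r" "\<And>i. i \<in> I \<Longrightarrow> convergent (\<lambda>n. ip (u (r n)) (\<phi> i))"
    using bounded_family_convergent_subseq[OF I(1), of "\<lambda>n i. ip (u n) (\<phi> i)"] by blast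
  have hr: "(\<lambda>n. H.nrm (h (r n))) \<longlonglongrightarrow> 0"
    using LIMSEQ_subseq_LIMSEQ[OF lim r(1)] by (simp add: h_def o_def)
  have est: "c * (D.nrm (u (r m) - u (r n)))\<^sup>2 \<le> 2 * (H.nrm (h (r m)) + H.nrm (h (r n)))
      + \<bar>C\<bar> * (\<Sum>i\<in>I. (cmod (ip (u (r m)) (\<phi> i) - ip (u (r n)) (\<phi> i)))\<^sup>2)" for m n
  proof -
    let ?w = "u (r m) - u (r n)"
    have w: "?w \<in> D" by simp
    obtain v where v: "v \<in> D" "H.nrm v \<le> H.nrm ?w"
      "c * (D.nrm ?w)\<^sup>2 \<le> Re (a ?w v - complex_of_real l * ip ?w v) + C * (\<Sum>i\<in>I. (cmod (ip ?w (\<phi> i)))\<^sup>2)"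
      using G w unfolding garding_def by blast
    have "H.nrm ?w \<le> 2" using H.nrm_triangle_diff[of "u (r m)" "u (r n)"] nu by simp
    then have "H.nrm v \<le> 2" using v(2) by linarith
    have "a ?w v - complex_of_real l * ip ?w v = ip (h (r m) - h (r n)) v"
      using au[OF v(1), of "r m"] au[OF v(1), of "r n"] v(1)
      by (simp add: A.ip_diff H.ip_diff algebra_simps)
    moreover have "Re (ip (h (r m) - h (r n)) v) \<le> H.nrm (h (r m) - h (r n)) * H.nrm v"
      using H.cauchy_schwarz_Re[of "h (r m) - h (r n)" v] v(1) by simp
    moreover have "H.nrm (h (r m) - h (r n)) * H.nrm v \<le> (H.nrm (h (r m)) + H.nrm (h (r n))) * 2"
      using \<open>H.nrm v \<le> 2\<close> H.nrm_triangle_diff[of "h (r m)" "h (r n)"] v(1)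
      by (intro mult_mono) simp_all
    moreover have "C * (\<Sum>i\<in>I. (cmod (ip ?w (\<phi> i)))\<^sup>2)
        \<le> \<bar>C\<bar> * (\<Sum>i\<in>I. (cmod (ip (u (r m)) (\<phi> i) - ip (u (r n)) (\<phi> i)))\<^sup>2)"
    proof -
      have "(\<Sum>i\<in>I. (cmod (ip ?w (\<phi> i)))\<^sup>2) = (\<Sum>i\<in>I. (cmod (ip (u (r m)) (\<phi> i) - ip (u (r n)) (\<phi> i)))\<^sup>2)"
        using I by (intro sum.cong) (simp_all add: H.ip_diff)
      then show ?thesis by (simp add: mult_right_mono sum_nonneg)
    qed
    ultimately show ?thesis using v(3) by simp
  qed
  have "D.cauchy_seq (\<lambda>n. u (r n))"
    unfolding D.cauchy_seq_def
  proof (intro allI impI)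
    fix e :: real assume "0 < e"
    \<comment> \<open>The \<open>1\<close> guards against division by zero. The residuals cost
      \<open>4 * \<delta>\<close> and the functionals
      \<open>\<bar>C\<bar> * card I * \<delta>\<close>, together at most half of
      \<open>c * e^2\<close>.\<close>
    define \<delta> where "\<delta> = c * e\<^sup>2 / (8 * (1 + \<bar>C\<bar> * real (card I)))"
    have den: "0 < 1 + \<bar>C\<bar> * real (card I)" by (simp add: add_pos_nonneg)
    have "0 < \<delta>" using \<open>0 < e\<close> I(2) den by (simp add: \<delta>_def)
    have "\<forall>i\<in>I. \<exists>N. \<forall>m\<ge>N. \<forall>n\<ge>N. cmod (ip (u (r m)) (\<phi> i) - ip (u (r n)) (\<phi> i)) < sqrt \<delta>"
    proof
      fix i assume "i \<in> I"
      then have "Cauchy (\<lambda>n. ip (u (r n)) (\<phi> i))" using r(2) convergent_Cauchy by blast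
      then show "\<exists>N. \<forall>m\<ge>N. \<forall>n\<ge>N. cmod (ip (u (r m)) (\<phi> i) - ip (u (r n)) (\<phi> i)) < sqrt \<delta>"
        using CauchyD[of _ "sqrt \<delta>"] \<open>0 < \<delta>\<close> by auto
    qed
    then obtain N where N: "\<And>i m n. i \<in> I \<Longrightarrow> m \<ge> N i \<Longrightarrow> n \<ge> N i \<Longrightarrow>
        cmod (ip (u (r m)) (\<phi> i) - ip (u (r n)) (\<phi> i)) < sqrt \<delta>" by metis
    obtain N0 where N0: "\<And>n. n \<ge> N0 \<Longrightarrow> H.nrm (h (r n)) < \<delta>"
      using LIMSEQ_D[OF hr \<open>0 < \<delta>\<close>] by auto
    define M where "M = N0 + (\<Sum>i\<in>I. N i)"
    have "D.nrm (u (r m) - u (r n)) < e" if mn: "m \<ge> M" "n \<ge> M" for m n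
    proof -
      have "N i \<le> M" if "i \<in> I" for i
        using member_le_sum[of i I N] that I(1) by (simp add: M_def)
      then have "cmod (ip (u (r m)) (\<phi> i) - ip (u (r n)) (\<phi> i)) < sqrt \<delta>" if "i \<in> I" for i
        using N[OF that] that mn le_trans by blast
      then have "(cmod (ip (u (r m)) (\<phi> i) - ip (u (r n)) (\<phi> i)))\<^sup>2 \<le> \<delta>" if "i \<in> I" for i
        using that \<open>0 < \<delta>\<close> power_mono[of "cmod (ip (u (r m)) (\<phi> i) - ip (u (r n)) (\<phi> i))" "sqrt \<delta>" 2]
        by (simp add: less_imp_le)
      then have "(\<Sum>i\<in>I. (cmod (ip (u (r m)) (\<phi> i) - ip (u (r n)) (\<phi> i)))\<^sup>2) \<le> real (card I) * \<delta>"
        by (rule sum_bounded_above)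
      then have "\<bar>C\<bar> * (\<Sum>i\<in>I. (cmod (ip (u (r m)) (\<phi> i) - ip (u (r n)) (\<phi> i)))\<^sup>2) \<le> \<bar>C\<bar> * (real (card I) * \<delta>)"
        by (rule mult_left_mono) simp
      moreover have "H.nrm (h (r m)) < \<delta>" "H.nrm (h (r n)) < \<delta>" using N0 mn by (simp_all add: M_def)
      ultimately have "c * (D.nrm (u (r m) - u (r n)))\<^sup>2 \<le> 4 * \<delta> + \<bar>C\<bar> * (real (card I) * \<delta>)"
        by (intro order_trans[OF est] add_mono) simp_all
      also have "\<dots> \<le> 4 * (1 + \<bar>C\<bar> * real (card I)) * \<delta>"
        using \<open>0 < \<delta>\<close> by (simp add: algebra_simps)
      also have "\<dots> = c * e\<^sup>2 / 2"
      proof -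
        have gen: "4 * M * (c * e\<^sup>2 / (8 * M)) = c * e\<^sup>2 / 2" if "M \<noteq> 0" for M :: real
          using that by (simp add: field_simps)
        show ?thesis unfolding \<delta>_def by (rule gen) (use den in linarith)
      qed
      also have "\<dots> < c * e\<^sup>2" using I(2) \<open>0 < e\<close> by simp
      finally have "(D.nrm (u (r m) - u (r n)))\<^sup>2 < e\<^sup>2" using I(2) by simp
      then show ?thesis using \<open>0 < e\<close> by (simp add: power2_less_imp_less)
    qed
    then show "\<exists>N. \<forall>m\<ge>N. \<forall>n\<ge>N. D.nrm (u (r m) - u (r n)) < e" by blast
  qed
  then obtain w where w: "w \<in> D" "(\<lambda>n. D.nrm (u (r n) - w)) \<longlonglongrightarrow> 0"
    using D.complete[of "\<lambda>n. u (r n)"] by auto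
  have wH: "(\<lambda>n. H.nrm (u (r n) - w)) \<longlonglongrightarrow> 0"
  proof (rule Lim_null_comparison[OF _ w(2)])
    show "\<forall>\<^sub>F n in sequentially. norm (H.nrm (u (r n) - w)) \<le> D.nrm (u (r n) - w)"
      using H_nrm_le[of "u (r _) - w"] w(1) by (intro always_eventually) simp
  qed
  have "(\<lambda>n. H.nrm (u (r n))) \<longlonglongrightarrow> H.nrm w" using w(1) by (intro H.tendsto_nrm wH) simp_all
  then have nw: "H.nrm w = 1" by (simp add: nu LIMSEQ_const_iff)
  have "a w v = complex_of_real l * ip w v" if v: "v \<in> D" for v
  proof -
    have 1: "(\<lambda>n. a (u (r n)) v + ip (u (r n)) v) \<longlonglongrightarrow> a w v + ip w v"
      using v w by (intro D.tendsto_ip) simp_all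
    have 2: "(\<lambda>n. ip (u (r n)) v) \<longlonglongrightarrow> ip w v"
      using v w wH by (intro H.tendsto_ip) simp_all
    have "(\<lambda>n. H.nrm (h (r n) - 0)) \<longlonglongrightarrow> 0" using hr by simp
    then have 3: "(\<lambda>n. ip (h (r n)) v) \<longlonglongrightarrow> ip 0 v"
      using v by (intro H.tendsto_ip) simp_all
    have "(\<lambda>n. a (u (r n)) v + ip (u (r n)) v - ip (u (r n)) v - complex_of_real l * ip (u (r n)) v)
        \<longlonglongrightarrow> a w v + ip w v - ip w v - complex_of_real l * ip w v"
      by (intro tendsto_intros 1 2)
    then have "(\<lambda>n. ip (h (r n)) v) \<longlonglongrightarrow> a w v - complex_of_real l * ip w v"
      using au[OF v] by simp
    from LIMSEQ_unique[OF this 3] v show ?thesis by simp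
  qed
  then have "(w, cscale (complex_of_real l) w) \<in> op" using w(1) by (intro opI) (simp_all add: H.ip_scale)
  with that r(1) nw wH show ?thesis by blast
qed

lemma not_lower_bound:
  assumes "\<nexists>c. lower_bound z c" "0 < \<epsilon>"
  obtains u f where "(u, f) \<in> op" "H.nrm u = 1" "H.nrm (f - cscale z u) < \<epsilon>"
proof -
  obtain u f where uf: "(u, f) \<in> op" "H.nrm (f - cscale z u) < \<epsilon> * H.nrm u"
    using assms unfolding lower_bound_def by force
  have V: "u \<in> V" "f \<in> V" using opD[OF uf(1)] by auto
  have "0 < \<epsilon> * H.nrm u" using uf(2) H.nrm_nonneg[of "f - cscale z u"] V by (simp del: H.nrm_nonneg)
  then have pos: "0 < H.nrm u" using assms(2) by (simp add: zero_less_mult_iff)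
  define t where "t = complex_of_real (1 / H.nrm u)"
  have t: "cmod t = 1 / H.nrm u" using pos by (simp add: t_def norm_divide)
  have eq: "cscale t f - cscale z (cscale t u) = cscale t (f - cscale z u)"
    by (simp add: fun_eq_iff algebra_simps)
  have "H.nrm (cscale t f - cscale z (cscale t u)) = H.nrm (f - cscale z u) / H.nrm u"
    unfolding eq using V by (simp add: H.nrm_scale t)
  also have "\<dots> < \<epsilon>" using uf(2) pos by (simp add: field_simps)
  finally have "H.nrm (cscale t f - cscale z (cscale t u)) < \<epsilon>" .
  moreover have "H.nrm (cscale t u) = 1" using V pos by (simp add: H.nrm_scale t)
  ultimately show ?thesis using that op_scale[OF uf(1)] by blast
qed

lemma garding_lower_bound:
  assumes G: "garding l I \<phi> c C"
    and no: "\<And>w. (w, cscale (complex_of_real l) w) \<in> op \<Longrightarrow> H.nrm w = 0"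
  shows "\<exists>c. lower_bound (complex_of_real l) c"
proof (rule ccontr)
  assume neg: "\<not> ?thesis"
  have "\<exists>u f. (u, f) \<in> op \<and> H.nrm u = 1 \<and> H.nrm (f - cscale (complex_of_real l) u) < 1 / real (Suc n)" for n
    using not_lower_bound[OF neg, of "1 / real (Suc n)"] by (metis divide_pos_pos of_nat_0_less_iff zero_less_Suc zero_less_one)
  then obtain u f where uf: "\<And>n. (u n, f n) \<in> op" "\<And>n. H.nrm (u n) = 1"
    "\<And>n. H.nrm (f n - cscale (complex_of_real l) (u n)) < 1 / real (Suc n)" by metis
  have "(\<lambda>n. H.nrm (f n - cscale (complex_of_real l) (u n))) \<longlonglongrightarrow> 0"
  proof (rule Lim_null_comparison)
    show "\<forall>\<^sub>F n in sequentially. norm (H.nrm (f n - cscale (complex_of_real l) (u n))) \<le> 1 / real (Suc n)"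
      using uf(3) opD[OF uf(1)] by (intro always_eventually) (simp add: less_imp_le)
    show "(\<lambda>n. 1 / real (Suc n)) \<longlonglongrightarrow> 0" by (intro LIMSEQ_Suc lim_1_over_n)
  qed
  from garding_compactness[OF G uf(1,2) this] show False using no by (metis zero_neq_one)
qed

text \<open>
  Almost eigenvectors at nearby points \<open>z \<noteq> l\<close> are almost orthogonal to the eigenspace at \<open>l\<close>, but
  accumulate at it.
\<close>

lemma garding_isolated:
  assumes G: "garding l I \<phi> c C"
  obtains r where "0 < r" "\<And>z. z \<noteq> complex_of_real l \<Longrightarrow> cmod (z - complex_of_real l) < r \<Longrightarrow> \<exists>c. lower_bound z c"
proof (rule ccontr)
  assume neg: "\<not> thesis"
  \<comment> \<open>The residual is taken small even relative to the distance of \<open>z\<close>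
    from \<open>l\<close>, because this distance is divided out below.\<close>
  have "\<exists>z u f. z \<noteq> complex_of_real l \<and> cmod (z - complex_of_real l) < 1 / real (Suc n) \<and> (u, f) \<in> op \<and>
      H.nrm u = 1 \<and> H.nrm (f - cscale z u) < cmod (z - complex_of_real l) / real (Suc n)" for n
  proof -
    have "0 < 1 / real (Suc n)" by simp
    then have "\<exists>z. z \<noteq> complex_of_real l \<and> cmod (z - complex_of_real l) < 1 / real (Suc n) \<and> (\<nexists>c. lower_bound z c)"
      using neg that by blast
    then obtain z where z: "z \<noteq> complex_of_real l" "cmod (z - complex_of_real l) < 1 / real (Suc n)" "\<nexists>c. lower_bound z c"
      by blast
    have "0 < cmod (z - complex_of_real l) / real (Suc n)" using z(1) by simp
    then show ?thesis using not_lower_bound[OF z(3)] z(1,2) by metis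
  qed
  then obtain z u f where z: "\<And>n. z n \<noteq> complex_of_real l" "\<And>n. cmod (z n - complex_of_real l) < 1 / real (Suc n)"
    and uf: "\<And>n. (u n, f n) \<in> op" "\<And>n. H.nrm (u n) = 1"
    and small: "\<And>n. H.nrm (f n - cscale (z n) (u n)) < cmod (z n - complex_of_real l) / real (Suc n)" by metis
  have [simp]: "u n \<in> D" "f n \<in> V" for n using opD[OF uf(1)[of n]] by auto
  have lim1: "(\<lambda>n. 1 / real (Suc n)) \<longlonglongrightarrow> 0" by (intro LIMSEQ_Suc lim_1_over_n)
  have "(\<lambda>n. H.nrm (f n - cscale (complex_of_real l) (u n))) \<longlonglongrightarrow> 0"
  proof (rule Lim_null_comparison)
    show "(\<lambda>n. 2 * (1 / real (Suc n))) \<longlonglongrightarrow> 0" using tendsto_mult_left[OF lim1, of 2] by simp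
    show "\<forall>\<^sub>F n in sequentially. norm (H.nrm (f n - cscale (complex_of_real l) (u n))) \<le> 2 * (1 / real (Suc n))"
    proof (intro always_eventually allI)
      fix n
      have "H.nrm (f n - cscale (complex_of_real l) (u n))
          \<le> H.nrm (f n - cscale (z n) (u n)) + H.nrm (cscale (z n) (u n) - cscale (complex_of_real l) (u n))"
        by (intro H.nrm_triangle3) simp_all
      also have "cscale (z n) (u n) - cscale (complex_of_real l) (u n) = cscale (z n - complex_of_real l) (u n)"
        by (simp add: fun_eq_iff algebra_simps)
      finally have "H.nrm (f n - cscale (complex_of_real l) (u n))
          \<le> H.nrm (f n - cscale (z n) (u n)) + cmod (z n - complex_of_real l)"
        by (simp only: H.nrm_scale D_V \<open>u n \<in> D\<close> uf(2) mult_1_right)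
      moreover have "cmod (z n - complex_of_real l) / real (Suc n) \<le> cmod (z n - complex_of_real l)"
        by (simp add: field_simps)
      moreover have "cmod (z n - complex_of_real l) \<le> 1 / real (Suc n)" using z(2)[of n] by linarith
      moreover have "cmod (z n - complex_of_real l) / real (Suc n) \<le> 1 / real (Suc n)"
      proof (rule divide_right_mono)
        have "1 / real (Suc n) \<le> 1" by simp
        then show "cmod (z n - complex_of_real l) \<le> 1" using z(2)[of n] by linarith
      qed simp
      ultimately show "norm (H.nrm (f n - cscale (complex_of_real l) (u n))) \<le> 2 * (1 / real (Suc n))"
        using small[of n] by simp
    qed
  qed
  from garding_compactness[OF G uf(1,2) this] obtain r w where r: "strict_mono (r :: nat \<Rightarrow> nat)"
    "(w, cscale (complex_of_real l) w) \<in> op" "H.nrm w = 1" "(\<lambda>n. H.nrm (u (r n) - w)) \<longlonglongrightarrow> 0" .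
  have w: "w \<in> D" using opD[OF r(2)] by simp
  \<comment> \<open>Symmetry moves \<open>l\<close> from the eigenvector \<open>w\<close> to
    \<open>u n\<close>; the factor \<open>z n - l\<close> then cancels against the relative
    residual.\<close>
  have "cmod (ip (u n) w) \<le> 1 / real (Suc n)" for n
  proof -
    have "ip (f n) w = complex_of_real l * ip (u n) w"
    proof -
      have "ip (f n) w = a (u n) w" using opD(3)[OF uf(1) w] by simp
      also have "\<dots> = cnj (a w (u n))" using w by (simp add: A.ip_cnj)
      also have "\<dots> = cnj (ip (cscale (complex_of_real l) w) (u n))" using opD(3)[OF r(2), of "u n"] by simp
      finally show ?thesis using w by (simp add: H.ip_scale H.ip_cnj)
    qed
    then have "(complex_of_real l - z n) * ip (u n) w = ip (f n - cscale (z n) (u n)) w"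
      using w by (simp add: H.ip_diff H.ip_scale algebra_simps)
    then have "cmod (z n - complex_of_real l) * cmod (ip (u n) w) = cmod (ip (f n - cscale (z n) (u n)) w)"
      by (metis norm_minus_commute norm_mult)
    also have "\<dots> \<le> H.nrm (f n - cscale (z n) (u n)) * H.nrm w"
      using w by (intro H.cauchy_schwarz) simp_all
    also have "\<dots> \<le> cmod (z n - complex_of_real l) * (1 / real (Suc n))"
      using small[of n] r(3) by simp
    finally show ?thesis
      by (rule mult_left_le_imp_le) (use z(1)[of n] in simp)
  qed
  then have "(\<lambda>n. ip (u n) w) \<longlonglongrightarrow> 0"
    by (intro Lim_null_comparison[OF _ lim1] always_eventually) simp
  from LIMSEQ_subseq_LIMSEQ[OF this r(1)] have "(\<lambda>n. ip (u (r n)) w) \<longlonglongrightarrow> 0" by (simp add: o_def)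
  moreover have "(\<lambda>n. ip (u (r n)) w) \<longlonglongrightarrow> ip w w"
    using w r(4) by (intro H.tendsto_ip) simp_all
  ultimately have "ip w w = 0" using LIMSEQ_unique by blast
  then show False using r(3) w by (simp add: H.ip_self)
qed

text \<open>With more eigenvectors than functionals, some nontrivial combination is annihilated by
  all functionals. On it the right-hand side of the inequality vanishes, and so does its form
  norm.\<close>

lemma garding_finite_multiplicity:
  assumes G: "garding l I \<phi> c C" and X: "finite X" "card I < card X"
    and e: "\<And>x. x \<in> X \<Longrightarrow> (e x, cscale (complex_of_real l) (e x)) \<in> op"
  shows "\<exists>b. (\<exists>x\<in>X. b x \<noteq> 0) \<and> H.nrm (\<Sum>x\<in>X. cscale (b x) (e x)) = 0"
proof -
  have I: "finite I" "0 < c" "\<And>i. i \<in> I \<Longrightarrow> \<phi> i \<in> V" using G by (auto simp: garding_def)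
  obtain b where b: "\<exists>x\<in>X. b x \<noteq> 0" "\<forall>i\<in>I. (\<Sum>x\<in>X. b x * ip (e x) (\<phi> i)) = 0"
    using homogeneous_system_solution[OF I(1) X, of "\<lambda>x i. ip (e x) (\<phi> i)"] by blast
  let ?u = "\<Sum>x\<in>X. cscale (b x) (e x)"
  have eD: "e x \<in> D" if "x \<in> X" for x using opD[OF e[OF that]] by simp
  have uD: "?u \<in> D" using eD by (intro D.sum_mem) simp
  have u0: "ip ?u (\<phi> i) = 0" if "i \<in> I" for i
    using b(2) that eD I(3) by (simp add: H.ip_sum H.ip_scale)
  have au: "a ?u v = complex_of_real l * ip ?u v" if v: "v \<in> D" for v
  proof -
    have "a ?u v = (\<Sum>x\<in>X. b x * a (e x) v)" using v eD by (simp add: A.ip_sum A.ip_scale)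
    also have "\<dots> = (\<Sum>x\<in>X. b x * (complex_of_real l * ip (e x) v))"
      using v eD opD(3)[OF e v] by (intro sum.cong) (simp_all add: H.ip_scale)
    finally show ?thesis using v eD by (simp add: H.ip_sum H.ip_scale sum_distrib_left mult_ac)
  qed
  obtain v where v: "v \<in> D"
    "c * (D.nrm ?u)\<^sup>2 \<le> Re (a ?u v - complex_of_real l * ip ?u v) + C * (\<Sum>i\<in>I. (cmod (ip ?u (\<phi> i)))\<^sup>2)"
    using G uD unfolding garding_def by blast
  then have "c * (D.nrm ?u)\<^sup>2 \<le> 0" using au[OF v(1)] u0 by simp
  then have "D.nrm ?u = 0" using I(2) by (simp add: mult_le_0_iff)
  have "H.nrm ?u = 0"
  proof (rule antisym)
    show "H.nrm ?u \<le> 0" using H_nrm_le[OF uD] \<open>D.nrm ?u = 0\<close> by simp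
  qed (use uD in simp)
  then show ?thesis using b(1) by blast
qed

subsection \<open>Points of the essential spectrum\<close>

text \<open>For an element of the form domain the residual is available only as a functional on that
  domain. Testing it with \<open>R (B u)\<close>, whose form norm is at most the norm of
  \<open>B u\<close>, turns it into a bound in \<open>V\<close>.\<close>

lemma singular_sequence_B:
  assumes u: "u \<in> D" and l: "0 \<le> l"
    and eps: "\<And>v. v \<in> D \<Longrightarrow> cmod (a u v - complex_of_real l * ip u v) \<le> \<epsilon> * D.nrm v" and "0 \<le> \<epsilon>"
  shows "H.nrm (B (complex_of_real l) u) \<le> \<epsilon>"
proof -
  let ?K = "B (complex_of_real l)"
  let ?f = "?K u"
  have f: "?f \<in> V" using u by simp
  have auR: "a u (R ?f) + ip u (R ?f) = ip u ?f"
  proof -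
    have "a u (R ?f) + ip u (R ?f) = cnj (a (R ?f) u + ip (R ?f) u)"
      using u f by (simp add: A.ip_cnj H.ip_cnj)
    then show ?thesis using R_eq[OF f u] u f by (simp add: H.ip_cnj)
  qed
  have "ip ?f ?f = ip u (?K ?f)" using u f B_adj[of u ?f "complex_of_real l"] by simp
  also have "\<dots> = ip u ?f - (1 + complex_of_real l) * ip u (R ?f)"
    using u f by (simp add: B_def[of _ ?f] H.ip_diff_right H.ip_scale_right)
  also have "\<dots> = a u (R ?f) - complex_of_real l * ip u (R ?f)"
    unfolding auR[symmetric] by (simp add: algebra_simps)
  finally have "cmod (ip ?f ?f) \<le> \<epsilon> * D.nrm (R ?f)" using eps[of "R ?f"] f by simp
  also have "\<dots> \<le> \<epsilon> * H.nrm ?f" using D_nrm_R[OF f] \<open>0 \<le> \<epsilon>\<close> by (rule mult_left_mono)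
  finally have *: "H.nrm ?f * H.nrm ?f \<le> \<epsilon> * H.nrm ?f"
    using f by (simp add: H.ip_self norm_power power2_eq_square norm_mult)
  show ?thesis
  proof (cases "H.nrm ?f = 0")
    case False
    then have "0 < H.nrm ?f" using H.nrm_nonneg[OF f] by linarith
    with * show ?thesis by (rule mult_right_le_imp_le)
  qed (use \<open>0 \<le> \<epsilon>\<close> in simp)
qed

lemma singular_sequence_spectrum:
  assumes u: "\<And>n. u n \<in> D" "\<And>n. H.nrm (u n) = 1" and l: "0 \<le> l"
    and eps: "\<And>n v. v \<in> D \<Longrightarrow> cmod (a (u n) v - complex_of_real l * ip (u n) v) \<le> \<epsilon> n * D.nrm v"
    and \<epsilon>: "\<And>n. 0 \<le> \<epsilon> n" "\<epsilon> \<longlonglongrightarrow> 0"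
  shows "\<nexists>c. lower_bound (complex_of_real l) c"
proof
  assume "\<exists>c. lower_bound (complex_of_real l) c"
  then obtain c where c: "lower_bound (complex_of_real l) c" by blast
  let ?M = "1 + cmod (1 + complex_of_real l) / c"
  have "0 < ?M" using lower_boundD(1)[OF c] by (simp add: add_pos_nonneg)
  have "1 \<le> ?M * \<epsilon> n" for n
  proof -
    have "1 \<le> ?M * H.nrm (B (complex_of_real l) (u n))"
      using B_lower_bound[OF c, of "u n"] u by simp
    also have "\<dots> \<le> ?M * \<epsilon> n"
      using singular_sequence_B[OF u(1) l eps \<epsilon>(1)] \<open>0 < ?M\<close> by (intro mult_left_mono) simp_all
    finally show ?thesis .
  qed
  moreover have "(\<lambda>n. ?M * \<epsilon> n) \<longlonglongrightarrow> 0" using tendsto_mult_left[OF \<epsilon>(2), of ?M] by simp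
  ultimately have "1 \<le> (0::real)" using LIMSEQ_le_const by blast
  then show False by simp
qed

text \<open>Isolation of \<open>l\<close> means that \<open>0\<close> is isolated in the spectrum of
  \<open>B l\<close>, because \<open>B l - t\<close> is a multiple of \<open>B y\<close> for a
  \<open>y\<close> near \<open>l\<close>. Hence \<open>kernel_approximation\<close> puts true
  eigenvectors close to the orthonormal approximate ones, and a small perturbation of
  \<open>N\<close> orthonormal vectors is independent.\<close>

lemma singular_sequence_multiplicity:
  assumes u: "\<And>n. u n \<in> D" "\<And>m n. ip (u m) (u n) = (if m = n then 1 else 0)" and l: "0 \<le> l"
    and eps: "\<And>n v. v \<in> D \<Longrightarrow> cmod (a (u n) v - complex_of_real l * ip (u n) v) \<le> \<epsilon> n * D.nrm v"
    and \<epsilon>: "\<And>n. 0 \<le> \<epsilon> n" "\<epsilon> \<longlonglongrightarrow> 0"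
    and iso: "0 < r" "\<And>z. z \<noteq> complex_of_real l \<Longrightarrow> cmod (z - complex_of_real l) < r \<Longrightarrow> \<exists>c. lower_bound z c"
  obtains e :: "nat \<Rightarrow> 'a \<Rightarrow> complex" where "\<And>i. i < N \<Longrightarrow> (e i, cscale (complex_of_real l) (e i)) \<in> op"
    "\<And>b. H.nrm (\<Sum>i<N. cscale (b i) (e i)) = 0 \<Longrightarrow> \<forall>i<N. b i = 0"
proof -
  let ?K = "B (complex_of_real l)"
  interpret K: bounded_self_adjoint V ip ?K "1 + cmod (1 + complex_of_real l)"
    by unfold_locales (use B_adj[of _ _ "complex_of_real l"] B_bound in auto)
  \<comment> \<open>The bound \<open>1 / 2\<close> keeps \<open>1 - t\<close> above
    \<open>1 / 2\<close>; the second bound then gives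
    \<open>\<bar>y - l\<bar> \<le> 2 * (1 + l) * \<bar>t\<bar> < r\<close>.\<close>
  define s where "s = min (1 / 2) (r / (2 * (1 + l)))"
  have "0 < s" using iso(1) l by (simp add: s_def)
  have low: "s * H.nrm (?K h) \<le> H.nrm (?K (?K h))" if "h \<in> V" for h
  proof (rule K.isolated_zero_lower_bound[OF K.T_bounded _ \<open>0 < s\<close> that])
    fix t :: real assume t: "0 < \<bar>t\<bar>" "\<bar>t\<bar> < s"
    then have t1: "\<bar>t\<bar> < 1 / 2" "\<bar>t\<bar> < r / (2 * (1 + l))" by (auto simp: s_def)
    \<comment> \<open>\<open>y\<close> is the solution of \<open>(1 - t) * (1 + y) = 1 + l\<close>,
      which makes \<open>B l - t\<close> equal to \<open>(1 - t) * B y\<close>.\<close>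
    define y where "y = (l + t) / (1 - t)"
    have nz: "1 - t \<noteq> 0" "1 / 2 < 1 - t" using t1 by (auto simp: abs_if split: if_splits)
    have yl: "y - l = (1 + l) * t / (1 - t)" using nz by (simp add: y_def field_simps)
    have "\<bar>y - l\<bar> = (1 + l) * \<bar>t\<bar> / (1 - t)" using nz l unfolding yl by (simp add: abs_mult)
    also have "\<dots> \<le> (1 + l) * \<bar>t\<bar> / (1 / 2)" using nz l by (intro divide_left_mono) auto
    also have "\<dots> < r" using t1(2) l by (simp add: field_simps)
    finally have "\<bar>y - l\<bar> < r" .
    moreover have "y \<noteq> l" using yl t nz l by auto
    ultimately obtain c where c: "lower_bound (complex_of_real y) c"
      using iso(2)[of "complex_of_real y"] by (auto simp flip: of_real_diff)
    let ?M = "1 + cmod (1 + complex_of_real y) / c"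
    have "0 < ?M" using lower_boundD(1)[OF c] by (simp add: add_pos_nonneg)
    have "(1 - t) / ?M * H.nrm h \<le> H.nrm (?K h - cscale (complex_of_real t) h)" if "h \<in> V" for h
    proof -
      have "(1 - t) * (1 + y) = 1 + l" using nz by (simp add: y_def field_simps)
      then have yl: "(1 - complex_of_real t) * (1 + complex_of_real y) = 1 + complex_of_real l"
        by (metis of_real_1 of_real_add of_real_diff of_real_mult)
      have "cscale (complex_of_real (1 - t)) (B (complex_of_real y) h)
          = cscale (complex_of_real (1 - t)) h - cscale ((1 - complex_of_real t) * (1 + complex_of_real y)) (R h)"
        by (simp add: fun_eq_iff B_def algebra_simps)
      also have "\<dots> = ?K h - cscale (complex_of_real t) h"
        unfolding yl by (simp add: fun_eq_iff B_def algebra_simps)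
      finally have "?K h - cscale (complex_of_real t) h = cscale (complex_of_real (1 - t)) (B (complex_of_real y) h)"
        by simp
      moreover have "cmod (complex_of_real (1 - t)) = 1 - t" using nz by (simp only: norm_of_real)
      ultimately have "H.nrm (?K h - cscale (complex_of_real t) h) = (1 - t) * H.nrm (B (complex_of_real y) h)"
        using H.nrm_scale[of "B (complex_of_real y) h" "complex_of_real (1 - t)"] that by simp
      moreover have "H.nrm h / ?M \<le> H.nrm (B (complex_of_real y) h)"
        using B_lower_bound[OF c that] \<open>0 < ?M\<close> by (simp add: pos_divide_le_eq mult.commute)
      ultimately show ?thesis using mult_left_mono[of "H.nrm h / ?M" _ "1 - t"] nz by simp
    qed
    then show "\<exists>c>0. \<forall>h\<in>V. c * H.nrm h \<le> H.nrm (?K h - cscale (complex_of_real t) h)"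
      using nz \<open>0 < ?M\<close> by (intro exI[of _ "(1 - t) / ?M"]) simp
  qed
  have nu: "H.nrm (u n) = 1" for n using u(2)[of n n] by (simp add: H.nrm_def)
  \<comment> \<open>\<open>N\<close> errors of size \<open>\<delta>\<close> add up to
    \<open>N / (N + 1) < 1\<close>, which is what independence requires.\<close>
  define \<delta> where "\<delta> = 1 / (real N + 1)"
  have "0 < \<delta>" by (simp add: \<delta>_def)
  have "0 < s * \<delta>" using \<open>0 < s\<close> \<open>0 < \<delta>\<close> by simp
  from LIMSEQ_D[OF \<epsilon>(2) this] obtain n0 where "\<forall>n\<ge>n0. norm (\<epsilon> n - 0) < s * \<delta>" by blast
  then have n0: "\<epsilon> n < s * \<delta>" if "n \<ge> n0" for n using that by force
  define x where "x i = u (n0 + i)" for i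
  have x [simp]: "x i \<in> D" for i using u by (simp add: x_def)
  have "\<exists>p\<in>V. H.nrm (?K p) = 0 \<and> H.nrm (x i - p) < \<delta>" for i
  proof -
    obtain p where p: "p \<in> V" "H.nrm (?K p) = 0" "s * H.nrm (x i - p) \<le> H.nrm (?K (x i))"
      using K.kernel_approximation[OF low \<open>0 < s\<close>, of "x i"] by auto
    have "H.nrm (?K (x i)) \<le> \<epsilon> (n0 + i)"
      unfolding x_def using singular_sequence_B[OF u(1) l eps \<epsilon>(1)] by simp
    then have "s * H.nrm (x i - p) < s * \<delta>" using p(3) n0[of "n0 + i"] by simp
    then show ?thesis using p \<open>0 < s\<close> by auto
  qed
  then obtain p where p: "\<And>i. p i \<in> V" "\<And>i. H.nrm (?K (p i)) = 0" "\<And>i. H.nrm (x i - p i) < \<delta>" by metis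
  \<comment> \<open>\<open>p i\<close> is only known to lie in \<open>V\<close>; \<open>e i\<close>
    differs from it by \<open>B l (p i)\<close>, of norm \<open>0\<close>, and lies in the form
    domain.\<close>
  define e where "e i = cscale (1 + complex_of_real l) (R (p i))" for i
  have e [simp]: "e i \<in> D" for i using p by (simp add: e_def)
  have pe: "H.nrm (p i - e i) = 0" for i using p(2)[of i] by (simp add: B_def e_def)
  have "(e i, cscale (complex_of_real l) (e i)) \<in> op" for i
  proof (rule opI)
    fix v assume v: "v \<in> D"
    have "a (e i) v + ip (e i) v = (1 + complex_of_real l) * (a (R (p i)) v + ip (R (p i)) v)"
      using v p(1) by (simp add: e_def A.ip_scale H.ip_scale algebra_simps)
    also have "\<dots> = (1 + complex_of_real l) * ip (e i) v"
      using R_eq[OF p(1) v] H.ip_cong[OF p(1)[of i] _ _ pe[of i], of v] v by simp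
    finally show "a (e i) v = ip (cscale (complex_of_real l) (e i)) v"
      using v by (simp add: H.ip_scale algebra_simps)
  qed simp_all
  moreover have "\<forall>i<N. b i = 0" if b: "H.nrm (\<Sum>i<N. cscale (b i) (e i)) = 0" for b
  proof -
    \<comment> \<open>\<open>B2\<close> is the norm of the combination of the \<open>x i\<close>. If
      the same combination of the \<open>e i\<close> vanishes, then
      \<open>B2 \<le> B2 * N / (N + 1)\<close>, which forces \<open>B2 = 0\<close>.\<close>
    define B2 where "B2 = sqrt (\<Sum>i<N. (cmod (b i))\<^sup>2)"
    have B2: "cmod (b i) \<le> B2" if "i < N" for i
      unfolding B2_def using that member_le_sum[of i "{..<N}" "\<lambda>i. (cmod (b i))\<^sup>2"]
      by (intro real_le_rsqrt) simp
    have "0 \<le> B2" by (simp add: B2_def sum_nonneg)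
    let ?x = "\<Sum>i<N. cscale (b i) (x i)"
    have xV: "?x \<in> V" by (intro H.sum_mem) simp
    have eV: "(\<Sum>i<N. cscale (b i) (e i)) \<in> V" by (intro H.sum_mem) simp
    have "ip ?x ?x = (\<Sum>i<N. \<Sum>j<N. cnj (b i) * (b j * (if j = i then 1 else 0)))"
      by (simp add: H.ip_sum H.ip_sum_right H.ip_scale H.ip_scale_right H.sum_mem x_def u sum_distrib_left)
    also have "\<dots> = (\<Sum>i<N. complex_of_real ((cmod (b i))\<^sup>2))"
      by (intro sum.cong refl) (simp add: if_distrib complex_norm_square mult.commute cong: if_cong del: of_real_power)
    finally have "(H.nrm ?x)\<^sup>2 = (\<Sum>i<N. (cmod (b i))\<^sup>2)"
      using xV by (simp add: H.nrm_power2)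
    then have "H.nrm ?x = B2" using xV by (simp add: B2_def real_sqrt_unique)
    have xe: "H.nrm (x i - e i) < \<delta>" for i
      using H.nrm_triangle3[of "x i" "p i" "e i"] p(1,3)[of i] pe[of i] by simp
    have "B2 \<le> H.nrm (?x - (\<Sum>i<N. cscale (b i) (e i)))"
      using H.nrm_diff_ge[OF xV eV] b \<open>H.nrm ?x = B2\<close> by simp
    also have "?x - (\<Sum>i<N. cscale (b i) (e i)) = (\<Sum>i<N. cscale (b i) (x i - e i))"
      unfolding sum_subtractf[symmetric] by (intro sum.cong) (simp_all add: fun_eq_iff algebra_simps)
    also have "H.nrm \<dots> \<le> (\<Sum>i<N. H.nrm (cscale (b i) (x i - e i)))" by (intro H.nrm_sum) simp
    also have "\<dots> \<le> (\<Sum>i<N. B2 * \<delta>)"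
    proof (rule sum_mono)
      fix i assume "i \<in> {..<N}"
      then show "H.nrm (cscale (b i) (x i - e i)) \<le> B2 * \<delta>"
        using B2[of i] xe[of i] \<open>0 \<le> B2\<close> by (simp add: H.nrm_scale mult_mono less_imp_le)
    qed
    also have "\<dots> = B2 * (real N / (real N + 1))" by (simp add: \<delta>_def)
    finally have "B2 * (1 / (real N + 1)) \<le> 0" by (simp add: field_simps)
    then have "B2 = 0" using \<open>0 \<le> B2\<close> by (simp add: mult_le_0_iff divide_le_0_iff)
    then show ?thesis using B2 by auto
  qed
  ultimately show ?thesis using that[of e] by blast
qed

end

section \<open>The space \<open>L\<^sup>2(M)\<close>\<close>

lemma sum_fun_apply: "(\<Sum>i\<in>I. f i) x = (\<Sum>i\<in>I. f i x :: complex)"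
  by (induction I rule: infinite_finite_induct) simp_all

lemma L2_measurable: "u \<in> L2 M \<Longrightarrow> u \<in> borel_measurable M"
  by (simp add: L2_def)

lemma L2_integrable: "u \<in> L2 M \<Longrightarrow> integrable M (\<lambda>x. (cmod (u x))\<^sup>2)"
  by (simp add: L2_def)

lemma L2_mult_integrable:
  assumes "u \<in> L2 M" "v \<in> L2 M" shows "integrable M (\<lambda>x. u x * cnj (v x))"
proof (rule Bochner_Integration.integrable_bound)
  show "integrable M (\<lambda>x. (cmod (u x))\<^sup>2 + (cmod (v x))\<^sup>2)"
    using assms by (intro Bochner_Integration.integrable_add L2_integrable)
  have [measurable]: "u \<in> borel_measurable M" "v \<in> borel_measurable M"
    using assms by (auto intro: L2_measurable)
  have "(\<lambda>x. cnj (v x)) \<in> borel_measurable M"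
    by (rule measurable_compose[OF _ borel_measurable_continuous_onI])
      (auto intro: continuous_intros)
  then show "(\<lambda>x. u x * cnj (v x)) \<in> borel_measurable M" by measurable
  have "cmod a * cmod b \<le> (cmod a)\<^sup>2 + (cmod b)\<^sup>2" for a b
  proof -
    have "0 \<le> cmod a * cmod b" by simp
    then show ?thesis using sum_squares_bound[of "cmod a" "cmod b"] by linarith
  qed
  then show "AE x in M. norm (u x * cnj (v x)) \<le> norm ((cmod (u x))\<^sup>2 + (cmod (v x))\<^sup>2)"
    by (simp add: norm_mult)
qed

lemma L2_add: assumes "u \<in> L2 M" "v \<in> L2 M" shows "u + v \<in> L2 M"
proof -
  have [measurable]: "u \<in> borel_measurable M" "v \<in> borel_measurable M"
    using assms by (auto intro: L2_measurable)
  have "integrable M (\<lambda>x. (cmod (u x + v x))\<^sup>2)"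
  proof (rule Bochner_Integration.integrable_bound)
    show "integrable M (\<lambda>x. 2 * (cmod (u x))\<^sup>2 + 2 * (cmod (v x))\<^sup>2)"
      using assms by (intro Bochner_Integration.integrable_add integrable_mult_right L2_integrable)
    have "(cmod (a + b))\<^sup>2 \<le> 2 * (cmod a)\<^sup>2 + 2 * (cmod b)\<^sup>2" for a b
    proof -
      have "(cmod (a + b))\<^sup>2 \<le> (cmod a + cmod b)\<^sup>2"
        by (intro power_mono norm_triangle_ineq) simp
      moreover have "0 \<le> (cmod a - cmod b)\<^sup>2" by simp
      ultimately show ?thesis by (simp add: power2_sum power2_diff)
    qed
    then show "AE x in M. norm ((cmod (u x + v x))\<^sup>2) \<le> norm (2 * (cmod (u x))\<^sup>2 + 2 * (cmod (v x))\<^sup>2)"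
      by simp
  qed measurable
  then show ?thesis by (simp add: L2_def plus_fun_def)
qed

lemma L2_scale: "u \<in> L2 M \<Longrightarrow> cscale c u \<in> L2 M"
  by (auto simp: L2_def cscale_def norm_mult power_mult_distrib)

lemma L2_zero: "0 \<in> L2 M"
  by (simp add: L2_def zero_fun_def)

lemma l2_inner_self: "l2_inner M u u = complex_of_real (LINT x|M. (cmod (u x))\<^sup>2)"
proof -
  have "u x * cnj (u x) = complex_of_real ((cmod (u x))\<^sup>2)" for x
    by (simp only: complex_norm_square)
  then have "l2_inner M u u = (LINT x|M. complex_of_real ((cmod (u x))\<^sup>2))"
    by (simp add: l2_inner_def)
  then show ?thesis by (simp only: integral_complex_of_real)
qed

lemma semi_inner_L2: "semi_inner (L2 M) (l2_inner M)"
proof (unfold_locales, goal_cases)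
  case (4 u v w)
  then show ?case using L2_mult_integrable[of u M w] L2_mult_integrable[of v M w]
    by (simp add: l2_inner_def distrib_right)
next
  case (5 u w c)
  then show ?case using L2_mult_integrable[of u M w] by (simp add: l2_inner_def mult.assoc)
next
  case (6 u v)
  show ?case
    unfolding l2_inner_def by (subst Bochner_Integration.integral_cnj[symmetric]) (simp add: mult.commute)
next
  case (7 u)
  then show ?case by (simp add: l2_inner_self)
qed (simp_all add: L2_zero L2_add L2_scale)

lemma nrm_L2: "semi_inner.nrm (l2_inner M) u = l2_norm M u"
  by (simp add: semi_inner.nrm_def[OF semi_inner_L2] l2_inner_self l2_norm_def)

lemma l2_norm_power2: "(l2_norm M u)\<^sup>2 = (LINT x|M. (cmod (u x))\<^sup>2)"
  by (simp add: l2_norm_def)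

lemma l2_norm_eq_0_iff:
  assumes "u \<in> L2 M" shows "l2_norm M u = 0 \<longleftrightarrow> (AE x in M. u x = 0)"
  using integral_nonneg_eq_0_iff_AE[OF L2_integrable[OF assms]] by (simp add: l2_norm_def)

lemma nn_integral_L2:
  assumes "u \<in> L2 M" shows "(\<integral>\<^sup>+x. ennreal ((cmod (u x))\<^sup>2) \<partial>M) = ennreal ((l2_norm M u)\<^sup>2)"
  using nn_integral_eq_integral[OF L2_integrable[OF assms]] by (simp add: l2_norm_power2)

lemma L2_I_nn_integral:
  assumes "u \<in> borel_measurable M" "(\<integral>\<^sup>+x. ennreal ((cmod (u x))\<^sup>2) \<partial>M) \<le> ennreal c"
  shows "u \<in> L2 M"
proof -
  have "(\<integral>\<^sup>+x. ennreal ((cmod (u x))\<^sup>2) \<partial>M) < \<infinity>"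
    using assms(2) ennreal_less_top[of c] by (simp add: order_le_less_trans)
  then have "integrable M (\<lambda>x. (cmod (u x))\<^sup>2)"
    using assms(1) by (intro integrableI_nonneg) simp_all
  then show ?thesis using assms(1) by (simp add: L2_def)
qed

text \<open>Riesz-Fischer: a rapidly Cauchy subsequence has increments \<open>g k\<close> that are
  summable at almost every point, and Fatou's lemma carries the Cauchy estimate over to the
  pointwise limit.\<close>

lemma semi_hilbert_L2: "semi_hilbert (L2 M) (l2_inner M)"
proof -
  interpret semi_inner "L2 M" "l2_inner M" by (rule semi_inner_L2)
  show ?thesis
  proof
    fix f :: "nat \<Rightarrow> 'a \<Rightarrow> complex" assume f: "\<And>n. f n \<in> L2 M" "cauchy_seq f"
    have [measurable]: "f n \<in> borel_measurable M" for n using f(1) by (rule L2_measurable)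
    have "\<exists>N. \<forall>m\<ge>N. \<forall>n\<ge>N. l2_norm M (f m - f n) < (1/2)^k" for k
      using f(2) unfolding cauchy_seq_def nrm_L2 by simp
    then obtain N where N: "\<And>k m n. m \<ge> N k \<Longrightarrow> n \<ge> N k \<Longrightarrow> l2_norm M (f m - f n) < (1/2)^k"
      by metis
    define r where "r k = (\<Sum>j\<le>k. N j)" for k
    have rN: "N k \<le> r k" for k unfolding r_def by (rule member_le_sum) auto
    have rmono: "r k \<le> r (Suc k)" for k by (simp add: r_def)
    define g where "g k = f (r (Suc k)) - f (r k)" for k
    have gL2: "g k \<in> L2 M" for k using f(1) by (simp add: g_def)
    have [measurable]: "g k \<in> borel_measurable M" for k using gL2 by (rule L2_measurable)
    have gn: "l2_norm M (g k) < (1/2)^k" for k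
      unfolding g_def using rN[of k] rmono[of k] by (intro N) auto
    have l2nn: "0 \<le> l2_norm M u" for u by (simp add: l2_norm_def)
    have "(\<integral>\<^sup>+x. (\<Sum>k. ennreal (2^k * (cmod (g k x))\<^sup>2)) \<partial>M) = (\<Sum>k. \<integral>\<^sup>+x. ennreal (2^k * (cmod (g k x))\<^sup>2) \<partial>M)"
      by (intro nn_integral_suminf) measurable
    also have "\<dots> \<le> (\<Sum>k. ennreal ((1/2)^k))"
    proof (rule suminf_le)
      fix k
      have "(\<integral>\<^sup>+x. ennreal (2^k * (cmod (g k x))\<^sup>2) \<partial>M) = ennreal (2^k) * ennreal ((l2_norm M (g k))\<^sup>2)"
        by (simp add: ennreal_mult nn_integral_cmult nn_integral_L2[OF gL2])
      also have "\<dots> = ennreal (2^k * (l2_norm M (g k))\<^sup>2)" by (simp add: ennreal_mult)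
      also have "\<dots> \<le> ennreal ((1/2)^k)"
      proof (rule ennreal_leI)
        have "(l2_norm M (g k))\<^sup>2 \<le> ((1/2)^k)\<^sup>2"
          using gn[of k] l2nn by (intro power_mono) (auto intro: less_imp_le)
        then have "2^k * (l2_norm M (g k))\<^sup>2 \<le> 2^k * ((1/2)^k * (1/2)^k)"
          by (simp add: power2_eq_square)
        also have "\<dots> = (1/2::real)^k" by (simp add: power_divide)
        finally show "2^k * (l2_norm M (g k))\<^sup>2 \<le> (1/2)^k" .
      qed
      finally show "(\<integral>\<^sup>+x. ennreal (2^k * (cmod (g k x))\<^sup>2) \<partial>M) \<le> ennreal ((1/2)^k)" .
    qed simp_all
    also have "\<dots> = ennreal (\<Sum>k. (1/2)^k)"
      by (intro suminf_ennreal2 summable_geometric) simp_all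
    finally have "(\<integral>\<^sup>+x. (\<Sum>k. ennreal (2^k * (cmod (g k x))\<^sup>2)) \<partial>M) \<noteq> \<infinity>"
      by (metis ennreal_less_top infinity_ennreal_def leD)
    then have "AE x in M. (\<Sum>k. ennreal (2^k * (cmod (g k x))\<^sup>2)) \<noteq> \<infinity>"
      by (intro nn_integral_noteq_infinite) measurable
    then have conv: "AE x in M. convergent (\<lambda>k. f (r k) x)"
    proof (rule AE_mp, intro AE_I2 impI)
      fix x assume "(\<Sum>k. ennreal (2^k * (cmod (g k x))\<^sup>2)) \<noteq> \<infinity>"
      then have "summable (\<lambda>k. 2^k * (cmod (g k x))\<^sup>2)"
        by (intro summable_suminf_not_top) simp_all
      then have "Bseq (\<lambda>k. 2^k * (cmod (g k x))\<^sup>2)"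
        using summable_LIMSEQ_zero convergent_imp_Bseq convergentI by blast
      then obtain K where K: "K > 0" "\<And>k. norm (2^k * (cmod (g k x))\<^sup>2) \<le> K" by (auto simp: Bseq_def)
      \<comment> \<open>The weight \<open>2^k\<close> turns a finite weighted sum of squares at
        \<open>x\<close> into geometric decay of \<open>g k x\<close>.\<close>
      have "cmod (g k x) \<le> sqrt K * (1 / sqrt 2)^k" for k
      proof -
        have "(cmod (g k x))\<^sup>2 \<le> K / 2^k" using K(2)[of k] by (simp add: field_simps)
        then have "cmod (g k x) \<le> sqrt (K / 2^k)" by (rule real_le_rsqrt)
        then show ?thesis by (simp add: real_sqrt_divide real_sqrt_power power_divide)
      qed
      note le = this
      have "norm (1 / sqrt 2) < (1::real)" by (simp add: divide_less_eq_1)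
      then have "summable (\<lambda>k. (1 / sqrt 2 :: real)^k)" by (rule summable_geometric)
      then have "summable (\<lambda>k. sqrt K * (1 / sqrt 2)^k)" by (rule summable_mult)
      then have "summable (\<lambda>k. g k x)"
        by (rule summable_comparison_test'[where N = 0]) (rule le)
      then have "convergent (\<lambda>n. \<Sum>k<n. g k x)" by (simp add: summable_iff_convergent)
      then have "convergent (\<lambda>n. (\<Sum>k<n. g k x) + f (r 0) x)"
        by (intro convergent_add convergent_const)
      moreover have "(\<Sum>k<n. g k x) = f (r n) x - f (r 0) x" for n
        by (induction n) (simp_all add: g_def)
      ultimately show "convergent (\<lambda>k. f (r k) x)" by simp
    qed
    define u where "u x = lim (\<lambda>k. f (r k) x)" for x
    have um [measurable]: "u \<in> borel_measurable M"
      unfolding u_def by (intro borel_measurable_lim_metric) measurable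
    have fatou: "(\<integral>\<^sup>+x. ennreal ((cmod ((f n - u) x))\<^sup>2) \<partial>M) \<le> ennreal (((1/2)^k)\<^sup>2)" if n: "n \<ge> N k" for n k
    proof -
      have "(\<integral>\<^sup>+x. ennreal ((cmod ((f n - u) x))\<^sup>2) \<partial>M)
          = (\<integral>\<^sup>+x. liminf (\<lambda>j. ennreal ((cmod (f n x - f (r j) x))\<^sup>2)) \<partial>M)"
      proof (rule nn_integral_cong_AE, rule AE_mp[OF conv], intro AE_I2 impI)
        fix x assume "convergent (\<lambda>k. f (r k) x)"
        then have "(\<lambda>k. f (r k) x) \<longlonglongrightarrow> u x" by (simp add: u_def convergent_LIMSEQ_iff)
        then have "(\<lambda>j. ennreal ((cmod (f n x - f (r j) x))\<^sup>2)) \<longlonglongrightarrow> ennreal ((cmod (f n x - u x))\<^sup>2)"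
          by (intro tendsto_ennrealI tendsto_power tendsto_norm tendsto_diff tendsto_const)
        then show "ennreal ((cmod ((f n - u) x))\<^sup>2) = liminf (\<lambda>j. ennreal ((cmod (f n x - f (r j) x))\<^sup>2))"
          using lim_imp_Liminf[OF trivial_limit_sequentially] by fastforce
      qed
      also have "\<dots> \<le> liminf (\<lambda>j. \<integral>\<^sup>+x. ennreal ((cmod (f n x - f (r j) x))\<^sup>2) \<partial>M)"
        by (intro nn_integral_liminf) measurable
      also have "\<dots> \<le> ennreal (((1/2)^k)\<^sup>2)"
      proof (rule Liminf_le)
        have "(\<integral>\<^sup>+x. ennreal ((cmod (f n x - f (r j) x))\<^sup>2) \<partial>M) \<le> ennreal (((1/2)^k)\<^sup>2)" if "j \<ge> k" for j
        proof -
          have "N k \<le> r j" using rN[of k] lift_Suc_mono_le[of r, OF rmono that] by linarith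
          then have "l2_norm M (f n - f (r j)) < (1/2)^k" using n by (intro N)
          then have "(l2_norm M (f n - f (r j)))\<^sup>2 \<le> ((1/2)^k)\<^sup>2"
            using l2nn by (intro power_mono) (auto intro: less_imp_le)
          then show ?thesis
            using nn_integral_L2[of "f n - f (r j)" M] f(1) by (simp add: ennreal_leI)
        qed
        then show "\<forall>\<^sub>F j in sequentially. (\<integral>\<^sup>+x. ennreal ((cmod (f n x - f (r j) x))\<^sup>2) \<partial>M) \<le> ennreal (((1/2)^k)\<^sup>2)"
          by (rule eventually_sequentiallyI)
      qed simp
      finally show ?thesis .
    qed
    have "f (N 0) - u \<in> L2 M"
    proof (rule L2_I_nn_integral[OF _ fatou[OF order_refl]])
      have "(\<lambda>x. f (N 0) x - u x) \<in> borel_measurable M" by measurable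
      then show "f (N 0) - u \<in> borel_measurable M" by (simp add: fun_diff_def)
    qed
    moreover have eq: "f (N 0) - (f (N 0) - u) = u" by (simp add: fun_eq_iff)
    ultimately have uL: "u \<in> L2 M" using diff_mem[OF f(1)[of "N 0"], of "f (N 0) - u"] by metis
    have "(\<lambda>n. nrm (f n - u)) \<longlonglongrightarrow> 0"
    proof (rule LIMSEQ_I)
      fix e :: real assume "0 < e"
      then obtain k where k: "(1/2)^k < e" using real_arch_pow_inv[of e "1/2"] by auto
      have "norm (nrm (f n - u) - 0) < e" if "n \<ge> N k" for n
      proof -
        have "ennreal ((l2_norm M (f n - u))\<^sup>2) \<le> ennreal (((1/2)^k)\<^sup>2)"
          using fatou[OF that] nn_integral_L2[of "f n - u" M] f(1) uL by simp
        then have "(l2_norm M (f n - u))\<^sup>2 \<le> ((1/2)^k)\<^sup>2" by (subst (asm) ennreal_le_iff) simp_all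
        then have "l2_norm M (f n - u) \<le> (1/2)^k" by (rule power2_le_imp_le) simp
        then show ?thesis using k l2nn[of "f n - u"] by (simp add: nrm_L2)
      qed
      then show "\<exists>no. \<forall>n\<ge>no. norm (nrm (f n - u) - 0) < e" by blast
    qed
    with uL show "\<exists>u\<in>L2 M. (\<lambda>n. nrm (f n - u)) \<longlonglongrightarrow> 0" by blast
  qed
qed

section \<open>Essential spectra of form operators\<close>

locale L2_form = closed_form "L2 M" "l2_inner M" D a for M :: "'a measure" and D a
begin

lemma op_eq: "op = form_operator M D a"
  by (simp add: op_def form_operator_def)

lemma AE_eq_iff_nrm:
  assumes "u \<in> L2 M" "v \<in> L2 M" shows "(AE x in M. u x = v x) \<longleftrightarrow> H.nrm (u - v) = 0"
  using l2_norm_eq_0_iff[of "u - v" M] assms by (simp add: nrm_L2)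

lemma resolvent_setI:
  assumes "lower_bound z c" "lower_bound (cnj z) c'"
  shows "z \<in> resolvent_set M (form_operator M D a)"
  unfolding resolvent_set_def op_eq[symmetric]
proof (intro CollectI conjI ballI)
  fix g assume g: "g \<in> L2 M"
  from resolvent_onto[OF assms g] obtain u f where uf: "(u, f) \<in> op" "H.nrm (f - cscale z u - g) = 0" .
  have "AE x in M. (f - cscale z u) x = g x"
    using uf opD[OF uf(1)] g by (subst AE_eq_iff_nrm) simp_all
  with uf(1) show "\<exists>(u, f)\<in>op. AE x in M. f x - z * u x = g x" by (auto intro!: bexI[of _ "(u, f)"])
next
  have "l2_norm M u \<le> (1 / c) * l2_norm M (\<lambda>x. f x - z * u x)" if "(u, f) \<in> op" for u f
  proof -
    have eq: "f - cscale z u = (\<lambda>x. f x - z * u x)" by (simp add: fun_eq_iff)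
    show ?thesis
      using lower_boundD(2)[OF assms(1) that] lower_boundD(1)[OF assms(1)]
      unfolding nrm_L2 eq by (simp add: field_simps)
  qed
  then show "\<exists>C. \<forall>(u, f)\<in>op. l2_norm M u \<le> C * l2_norm M (\<lambda>x. f x - z * u x)" by blast
qed

lemma resolvent_setD:
  assumes "z \<in> resolvent_set M (form_operator M D a)"
  shows "\<exists>c. lower_bound z c"
proof -
  obtain C where C: "\<And>u f. (u, f) \<in> op \<Longrightarrow> l2_norm M u \<le> C * l2_norm M (\<lambda>x. f x - z * u x)"
    using assms unfolding resolvent_set_def op_eq[symmetric] by blast
  have "1 / max C 1 * H.nrm u \<le> H.nrm (f - cscale z u)" if "(u, f) \<in> op" for u f
  proof -
    have eq: "f - cscale z u = (\<lambda>x. f x - z * u x)" by (simp add: fun_eq_iff)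
    have "H.nrm u \<le> C * H.nrm (f - cscale z u)" using C[OF that] unfolding nrm_L2 eq .
    also have "\<dots> \<le> max C 1 * H.nrm (f - cscale z u)"
      using opD[OF that] by (intro mult_right_mono) simp_all
    finally show ?thesis by (simp add: field_simps)
  qed
  then show ?thesis unfolding lower_bound_def by (intro exI[of _ "1 / max C 1"]) auto
qed

lemma not_essential_spectrum_outside:
  assumes "Im z \<noteq> 0 \<or> Re z < 0"
  shows "z \<notin> essential_spectrum M (form_operator M D a)"
  using lower_bound_outside[of z] lower_bound_outside[of "cnj z"] assms resolvent_setI
  by (auto simp: essential_spectrum_def spectrum_def)

text \<open>A spectral point that satisfies the inequality admits no lower bound, hence is an
  eigenvalue by compactness. The same inequality gives isolation and bounds the multiplicity by
  \<open>card I\<close>.\<close>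

lemma not_essential_spectrum_garding:
  assumes G: "garding l I \<phi> c C"
  shows "complex_of_real l \<notin> essential_spectrum M (form_operator M D a)"
proof
  let ?A = "form_operator M D a"
  assume "complex_of_real l \<in> essential_spectrum M ?A"
  then have sp: "complex_of_real l \<in> spectrum M ?A" and nd: "complex_of_real l \<notin> discrete_spectrum M ?A"
    by (auto simp: essential_spectrum_def)
  have "\<nexists>c. lower_bound (complex_of_real l) c"
    using sp resolvent_setI[of "complex_of_real l"] by (auto simp: spectrum_def)
  then obtain w where w: "(w, cscale (complex_of_real l) w) \<in> op" "H.nrm w \<noteq> 0"
    using garding_lower_bound[OF G] by blast
  have "is_eigenvalue M ?A (complex_of_real l)"
    unfolding is_eigenvalue_def eigenspace_def op_eq[symmetric]
    using w opD(1)[OF w(1)] l2_norm_eq_0_iff[of w M] by (auto simp: cscale_def nrm_L2)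
  moreover have "complex_of_real l isolated_in spectrum M ?A"
  proof -
    obtain r where r: "0 < r"
      "\<And>z. z \<noteq> complex_of_real l \<Longrightarrow> cmod (z - complex_of_real l) < r \<Longrightarrow> \<exists>c. lower_bound z c"
      using garding_isolated[OF G] by blast
    have "z \<notin> spectrum M ?A" if "z \<noteq> complex_of_real l" "z \<in> ball (complex_of_real l) r" for z
    proof -
      \<comment> \<open>Membership in the resolvent set is deduced from lower bounds at
        \<open>z\<close> and at \<open>cnj z\<close>; both points have the same distance to the real
        number \<open>l\<close>.\<close>
      have "cmod (cnj z - complex_of_real l) = cmod (z - complex_of_real l)"
        by (metis complex_cnj_complex_of_real complex_cnj_diff complex_mod_cnj)
      moreover have "cmod (z - complex_of_real l) < r" using that by (simp add: dist_norm norm_minus_commute)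
      moreover have "cnj z \<noteq> complex_of_real l" using that(1) by (metis complex_cnj_cnj complex_cnj_complex_of_real)
      ultimately show ?thesis
        using r(2)[OF that(1)] r(2)[of "cnj z"] resolvent_setI by (auto simp: spectrum_def)
    qed
    moreover have "complex_of_real l \<in> ball (complex_of_real l) r" using r(1) by simp
    ultimately have "ball (complex_of_real l) r \<inter> spectrum M ?A = {complex_of_real l}" using sp by blast
    then show ?thesis using sp unfolding isolated_in_def by blast
  qed
  moreover have "multiplicity_eigval M ?A (complex_of_real l) < \<infinity>"
  proof -
    have "n \<le> card I" if e: "\<And>i. i < n \<Longrightarrow> e i \<in> eigenspace ?A (complex_of_real l)"
      "ae_independent M n e" for n e
    proof (rule ccontr)
      assume "\<not> n \<le> card I"
      have eo: "(e i, cscale (complex_of_real l) (e i)) \<in> op" if "i \<in> {..<n}" for i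
        using e(1) that by (simp add: eigenspace_def op_eq cscale_def)
      obtain b where b: "\<exists>i\<in>{..<n}. b i \<noteq> 0" "H.nrm (\<Sum>i<n. cscale (b i) (e i)) = 0"
        using garding_finite_multiplicity[OF G, of "{..<n}" e] eo \<open>\<not> n \<le> card I\<close> by auto
      have "(\<Sum>i<n. cscale (b i) (e i)) \<in> L2 M" using opD(1)[OF eo] by (intro H.sum_mem) simp
      then have "AE x in M. (\<Sum>i<n. b i * e i x) = 0"
        using b(2) l2_norm_eq_0_iff[of "\<Sum>i<n. cscale (b i) (e i)" M] by (simp add: nrm_L2 sum_fun_apply)
      then have "\<forall>i<n. b i = 0" using e(2) unfolding ae_independent_def by blast
      with b(1) show False by auto
    qed
    then have "multiplicity_eigval M ?A (complex_of_real l) \<le> enat (card I)"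
      unfolding multiplicity_eigval_def ae_dim_def by (intro Sup_least) (clarsimp, blast)
    then show ?thesis by (metis enat_ord_simps(4) infinity_ileE not_infinity_eq order_le_less)
  qed
  ultimately show False using nd by (simp add: discrete_spectrum_def)
qed

text \<open>The sequence rules out a bounded inverse at \<open>l\<close>. If \<open>l\<close> were
  in the discrete spectrum, its isolation would produce \<open>n\<close> independent eigenvectors
  for every \<open>n\<close>, against finite multiplicity.\<close>

lemma essential_spectrum_singular_sequence:
  assumes u: "\<And>n. u n \<in> D" "\<And>m n. l2_inner M (u m) (u n) = (if m = n then 1 else 0)" and l: "0 \<le> l"
    and eps: "\<And>n v. v \<in> D \<Longrightarrow> cmod (a (u n) v - complex_of_real l * l2_inner M (u n) v) \<le> \<epsilon> n * D.nrm v"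
    and \<epsilon>: "\<And>n. 0 \<le> \<epsilon> n" "\<epsilon> \<longlonglongrightarrow> 0"
  shows "complex_of_real l \<in> essential_spectrum M (form_operator M D a)"
proof -
  let ?A = "form_operator M D a"
  have nu: "H.nrm (u n) = 1" for n using u(2)[of n n] by (simp add: H.nrm_def)
  have "complex_of_real l \<in> spectrum M ?A"
    using singular_sequence_spectrum[OF u(1) nu l eps \<epsilon>] resolvent_setD by (auto simp: spectrum_def)
  moreover have "complex_of_real l \<notin> discrete_spectrum M ?A"
  proof
    assume disc: "complex_of_real l \<in> discrete_spectrum M ?A"
    then obtain T where T: "open T" "T \<inter> spectrum M ?A = {complex_of_real l}"
      by (auto simp: discrete_spectrum_def isolated_in_def)
    then obtain r where r: "0 < r" "ball (complex_of_real l) r \<subseteq> T"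
      using open_contains_ball[of T] by blast
    have low: "\<exists>c. lower_bound z c" if "z \<noteq> complex_of_real l" "cmod (z - complex_of_real l) < r" for z
    proof -
      have "z \<in> T" using that r(2) by (auto simp: dist_norm norm_minus_commute)
      then have "z \<notin> spectrum M ?A" using T(2) that(1) by blast
      then show ?thesis using resolvent_setD by (auto simp: spectrum_def)
    qed
    have "enat n \<le> multiplicity_eigval M ?A (complex_of_real l)" for n
    proof -
      obtain e :: "nat \<Rightarrow> 'a \<Rightarrow> complex" where e: "\<And>i. i < n \<Longrightarrow> (e i, cscale (complex_of_real l) (e i)) \<in> op"
        "\<And>b. H.nrm (\<Sum>i<n. cscale (b i) (e i)) = 0 \<Longrightarrow> \<forall>i<n. b i = 0"
        using singular_sequence_multiplicity[OF u l eps \<epsilon> r(1) low, of n] by blast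
      have "e i \<in> eigenspace ?A (complex_of_real l)" if "i < n" for i
        using e(1)[OF that] by (simp add: eigenspace_def op_eq cscale_def)
      moreover have "ae_independent M n e"
        unfolding ae_independent_def
      proof (rule allI, rule impI)
        fix b assume b: "AE x in M. (\<Sum>i<n. b i * e i x) = 0"
        have "(\<Sum>i<n. cscale (b i) (e i)) \<in> L2 M" using opD(1)[OF e(1)] by (intro H.sum_mem) simp
        then have "H.nrm (\<Sum>i<n. cscale (b i) (e i)) = 0"
          using b l2_norm_eq_0_iff[of "\<Sum>i<n. cscale (b i) (e i)" M] by (simp add: nrm_L2 sum_fun_apply)
        then show "\<forall>i<n. b i = 0" by (rule e(2))
      qed
      ultimately show ?thesis
        unfolding multiplicity_eigval_def ae_dim_def by (intro Sup_upper) blast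
    qed
    moreover have "multiplicity_eigval M ?A (complex_of_real l) < \<infinity>"
      using disc by (simp add: discrete_spectrum_def)
    then obtain m where "multiplicity_eigval M ?A (complex_of_real l) = enat m" by auto
    ultimately have "enat (Suc m) \<le> enat m" by metis
    then show False by simp
  qed
  ultimately show ?thesis by (simp add: essential_spectrum_def)
qed

end

section \<open>Integrals over intervals\<close>

lemma integral_lebesgue_on:
  fixes f :: "real \<Rightarrow> 'b::{banach, second_countable_topology}"
  assumes "S \<in> sets lebesgue"
  shows "integral\<^sup>L (lebesgue_on S) f = set_lebesgue_integral lebesgue S f"
  using assms by (simp add: integral_restrict_space set_lebesgue_integral_def)

lemma integrable_lebesgue_on:
  fixes f :: "real \<Rightarrow> 'b::{banach, second_countable_topology}"
  assumes "S \<in> sets lebesgue"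
  shows "integrable (lebesgue_on S) f \<longleftrightarrow> set_integrable lebesgue S f"
  using assms by (simp add: integrable_restrict_space set_integrable_def)

lemma integrable_lebesgue_on_subset:
  fixes f :: "real \<Rightarrow> 'b::{banach, second_countable_topology}"
  assumes "integrable (lebesgue_on T) f" "S \<subseteq> T" "S \<in> sets lebesgue" "T \<in> sets lebesgue"
  shows "integrable (lebesgue_on S) f"
  using assms set_integrable_subset[of lebesgue T f S] by (simp add: integrable_lebesgue_on)

lemma AE_lebesgue_on_subset:
  assumes "AE x in lebesgue_on T. P x" "S \<subseteq> T" "S \<in> sets lebesgue" "T \<in> sets lebesgue"
  shows "AE x in lebesgue_on S. P x"
  using assms(1) assms(2) by (auto simp: AE_restrict_space_iff assms(3,4))

lemma measurable_lebesgue_on_subset: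
  assumes "f \<in> borel_measurable (lebesgue_on T)" "S \<subseteq> T"
  shows "f \<in> borel_measurable (lebesgue_on S)"
  using assms by (rule measurable_restrict_mono)

lemma L2_lebesgue_on_subset:
  fixes S T :: "real set"
  assumes "u \<in> L2 (lebesgue_on T)" "S \<subseteq> T" "S \<in> sets lebesgue" "T \<in> sets lebesgue"
  shows "u \<in> L2 (lebesgue_on S)"
  unfolding L2_def
  by (intro CollectI conjI measurable_lebesgue_on_subset[OF L2_measurable[OF assms(1)] assms(2)]
      integrable_lebesgue_on_subset[OF L2_integrable[OF assms(1)] assms(2-4)])

lemma finite_measure_ivl: "finite_measure (lebesgue_on {a<..<b::real})"
  by (intro finite_measure_lebesgue_on) simp

lemma integral_const_ivl:
  fixes c :: "'b::{banach, second_countable_topology}"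
  assumes "a \<le> b" shows "(LINT x|lebesgue_on {a<..<b::real}. c) = (b - a) *\<^sub>R c"
  using assms by (simp add: measure_restrict_space)

lemma integrable_const_ivl':
  fixes c :: "'b::{banach, second_countable_topology}"
  shows "integrable (lebesgue_on {a<..<b::real}) (\<lambda>x. c)"
  by (intro finite_measure.integrable_const finite_measure_ivl)

lemma const_L2: "(\<lambda>x. c) \<in> L2 (lebesgue_on {a<..<b::real})"
  by (simp add: L2_def integrable_const_ivl')

lemma L2_integrable_ivl:
  assumes "u \<in> L2 (lebesgue_on {a<..<b::real})"
  shows "integrable (lebesgue_on {a<..<b}) u"
  using L2_mult_integrable[OF assms const_L2[of 1]] by simp

lemma integral_ivl_split:
  fixes f :: "real \<Rightarrow> 'b::{banach, second_countable_topology}"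
  assumes "integrable (lebesgue_on {a<..<c}) f" "a \<le> b" "b \<le> c"
  shows "integral\<^sup>L (lebesgue_on {a<..<c}) f
    = integral\<^sup>L (lebesgue_on {a<..<b}) f + integral\<^sup>L (lebesgue_on {b<..<c}) f"
proof -
  have i: "set_integrable lebesgue {a<..<c} f" using assms by (simp add: integrable_lebesgue_on)
  have "set_integrable lebesgue {a<..<b} f" "set_integrable lebesgue {b<..<c} f"
    by (rule set_integrable_subset[OF i]; use assms in auto)+
  moreover have "{a<..<b} \<inter> {b<..<c} = {}" by auto
  ultimately have "(LINT x:{a<..<b} \<union> {b<..<c}|lebesgue. f x)
      = (LINT x:{a<..<b}|lebesgue. f x) + (LINT x:{b<..<c}|lebesgue. f x)"
    by (intro set_integral_Un)
  moreover have "(LINT x:{a<..<b} \<union> {b<..<c}|lebesgue. f x) = (LINT x:{a<..<c}|lebesgue. f x)"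
  proof (rule set_integral_cong_set)
    from i show "set_borel_measurable lebesgue {a<..<c} f"
      unfolding set_borel_measurable_def set_integrable_def by (rule borel_measurable_integrable)
    have "set_integrable lebesgue ({a<..<b} \<union> {b<..<c}) f"
      by (rule set_integrable_subset[OF i]) (use assms in auto)
    then show "set_borel_measurable lebesgue ({a<..<b} \<union> {b<..<c}) f"
      unfolding set_borel_measurable_def set_integrable_def by (rule borel_measurable_integrable)
    have "AE x in lebesgue. x \<noteq> b" by (intro AE_completion AE_lborel_singleton)
    then show "AE x in lebesgue. (x \<in> {a<..<c}) = (x \<in> {a<..<b} \<union> {b<..<c})"
      by eventually_elim (use assms in auto)
  qed
  ultimately show ?thesis by (simp add: integral_lebesgue_on)
qed

lemma FTC_lebesgue_on:
  fixes F f :: "real \<Rightarrow> real"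
  assumes "a \<le> b" "\<And>x. (F has_real_derivative f x) (at x)" "continuous_on UNIV f"
  shows "(LINT x|lebesgue_on {a<..<b}. f x) = F b - F a"
proof -
  have [measurable]: "f \<in> borel_measurable borel" by (rule borel_measurable_continuous_onI) fact
  have "F b - F a = (LINT x|lborel. f x * indicator {a..b} x)"
    using assms by (intro integral_FTC_Icc_real[symmetric]) (auto simp: continuous_on_eq_continuous_at)
  also have "\<dots> = (LINT x|lborel. indicator {a<..<b} x *\<^sub>R f x)"
  proof (rule integral_cong_AE)
    have "AE x in lborel. x \<noteq> a" "AE x in lborel. x \<noteq> b" by (rule AE_lborel_singleton)+
    then show "AE x in lborel. f x * indicator {a..b} x = indicator {a<..<b} x *\<^sub>R f x"
      by eventually_elim (auto simp: indicator_def)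
  qed measurable
  also have "\<dots> = (LINT x|lebesgue. indicator {a<..<b} x *\<^sub>R f x)"
    by (rule integral_completion[symmetric]) measurable
  finally show ?thesis by (simp add: integral_lebesgue_on set_lebesgue_integral_def)
qed

lemma continuous_bounded_ivl:
  fixes f :: "real \<Rightarrow> 'b::real_normed_vector"
  assumes "continuous_on UNIV f"
  obtains K where "0 \<le> K" "\<And>x. a \<le> x \<Longrightarrow> x \<le> b \<Longrightarrow> norm (f x) \<le> K"
proof -
  have "compact (f ` {a..b})"
    by (intro compact_continuous_image continuous_on_subset[OF assms]) auto
  then obtain K where K: "\<forall>y\<in>f ` {a..b}. norm y \<le> K"
    using compact_imp_bounded bounded_iff by blast
  show ?thesis by (rule that[of "max K 0"]) (use K in \<open>auto simp: le_max_iff_disj\<close>)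
qed

section \<open>Test functions and weak derivatives\<close>

lemma test_functionD:
  assumes "\<phi> \<in> test_functions \<Omega>"
  shows test_deriv: "\<And>x. (\<phi> has_real_derivative deriv \<phi> x) (at x)"
    and test_deriv_cont: "continuous_on UNIV (deriv \<phi>)"
    and test_zero: "\<And>x. x \<notin> \<Omega> \<Longrightarrow> \<phi> x = 0"
    and test_deriv_zero: "\<And>x. x \<notin> \<Omega> \<Longrightarrow> deriv \<phi> x = 0"
    and test_cont: "continuous_on UNIV \<phi>"
proof -
  obtain D where D: "\<And>x. (\<phi> has_vector_derivative D x) (at x)" "continuous_on UNIV D"
    using assms by (auto simp: test_functions_def C1_differentiable_on_def)
  then have D': "(\<phi> has_real_derivative D x) (at x)" for x
    by (simp add: has_real_derivative_iff_has_vector_derivative)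
  then have "deriv \<phi> = D" by (intro ext DERIV_imp_deriv)
  with D D' show *: "(\<phi> has_real_derivative deriv \<phi> x) (at x)" "continuous_on UNIV (deriv \<phi>)" for x
    by auto
  show "continuous_on UNIV \<phi>"
    using * by (meson DERIV_isCont continuous_at_imp_continuous_on)
  show z: "\<phi> x = 0" if "x \<notin> \<Omega>" for x
    using assms that closure_subset[of "{x. \<phi> x \<noteq> 0}"] by (auto simp: test_functions_def)
  show "deriv \<phi> x = 0" if "x \<notin> \<Omega>" for x
  proof -
    let ?S = "- closure {x. \<phi> x \<noteq> 0}"
    have "x \<in> ?S" using assms that by (auto simp: test_functions_def)
    moreover have "open ?S" by (rule open_Compl[OF closed_closure])
    moreover have "\<phi> y = 0" if "y \<in> ?S" for y using that closure_subset[of "{x. \<phi> x \<noteq> 0}"] by auto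
    ultimately have "((\<lambda>x. 0) has_real_derivative deriv \<phi> x) (at x)"
      using DERIV_cong_ev[of x x \<phi> "\<lambda>x. 0" "deriv \<phi> x" "deriv \<phi> x"] *(1)[of x]
      by (metis (mono_tags, lifting) eventually_nhds)
    then show ?thesis using DERIV_unique DERIV_const by blast
  qed
qed

lemma test_functions_mono: "\<Omega> \<subseteq> \<Omega>' \<Longrightarrow> test_functions \<Omega> \<subseteq> test_functions \<Omega>'"
  by (auto simp: test_functions_def)

lemma weak_deriv_subset:
  assumes "is_weak_deriv T u g" "S \<subseteq> T" "S \<in> sets lebesgue" "T \<in> sets lebesgue"
  shows "is_weak_deriv S u g"
  unfolding is_weak_deriv_def
proof
  fix \<phi> assume \<phi>: "\<phi> \<in> test_functions S"
  then have "\<phi> \<in> test_functions T" using test_functions_mono[OF assms(2)] by blast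
  then have "(LINT x|lebesgue_on T. deriv \<phi> x *\<^sub>R u x) = - (LINT x|lebesgue_on T. \<phi> x *\<^sub>R g x)"
    using assms(1) by (simp add: is_weak_deriv_def)
  moreover have "(LINT x|lebesgue_on T. f x *\<^sub>R v x) = (LINT x|lebesgue_on S. f x *\<^sub>R v x)"
    if "\<And>x. x \<notin> S \<Longrightarrow> f x = 0" for f :: "real \<Rightarrow> real" and v :: "real \<Rightarrow> complex"
  proof -
    have eq: "(\<lambda>x. indicator T x *\<^sub>R (f x *\<^sub>R v x)) = (\<lambda>x. indicator S x *\<^sub>R (f x *\<^sub>R v x))"
      using that assms(2) by (force simp: indicator_def)
    have "(LINT x|lebesgue_on T. f x *\<^sub>R v x) = (LINT x|lebesgue. indicator T x *\<^sub>R (f x *\<^sub>R v x))"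
      by (rule integral_restrict_space) (use assms in simp)
    moreover have "(LINT x|lebesgue_on S. f x *\<^sub>R v x) = (LINT x|lebesgue. indicator S x *\<^sub>R (f x *\<^sub>R v x))"
      by (rule integral_restrict_space) (use assms in simp)
    ultimately show ?thesis unfolding eq by simp
  qed
  ultimately show "(LINT x|lebesgue_on S. deriv \<phi> x *\<^sub>R u x) = - (LINT x|lebesgue_on S. \<phi> x *\<^sub>R g x)"
    using test_zero[OF \<phi>] test_deriv_zero[OF \<phi>] by simp
qed

text \<open>Vanishing mean makes the primitive return to \<open>0\<close> at \<open>b\<close>; so it
  is supported in \<open>[a, b]\<close>, inside the open interval.\<close>

lemma test_function_primitive:
  fixes \<psi> :: "real \<Rightarrow> real"
  assumes \<psi>: "continuous_on UNIV \<psi>" "\<And>x. x \<notin> {a..b} \<Longrightarrow> \<psi> x = 0"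
    and ab: "\<alpha> < a" "a \<le> b" "b < \<beta>" and 0: "(LINT x|lebesgue_on {\<alpha><..<\<beta>}. \<psi> x) = 0"
  obtains \<phi> where "\<phi> \<in> test_functions {\<alpha><..<\<beta>}" "deriv \<phi> = \<psi>"
proof -
  define \<phi> where "\<phi> x = (LBINT y=a..x. \<psi> y)" for x :: real
  have der: "(\<phi> has_real_derivative \<psi> x) (at x)" for x
  proof -
    define l where "l = min a x - 1"
    define r where "r = max a x + 1"
    have "(\<phi> has_vector_derivative \<psi> x) (at x within {l..r})"
      unfolding \<phi>_def by (rule interval_integral_FTC2)
        (auto simp: l_def r_def intro: continuous_on_subset[OF \<psi>(1)])
    moreover have "x \<in> interior {l..r}" by (auto simp: l_def r_def)
    ultimately show ?thesis
      using at_within_interior[of x "{l..r}"] by (simp only: has_real_derivative_iff_has_vector_derivative)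
  qed
  have left: "\<phi> x = 0" if "x \<le> a" for x
  proof (cases "x = a")
    case False
    then have "x < a" using that by simp
    then obtain z where "z > x" "z < a" "\<phi> a - \<phi> x = (a - x) * \<psi> z"
      using MVT2[of x a \<phi> \<psi>] der by blast
    then show ?thesis using \<psi>(2)[of z] by (simp add: \<phi>_def)
  qed (simp add: \<phi>_def)
  have "\<phi> \<beta> = 0"
    using FTC_lebesgue_on[of \<alpha> \<beta> \<phi> \<psi>] ab 0 der \<psi>(1) left[of \<alpha>] by simp
  have right: "\<phi> x = 0" if "x \<ge> b" for x
  proof (cases x \<beta> rule: linorder_cases)
    case less
    then obtain z where "z > x" "z < \<beta>" "\<phi> \<beta> - \<phi> x = (\<beta> - x) * \<psi> z"
      using MVT2[of x \<beta> \<phi> \<psi>] der by blast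
    then show ?thesis using \<psi>(2)[of z] that \<open>\<phi> \<beta> = 0\<close> by simp
  next
    case greater
    then obtain z where "z > \<beta>" "z < x" "\<phi> x - \<phi> \<beta> = (x - \<beta>) * \<psi> z"
      using MVT2[of \<beta> x \<phi> \<psi>] der by blast
    then show ?thesis using \<psi>(2)[of z] ab \<open>\<phi> \<beta> = 0\<close> by simp
  qed (use \<open>\<phi> \<beta> = 0\<close> in simp)
  have d: "deriv \<phi> = \<psi>" using der by (intro ext DERIV_imp_deriv)
  have sub0: "{x. \<phi> x \<noteq> 0} \<subseteq> {a..b}"
  proof
    fix x assume "x \<in> {x. \<phi> x \<noteq> 0}"
    then have "\<not> x \<le> a" "\<not> b \<le> x" using left[of x] right[of x] by auto
    then show "x \<in> {a..b}" by simp
  qed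
  then have sub: "closure {x. \<phi> x \<noteq> 0} \<subseteq> {a..b}" by (rule closure_minimal) simp
  have "compact (closure {x. \<phi> x \<noteq> 0})"
    using bounded_subset[OF bounded_closed_interval sub0] by (simp add: compact_closure)
  moreover have "\<phi> C1_differentiable_on UNIV"
    unfolding C1_differentiable_on_def
    using der \<psi>(1) by (intro exI[of _ \<psi>]) (simp add: has_real_derivative_iff_has_vector_derivative)
  ultimately have "\<phi> \<in> test_functions {\<alpha><..<\<beta>}"
    using sub ab by (auto simp: test_functions_def)
  with d that show ?thesis by blast
qed

text \<open>Fubini on the triangle \<open>t < x\<close>: integrating \<open>deriv \<phi>\<close>
  from \<open>t\<close> to \<open>\<beta>\<close> leaves \<open>- \<phi> t\<close>, since
  \<open>\<phi>\<close> vanishes at \<open>\<beta>\<close>. No differentiability of the primitive is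
  involved.\<close>

lemma integral_primitive_by_parts:
  fixes g :: "real \<Rightarrow> complex"
  assumes g: "integrable (lebesgue_on {\<alpha><..<\<beta>}) g" and \<phi>: "\<phi> \<in> test_functions {\<alpha><..<\<beta>}"
  shows "(LINT x|lebesgue_on {\<alpha><..<\<beta>}. deriv \<phi> x *\<^sub>R (LINT t|lebesgue_on {\<alpha><..<x}. g t))
    = - (LINT x|lebesgue_on {\<alpha><..<\<beta>}. \<phi> x *\<^sub>R g x)"
proof -
  let ?J = "{\<alpha><..<\<beta>}"
  define M where "M = lebesgue_on ?J"
  interpret M: finite_measure M unfolding M_def by (rule finite_measure_ivl)
  interpret MM: pair_sigma_finite M M ..
  have [measurable]: "g \<in> borel_measurable M" using g unfolding M_def by (rule borel_measurable_integrable)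
  have spM: "space M = ?J" by (simp add: M_def)
  have idM [measurable]: "(\<lambda>x. x) \<in> borel_measurable M"
    unfolding M_def using id_borel_measurable_lebesgue_on[of ?J] by (simp add: id_def)
  have [measurable]: "deriv \<phi> \<in> borel_measurable borel"
    by (rule borel_measurable_continuous_onI) (rule test_deriv_cont[OF \<phi>])
  have dM [measurable]: "deriv \<phi> \<in> borel_measurable M"
    using measurable_compose[OF idM \<open>deriv \<phi> \<in> borel_measurable borel\<close>] by simp
  obtain K where K: "0 \<le> K" "\<And>x. \<alpha> \<le> x \<Longrightarrow> x \<le> \<beta> \<Longrightarrow> norm (deriv \<phi> x) \<le> K"
    using continuous_bounded_ivl[OF test_deriv_cont[OF \<phi>]] by blast
  define F where "F x t = (if t < x then deriv \<phi> x *\<^sub>R g t else 0)" for x t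
  have intF: "integrable (M \<Otimes>\<^sub>M M) (case_prod F)"
  proof (rule Bochner_Integration.integrable_bound)
    show "integrable (M \<Otimes>\<^sub>M M) (\<lambda>(x, t). K *\<^sub>R g t)"
    proof (rule MM.Fubini_integrable)
      show "AE x in M. integrable M (\<lambda>y. case (x, y) of (x, t) \<Rightarrow> K *\<^sub>R g t)"
        using g by (simp add: M_def)
    qed (simp_all add: case_prod_beta)
    show "case_prod F \<in> borel_measurable (M \<Otimes>\<^sub>M M)"
      unfolding F_def case_prod_beta by measurable
    show "AE x in M \<Otimes>\<^sub>M M. norm (case x of (x, t) \<Rightarrow> F x t) \<le> norm (case x of (x, t) \<Rightarrow> K *\<^sub>R g t)"
    proof (rule AE_I2)
      fix z assume "z \<in> space (M \<Otimes>\<^sub>M M)"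
      then have "fst z \<in> ?J" by (auto simp: space_pair_measure spM)
      then have "norm (deriv \<phi> (fst z)) * norm (g (snd z)) \<le> K * norm (g (snd z))"
        using K(2)[of "fst z"] by (intro mult_right_mono) auto
      then show "norm (case z of (x, t) \<Rightarrow> F x t) \<le> norm (case z of (x, t) \<Rightarrow> K *\<^sub>R g t)"
        using K(1) by (simp add: F_def case_prod_beta)
    qed
  qed
  have inner1: "(LINT t|M. F x t) = deriv \<phi> x *\<^sub>R (LINT t|lebesgue_on {\<alpha><..<x}. g t)" if "x \<in> ?J" for x
  proof -
    have "(LINT t|M. F x t) = (LINT t|M. deriv \<phi> x *\<^sub>R (if t \<in> {\<alpha><..<x} then g t else 0))"
      by (intro Bochner_Integration.integral_cong) (auto simp: F_def spM)
    also have "\<dots> = deriv \<phi> x *\<^sub>R (LINT t|M. (if t \<in> {\<alpha><..<x} then g t else 0))"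
      by simp
    also have "(LINT t|M. (if t \<in> {\<alpha><..<x} then g t else 0)) = (LINT t|lebesgue_on {\<alpha><..<x}. g t)"
      unfolding M_def using that by (intro integral_restrict) auto
    finally show ?thesis .
  qed
  have inner2: "(LINT x|M. F x t) = - \<phi> t *\<^sub>R g t" if t: "t \<in> ?J" for t
  proof -
    have "(LINT x|M. F x t) = (LINT x|M. (if x \<in> {t<..<\<beta>} then deriv \<phi> x else 0) *\<^sub>R g t)"
      by (intro Bochner_Integration.integral_cong) (auto simp: F_def spM)
    also have "\<dots> = (LINT x|M. (if x \<in> {t<..<\<beta>} then deriv \<phi> x else 0)) *\<^sub>R g t"
    proof (rule integral_scaleR_left)
      show "integrable M (\<lambda>x. if x \<in> {t<..<\<beta>} then deriv \<phi> x else 0)"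
      proof (rule M.integrable_const_bound)
        show "AE x in M. norm (if x \<in> {t<..<\<beta>} then deriv \<phi> x else 0) \<le> K"
          using K t by (intro AE_I2) (auto simp: spM)
        show "(\<lambda>x. if x \<in> {t<..<\<beta>} then deriv \<phi> x else 0) \<in> borel_measurable M"
          unfolding greaterThanLessThan_iff by measurable
      qed
    qed
    also have "(LINT x|M. (if x \<in> {t<..<\<beta>} then deriv \<phi> x else 0)) = (LINT x|lebesgue_on {t<..<\<beta>}. deriv \<phi> x)"
      unfolding M_def using t by (intro integral_restrict) auto
    also have "\<dots> = \<phi> \<beta> - \<phi> t"
      using t by (intro FTC_lebesgue_on test_deriv[OF \<phi>] test_deriv_cont[OF \<phi>]) simp
    also have "\<phi> \<beta> = 0" by (rule test_zero[OF \<phi>]) simp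
    finally show ?thesis by simp
  qed
  have "(LINT x|M. deriv \<phi> x *\<^sub>R (LINT t|lebesgue_on {\<alpha><..<x}. g t)) = (LINT x|M. LINT t|M. F x t)"
    by (rule Bochner_Integration.integral_cong[OF refl]) (simp add: spM inner1)
  also have "\<dots> = (LINT t|M. LINT x|M. F x t)" by (rule MM.Fubini_integral[symmetric, OF intF])
  also have "\<dots> = (LINT t|M. - (\<phi> t *\<^sub>R g t))"
    by (rule Bochner_Integration.integral_cong[OF refl]) (simp add: spM inner2)
  also have "\<dots> = - (LINT t|M. \<phi> t *\<^sub>R g t)" by simp
  finally show ?thesis by (simp add: M_def)
qed

text \<open>The measures whose densities are the positive and the negative part agree on all rays,
  hence everywhere, and densities are unique almost everywhere.\<close>

lemma AE_zero_if_integral_greaterThan_zero_real: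
  fixes F :: "real \<Rightarrow> real"
  assumes F: "integrable lebesgue F" and z: "\<And>x. (LINT t:{x<..}|lebesgue. F t) = 0"
  shows "AE x in lebesgue. F x = 0"
proof -
  obtain G where G: "G \<in> borel_measurable lborel" "AE x in lborel. F x = G x"
    using completion_ex_borel_measurable_real[of F lborel] borel_measurable_integrable[OF F] by blast
  have [measurable]: "G \<in> borel_measurable lborel" "G \<in> borel_measurable borel" "F \<in> borel_measurable lebesgue"
    using G borel_measurable_integrable[OF F] by auto
  have GL: "G \<in> borel_measurable lebesgue" using G(1) by (rule measurable_completion)
  have ae: "AE x in lebesgue. F x = G x" using G(2) by (rule AE_completion)
  have "integrable lebesgue G"
    using F ae GL by (subst integrable_cong_AE[of _ _ F]) auto
  then have Gint: "integrable lborel G" using G(1) by (simp add: integrable_completion)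
  have Gz: "(LINT t|lborel. indicator {x<..} t *\<^sub>R G t) = 0" for x
  proof -
    have "(LINT t|lborel. indicator {x<..} t *\<^sub>R G t) = (LINT t|lebesgue. indicator {x<..} t *\<^sub>R G t)"
      by (rule integral_completion[symmetric]) measurable
    also have "\<dots> = (LINT t|lebesgue. indicator {x<..} t *\<^sub>R F t)"
    proof (rule integral_cong_AE)
      show "AE t in lebesgue. indicator {x<..} t *\<^sub>R G t = indicator {x<..} t *\<^sub>R F t"
        using ae by eventually_elim simp
      show "(\<lambda>t. indicator {x<..} t *\<^sub>R G t) \<in> borel_measurable lebesgue"
        "(\<lambda>t. indicator {x<..} t *\<^sub>R F t) \<in> borel_measurable lebesgue"
        using GL \<open>F \<in> borel_measurable lebesgue\<close> by (auto intro!: borel_measurable_times borel_measurable_indicator)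
    qed
    also have "\<dots> = 0" using z[of x] by (simp add: set_lebesgue_integral_def)
    finally show ?thesis .
  qed
  \<comment> \<open>\<open>ennreal\<close> cuts off negative values, so the densities of
    \<open>P\<close> and \<open>N\<close> are the positive and the negative part of
    \<open>G\<close>.\<close>
  define P where "P = density lborel (\<lambda>x. ennreal (G x))"
  define N where "N = density lborel (\<lambda>x. ennreal (- G x))"
  have i: "integrable lborel (\<lambda>t. indicator {x<..} t * max 0 (G t))"
    "integrable lborel (\<lambda>t. indicator {x<..} t * max 0 (- G t))" for x
    using integrable_mult_indicator[of "{x<..}" lborel "\<lambda>t. max 0 (G t)"]
      integrable_mult_indicator[of "{x<..}" lborel "\<lambda>t. max 0 (- G t)"]
      integrable_max[OF integrable_zero Gint] integrable_max[OF integrable_zero, of lborel "\<lambda>t. - G t"] Gint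
    by simp_all
  have eP: "emeasure P {x<..} = ennreal (LINT t|lborel. indicator {x<..} t * max 0 (G t))" for x
  proof -
    have "emeasure P {x<..} = (\<integral>\<^sup>+t. ennreal (indicator {x<..} t * max 0 (G t)) \<partial>lborel)"
      unfolding P_def by (subst emeasure_density) (auto intro!: nn_integral_cong simp: indicator_def ennreal_neg max_def)
    also have "\<dots> = ennreal (LINT t|lborel. indicator {x<..} t * max 0 (G t))"
      by (intro nn_integral_eq_integral i) simp
    finally show ?thesis .
  qed
  have eN: "emeasure N {x<..} = ennreal (LINT t|lborel. indicator {x<..} t * max 0 (- G t))" for x
  proof -
    have "emeasure N {x<..} = (\<integral>\<^sup>+t. ennreal (indicator {x<..} t * max 0 (- G t)) \<partial>lborel)"
      unfolding N_def by (subst emeasure_density) (auto intro!: nn_integral_cong simp: indicator_def ennreal_neg max_def)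
    also have "\<dots> = ennreal (LINT t|lborel. indicator {x<..} t * max 0 (- G t))"
      by (intro nn_integral_eq_integral i) simp
    finally show ?thesis .
  qed
  have "P = N"
  proof (rule measure_eqI_lessThan)
    fix x :: real
    show "emeasure P {x<..} < \<infinity>" unfolding eP by simp
    have "(LINT t|lborel. indicator {x<..} t * max 0 (G t)) - (LINT t|lborel. indicator {x<..} t * max 0 (- G t))
        = (LINT t|lborel. indicator {x<..} t * max 0 (G t) - indicator {x<..} t * max 0 (- G t))"
      using i[of x] by simp
    also have "\<dots> = (LINT t|lborel. indicator {x<..} t *\<^sub>R G t)"
      by (intro Bochner_Integration.integral_cong) (auto simp: indicator_def max_def)
    finally show "emeasure P {x<..} = emeasure N {x<..}" unfolding eP eN using Gz[of x] by simp
  qed (simp_all add: P_def N_def)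
  then have "AE x in lborel. ennreal (G x) = ennreal (- G x)"
    unfolding P_def N_def by (intro sigma_finite_measure.density_unique[OF sigma_finite_lborel]) measurable
  then have "AE x in lborel. G x = 0"
    by eventually_elim (metis ennreal_eq_0_iff ennreal_inj less_eq_real_def linorder_le_cases neg_equal_0_iff_equal neg_le_0_iff_le order_antisym)
  then have "AE x in lebesgue. G x = 0" by (rule AE_completion)
  with ae show ?thesis by eventually_elim simp
qed

lemma AE_zero_if_integral_ivl_zero:
  fixes f :: "real \<Rightarrow> complex"
  assumes f: "integrable (lebesgue_on {\<alpha><..<\<beta>}) f"
    and z: "\<And>a b. \<alpha> \<le> a \<Longrightarrow> a < b \<Longrightarrow> b \<le> \<beta> \<Longrightarrow> (LINT x|lebesgue_on {a<..<b}. f x) = 0"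
  shows "AE x in lebesgue_on {\<alpha><..<\<beta>}. f x = 0"
proof -
  let ?F = "\<lambda>x. indicator {\<alpha><..<\<beta>} x *\<^sub>R f x"
  have F: "integrable lebesgue ?F" using f by (simp add: integrable_restrict_space)
  have zF: "(LINT t|lebesgue. indicator {x<..} t *\<^sub>R ?F t) = 0" for x
  proof -
    have "(\<lambda>t. indicator {x<..} t *\<^sub>R ?F t) = (\<lambda>t. indicator {max \<alpha> x<..<\<beta>} t *\<^sub>R f t)"
      by (auto simp: indicator_def fun_eq_iff)
    then have "(LINT t|lebesgue. indicator {x<..} t *\<^sub>R ?F t) = (LINT x|lebesgue_on {max \<alpha> x<..<\<beta>}. f x)"
      by (simp add: integral_restrict_space)
    also have "\<dots> = 0" using z[of "max \<alpha> x" \<beta>] by (cases "max \<alpha> x < \<beta>") auto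
    finally show ?thesis .
  qed
  have zi: "integrable lebesgue (\<lambda>t. indicator {x<..} t *\<^sub>R ?F t)" for x :: real
    by (rule integrable_mult_indicator[OF _ F]) simp
  have "AE x in lebesgue. Re (?F x) = 0"
  proof (rule AE_zero_if_integral_greaterThan_zero_real)
    fix x
    have "(LINT t:{x<..}|lebesgue. Re (?F t)) = Re (LINT t|lebesgue. indicator {x<..} t *\<^sub>R ?F t)"
      unfolding set_lebesgue_integral_def
      by (subst integral_Re[OF zi[of x], symmetric]) (simp add: mult.assoc)
    then show "(LINT t:{x<..}|lebesgue. Re (?F t)) = 0" using zF by simp
  qed (rule integrable_bounded_linear[OF bounded_linear_Re F])
  moreover have "AE x in lebesgue. Im (?F x) = 0"
  proof (rule AE_zero_if_integral_greaterThan_zero_real)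
    fix x
    have "(LINT t:{x<..}|lebesgue. Im (?F t)) = Im (LINT t|lebesgue. indicator {x<..} t *\<^sub>R ?F t)"
      unfolding set_lebesgue_integral_def
      by (subst integral_Im[OF zi[of x], symmetric]) (simp add: mult.assoc)
    then show "(LINT t:{x<..}|lebesgue. Im (?F t)) = 0" using zF by simp
  qed (rule integrable_bounded_linear[OF bounded_linear_Im F])
  ultimately have "AE x in lebesgue. x \<in> {\<alpha><..<\<beta>} \<longrightarrow> f x = 0"
  proof eventually_elim
    case (elim x)
    show ?case
    proof
      assume "x \<in> {\<alpha><..<\<beta>}"
      then have "indicat_real {\<alpha><..<\<beta>} x = 1" by simp
      with elim show "f x = 0" by (intro complex_eqI) simp_all
    qed
  qed
  then show ?thesis by (simp add: AE_restrict_space_iff)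
qed

lemma measure_lebesgue_on_ivl [simp]:
  "a \<le> b \<Longrightarrow> measure (lebesgue_on {a<..<b}) {a<..<b} = b - (a::real)"
  by (simp add: measure_restrict_space)

section \<open>Weakly differentiable functions on an interval are primitives\<close>

definition prim :: "real \<Rightarrow> (real \<Rightarrow> complex) \<Rightarrow> real \<Rightarrow> complex" where
  "prim a g x = (LINT t|lebesgue_on {a<..<x}. g t)"

lemma prim_diff:
  assumes "integrable (lebesgue_on {a<..<b}) g" "a \<le> x" "x \<le> y" "y \<le> b"
  shows "prim a g y - prim a g x = prim x g y"
proof -
  have "integrable (lebesgue_on {a<..<y}) g"
    by (rule integrable_lebesgue_on_subset[OF assms(1)]) (use assms in auto)
  then show ?thesis using integral_ivl_split[of a y g x] assms by (simp add: prim_def)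
qed

lemma l2_norm_nonneg [simp]: "0 \<le> l2_norm M u"
  by (simp add: l2_norm_def)

lemma l2_norm_subset:
  fixes S T :: "real set"
  assumes "u \<in> L2 (lebesgue_on T)" "S \<subseteq> T" "S \<in> sets lebesgue" "T \<in> sets lebesgue"
  shows "(l2_norm (lebesgue_on S) u)\<^sup>2 \<le> (l2_norm (lebesgue_on T) u)\<^sup>2"
  unfolding l2_norm_power2 using assms L2_integrable[OF assms(1)]
  by (intro integral_mono_lebesgue_on_AE) auto

lemma l2_norm_const:
  assumes "a \<le> b" shows "(l2_norm (lebesgue_on {a<..<b::real}) (\<lambda>x. c))\<^sup>2 = (b - a) * (cmod c)\<^sup>2"
  unfolding l2_norm_power2 using integral_const_ivl[OF assms, of "(cmod c)\<^sup>2"] by simp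

lemma cmod_integral_ivl_power2:
  assumes "g \<in> L2 (lebesgue_on {a<..<b})" "a \<le> b"
  shows "(cmod (LINT t|lebesgue_on {a<..<b}. g t))\<^sup>2 \<le> (b - a) * (l2_norm (lebesgue_on {a<..<b}) g)\<^sup>2"
proof -
  interpret semi_inner "L2 (lebesgue_on {a<..<b})" "l2_inner (lebesgue_on {a<..<b})"
    by (rule semi_inner_L2)
  have "cmod (l2_inner (lebesgue_on {a<..<b}) g (\<lambda>x. 1)) \<le> l2_norm (lebesgue_on {a<..<b}) g * l2_norm (lebesgue_on {a<..<b}) (\<lambda>x. 1)"
    using cauchy_schwarz[OF assms(1) const_L2] by (simp add: nrm_L2)
  then have "(cmod (l2_inner (lebesgue_on {a<..<b}) g (\<lambda>x. 1)))\<^sup>2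
      \<le> (l2_norm (lebesgue_on {a<..<b}) g * l2_norm (lebesgue_on {a<..<b}) (\<lambda>x. 1))\<^sup>2"
    by (rule power_mono) simp
  then show ?thesis
    by (simp add: power_mult_distrib l2_norm_const[OF assms(2)] l2_inner_def mult.commute)
qed

lemma prim_holder:
  assumes g: "g \<in> L2 (lebesgue_on {\<alpha><..<\<beta>})" and xy: "\<alpha> \<le> x" "x \<le> y" "y \<le> \<beta>"
  shows "(cmod (prim \<alpha> g y - prim \<alpha> g x))\<^sup>2 \<le> (y - x) * (l2_norm (lebesgue_on {x<..<y}) g)\<^sup>2"
proof -
  have "g \<in> L2 (lebesgue_on {x<..<y})"
    by (rule L2_lebesgue_on_subset[OF g]) (use xy in auto)
  from cmod_integral_ivl_power2[OF this xy(2)] show ?thesis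
    using prim_diff[OF L2_integrable_ivl[OF g] xy] by (simp add: prim_def)
qed

lemma prim_holder_abs:
  assumes g: "g \<in> L2 (lebesgue_on {\<alpha><..<\<beta>})" and xy: "x \<in> {\<alpha>..\<beta>}" "y \<in> {\<alpha>..\<beta>}"
  shows "(cmod (prim \<alpha> g y - prim \<alpha> g x))\<^sup>2 \<le> \<bar>y - x\<bar> * (l2_norm (lebesgue_on {\<alpha><..<\<beta>}) g)\<^sup>2"
proof -
  have *: "(cmod (prim \<alpha> g y - prim \<alpha> g x))\<^sup>2 \<le> (y - x) * (l2_norm (lebesgue_on {\<alpha><..<\<beta>}) g)\<^sup>2"
    if "\<alpha> \<le> x" "x \<le> y" "y \<le> \<beta>" for x y
  proof -
    have "(l2_norm (lebesgue_on {x<..<y}) g)\<^sup>2 \<le> (l2_norm (lebesgue_on {\<alpha><..<\<beta>}) g)\<^sup>2"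
      by (rule l2_norm_subset[OF g]) (use that in auto)
    then have "(y - x) * (l2_norm (lebesgue_on {x<..<y}) g)\<^sup>2 \<le> (y - x) * (l2_norm (lebesgue_on {\<alpha><..<\<beta>}) g)\<^sup>2"
      using that by (intro mult_left_mono) auto
    with prim_holder[OF g that] show ?thesis by linarith
  qed
  show ?thesis
  proof (cases "x \<le> y")
    case True
    then show ?thesis using *[of x y] xy by simp
  next
    case False
    then show ?thesis using *[of y x] xy by (simp add: norm_minus_commute)
  qed
qed

lemma prim_continuous:
  assumes g: "g \<in> L2 (lebesgue_on {\<alpha><..<\<beta>})"
  shows "continuous_on {\<alpha>..\<beta>} (prim \<alpha> g)"
  unfolding continuous_on_iff
proof (intro ballI allI impI)
  fix x e :: real assume x: "x \<in> {\<alpha>..\<beta>}" and e: "0 < e"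
  define N where "N = (l2_norm (lebesgue_on {\<alpha><..<\<beta>}) g)\<^sup>2 + 1"
  have N: "0 < N" by (simp add: N_def add_nonneg_pos)
  have "dist (prim \<alpha> g y) (prim \<alpha> g x) < e" if y: "y \<in> {\<alpha>..\<beta>}" "dist y x < e\<^sup>2 / N" for y
  proof -
    have "(cmod (prim \<alpha> g y - prim \<alpha> g x))\<^sup>2 \<le> \<bar>y - x\<bar> * (l2_norm (lebesgue_on {\<alpha><..<\<beta>}) g)\<^sup>2"
      by (rule prim_holder_abs[OF g x y(1)])
    also have "\<dots> \<le> \<bar>y - x\<bar> * N" by (intro mult_left_mono) (simp_all add: N_def)
    also have "\<dots> < e\<^sup>2" using y(2) N by (simp add: dist_real_def field_simps)
    finally show ?thesis using e by (simp add: dist_norm power2_less_imp_less)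
  qed
  then show "\<exists>d>0. \<forall>x'\<in>{\<alpha>..\<beta>}. dist x' x < d \<longrightarrow> dist (prim \<alpha> g x') (prim \<alpha> g x) < e"
    using e N by (intro exI[of _ "e\<^sup>2 / N"]) simp
qed

lemma continuous_L2_ivl:
  assumes "continuous_on {\<alpha>..\<beta>} W" shows "W \<in> L2 (lebesgue_on {\<alpha><..<\<beta>::real})"
proof -
  have "continuous_on {\<alpha><..<\<beta>} W" using assms by (rule continuous_on_subset) auto
  then have m [measurable]: "W \<in> borel_measurable (lebesgue_on {\<alpha><..<\<beta>})"
    by (rule continuous_imp_measurable_on_sets_lebesgue) simp
  have "compact (W ` {\<alpha>..\<beta>})" by (intro compact_continuous_image assms) simp
  then obtain K where K: "\<And>x. x \<in> {\<alpha>..\<beta>} \<Longrightarrow> cmod (W x) \<le> K"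
    using compact_imp_bounded bounded_iff by (metis imageI)
  have "integrable (lebesgue_on {\<alpha><..<\<beta>}) (\<lambda>x. (cmod (W x))\<^sup>2)"
  proof (rule finite_measure.integrable_const_bound[OF finite_measure_ivl])
    show "AE x in lebesgue_on {\<alpha><..<\<beta>}. norm ((cmod (W x))\<^sup>2) \<le> K\<^sup>2"
      using K by (intro AE_I2) (auto intro!: power_mono)
  qed measurable
  then show ?thesis using m by (simp add: L2_def)
qed

lemma test_bounded:
  assumes "\<phi> \<in> test_functions \<Omega>"
  obtains K where "\<And>x. \<bar>\<phi> x\<bar> \<le> K" "\<And>x. \<bar>deriv \<phi> x\<bar> \<le> K"
proof -
  have "bounded (closure {x. \<phi> x \<noteq> 0})"
    using assms by (auto simp: test_functions_def intro: compact_imp_bounded)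
  then obtain B where B: "\<And>x. x \<in> closure {x. \<phi> x \<noteq> 0} \<Longrightarrow> \<bar>x\<bar> \<le> B"
    unfolding bounded_iff by auto
  have "closure {x. \<phi> x \<noteq> 0} \<subseteq> {-(B+1)<..<B+1}"
    using B by fastforce
  then have t: "\<phi> \<in> test_functions {-(B+1)<..<B+1}" using assms by (simp add: test_functions_def)
  obtain K1 where K1: "0 \<le> K1" "\<And>x. -(B+1) \<le> x \<Longrightarrow> x \<le> B+1 \<Longrightarrow> norm (\<phi> x) \<le> K1"
    using continuous_bounded_ivl[OF test_cont[OF t]] by blast
  obtain K2 where K2: "0 \<le> K2" "\<And>x. -(B+1) \<le> x \<Longrightarrow> x \<le> B+1 \<Longrightarrow> norm (deriv \<phi> x) \<le> K2"
    using continuous_bounded_ivl[OF test_deriv_cont[OF t]] by blast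
  show ?thesis
  proof (rule that[of "K1 + K2"])
    fix x
    show "\<bar>\<phi> x\<bar> \<le> K1 + K2" using K1(2)[of x] K1(1) K2(1) test_zero[OF t, of x]
      by (cases "x \<in> {-(B+1)<..<B+1}") auto
    show "\<bar>deriv \<phi> x\<bar> \<le> K1 + K2" using K2(2)[of x] K1(1) K2(1) test_deriv_zero[OF t, of x]
      by (cases "x \<in> {-(B+1)<..<B+1}") auto
  qed
qed

lemma bounded_mult_integrable:
  fixes f :: "real \<Rightarrow> real" and u :: "real \<Rightarrow> complex"
  assumes "integrable (lebesgue_on S) u" "continuous_on UNIV f" "\<And>x. \<bar>f x\<bar> \<le> K"
  shows "integrable (lebesgue_on S) (\<lambda>x. f x *\<^sub>R u x)"
proof (rule Bochner_Integration.integrable_bound)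
  show "integrable (lebesgue_on S) (\<lambda>x. K *\<^sub>R u x)" using assms(1) by simp
  have [measurable]: "u \<in> borel_measurable (lebesgue_on S)"
    using assms(1) by (rule borel_measurable_integrable)
  have "f \<in> borel_measurable borel" using assms(2) by (rule borel_measurable_continuous_onI)
  moreover have "(\<lambda>x. x) \<in> borel_measurable (lebesgue_on S)"
    using id_borel_measurable_lebesgue_on[of S] by (simp add: id_def)
  ultimately have [measurable]: "f \<in> borel_measurable (lebesgue_on S)"
    using measurable_compose by fastforce
  show "(\<lambda>x. f x *\<^sub>R u x) \<in> borel_measurable (lebesgue_on S)" by measurable
  have "\<bar>f x\<bar> * cmod (u x) \<le> \<bar>K\<bar> * cmod (u x)" for x
    using assms(3)[of x] by (intro mult_right_mono) auto
  then show "AE x in lebesgue_on S. norm (f x *\<^sub>R u x) \<le> norm (K *\<^sub>R u x)" by simp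
qed

lemma test_mult_integrable:
  fixes u :: "real \<Rightarrow> complex"
  assumes "integrable (lebesgue_on S) u" "\<phi> \<in> test_functions \<Omega>"
  shows "integrable (lebesgue_on S) (\<lambda>x. \<phi> x *\<^sub>R u x)"
    "integrable (lebesgue_on S) (\<lambda>x. deriv \<phi> x *\<^sub>R u x)"
proof -
  obtain K where K: "\<And>x. \<bar>\<phi> x\<bar> \<le> K" "\<And>x. \<bar>deriv \<phi> x\<bar> \<le> K" using test_bounded[OF assms(2)] by blast
  show "integrable (lebesgue_on S) (\<lambda>x. \<phi> x *\<^sub>R u x)" "integrable (lebesgue_on S) (\<lambda>x. deriv \<phi> x *\<^sub>R u x)"
    by (rule bounded_mult_integrable[OF assms(1)], (rule test_cont test_deriv_cont, rule assms(2)), rule K)+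
qed

lemma weak_deriv_add:
  assumes "is_weak_deriv \<Omega> u g" "is_weak_deriv \<Omega> v h"
    and "integrable (lebesgue_on \<Omega>) u" "integrable (lebesgue_on \<Omega>) v"
    and "integrable (lebesgue_on \<Omega>) g" "integrable (lebesgue_on \<Omega>) h"
  shows "is_weak_deriv \<Omega> (u + v) (g + h)"
  unfolding is_weak_deriv_def
proof
  fix \<phi> assume \<phi>: "\<phi> \<in> test_functions \<Omega>"
  then show "(LINT x|lebesgue_on \<Omega>. deriv \<phi> x *\<^sub>R (u + v) x) = - (LINT x|lebesgue_on \<Omega>. \<phi> x *\<^sub>R (g + h) x)"
    using assms(1,2) test_mult_integrable[OF assms(3) \<phi>] test_mult_integrable[OF assms(4) \<phi>]
      test_mult_integrable[OF assms(5) \<phi>] test_mult_integrable[OF assms(6) \<phi>]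
    by (simp add: is_weak_deriv_def scaleR_add_right)
qed

lemma weak_deriv_scale:
  assumes "is_weak_deriv \<Omega> u g"
  shows "is_weak_deriv \<Omega> (cscale c u) (cscale c g)"
  unfolding is_weak_deriv_def
proof
  fix \<phi> assume \<phi>: "\<phi> \<in> test_functions \<Omega>"
  have eq: "f *\<^sub>R (c * z) = c * (f *\<^sub>R z)" for f :: real and z :: complex by simp
  have int: "(LINT x|lebesgue_on \<Omega>. f x *\<^sub>R cscale c v x) = c * (LINT x|lebesgue_on \<Omega>. f x *\<^sub>R v x)"
    for f :: "real \<Rightarrow> real" and v
    unfolding cscale_apply eq by (rule integral_mult_right_zero)
  show "(LINT x|lebesgue_on \<Omega>. deriv \<phi> x *\<^sub>R cscale c u x) = - (LINT x|lebesgue_on \<Omega>. \<phi> x *\<^sub>R cscale c g x)"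
    using assms \<phi> unfolding is_weak_deriv_def int by simp
qed

lemma weak_deriv_diff:
  assumes "is_weak_deriv \<Omega> u g" "is_weak_deriv \<Omega> v h"
    and "integrable (lebesgue_on \<Omega>) u" "integrable (lebesgue_on \<Omega>) v"
    and "integrable (lebesgue_on \<Omega>) g" "integrable (lebesgue_on \<Omega>) h"
  shows "is_weak_deriv \<Omega> (u - v) (g - h)"
proof -
  have eq: "x - y = x + cscale (-1) y" for x y :: "real \<Rightarrow> complex" by (simp add: fun_eq_iff)
  have "integrable (lebesgue_on \<Omega>) (cscale (-1) v)" "integrable (lebesgue_on \<Omega>) (cscale (-1) h)"
    using assms(4,6) by (simp_all add: cscale_def)
  then show ?thesis unfolding eq
    using assms by (intro weak_deriv_add weak_deriv_scale) auto
qed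

text \<open>Continuous approximations of the indicator of \<open>(a, b)\<close> with support in a
  compact subinterval. Since test functions are continuously differentiable, only continuous
  functions can be prescribed as their derivatives.\<close>

lemma trapezoid_limit:
  fixes a b :: real
  defines "T \<equiv> \<lambda>n x. min 1 (real (Suc n) * max 0 (min (x - a - 1 / real (Suc n)) (b - x - 1 / real (Suc n))))"
  shows "continuous_on UNIV (T n)" "\<bar>T n x\<bar> \<le> 1"
    "x \<notin> {a + 1 / real (Suc n) .. b - 1 / real (Suc n)} \<Longrightarrow> T n x = 0"
    "(\<lambda>n. T n x) \<longlonglongrightarrow> indicator {a<..<b} x"
proof -
  show "continuous_on UNIV (T n)" unfolding T_def by (intro continuous_intros)
  have "0 \<le> T n x" by (simp add: T_def)
  moreover have "T n x \<le> 1" by (simp add: T_def)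
  ultimately show "\<bar>T n x\<bar> \<le> 1" by simp
  show z: "T n x = 0" if "x \<notin> {a + 1 / real (Suc n) .. b - 1 / real (Suc n)}" for n x
  proof -
    have "min (x - a - 1 / real (Suc n)) (b - x - 1 / real (Suc n)) \<le> 0" using that by auto
    then have "max 0 (min (x - a - 1 / real (Suc n)) (b - x - 1 / real (Suc n))) = 0" by simp
    then show ?thesis by (simp only: T_def)
  qed
  show "(\<lambda>n. T n x) \<longlonglongrightarrow> indicator {a<..<b} x"
  proof (cases "x \<in> {a<..<b}")
    case True
    define m where "m = min (x - a) (b - x)"
    have "0 < m" using True by (simp add: m_def)
    obtain N where N: "2 / m < real N" using reals_Archimedean2 by blast
    have "T n x = 1" if "n \<ge> N" for n
    proof -
      have "2 / m < real (Suc n)" using N that by simp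
      then have "2 < real (Suc n) * m" using \<open>0 < m\<close> by (simp add: field_simps)
      then have "1 \<le> real (Suc n) * (m - 1 / real (Suc n))" by (simp add: right_diff_distrib)
      moreover have "m - 1 / real (Suc n) = min (x - a - 1 / real (Suc n)) (b - x - 1 / real (Suc n))"
        by (simp add: m_def min_def)
      ultimately have "1 \<le> real (Suc n) * min (x - a - 1 / real (Suc n)) (b - x - 1 / real (Suc n))"
        by (simp only:)
      moreover have "real (Suc n) * min (x - a - 1 / real (Suc n)) (b - x - 1 / real (Suc n))
          \<le> real (Suc n) * max 0 (min (x - a - 1 / real (Suc n)) (b - x - 1 / real (Suc n)))"
        by (intro mult_left_mono) simp_all
      ultimately have "1 \<le> real (Suc n) * max 0 (min (x - a - 1 / real (Suc n)) (b - x - 1 / real (Suc n)))"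
        by (rule order_trans)
      then show ?thesis unfolding T_def by (rule min_absorb1)
    qed
    then have "(\<lambda>n. T n x) \<longlonglongrightarrow> 1"
      by (intro tendsto_eventually eventually_sequentiallyI)
    then show ?thesis using True by simp
  next
    case False
    have "T n x = 0" for n
    proof (rule z)
      have "x \<notin> {a + e .. b - e}" if "0 < e" for e using False that by auto
      then show "x \<notin> {a + 1 / real (Suc n) .. b - 1 / real (Suc n)}" by simp
    qed
    then show ?thesis using False by simp
  qed
qed

text \<open>A combination of the trapezoids over \<open>(a, b)\<close> and over the whole interval
  with vanishing mean is the derivative of a test function. In the limit, the mean of
  \<open>w\<close> over every subinterval equals its total mean \<open>\<kappa>\<close>.\<close>

lemma du_bois_reymond:
  assumes w: "integrable (lebesgue_on {\<alpha><..<\<beta>}) w" and ab: "\<alpha> < \<beta>"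
    and z: "\<And>\<phi>. \<phi> \<in> test_functions {\<alpha><..<\<beta>} \<Longrightarrow> (LINT x|lebesgue_on {\<alpha><..<\<beta>}. deriv \<phi> x *\<^sub>R w x) = 0"
  obtains \<kappa> :: complex where "AE x in lebesgue_on {\<alpha><..<\<beta>}. w x = \<kappa>"
proof -
  let ?J = "{\<alpha><..<\<beta>}"
  define T where "T a b n x = min 1 (real (Suc n) * max 0 (min (x - a - 1 / real (Suc n)) (b - x - 1 / real (Suc n))))"
    for a b :: real and n and x :: real
  note T = trapezoid_limit[folded T_def]
  have Tlim: "(\<lambda>n. LINT x|lebesgue_on ?J. T a b n x *\<^sub>R v x) \<longlonglongrightarrow> (LINT x|lebesgue_on {a<..<b}. v x)"
    if v: "integrable (lebesgue_on ?J) v" and "\<alpha> \<le> a" "b \<le> \<beta>" for a b and v :: "real \<Rightarrow> complex"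
  proof -
    have [measurable]: "v \<in> borel_measurable (lebesgue_on ?J)" using v by (rule borel_measurable_integrable)
    have sub: "{a<..<b} \<subseteq> ?J" using that(2,3) by auto
    have "(\<lambda>n. LINT x|lebesgue_on ?J. T a b n x *\<^sub>R v x) \<longlonglongrightarrow> (LINT x|lebesgue_on ?J. indicator {a<..<b} x *\<^sub>R v x)"
    proof (rule integral_dominated_convergence[where w = "\<lambda>x. norm (v x)"])
      show "(\<lambda>x. T a b n x *\<^sub>R v x) \<in> borel_measurable (lebesgue_on ?J)" for n
        using bounded_mult_integrable[OF v T(1) T(2)] by (rule borel_measurable_integrable)
      show "(\<lambda>x. indicator {a<..<b} x *\<^sub>R v x) \<in> borel_measurable (lebesgue_on ?J)"
        by (intro borel_measurable_scaleR borel_measurable_indicator) (simp_all add: sets_restrict_space_iff sub)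
      show "AE x in lebesgue_on ?J. (\<lambda>n. T a b n x *\<^sub>R v x) \<longlonglongrightarrow> indicator {a<..<b} x *\<^sub>R v x"
        using T(4) by (intro AE_I2 tendsto_scaleR tendsto_const) 
      show "AE x in lebesgue_on ?J. norm (T a b n x *\<^sub>R v x) \<le> norm (v x)" for n
        using T(2)[of a b n] by (intro AE_I2) (simp add: mult_left_le_one_le)
    qed (use v in simp)
    also have "(LINT x|lebesgue_on ?J. indicator {a<..<b} x *\<^sub>R v x) = (LINT x|lebesgue_on {a<..<b}. v x)"
      using integral_restrict[OF sub, of v] by (simp add: indicator_scaleR_eq_if)
    finally show ?thesis .
  qed
  define \<kappa> where "\<kappa> = (1 / (\<beta> - \<alpha>)) *\<^sub>R (LINT x|lebesgue_on ?J. w x)"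
  have mean: "(LINT x|lebesgue_on {a<..<b}. w x) = (b - a) *\<^sub>R \<kappa>" if "\<alpha> \<le> a" "a < b" "b \<le> \<beta>" for a b
  proof -
    define c where "c n = (LINT x|lebesgue_on ?J. T a b n x *\<^sub>R (1::complex))" for n
    define e where "e n = (LINT x|lebesgue_on ?J. T \<alpha> \<beta> n x *\<^sub>R (1::complex))" for n
    have c: "c \<longlonglongrightarrow> complex_of_real (b - a)"
      using Tlim[OF integrable_const_ivl', of a b 1] integral_const_ivl[of a b "1::complex"] that
      unfolding c_def by (simp add: scaleR_conv_of_real)
    have e: "e \<longlonglongrightarrow> complex_of_real (\<beta> - \<alpha>)"
      using Tlim[OF integrable_const_ivl', of \<alpha> \<beta> 1] integral_const_ivl[of \<alpha> \<beta> "1::complex"] ab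
      unfolding e_def by (simp add: scaleR_conv_of_real)
    have lhs: "(\<lambda>n. e n * (LINT x|lebesgue_on ?J. T a b n x *\<^sub>R w x))
        \<longlonglongrightarrow> complex_of_real (\<beta> - \<alpha>) * (LINT x|lebesgue_on {a<..<b}. w x)"
      using Tlim[OF w, of a b] that by (intro tendsto_mult e) auto
    have rhs: "(\<lambda>n. c n * (LINT x|lebesgue_on ?J. T \<alpha> \<beta> n x *\<^sub>R w x))
        \<longlonglongrightarrow> complex_of_real (b - a) * (LINT x|lebesgue_on ?J. w x)"
      using Tlim[OF w, of \<alpha> \<beta>] by (intro tendsto_mult c) auto
    have eq: "e n * (LINT x|lebesgue_on ?J. T a b n x *\<^sub>R w x) = c n * (LINT x|lebesgue_on ?J. T \<alpha> \<beta> n x *\<^sub>R w x)"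
      if n: "\<alpha> + 1 / real (Suc n) \<le> \<beta> - 1 / real (Suc n)" for n
    proof -
      define C where "C = (LINT x|lebesgue_on ?J. T a b n x)"
      define E where "E = (LINT x|lebesgue_on ?J. T \<alpha> \<beta> n x)"
      have r1: "integrable (lebesgue_on ?J) (T a' b' n)" for a' b'
      proof -
        have "integrable (lebesgue_on ?J) (\<lambda>x. T a' b' n x *\<^sub>R (1::complex))"
          by (rule bounded_mult_integrable[OF integrable_const_ivl' T(1) T(2)])
        from integrable_bounded_linear[OF bounded_linear_Re this] show ?thesis by simp
      qed
      have C: "c n = complex_of_real C" "e n = complex_of_real E"
        by (simp_all add: c_def e_def C_def E_def scaleR_conv_of_real)
      define \<psi> where "\<psi> x = E * T a b n x - C * T \<alpha> \<beta> n x" for x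
      obtain \<phi> where \<phi>: "\<phi> \<in> test_functions ?J" "deriv \<phi> = \<psi>"
      proof (rule test_function_primitive[of \<psi> "\<alpha> + 1 / real (Suc n)" "\<beta> - 1 / real (Suc n)" \<alpha> \<beta>])
        show "continuous_on UNIV \<psi>" unfolding \<psi>_def by (intro continuous_intros T(1))
        show "\<psi> x = 0" if x: "x \<notin> {\<alpha> + 1 / real (Suc n)..\<beta> - 1 / real (Suc n)}" for x
        proof -
          have "x \<notin> {a + 1 / real (Suc n)..b - 1 / real (Suc n)}"
            using x \<open>\<alpha> \<le> a\<close> \<open>b \<le> \<beta>\<close> by auto
          then show ?thesis using T(3)[of x a n b] T(3)[OF x] by (simp add: \<psi>_def)
        qed
        show "(LINT x|lebesgue_on ?J. \<psi> x) = 0"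
          using r1 by (simp add: \<psi>_def C_def E_def)
      qed (use n in auto)
      have wi: "integrable (lebesgue_on ?J) (\<lambda>x. T a' b' n x *\<^sub>R w x)" for a' b'
        by (rule bounded_mult_integrable[OF w T(1) T(2)])
      have "0 = (LINT x|lebesgue_on ?J. E *\<^sub>R (T a b n x *\<^sub>R w x) - C *\<^sub>R (T \<alpha> \<beta> n x *\<^sub>R w x))"
        using z[OF \<phi>(1)] unfolding \<phi>(2) by (simp add: \<psi>_def scaleR_left_diff_distrib)
      also have "\<dots> = E *\<^sub>R (LINT x|lebesgue_on ?J. T a b n x *\<^sub>R w x) - C *\<^sub>R (LINT x|lebesgue_on ?J. T \<alpha> \<beta> n x *\<^sub>R w x)"
        by (simp only: Bochner_Integration.integral_diff[OF integrable_scaleR_right[OF wi] integrable_scaleR_right[OF wi]]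
            integral_scaleR_right)
      finally show ?thesis by (simp add: C scaleR_conv_of_real)
    qed
    \<comment> \<open>From this index on the shrunken interval is nonempty, as
      \<open>test_function_primitive\<close> requires.\<close>
    obtain N where N: "2 / (\<beta> - \<alpha>) < real N" using reals_Archimedean2 by blast
    have "\<forall>\<^sub>F n in sequentially. e n * (LINT x|lebesgue_on ?J. T a b n x *\<^sub>R w x) = c n * (LINT x|lebesgue_on ?J. T \<alpha> \<beta> n x *\<^sub>R w x)"
    proof (rule eventually_sequentiallyI[of N], rule eq)
      fix n assume "N \<le> n"
      then have "2 / (\<beta> - \<alpha>) < real (Suc n)" using N by linarith
      then have "2 / real (Suc n) \<le> \<beta> - \<alpha>" using ab by (simp add: field_simps)
      moreover have "2 / real (Suc n) = 1 / real (Suc n) + 1 / real (Suc n)"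
        unfolding add_divide_distrib[symmetric] by (simp only: one_add_one)
      ultimately show "\<alpha> + 1 / real (Suc n) \<le> \<beta> - 1 / real (Suc n)" by linarith
    qed
    from LIMSEQ_unique[OF Lim_transform_eventually[OF lhs this] rhs]
    have "complex_of_real (\<beta> - \<alpha>) * (LINT x|lebesgue_on {a<..<b}. w x) = complex_of_real (b - a) * (LINT x|lebesgue_on ?J. w x)" .
    moreover have "complex_of_real (\<beta> - \<alpha>) \<noteq> 0" using ab by simp
    ultimately show ?thesis by (simp add: \<kappa>_def scaleR_conv_of_real field_simps)
  qed
  have "AE x in lebesgue_on ?J. w x - \<kappa> = 0"
  proof (rule AE_zero_if_integral_ivl_zero)
    show "integrable (lebesgue_on ?J) (\<lambda>x. w x - \<kappa>)"
      by (intro Bochner_Integration.integrable_diff w integrable_const_ivl')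
    fix a b assume ab': "\<alpha> \<le> a" "a < b" "b \<le> \<beta>"
    have "integrable (lebesgue_on {a<..<b}) w"
      by (rule integrable_lebesgue_on_subset[OF w]) (use ab' in auto)
    then have "(LINT x|lebesgue_on {a<..<b}. w x - \<kappa>) = (LINT x|lebesgue_on {a<..<b}. w x) - (LINT x|lebesgue_on {a<..<b}. \<kappa>)"
      by (intro Bochner_Integration.integral_diff integrable_const_ivl')
    then show "(LINT x|lebesgue_on {a<..<b}. w x - \<kappa>) = 0"
      using mean[OF ab'] integral_const_ivl[of a b \<kappa>] ab' by simp
  qed
  then have "AE x in lebesgue_on ?J. w x = \<kappa>" by simp
  then show ?thesis by (rule that)
qed

text \<open>\<open>g\<close> plays the role of the derivative of \<open>u\<close>, and
  \<open>\<kappa>\<close> is the value at the left endpoint, where \<open>prim\<close>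
  vanishes.\<close>

definition represents :: "real \<Rightarrow> real \<Rightarrow> (real \<Rightarrow> complex) \<Rightarrow> (real \<Rightarrow> complex) \<Rightarrow> complex \<Rightarrow> bool" where
  "represents \<alpha> \<beta> u g \<kappa> \<longleftrightarrow> (AE x in lebesgue_on {\<alpha><..<\<beta>}. u x = \<kappa> + prim \<alpha> g x)"

lemma weak_deriv_represents:
  assumes ab: "\<alpha> < \<beta>" and u: "u \<in> L2 (lebesgue_on {\<alpha><..<\<beta>})" and g: "g \<in> L2 (lebesgue_on {\<alpha><..<\<beta>})"
    and d: "is_weak_deriv {\<alpha><..<\<beta>} u g"
  obtains \<kappa> where "represents \<alpha> \<beta> u g \<kappa>"
proof -
  have ui: "integrable (lebesgue_on {\<alpha><..<\<beta>}) u" and gi: "integrable (lebesgue_on {\<alpha><..<\<beta>}) g"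
    using u g by (auto intro: L2_integrable_ivl)
  have pi: "integrable (lebesgue_on {\<alpha><..<\<beta>}) (prim \<alpha> g)"
    by (intro L2_integrable_ivl continuous_L2_ivl prim_continuous g)
  have "(LINT x|lebesgue_on {\<alpha><..<\<beta>}. deriv \<phi> x *\<^sub>R (u x - prim \<alpha> g x)) = 0"
    if \<phi>: "\<phi> \<in> test_functions {\<alpha><..<\<beta>}" for \<phi>
  proof -
    have "(LINT x|lebesgue_on {\<alpha><..<\<beta>}. deriv \<phi> x *\<^sub>R (u x - prim \<alpha> g x))
        = (LINT x|lebesgue_on {\<alpha><..<\<beta>}. deriv \<phi> x *\<^sub>R u x) - (LINT x|lebesgue_on {\<alpha><..<\<beta>}. deriv \<phi> x *\<^sub>R prim \<alpha> g x)"
      using test_mult_integrable[OF ui \<phi>] test_mult_integrable[OF pi \<phi>]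
      by (simp add: scaleR_diff_right)
    then show ?thesis
      using d \<phi> integral_primitive_by_parts[OF gi \<phi>] by (simp add: is_weak_deriv_def prim_def)
  qed
  moreover have "integrable (lebesgue_on {\<alpha><..<\<beta>}) (\<lambda>x. u x - prim \<alpha> g x)" using ui pi by simp
  ultimately obtain \<kappa> where "AE x in lebesgue_on {\<alpha><..<\<beta>}. u x - prim \<alpha> g x = \<kappa>"
    using du_bois_reymond[OF _ ab] by blast
  then have "AE x in lebesgue_on {\<alpha><..<\<beta>}. u x = \<kappa> + prim \<alpha> g x"
    by eventually_elim (simp add: algebra_simps)
  then show ?thesis by (intro that) (simp add: represents_def)
qed

lemma AE_continuous_zero:
  fixes h :: "real \<Rightarrow> complex"
  assumes ab: "\<alpha> < \<beta>" and h: "continuous_on {\<alpha>..\<beta>} h" and ae: "AE x in lebesgue_on {\<alpha><..<\<beta>}. h x = 0"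
    and x: "x \<in> {\<alpha>..\<beta>}"
  shows "h x = 0"
proof -
  have ho: "continuous_on {\<alpha><..<\<beta>} h" using h by (rule continuous_on_subset) auto
  have op: "open ({\<alpha><..<\<beta>} \<inter> h -` (- {0}))"
    by (rule continuous_open_preimage[OF ho]) auto
  moreover have "negligible ({\<alpha><..<\<beta>} \<inter> h -` (- {0}))"
  proof -
    have "AE x in lebesgue. x \<notin> {\<alpha><..<\<beta>} \<inter> h -` (- {0})"
      using ae by (auto simp: AE_restrict_space_iff)
    moreover have "{\<alpha><..<\<beta>} \<inter> h -` (- {0}) \<in> sets lebesgue"
      using borel_open[OF op] by simp
    ultimately show ?thesis
      using AE_iff_null_sets by (auto simp only: negligible_iff_null_sets)
  qed
  ultimately have "{\<alpha><..<\<beta>} \<inter> h -` (- {0}) = {}" using open_not_negligible by blast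
  then have z: "\<And>y. y \<in> {\<alpha><..<\<beta>} \<Longrightarrow> h y = 0" by blast
  show ?thesis
  proof (rule continuous_constant_on_closure[of "{\<alpha><..<\<beta>}" h 0 x])
    show "continuous_on (closure {\<alpha><..<\<beta>}) h" using h ab by simp
    show "x \<in> closure {\<alpha><..<\<beta>}" using x ab by simp
  qed (use z in blast)
qed

text \<open>The function \<open>u - u = 0\<close> has the weak derivative \<open>g - h\<close>, so a
  constant plus the primitive of \<open>g - h\<close> vanishes almost everywhere, hence everywhere
  by continuity. Thus all integrals of \<open>g - h\<close> over subintervals are zero.\<close>

lemma weak_deriv_unique_ivl:
  assumes ab: "\<alpha> < \<beta>" and u: "u \<in> L2 (lebesgue_on {\<alpha><..<\<beta>})" and gh: "g \<in> L2 (lebesgue_on {\<alpha><..<\<beta>})" "h \<in> L2 (lebesgue_on {\<alpha><..<\<beta>})"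
    and d: "is_weak_deriv {\<alpha><..<\<beta>} u g" "is_weak_deriv {\<alpha><..<\<beta>} u h"
  shows "AE x in lebesgue_on {\<alpha><..<\<beta>}. g x = h x"
proof -
  interpret semi_inner "L2 (lebesgue_on {\<alpha><..<\<beta>})" "l2_inner (lebesgue_on {\<alpha><..<\<beta>})"
    by (rule semi_inner_L2)
  have gh': "g - h \<in> L2 (lebesgue_on {\<alpha><..<\<beta>})" using gh by simp
  have "is_weak_deriv {\<alpha><..<\<beta>} (u - u) (g - h)"
    by (intro weak_deriv_diff d L2_integrable_ivl u gh)
  then obtain \<kappa> where "represents \<alpha> \<beta> (u - u) (g - h) \<kappa>"
    using weak_deriv_represents[OF ab _ gh', of "u - u"] u by auto
  then have "AE x in lebesgue_on {\<alpha><..<\<beta>}. \<kappa> + prim \<alpha> (g - h) x = 0"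
    unfolding represents_def by eventually_elim simp
  moreover have "continuous_on {\<alpha>..\<beta>} (\<lambda>x. \<kappa> + prim \<alpha> (g - h) x)"
    by (intro continuous_intros prim_continuous[OF gh'])
  ultimately have *: "\<kappa> + prim \<alpha> (g - h) x = 0" if "x \<in> {\<alpha>..\<beta>}" for x
    using AE_continuous_zero[OF ab _ _ that, of "\<lambda>x. \<kappa> + prim \<alpha> (g - h) x"] by blast
  have "AE x in lebesgue_on {\<alpha><..<\<beta>}. (g - h) x = 0"
  proof (rule AE_zero_if_integral_ivl_zero)
    show "integrable (lebesgue_on {\<alpha><..<\<beta>}) (g - h)" by (rule L2_integrable_ivl[OF gh'])
    fix a b assume "\<alpha> \<le> a" "a < b" "b \<le> \<beta>"
    then have "(LINT x|lebesgue_on {a<..<b}. (g - h) x) = (\<kappa> + prim \<alpha> (g - h) b) - (\<kappa> + prim \<alpha> (g - h) a)"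
      using prim_diff[OF L2_integrable_ivl[OF gh'], of a b] by (simp add: prim_def[of a])
    then show "(LINT x|lebesgue_on {a<..<b}. (g - h) x) = 0"
      using *[of a] *[of b] \<open>\<alpha> \<le> a\<close> \<open>a < b\<close> \<open>b \<le> \<beta>\<close> by simp
  qed
  then show ?thesis by simp
qed

lemma represents_subinterval:
  assumes "represents \<alpha> \<beta> u g \<kappa>" "g \<in> L2 (lebesgue_on {\<alpha><..<\<beta>})" "\<alpha> \<le> a" "b \<le> \<beta>"
  shows "represents a b u g (\<kappa> + prim \<alpha> g a)"
proof -
  have "AE x in lebesgue_on {a<..<b}. u x = \<kappa> + prim \<alpha> g x"
    by (rule AE_lebesgue_on_subset[OF assms(1)[unfolded represents_def]]) (use assms in auto)
  moreover have "AE x in lebesgue_on {a<..<b}. prim \<alpha> g x = prim \<alpha> g a + prim a g x"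
  proof (rule AE_I2)
    fix x assume "x \<in> space (lebesgue_on {a<..<b})"
    then show "prim \<alpha> g x = prim \<alpha> g a + prim a g x"
      using prim_diff[OF L2_integrable_ivl[OF assms(2)], of a x] assms by (simp add: algebra_simps)
  qed
  ultimately show ?thesis unfolding represents_def by eventually_elim simp
qed

text \<open>Compare the value at \<open>y\<close> with \<open>u x\<close> by the Hoelder estimate of
  order one half and average over \<open>x\<close>; the factors \<open>2\<close> come from squaring
  a sum of two terms.\<close>

lemma represents_pointwise_bound:
  assumes ab: "\<alpha> < \<beta>" and u: "u \<in> L2 (lebesgue_on {\<alpha><..<\<beta>})" and g: "g \<in> L2 (lebesgue_on {\<alpha><..<\<beta>})"
    and r: "represents \<alpha> \<beta> u g \<kappa>" and y: "y \<in> {\<alpha>..\<beta>}"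
  shows "(cmod (\<kappa> + prim \<alpha> g y))\<^sup>2 \<le> 2 / (\<beta> - \<alpha>) * (l2_norm (lebesgue_on {\<alpha><..<\<beta>}) u)\<^sup>2
    + 2 * (\<beta> - \<alpha>) * (l2_norm (lebesgue_on {\<alpha><..<\<beta>}) g)\<^sup>2"
proof -
  let ?M = "lebesgue_on {\<alpha><..<\<beta>}"
  let ?h = "\<beta> - \<alpha>"
  let ?N = "(l2_norm ?M g)\<^sup>2"
  have "?h * (cmod (\<kappa> + prim \<alpha> g y))\<^sup>2 = (LINT x|?M. (cmod (\<kappa> + prim \<alpha> g y))\<^sup>2)"
    unfolding integral_const_ivl[OF less_imp_le[OF ab]] by simp
  also have "\<dots> \<le> (LINT x|?M. 2 * (cmod (u x))\<^sup>2 + 2 * (?h * ?N))"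
  proof (rule integral_mono_AE)
    show "AE x in ?M. (cmod (\<kappa> + prim \<alpha> g y))\<^sup>2 \<le> 2 * (cmod (u x))\<^sup>2 + 2 * (?h * ?N)"
    proof (rule AE_mp[OF r[unfolded represents_def]], rule AE_I2, rule impI)
      fix x assume x: "x \<in> space ?M" and ux: "u x = \<kappa> + prim \<alpha> g x"
      have "(cmod (prim \<alpha> g y - prim \<alpha> g x))\<^sup>2 \<le> \<bar>y - x\<bar> * ?N"
        using x y by (intro prim_holder_abs[OF g]) auto
      also have "\<dots> \<le> ?h * ?N" using x y by (intro mult_right_mono) auto
      finally have 1: "(cmod (prim \<alpha> g y - prim \<alpha> g x))\<^sup>2 \<le> ?h * ?N" .
      have "\<kappa> + prim \<alpha> g y = u x + (prim \<alpha> g y - prim \<alpha> g x)" using ux by simp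
      then have "cmod (\<kappa> + prim \<alpha> g y) \<le> cmod (u x) + cmod (prim \<alpha> g y - prim \<alpha> g x)"
        by (metis norm_triangle_ineq)
      then have "(cmod (\<kappa> + prim \<alpha> g y))\<^sup>2 \<le> (cmod (u x) + cmod (prim \<alpha> g y - prim \<alpha> g x))\<^sup>2"
        by (rule power_mono) simp
      also have "\<dots> \<le> 2 * (cmod (u x))\<^sup>2 + 2 * (cmod (prim \<alpha> g y - prim \<alpha> g x))\<^sup>2"
        using sum_squares_bound[of "cmod (u x)" "cmod (prim \<alpha> g y - prim \<alpha> g x)"] by (simp add: power2_sum)
      finally show "(cmod (\<kappa> + prim \<alpha> g y))\<^sup>2 \<le> 2 * (cmod (u x))\<^sup>2 + 2 * (?h * ?N)"
        using 1 by linarith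
    qed
    show "integrable ?M (\<lambda>x. 2 * (cmod (u x))\<^sup>2 + 2 * (?h * ?N))"
      by (rule Bochner_Integration.integrable_add[OF integrable_mult_right[OF L2_integrable[OF u]] integrable_const_ivl'])
  qed (rule integrable_const_ivl')
  also have "\<dots> = (LINT x|?M. 2 * (cmod (u x))\<^sup>2) + (LINT x|?M. 2 * (?h * ?N))"
    using L2_integrable[OF u] by (intro Bochner_Integration.integral_add integrable_const_ivl') simp
  also have "\<dots> = 2 * (l2_norm ?M u)\<^sup>2 + ?h * (2 * (?h * ?N))"
    using integral_const_ivl[of \<alpha> \<beta> "2 * (?h * ?N)"] ab by (simp add: l2_norm_power2)
  finally have "?h * (cmod (\<kappa> + prim \<alpha> g y))\<^sup>2 \<le> 2 * (l2_norm ?M u)\<^sup>2 + ?h * (2 * (?h * ?N))" .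
  then have "(cmod (\<kappa> + prim \<alpha> g y))\<^sup>2 \<le> (2 * (l2_norm ?M u)\<^sup>2 + ?h * (2 * (?h * ?N))) / ?h"
    using ab by (simp add: pos_le_divide_eq mult.commute)
  also have "\<dots> = 2 / ?h * (l2_norm ?M u)\<^sup>2 + 2 * ?h * ?N"
    using ab by (simp add: add_divide_distrib)
  finally show ?thesis .
qed

text \<open>Compare \<open>u\<close> with its value \<open>c\<close> at the midpoint: on either half
  the Hoelder estimate costs \<open>(h / 2)^2\<close>. Replacing \<open>c\<close> by the mean can
  only decrease the distance, which brings in the squared integral of \<open>u\<close>.\<close>

lemma represents_poincare:
  assumes ab: "\<alpha> < \<beta>" and u: "u \<in> L2 (lebesgue_on {\<alpha><..<\<beta>})" and g: "g \<in> L2 (lebesgue_on {\<alpha><..<\<beta>})"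
    and r: "represents \<alpha> \<beta> u g \<kappa>"
  shows "(l2_norm (lebesgue_on {\<alpha><..<\<beta>}) u)\<^sup>2
    \<le> (cmod (LINT x|lebesgue_on {\<alpha><..<\<beta>}. u x))\<^sup>2 / (\<beta> - \<alpha>)
      + (\<beta> - \<alpha>)\<^sup>2 / 4 * (l2_norm (lebesgue_on {\<alpha><..<\<beta>}) g)\<^sup>2"
proof -
  let ?M = "lebesgue_on {\<alpha><..<\<beta>}"
  interpret semi_inner "L2 ?M" "l2_inner ?M" by (rule semi_inner_L2)
  define h where "h = \<beta> - \<alpha>"
  define m where "m = (\<alpha> + \<beta>) / 2"
  have m: "\<alpha> < m" "m < \<beta>" "m - \<alpha> = h / 2" "\<beta> - m = h / 2" "0 < h" using ab by (auto simp: m_def h_def field_simps)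
  define c where "c = \<kappa> + prim \<alpha> g m"
  have cL: "(\<lambda>x. c) \<in> L2 ?M" by (rule const_L2)
  have uc: "u - (\<lambda>x. c) \<in> L2 ?M" using u cL by simp
  have half: "(LINT x|lebesgue_on {a<..<b}. (cmod ((u - (\<lambda>x. c)) x))\<^sup>2) \<le> (h / 2)\<^sup>2 * (LINT x|lebesgue_on {a<..<b}. (cmod (g x))\<^sup>2)"
    if "a = \<alpha> \<and> b = m \<or> a = m \<and> b = \<beta>" for a b
  proof -
    have I: "a < b" "\<alpha> \<le> a" "b \<le> \<beta>" "b - a = h / 2" using that m by auto
    have gI: "g \<in> L2 (lebesgue_on {a<..<b})" by (rule L2_lebesgue_on_subset[OF g]) (use I in auto)
    let ?N = "(l2_norm (lebesgue_on {a<..<b}) g)\<^sup>2"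
    have "(LINT x|lebesgue_on {a<..<b}. (cmod ((u - (\<lambda>x. c)) x))\<^sup>2) \<le> (LINT x|lebesgue_on {a<..<b}. h / 2 * ?N)"
    proof (rule integral_mono_AE)
      have "u - (\<lambda>x. c) \<in> L2 (lebesgue_on {a<..<b})" by (rule L2_lebesgue_on_subset[OF uc]) (use I in auto)
      then show "integrable (lebesgue_on {a<..<b}) (\<lambda>x. (cmod ((u - (\<lambda>x. c)) x))\<^sup>2)" by (rule L2_integrable)
      have "AE x in lebesgue_on {a<..<b}. u x = \<kappa> + prim \<alpha> g x"
        by (rule AE_lebesgue_on_subset[OF r[unfolded represents_def]]) (use I in auto)
      then show "AE x in lebesgue_on {a<..<b}. (cmod ((u - (\<lambda>x. c)) x))\<^sup>2 \<le> h / 2 * ?N"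
      proof (rule AE_mp, intro AE_I2 impI)
        fix x assume x: "x \<in> space (lebesgue_on {a<..<b})" and ux: "u x = \<kappa> + prim \<alpha> g x"
        have xm: "x \<in> {a..b}" "m \<in> {a..b}" "\<bar>x - m\<bar> \<le> h / 2" using x that m by auto
        have "prim \<alpha> g y = prim \<alpha> g a + prim a g y" if "y \<in> {a..b}" for y
          using prim_diff[OF L2_integrable_ivl[OF g], of a y] I that by (simp add: algebra_simps)
        from this[OF xm(1)] this[OF xm(2)]
        have "prim \<alpha> g x - prim \<alpha> g m = prim a g x - prim a g m" by simp
        then have "(cmod (prim \<alpha> g x - prim \<alpha> g m))\<^sup>2 = (cmod (prim a g x - prim a g m))\<^sup>2" by simp
        also have "\<dots> \<le> \<bar>x - m\<bar> * ?N" by (rule prim_holder_abs[OF gI xm(2,1)])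
        also have "\<dots> \<le> h / 2 * ?N" using xm(3) by (rule mult_right_mono) simp
        finally show "(cmod ((u - (\<lambda>x. c)) x))\<^sup>2 \<le> h / 2 * ?N" using ux by (simp add: c_def)
      qed
    qed (rule integrable_const_ivl')
    also have "\<dots> = (b - a) * (h / 2 * ?N)" using integral_const_ivl[of a b "h / 2 * ?N"] I by simp
    also have "\<dots> = (h / 2)\<^sup>2 * ?N" using I by (simp add: power2_eq_square)
    finally show ?thesis by (simp add: l2_norm_power2)
  qed
  have "(l2_norm ?M (u - (\<lambda>x. c)))\<^sup>2 = (LINT x|lebesgue_on {\<alpha><..<m}. (cmod ((u - (\<lambda>x. c)) x))\<^sup>2) + (LINT x|lebesgue_on {m<..<\<beta>}. (cmod ((u - (\<lambda>x. c)) x))\<^sup>2)"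
    unfolding l2_norm_power2 using m by (intro integral_ivl_split L2_integrable[OF uc]) auto
  also have "\<dots> \<le> (h / 2)\<^sup>2 * (LINT x|lebesgue_on {\<alpha><..<m}. (cmod (g x))\<^sup>2) + (h / 2)\<^sup>2 * (LINT x|lebesgue_on {m<..<\<beta>}. (cmod (g x))\<^sup>2)"
    using half[of \<alpha> m] half[of m \<beta>] by (intro add_mono) auto
  also have "\<dots> = (h / 2)\<^sup>2 * ((LINT x|lebesgue_on {\<alpha><..<m}. (cmod (g x))\<^sup>2) + (LINT x|lebesgue_on {m<..<\<beta>}. (cmod (g x))\<^sup>2))"
    by (simp add: distrib_left)
  also have "\<dots> = (h / 2)\<^sup>2 * (l2_norm ?M g)\<^sup>2"
    unfolding l2_norm_power2 using m
    by (subst integral_ivl_split[of \<alpha> \<beta> "\<lambda>x. (cmod (g x))\<^sup>2" m]) (auto intro: L2_integrable[OF g])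
  finally have 1: "(l2_norm ?M (u - (\<lambda>x. c)))\<^sup>2 \<le> (h / 2)\<^sup>2 * (l2_norm ?M g)\<^sup>2" .
  define I where "I = (LINT x|?M. u x)"
  have "l2_inner ?M u (\<lambda>x. c) = I * cnj c"
    by (simp add: l2_inner_def I_def)
  then have "(l2_norm ?M (u - (\<lambda>x. c)))\<^sup>2 = (l2_norm ?M u)\<^sup>2 - 2 * Re (I * cnj c) + h * (cmod c)\<^sup>2"
    using nrm_diff_power2[OF u cL] l2_norm_const[of \<alpha> \<beta> c] ab by (simp add: nrm_L2 h_def)
  \<comment> \<open>Completing the square in \<open>cmod c\<close>: the distance from
    \<open>u\<close> to a constant is least at the mean \<open>I / h\<close>.\<close>
  moreover have "0 \<le> (cmod I)\<^sup>2 / h - 2 * Re (I * cnj c) + h * (cmod c)\<^sup>2"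
  proof -
    have "Re (I * cnj c) \<le> cmod I * cmod c" using complex_Re_le_cmod[of "I * cnj c"] by (simp add: norm_mult)
    moreover have "0 \<le> (cmod I - h * cmod c)\<^sup>2 / h" using m by simp
    moreover have "(cmod I - h * cmod c)\<^sup>2 / h = (cmod I)\<^sup>2 / h - 2 * (cmod I * cmod c) + h * (cmod c)\<^sup>2"
      using m by (simp add: power2_diff field_simps power2_eq_square)
    ultimately show ?thesis by linarith
  qed
  ultimately have "(l2_norm ?M u)\<^sup>2 \<le> (cmod I)\<^sup>2 / h + (l2_norm ?M (u - (\<lambda>x. c)))\<^sup>2" by linarith
  with 1 show ?thesis by (simp add: I_def h_def power_divide)
qed

section \<open>Traces\<close>

lemma AE_tendsto_at_right_unique:
  fixes w w' :: "real \<Rightarrow> complex"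
  assumes "AE x in lebesgue. w x = w' x" "(w \<longlongrightarrow> l) (at_right y)" "(w' \<longlongrightarrow> l') (at_right y)"
  shows "l = l'"
proof (rule ccontr)
  assume "l \<noteq> l'"
  then have "\<forall>\<^sub>F x in at_right y. w x - w' x \<noteq> 0"
    using tendsto_diff[OF assms(2,3)] by (intro tendsto_imp_eventually_ne) auto
  then obtain b where b: "y < b" "\<And>x. y < x \<Longrightarrow> x < b \<Longrightarrow> w x \<noteq> w' x"
    by (auto simp: eventually_at_right_field)
  have "AE x in lebesgue. x \<notin> {y<..<b}"
    using assms(1) by eventually_elim (use b(2) in auto)
  then have "{y<..<b} \<in> null_sets lebesgue" by (simp add: AE_iff_null_sets)
  then show False using b(1) by (simp add: null_sets_def)
qed

lemma AE_tendsto_at_left_unique: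
  fixes w w' :: "real \<Rightarrow> complex"
  assumes "AE x in lebesgue. w x = w' x" "(w \<longlongrightarrow> l) (at_left y)" "(w' \<longlongrightarrow> l') (at_left y)"
  shows "l = l'"
proof (rule ccontr)
  assume "l \<noteq> l'"
  then have "\<forall>\<^sub>F x in at_left y. w x - w' x \<noteq> 0"
    using tendsto_diff[OF assms(2,3)] by (intro tendsto_imp_eventually_ne) auto
  then obtain b where b: "b < y" "\<And>x. b < x \<Longrightarrow> x < y \<Longrightarrow> w x \<noteq> w' x"
    by (auto simp: eventually_at_left_field)
  have "AE x in lebesgue. x \<notin> {b<..<y}"
    using assms(1) by eventually_elim (use b(2) in auto)
  then have "{b<..<y} \<in> null_sets lebesgue" by (simp add: AE_iff_null_sets)
  then show False using b(1) by (simp add: null_sets_def)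
qed

lemma trace_right_eq:
  assumes ab: "\<alpha> < \<beta>" and ae: "AE x in lebesgue_on {\<alpha><..<\<beta>}. u x = W x" and lim: "(W \<longlongrightarrow> l) (at_right \<alpha>)"
  shows "trace_right u \<alpha> = l"
proof -
  \<comment> \<open>The trace refers to representatives on the whole line; \<open>w\<close> is the
    one that agrees with \<open>W\<close> next to \<open>\<alpha>\<close> and with \<open>u\<close>
    elsewhere.\<close>
  define w where "w x = (if x \<in> {\<alpha><..<\<beta>} then W x else u x)" for x
  have 1: "AE x in lebesgue. w x = u x" using ae by (auto simp: AE_restrict_space_iff w_def)
  have "\<forall>\<^sub>F x in at_right \<alpha>. W x = w x"
    using ab by (auto simp: eventually_at_right_field w_def intro!: exI[of _ \<beta>])
  from Lim_transform_eventually[OF lim this] have 2: "(w \<longlongrightarrow> l) (at_right \<alpha>)" .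
  show ?thesis
    unfolding trace_right_def
  proof (rule the_equality)
    show "\<exists>w. (AE x in lebesgue. w x = u x) \<and> (w \<longlongrightarrow> l) (at_right \<alpha>)" using 1 2 by blast
    fix l' assume "\<exists>w. (AE x in lebesgue. w x = u x) \<and> (w \<longlongrightarrow> l') (at_right \<alpha>)"
    then obtain w' where w': "AE x in lebesgue. w' x = u x" "(w' \<longlongrightarrow> l') (at_right \<alpha>)" by blast
    have "AE x in lebesgue. w' x = w x" using w'(1) 1 by eventually_elim simp
    from AE_tendsto_at_right_unique[OF this w'(2) 2] show "l' = l" .
  qed
qed

lemma trace_left_eq:
  assumes ab: "\<alpha> < \<beta>" and ae: "AE x in lebesgue_on {\<alpha><..<\<beta>}. u x = W x" and lim: "(W \<longlongrightarrow> l) (at_left \<beta>)"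
  shows "trace_left u \<beta> = l"
proof -
  define w where "w x = (if x \<in> {\<alpha><..<\<beta>} then W x else u x)" for x
  have 1: "AE x in lebesgue. w x = u x" using ae by (auto simp: AE_restrict_space_iff w_def)
  have "\<forall>\<^sub>F x in at_left \<beta>. W x = w x"
    using ab by (auto simp: eventually_at_left_field w_def intro!: exI[of _ \<alpha>])
  from Lim_transform_eventually[OF lim this] have 2: "(w \<longlongrightarrow> l) (at_left \<beta>)" .
  show ?thesis
    unfolding trace_left_def
  proof (rule the_equality)
    show "\<exists>w. (AE x in lebesgue. w x = u x) \<and> (w \<longlongrightarrow> l) (at_left \<beta>)" using 1 2 by blast
    fix l' assume "\<exists>w. (AE x in lebesgue. w x = u x) \<and> (w \<longlongrightarrow> l') (at_left \<beta>)"
    then obtain w' where w': "AE x in lebesgue. w' x = u x" "(w' \<longlongrightarrow> l') (at_left \<beta>)" by blast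
    have "AE x in lebesgue. w' x = w x" using w'(1) 1 by eventually_elim simp
    from AE_tendsto_at_left_unique[OF this w'(2) 2] show "l' = l" .
  qed
qed

lemma represents_traces:
  assumes ab: "\<alpha> < \<beta>" and g: "g \<in> L2 (lebesgue_on {\<alpha><..<\<beta>})" and r: "represents \<alpha> \<beta> u g \<kappa>"
  shows "trace_right u \<alpha> = \<kappa> + prim \<alpha> g \<alpha>" "trace_left u \<beta> = \<kappa> + prim \<alpha> g \<beta>"
proof -
  have c: "continuous_on {\<alpha>..\<beta>} (\<lambda>x. \<kappa> + prim \<alpha> g x)"
    by (intro continuous_intros prim_continuous[OF g])
  have "((\<lambda>x. \<kappa> + prim \<alpha> g x) \<longlongrightarrow> \<kappa> + prim \<alpha> g \<alpha>) (at \<alpha> within {\<alpha>..\<beta>})"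
    using c ab by (auto simp: continuous_on)
  then have "((\<lambda>x. \<kappa> + prim \<alpha> g x) \<longlongrightarrow> \<kappa> + prim \<alpha> g \<alpha>) (at_right \<alpha>)"
    by (simp only: at_within_Icc_at_right[OF ab])
  then show "trace_right u \<alpha> = \<kappa> + prim \<alpha> g \<alpha>"
    by (rule trace_right_eq[OF ab r[unfolded represents_def]])
  have "((\<lambda>x. \<kappa> + prim \<alpha> g x) \<longlongrightarrow> \<kappa> + prim \<alpha> g \<beta>) (at \<beta> within {\<alpha>..\<beta>})"
    using c ab by (auto simp: continuous_on)
  then have "((\<lambda>x. \<kappa> + prim \<alpha> g x) \<longlongrightarrow> \<kappa> + prim \<alpha> g \<beta>) (at_left \<beta>)"
    by (simp only: at_within_Icc_at_left[OF ab])
  then show "trace_left u \<beta> = \<kappa> + prim \<alpha> g \<beta>"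
    by (rule trace_left_eq[OF ab r[unfolded represents_def]])
qed

section \<open>The form on a single interval\<close>

lemma borel_measurable_delete_point:
  fixes f :: "real \<Rightarrow> 'b::euclidean_space"
  assumes "S \<in> sets lebesgue"
  shows "f \<in> borel_measurable (lebesgue_on (S - {c})) \<longleftrightarrow> f \<in> borel_measurable (lebesgue_on S)"
proof -
  have "(\<lambda>x. if x \<in> S - {c} then f x else 0) \<in> borel_measurable lebesgue \<longleftrightarrow>
      (\<lambda>x. if x \<in> S then f x else 0) \<in> borel_measurable lebesgue"
  proof
    assume "(\<lambda>x. if x \<in> S - {c} then f x else 0) \<in> borel_measurable lebesgue"
    then show "(\<lambda>x. if x \<in> S then f x else 0) \<in> borel_measurable lebesgue"
      by (rule measurable_discrete_difference[where X = "{c}"]) auto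
  next
    assume "(\<lambda>x. if x \<in> S then f x else 0) \<in> borel_measurable lebesgue"
    then show "(\<lambda>x. if x \<in> S - {c} then f x else 0) \<in> borel_measurable lebesgue"
      by (rule measurable_discrete_difference[where X = "{c}"]) auto
  qed
  moreover have "S - {c} \<in> sets lebesgue" using assms by auto
  ultimately show ?thesis using assms by (simp only: borel_measurable_if)
qed

lemma integral_delete_point:
  fixes f :: "real \<Rightarrow> 'b::{banach, second_countable_topology}"
  assumes "S \<in> sets lebesgue"
  shows "integral\<^sup>L (lebesgue_on (S - {c})) f = integral\<^sup>L (lebesgue_on S) f"
    and "integrable (lebesgue_on (S - {c})) f \<longleftrightarrow> integrable (lebesgue_on S) f"
proof -
  have S': "S - {c} \<in> sets lebesgue" using assms by auto
  have *: "x \<noteq> c \<Longrightarrow> indicator (S - {c}) x *\<^sub>R f x = indicator S x *\<^sub>R f x" for x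
    by (simp add: indicator_def)
  have "(LINT x|lebesgue. indicator (S - {c}) x *\<^sub>R f x) = (LINT x|lebesgue. indicator S x *\<^sub>R f x)"
    by (rule integral_discrete_difference[where X = "{c}"]) (use * in \<open>auto simp: null_sets_def\<close>)
  then show "integral\<^sup>L (lebesgue_on (S - {c})) f = integral\<^sup>L (lebesgue_on S) f"
    using assms S' by (simp add: integral_restrict_space)
  have "integrable lebesgue (\<lambda>x. indicator (S - {c}) x *\<^sub>R f x) \<longleftrightarrow> integrable lebesgue (\<lambda>x. indicator S x *\<^sub>R f x)"
    by (rule integrable_discrete_difference[where X = "{c}"]) (use * in \<open>auto simp: null_sets_def\<close>)
  then show "integrable (lebesgue_on (S - {c})) f \<longleftrightarrow> integrable (lebesgue_on S) f"
    using assms S' by (simp add: integrable_restrict_space)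
qed

text \<open>The midpoint is a null set: removing it changes the class of test functions, and with it
  the weak derivative, but not the Hilbert space.\<close>

lemma L2_punctured: "L2 (lebesgue_on (punctured l r)) = L2 (lebesgue_on {l<..<r})"
  by (intro set_eqI)
    (simp add: L2_def punctured_def borel_measurable_delete_point integral_delete_point(2))

lemma l2_inner_punctured: "l2_inner (lebesgue_on (punctured l r)) = l2_inner (lebesgue_on {l<..<r})"
  using integral_delete_point(1)[of "{l<..<r}" "(l + r) / 2"]
  by (intro ext) (simp add: l2_inner_def punctured_def)

lemma represents_add:
  assumes "represents \<alpha> \<beta> u g \<kappa>" "represents \<alpha> \<beta> v h \<mu>"
    and gh: "g \<in> L2 (lebesgue_on {\<alpha><..<\<beta>})" "h \<in> L2 (lebesgue_on {\<alpha><..<\<beta>})"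
  shows "represents \<alpha> \<beta> (u + v) (g + h) (\<kappa> + \<mu>)"
proof -
  have "prim \<alpha> (g + h) x = prim \<alpha> g x + prim \<alpha> h x" if "x \<in> {\<alpha><..<\<beta>}" for x
  proof -
    have "integrable (lebesgue_on {\<alpha><..<x}) g" "integrable (lebesgue_on {\<alpha><..<x}) h"
      using that by (auto intro!: integrable_lebesgue_on_subset[OF L2_integrable_ivl[OF gh(1)]]
          integrable_lebesgue_on_subset[OF L2_integrable_ivl[OF gh(2)]])
    then show ?thesis by (simp add: prim_def)
  qed
  then have "AE x in lebesgue_on {\<alpha><..<\<beta>}. prim \<alpha> (g + h) x = prim \<alpha> g x + prim \<alpha> h x"
    by (intro AE_I2) simp
  with assms(1,2) show ?thesis unfolding represents_def by eventually_elim simp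
qed

lemma represents_scale:
  assumes "represents \<alpha> \<beta> u g \<kappa>"
  shows "represents \<alpha> \<beta> (cscale z u) (cscale z g) (z * \<kappa>)"
proof -
  have "prim \<alpha> (cscale z g) x = z * prim \<alpha> g x" for x by (simp add: prim_def)
  then show ?thesis
    using assms unfolding represents_def by (auto elim!: eventually_mono simp: distrib_left)
qed

text \<open>Linearity of \<open>T\<close> enters only after pairing with elements of
  \<open>W\<close>. The weak derivative, chosen among almost everywhere equal functions, is linear
  in exactly this sense.\<close>

lemma semi_inner_pullback:
  assumes "semi_inner W ip" and z: "0 \<in> V" and add: "\<And>u v. u \<in> V \<Longrightarrow> v \<in> V \<Longrightarrow> u + v \<in> V"
    and scale: "\<And>c u. u \<in> V \<Longrightarrow> cscale c u \<in> V"
    and T: "\<And>u. u \<in> V \<Longrightarrow> T u \<in> W"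
    and T_add: "\<And>u v w. u \<in> V \<Longrightarrow> v \<in> V \<Longrightarrow> w \<in> W \<Longrightarrow> ip (T (u + v)) w = ip (T u) w + ip (T v) w"
    and T_scale: "\<And>c u w. u \<in> V \<Longrightarrow> w \<in> W \<Longrightarrow> ip (T (cscale c u)) w = c * ip (T u) w"
  shows "semi_inner V (\<lambda>u v. ip (T u) (T v))"
proof -
  interpret semi_inner W ip by fact
  show ?thesis by unfold_locales (simp_all add: z add scale T T_add T_scale ip_cnj ip_pos)
qed

lemma integral_ivl_split_sum:
  fixes f :: "real \<Rightarrow> 'b::{banach, second_countable_topology}"
  assumes "0 \<le> h" "integrable (lebesgue_on {a<..<a + real n * h}) f"
  shows "integral\<^sup>L (lebesgue_on {a<..<a + real n * h}) f
    = (\<Sum>j<n. integral\<^sup>L (lebesgue_on {a + real j * h<..<a + real (Suc j) * h}) f)"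
  using assms(2)
proof (induction n)
  case (Suc n)
  have le: "a \<le> a + real n * h" "a + real n * h \<le> a + real (Suc n) * h"
    using assms(1) by (simp_all add: mult_right_mono)
  have "integrable (lebesgue_on {a<..<a + real n * h}) f"
    by (rule integrable_lebesgue_on_subset[OF Suc.prems]) (use le in auto)
  from Suc.IH[OF this] integral_ivl_split[OF Suc.prems le] show ?case by simp
qed simp

locale cell =
  fixes l r q :: real
  assumes lr: "l < r" and q: "0 < q"
begin

abbreviation "\<Omega> \<equiv> punctured l r"
abbreviation "M \<equiv> lebesgue_on {l<..<r}"
abbreviation "c \<equiv> (l + r) / 2"
abbreviation "d \<equiv> r - l"
abbreviation "wd \<equiv> weak_deriv \<Omega>"
abbreviation "N u \<equiv> l2_norm M u"

lemma lcr: "l < c" "c < r" "0 < d" "c - l = d / 2" "r - c = d / 2"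
  using lr by (auto simp: field_simps)

lemma halves_subset: "{l<..<c} \<subseteq> \<Omega>" "{c<..<r} \<subseteq> \<Omega>" "\<Omega> \<subseteq> {l<..<r}" "{l<..<c} \<subseteq> {l<..<r}" "{c<..<r} \<subseteq> {l<..<r}"
  using lr by (auto simp: punctured_def field_simps)

lemma \<Omega>_sets [simp]: "\<Omega> \<in> sets lebesgue"
  by (auto simp: punctured_def)

sublocale L: semi_hilbert "L2 M" "l2_inner M"
  by (rule semi_hilbert_L2)

lemma L_nrm [simp]: "L.nrm u = N u"
  by (rule nrm_L2)

lemma L2_half:
  assumes "u \<in> L2 M" shows "u \<in> L2 (lebesgue_on {l<..<c})" "u \<in> L2 (lebesgue_on {c<..<r})"
  using assms halves_subset by (auto intro!: L2_lebesgue_on_subset[of u "{l<..<r}"])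

lemma integral_halves:
  fixes f :: "real \<Rightarrow> 'b::{banach, second_countable_topology}"
  assumes "integrable M f"
  shows "integral\<^sup>L M f = integral\<^sup>L (lebesgue_on {l<..<c}) f + integral\<^sup>L (lebesgue_on {c<..<r}) f"
  using assms lcr(1,2) by (intro integral_ivl_split) auto

lemma AE_halves:
  assumes "AE x in lebesgue_on {l<..<c}. P x" "AE x in lebesgue_on {c<..<r}. P x"
  shows "AE x in M. P x"
proof -
  have "AE x in lebesgue. x \<noteq> c" by (intro AE_completion AE_lborel_singleton)
  moreover have "AE x in lebesgue. x \<in> {l<..<c} \<longrightarrow> P x" "AE x in lebesgue. x \<in> {c<..<r} \<longrightarrow> P x"
    using assms by (simp_all add: AE_restrict_space_iff)
  ultimately have "AE x in lebesgue. x \<in> {l<..<r} \<longrightarrow> P x"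
    by eventually_elim (auto simp: linorder_neq_iff)
  then show ?thesis by (simp add: AE_restrict_space_iff)
qed

section \<open>The Sobolev space of a punctured interval\<close>

lemma H1_D:
  assumes "u \<in> H1 \<Omega>"
  shows H1_L2: "u \<in> L2 M" and wd_L2: "wd u \<in> L2 M" and wd_weak: "is_weak_deriv \<Omega> u (wd u)"
proof -
  show "u \<in> L2 M" using assms by (simp add: H1_def L2_punctured)
  have "\<exists>g. g \<in> L2 (lebesgue_on \<Omega>) \<and> is_weak_deriv \<Omega> u g" using assms by (auto simp: H1_def)
  from someI_ex[OF this] show "wd u \<in> L2 M" "is_weak_deriv \<Omega> u (wd u)"
    by (simp_all add: weak_deriv_def L2_punctured)
qed

lemma H1_I: "u \<in> L2 M \<Longrightarrow> g \<in> L2 M \<Longrightarrow> is_weak_deriv \<Omega> u g \<Longrightarrow> u \<in> H1 \<Omega>"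
  by (auto simp: H1_def L2_punctured)

lemma L2_integrable_\<Omega>: "u \<in> L2 M \<Longrightarrow> integrable (lebesgue_on \<Omega>) u"
  by (rule integrable_lebesgue_on_subset[OF L2_integrable_ivl]) (use halves_subset in auto)

lemma weak_deriv_unique:
  assumes u: "u \<in> L2 M" and gh: "g \<in> L2 M" "h \<in> L2 M" and d: "is_weak_deriv \<Omega> u g" "is_weak_deriv \<Omega> u h"
  shows "AE x in M. g x = h x"
proof (rule AE_halves)
  show "AE x in lebesgue_on {l<..<c}. g x = h x"
    by (rule weak_deriv_unique_ivl[of l c u]) (use lcr(1,2) L2_half u gh d halves_subset in \<open>auto intro!: weak_deriv_subset[of \<Omega>]\<close>)
  show "AE x in lebesgue_on {c<..<r}. g x = h x"
    by (rule weak_deriv_unique_ivl[of c r u]) (use lcr(1,2) L2_half u gh d halves_subset in \<open>auto intro!: weak_deriv_subset[of \<Omega>]\<close>)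
qed

lemma wd_eq:
  assumes "u \<in> L2 M" "g \<in> L2 M" "is_weak_deriv \<Omega> u g"
  shows "AE x in M. wd u x = g x"
  using weak_deriv_unique[of u "wd u" g] H1_I[OF assms] assms wd_L2 wd_weak by blast

lemma wd_eq_nrm:
  assumes "u \<in> L2 M" "g \<in> L2 M" "is_weak_deriv \<Omega> u g"
  shows "L.nrm (wd u - g) = 0"
proof -
  have "AE x in M. (wd u - g) x = 0" using wd_eq[OF assms] by eventually_elim simp
  moreover have "wd u \<in> L2 M" using H1_I[OF assms] by (rule wd_L2)
  ultimately show ?thesis using l2_norm_eq_0_iff[of "wd u - g" M] assms(2) by simp
qed

lemma H1_zero: "0 \<in> H1 \<Omega>"
  by (rule H1_I[of 0 0]) (simp_all add: is_weak_deriv_def)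

lemma H1_add_weak:
  "u \<in> H1 \<Omega> \<Longrightarrow> v \<in> H1 \<Omega> \<Longrightarrow> is_weak_deriv \<Omega> (u + v) (wd u + wd v)"
  by (intro weak_deriv_add wd_weak L2_integrable_\<Omega> H1_L2 wd_L2)

lemma H1_scale_weak: "u \<in> H1 \<Omega> \<Longrightarrow> is_weak_deriv \<Omega> (cscale z u) (cscale z (wd u))"
  by (intro weak_deriv_scale wd_weak)

lemma H1_add: "u \<in> H1 \<Omega> \<Longrightarrow> v \<in> H1 \<Omega> \<Longrightarrow> u + v \<in> H1 \<Omega>"
  by (rule H1_I[of "u + v" "wd u + wd v"]) (simp_all add: H1_L2 wd_L2 H1_add_weak)

lemma H1_scale: "u \<in> H1 \<Omega> \<Longrightarrow> cscale z u \<in> H1 \<Omega>"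
  by (rule H1_I[of _ "cscale z (wd u)"]) (simp_all add: H1_L2 wd_L2 H1_scale_weak)

lemma wd_add: "u \<in> H1 \<Omega> \<Longrightarrow> v \<in> H1 \<Omega> \<Longrightarrow> L.nrm (wd (u + v) - (wd u + wd v)) = 0"
  by (rule wd_eq_nrm) (auto simp: H1_L2 wd_L2 H1_add_weak)

lemma wd_scale: "u \<in> H1 \<Omega> \<Longrightarrow> L.nrm (wd (cscale z u) - cscale z (wd u)) = 0"
  by (rule wd_eq_nrm) (auto simp: H1_L2 wd_L2 H1_scale_weak)

lemma semi_inner_wd: "semi_inner (H1 \<Omega>) (\<lambda>u v. l2_inner M (wd u) (wd v))"
proof (rule semi_inner_pullback[OF L.semi_inner_axioms])
  show "l2_inner M (wd (u + v)) w = l2_inner M (wd u) w + l2_inner M (wd v) w"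
    if "u \<in> H1 \<Omega>" "v \<in> H1 \<Omega>" "w \<in> L2 M" for u v w
    using L.ip_cong[OF _ _ that(3) wd_add[OF that(1,2)]] that by (simp add: wd_L2 H1_add L.ip_add)
  show "l2_inner M (wd (cscale z u)) w = z * l2_inner M (wd u) w"
    if "u \<in> H1 \<Omega>" "w \<in> L2 M" for z u w
    using L.ip_cong[OF _ _ that(2) wd_scale[OF that(1)]] that by (simp add: wd_L2 H1_scale L.ip_scale)
qed (auto simp: H1_zero H1_add H1_scale wd_L2)

lemma represents_halves:
  assumes u: "u \<in> L2 M" and g: "g \<in> L2 M" and d: "is_weak_deriv \<Omega> u g"
  obtains \<kappa> \<mu> where "represents l c u g \<kappa>" "represents c r u g \<mu>"
proof -
  have "is_weak_deriv {l<..<c} u g" "is_weak_deriv {c<..<r} u g"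
    using halves_subset by (auto intro!: weak_deriv_subset[OF d])
  then show ?thesis
    using weak_deriv_represents[OF lcr(1) L2_half(1)[OF u] L2_half(1)[OF g]]
      weak_deriv_represents[OF lcr(2) L2_half(2)[OF u] L2_half(2)[OF g]] that by metis
qed

section \<open>Traces and jumps of functions on a cell\<close>

definition traces :: "(real \<Rightarrow> complex) \<Rightarrow> complex set" where
  "traces u = {trace_right u l, trace_left u c, trace_right u c, trace_left u r}"

lemma trace_add:
  assumes u: "u \<in> H1 \<Omega>" and v: "v \<in> H1 \<Omega>"
  shows "trace_right (u + v) l = trace_right u l + trace_right v l"
    "trace_left (u + v) c = trace_left u c + trace_left v c"
    "trace_right (u + v) c = trace_right u c + trace_right v c"
    "trace_left (u + v) r = trace_left u r + trace_left v r"
proof -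
  have G: "wd u \<in> L2 M" "wd v \<in> L2 M" using u v by (auto intro: wd_L2)
  obtain \<kappa> \<mu> where 1: "represents l c u (wd u) \<kappa>" "represents c r u (wd u) \<mu>"
    using represents_halves[OF H1_L2[OF u] wd_L2[OF u] wd_weak[OF u]] by blast
  obtain \<kappa>' \<mu>' where 2: "represents l c v (wd v) \<kappa>'" "represents c r v (wd v) \<mu>'"
    using represents_halves[OF H1_L2[OF v] wd_L2[OF v] wd_weak[OF v]] by blast
  have Gs: "wd u + wd v \<in> L2 M" using G by simp
  have p: "prim a (wd u + wd v) x = prim a (wd u) x + prim a (wd v) x" if "{a<..<x} \<subseteq> {l<..<r}" for a x
  proof -
    have "integrable (lebesgue_on {a<..<x}) (wd u)" "integrable (lebesgue_on {a<..<x}) (wd v)"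
      using that by (auto intro!: integrable_lebesgue_on_subset[OF L2_integrable_ivl[OF G(1)]]
          integrable_lebesgue_on_subset[OF L2_integrable_ivl[OF G(2)]])
    then show ?thesis by (simp add: prim_def)
  qed
  have sub: "{l<..<l} \<subseteq> {l<..<r}" "{c<..<c} \<subseteq> {l<..<r}" by auto
  note pp = p[OF sub(1)] p[OF sub(2)] p[OF halves_subset(4)] p[OF halves_subset(5)]
  note r1 = represents_traces[OF lcr(1) L2_half(1)[OF G(1)] 1(1)] represents_traces[OF lcr(2) L2_half(2)[OF G(1)] 1(2)]
  note r2 = represents_traces[OF lcr(1) L2_half(1)[OF G(2)] 2(1)] represents_traces[OF lcr(2) L2_half(2)[OF G(2)] 2(2)]
  note r3 = represents_traces[OF lcr(1) L2_half(1)[OF Gs] represents_add[OF 1(1) 2(1) L2_half(1)[OF G(1)] L2_half(1)[OF G(2)]]]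
    represents_traces[OF lcr(2) L2_half(2)[OF Gs] represents_add[OF 1(2) 2(2) L2_half(2)[OF G(1)] L2_half(2)[OF G(2)]]]
  show "trace_right (u + v) l = trace_right u l + trace_right v l"
    "trace_left (u + v) c = trace_left u c + trace_left v c"
    "trace_right (u + v) c = trace_right u c + trace_right v c"
    "trace_left (u + v) r = trace_left u r + trace_left v r"
    unfolding r1 r2 r3 pp by (simp_all only: add_ac)
qed

lemma trace_scale:
  assumes u: "u \<in> H1 \<Omega>"
  shows "trace_right (cscale z u) l = z * trace_right u l" "trace_left (cscale z u) c = z * trace_left u c"
    "trace_right (cscale z u) c = z * trace_right u c" "trace_left (cscale z u) r = z * trace_left u r"
proof -
  have G: "wd u \<in> L2 M" using u by (auto intro: wd_L2)
  obtain \<kappa> \<mu> where 1: "represents l c u (wd u) \<kappa>" "represents c r u (wd u) \<mu>"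
    using represents_halves[OF H1_L2[OF u] wd_L2[OF u] wd_weak[OF u]] by blast
  have Gs: "cscale z (wd u) \<in> L2 M" using G by simp
  have p: "prim a (cscale z (wd u)) x = z * prim a (wd u) x" for a x by (simp add: prim_def)
  note r1 = represents_traces[OF lcr(1) L2_half(1)[OF G] 1(1)] represents_traces[OF lcr(2) L2_half(2)[OF G] 1(2)]
  note r3 = represents_traces[OF lcr(1) L2_half(1)[OF Gs] represents_scale[OF 1(1)]]
    represents_traces[OF lcr(2) L2_half(2)[OF Gs] represents_scale[OF 1(2)]]
  show "trace_right (cscale z u) l = z * trace_right u l" "trace_left (cscale z u) c = z * trace_left u c"
    "trace_right (cscale z u) c = z * trace_right u c" "trace_left (cscale z u) r = z * trace_left u r"
    unfolding r1 r3 p by (simp_all only: distrib_left)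
qed

text \<open>The pointwise bound on the half of length \<open>d / 2\<close> that carries the trace
  has the factors \<open>2 / (d / 2) = 4 / d\<close> and \<open>2 * (d / 2) = d\<close>; enlarging
  both norms to the whole cell makes the bound uniform in the four traces.\<close>

lemma trace_bound:
  assumes u: "u \<in> H1 \<Omega>" and t: "t \<in> traces u"
  shows "(cmod t)\<^sup>2 \<le> 4 / d * (N u)\<^sup>2 + d * (N (wd u))\<^sup>2"
proof -
  have uL: "u \<in> L2 M" and G: "wd u \<in> L2 M" using u by (auto intro: wd_L2 H1_L2)
  obtain \<kappa> \<mu> where 1: "represents l c u (wd u) \<kappa>" "represents c r u (wd u) \<mu>"
    using represents_halves[OF uL G wd_weak[OF u]] by blast
  note r1 = represents_traces[OF lcr(1) L2_half(1)[OF G] 1(1)] represents_traces[OF lcr(2) L2_half(2)[OF G] 1(2)]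
  have nn: "2 / (d / 2) * A + 2 * (d / 2) * B \<le> 4 / d * A' + d * B'" if "A \<le> A'" "B \<le> B'" for A B A' B'
  proof -
    have e: "2 / (d / 2) = 4 / d" "2 * (d / 2) = d" by simp_all
    show ?thesis
      unfolding e using that lr by (intro add_mono mult_left_mono) simp_all
  qed
  have left: "(cmod (\<kappa> + prim l (wd u) y))\<^sup>2 \<le> 4 / d * (N u)\<^sup>2 + d * (N (wd u))\<^sup>2" if "y \<in> {l..c}" for y
    using represents_pointwise_bound[OF lcr(1) L2_half(1)[OF uL] L2_half(1)[OF G] 1(1) that]
      nn[OF l2_norm_subset[OF uL halves_subset(4)] l2_norm_subset[OF G halves_subset(4)]]
    unfolding lcr(4) by simp
  have right: "(cmod (\<mu> + prim c (wd u) y))\<^sup>2 \<le> 4 / d * (N u)\<^sup>2 + d * (N (wd u))\<^sup>2" if "y \<in> {c..r}" for y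
    using represents_pointwise_bound[OF lcr(2) L2_half(2)[OF uL] L2_half(2)[OF G] 1(2) that]
      nn[OF l2_norm_subset[OF uL halves_subset(5)] l2_norm_subset[OF G halves_subset(5)]]
    unfolding lcr(5) by simp
  have "l \<in> {l..c}" "c \<in> {l..c}" "c \<in> {c..r}" "r \<in> {c..r}" using lcr(1,2) by auto
  then show ?thesis using t left right unfolding traces_def r1 by blast
qed

lemma trace_jump_add: "u \<in> H1 \<Omega> \<Longrightarrow> v \<in> H1 \<Omega> \<Longrightarrow> trace_jump (u + v) c = trace_jump u c + trace_jump v c"
  by (simp add: trace_jump_def trace_add)

lemma trace_jump_scale: "u \<in> H1 \<Omega> \<Longrightarrow> trace_jump (cscale z u) c = z * trace_jump u c"
  by (simp add: trace_jump_def trace_scale right_diff_distrib)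

lemma trace_jump_bound:
  assumes "u \<in> H1 \<Omega>"
  shows "(cmod (trace_jump u c))\<^sup>2 \<le> 4 * (4 / d * (N u)\<^sup>2 + d * (N (wd u))\<^sup>2)"
proof -
  have "cmod (trace_jump u c) \<le> cmod (trace_right u c) + cmod (trace_left u c)"
    unfolding trace_jump_def by (rule norm_triangle_ineq4)
  then have "(cmod (trace_jump u c))\<^sup>2 \<le> (cmod (trace_right u c) + cmod (trace_left u c))\<^sup>2"
    by (rule power_mono) simp
  also have "\<dots> \<le> 2 * (cmod (trace_right u c))\<^sup>2 + 2 * (cmod (trace_left u c))\<^sup>2"
    using sum_squares_bound[of "cmod (trace_right u c)" "cmod (trace_left u c)"] by (simp add: power2_sum)
  finally show ?thesis
    using trace_bound[OF assms, of "trace_right u c"] trace_bound[OF assms, of "trace_left u c"]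
    by (simp add: traces_def)
qed

section \<open>The cell form and its locality\<close>

abbreviation "form \<equiv> cell_form q l r"

lemma form_eq: "form u v = l2_inner M (wd u) (wd v) + complex_of_real (1 / q) * (trace_jump u c * cnj (trace_jump v c))"
  using l2_inner_punctured[of l r] by (simp add: cell_form_def l2_inner_def fun_eq_iff)

lemma semi_inner_form: "semi_inner (H1 \<Omega>) form"
proof -
  have "semi_inner (H1 \<Omega>) (\<lambda>u v. trace_jump u c * cnj (trace_jump v c))"
    by unfold_locales (auto simp: H1_zero H1_add H1_scale trace_jump_add trace_jump_scale algebra_simps)
  then have "semi_inner (H1 \<Omega>) (\<lambda>u v. complex_of_real (1 / q) * (trace_jump u c * cnj (trace_jump v c)))"
    by (rule semi_inner_scale) (use q in simp)
  from semi_inner_add[OF semi_inner_wd this] show ?thesis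
    by (simp only: form_eq[abs_def])
qed

sublocale F: semi_inner "H1 \<Omega>" form
  by (rule semi_inner_form)

lemma form_self: "Re (form u u) = (N (wd u))\<^sup>2 + (cmod (trace_jump u c))\<^sup>2 / q"
proof -
  have "form u u = complex_of_real ((N (wd u))\<^sup>2 + (cmod (trace_jump u c))\<^sup>2 / q)"
    unfolding form_eq l2_inner_self l2_norm_power2 by (simp add: complex_norm_square[symmetric] del: of_real_power)
  then show ?thesis by simp
qed

lemma wd_le_form: "(N (wd u))\<^sup>2 \<le> Re (form u u)"
  using q by (simp add: form_self)

text \<open>The jump term is controlled by the trace inequality, so the form norm of a cell is
  equivalent to its Sobolev norm; the constants depend on the cell.\<close>

lemma form_le:
  assumes "u \<in> H1 \<Omega>"
  shows "Re (form u u) \<le> (1 + 4 * d / q) * (N (wd u))\<^sup>2 + 16 / (d * q) * (N u)\<^sup>2"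
proof -
  have "(cmod (trace_jump u c))\<^sup>2 / q \<le> 4 * (4 / d * (N u)\<^sup>2 + d * (N (wd u))\<^sup>2) / q"
    using trace_jump_bound[OF assms] q by (intro divide_right_mono) auto
  also have "\<dots> = 16 / (d * q) * (N u)\<^sup>2 + 4 * d / q * (N (wd u))\<^sup>2"
    using lcr(3) q by (simp add: field_simps)
  finally show ?thesis by (simp add: form_self algebra_simps)
qed

text \<open>Locality, which allows glued functions to be treated cell by cell. The derivatives are
  equal and not only almost everywhere equal, since both are chosen from the same set.\<close>

lemma H1_cong:
  assumes "\<And>x. x \<in> {l<..<r} \<Longrightarrow> u x = v x"
  shows "u \<in> H1 \<Omega> \<longleftrightarrow> v \<in> H1 \<Omega>" "wd u = wd v"
proof -
  have w: "is_weak_deriv \<Omega> u g \<longleftrightarrow> is_weak_deriv \<Omega> v g" for g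
  proof -
    have "(LINT x|lebesgue_on \<Omega>. deriv \<phi> x *\<^sub>R u x) = (LINT x|lebesgue_on \<Omega>. deriv \<phi> x *\<^sub>R v x)" for \<phi>
      using assms halves_subset(3) by (intro Bochner_Integration.integral_cong) auto
    then show ?thesis by (simp add: is_weak_deriv_def)
  qed
  have "u \<in> L2 M \<longleftrightarrow> v \<in> L2 M"
    unfolding L2_def using assms measurable_lebesgue_cong[of "{l<..<r}" u v]
      Bochner_Integration.integrable_cong[of M M "\<lambda>x. (cmod (u x))\<^sup>2" "\<lambda>x. (cmod (v x))\<^sup>2"] by simp
  then show "u \<in> H1 \<Omega> \<longleftrightarrow> v \<in> H1 \<Omega>" by (simp add: H1_def L2_punctured w)
  show "wd u = wd v" by (simp add: weak_deriv_def w)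
qed

lemma trace_cong:
  assumes uv: "\<And>x. x \<in> {l<..<r} \<Longrightarrow> u x = v x" and u: "u \<in> H1 \<Omega>"
  shows "trace_right u l = trace_right v l" "trace_left u c = trace_left v c"
    "trace_right u c = trace_right v c" "trace_left u r = trace_left v r"
proof -
  have G: "wd u \<in> L2 M" using u by (rule wd_L2)
  obtain \<kappa> \<mu> where 1: "represents l c u (wd u) \<kappa>" "represents c r u (wd u) \<mu>"
    using represents_halves[OF H1_L2[OF u] wd_L2[OF u] wd_weak[OF u]] by blast
  have 2: "represents l c v (wd u) \<kappa>"
    using 1(1) unfolding represents_def by (rule lebesgue_on_mono) (use uv halves_subset in auto)
  have 3: "represents c r v (wd u) \<mu>"
    using 1(2) unfolding represents_def by (rule lebesgue_on_mono) (use uv halves_subset in auto)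
  note r1 = represents_traces[OF lcr(1) L2_half(1)[OF G] 1(1)] represents_traces[OF lcr(2) L2_half(2)[OF G] 1(2)]
  note r2 = represents_traces[OF lcr(1) L2_half(1)[OF G] 2] represents_traces[OF lcr(2) L2_half(2)[OF G] 3]
  show "trace_right u l = trace_right v l" "trace_left u c = trace_left v c"
    "trace_right u c = trace_right v c" "trace_left u r = trace_left v r"
    unfolding r1 r2 by simp_all
qed

lemma form_cong:
  assumes "\<And>x. x \<in> {l<..<r} \<Longrightarrow> u x = u' x" "\<And>x. x \<in> {l<..<r} \<Longrightarrow> v x = v' x" "u \<in> H1 \<Omega>" "v \<in> H1 \<Omega>"
  shows "form u v = form u' v'"
  using trace_cong[OF assms(1,3)] trace_cong[OF assms(2,4)] H1_cong(2)[OF assms(1)] H1_cong(2)[OF assms(2)]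
  by (simp add: form_eq trace_jump_def)

lemma const_H1: "(\<lambda>x. 1) \<in> H1 \<Omega>" and form_const: "v \<in> H1 \<Omega> \<Longrightarrow> form (\<lambda>x. 1) v = 0"
proof -
  have w: "is_weak_deriv \<Omega> (\<lambda>x. 1) 0"
    unfolding is_weak_deriv_def
  proof
    fix \<phi> assume \<phi>: "\<phi> \<in> test_functions \<Omega>"
    have i: "integrable M (\<lambda>x. deriv \<phi> x *\<^sub>R (1::complex))"
      by (rule test_mult_integrable(2)[OF integrable_const_ivl' \<phi>])
    have half: "(LINT x|lebesgue_on {a<..<b}. deriv \<phi> x *\<^sub>R (1::complex)) = complex_of_real (\<phi> b - \<phi> a)" if "a \<le> b" for a b
    proof -
      have "(LINT x|lebesgue_on {a<..<b}. deriv \<phi> x *\<^sub>R (1::complex)) = (LINT x|lebesgue_on {a<..<b}. complex_of_real (deriv \<phi> x))"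
        by (simp add: scaleR_conv_of_real)
      also have "\<dots> = complex_of_real (LINT x|lebesgue_on {a<..<b}. deriv \<phi> x)"
        by (rule integral_complex_of_real)
      also have "\<dots> = complex_of_real (\<phi> b - \<phi> a)"
        by (subst FTC_lebesgue_on[OF that test_deriv[OF \<phi>] test_deriv_cont[OF \<phi>]]) simp
      finally show ?thesis .
    qed
    have "(LINT x|lebesgue_on \<Omega>. deriv \<phi> x *\<^sub>R (1::complex)) = (LINT x|M. deriv \<phi> x *\<^sub>R (1::complex))"
      unfolding punctured_def by (rule integral_delete_point) simp
    \<comment> \<open>A test function on the punctured interval vanishes at \<open>l\<close>, at the
      midpoint and at \<open>r\<close>, so the integral of its derivative over each half is
      zero.\<close>
    also have "\<dots> = 0"
      unfolding integral_halves[OF i] half[OF less_imp_le[OF lcr(1)]] half[OF less_imp_le[OF lcr(2)]]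
      using test_zero[OF \<phi>, of l] test_zero[OF \<phi>, of c] test_zero[OF \<phi>, of r] by (simp add: punctured_def)
    finally show "(LINT x|lebesgue_on \<Omega>. deriv \<phi> x *\<^sub>R (1::complex)) = - (LINT x|lebesgue_on \<Omega>. \<phi> x *\<^sub>R 0 x)" by simp
  qed
  show "(\<lambda>x. 1) \<in> H1 \<Omega>" by (rule H1_I[OF const_L2 _ w]) simp
  have "L.nrm (wd (\<lambda>x. 1) - 0) = 0" by (rule wd_eq_nrm[OF const_L2 _ w]) simp
  then have "l2_inner M (wd (\<lambda>x. 1)) u = 0" if "u \<in> L2 M" for u
    using L.ip_cong[of "wd (\<lambda>x. 1)" 0 u] wd_L2[OF \<open>(\<lambda>x. 1) \<in> H1 \<Omega>\<close>] that by simp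
  moreover have "trace_jump (\<lambda>x. 1) c = 0"
  proof -
    have "trace_right (\<lambda>x. 1) c = 1" by (rule trace_right_eq[of c r _ "\<lambda>x. 1"]) (use lcr(1,2) in auto)
    moreover have "trace_left (\<lambda>x. 1) c = 1" by (rule trace_left_eq[of l c _ "\<lambda>x. 1"]) (use lcr(1,2) in auto)
    ultimately show ?thesis by (simp add: trace_jump_def)
  qed
  ultimately show "form (\<lambda>x. 1) v = 0" if "v \<in> H1 \<Omega>" for v
    using that by (simp add: form_eq wd_L2)
qed

text \<open>Closedness of the weak derivative: both sides of its defining identity are inner
  products with a fixed function and pass to the limit.\<close>

lemma H1_closed:
  assumes f: "\<And>n. f n \<in> H1 \<Omega>" and u: "u \<in> L2 M" and lim: "(\<lambda>n. N (f n - u)) \<longlonglongrightarrow> 0"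
    and cau: "\<And>e. 0 < e \<Longrightarrow> \<exists>K. \<forall>m\<ge>K. \<forall>n\<ge>K. N (wd (f m - f n)) < e"
  shows "u \<in> H1 \<Omega>" "(\<lambda>n. N (wd (f n - u))) \<longlonglongrightarrow> 0"
proof -
  interpret W: semi_inner "H1 \<Omega>" "\<lambda>u v. l2_inner M (wd u) (wd v)" by (rule semi_inner_wd)
  have diff: "N (wd (x - y)) = N (wd x - wd y)" if "x \<in> H1 \<Omega>" "y \<in> H1 \<Omega>" for x y
  proof -
    have "is_weak_deriv \<Omega> (x - y) (wd x - wd y)"
      using that by (intro weak_deriv_diff wd_weak L2_integrable_\<Omega> H1_L2 wd_L2)
    then have "L.nrm (wd (x - y) - (wd x - wd y)) = 0"
      using that by (intro wd_eq_nrm) (simp_all add: H1_L2 wd_L2)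
    then show ?thesis
      using L.nrm_cong[of "wd (x - y)" "wd x - wd y"] that by (simp add: wd_L2)
  qed
  have "L.cauchy_seq (\<lambda>n. wd (f n))"
    unfolding L.cauchy_seq_def using cau diff[OF f f] by simp
  then obtain g where g: "g \<in> L2 M" "(\<lambda>n. L.nrm (wd (f n) - g)) \<longlonglongrightarrow> 0"
    using L.complete[of "\<lambda>n. wd (f n)"] f wd_L2 by blast
  have w: "is_weak_deriv \<Omega> u g"
    unfolding is_weak_deriv_def
  proof
    fix \<phi> assume \<phi>: "\<phi> \<in> test_functions \<Omega>"
    have eq: "(LINT x|lebesgue_on \<Omega>. \<psi> x *\<^sub>R v x) = l2_inner M v (\<lambda>x. complex_of_real (\<psi> x))" for \<psi> v
    proof -
      have "(LINT x|lebesgue_on \<Omega>. \<psi> x *\<^sub>R v x) = (LINT x|M. \<psi> x *\<^sub>R v x)"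
        unfolding punctured_def by (rule integral_delete_point) simp
      then show ?thesis by (simp add: l2_inner_def scaleR_conv_of_real mult.commute)
    qed
    have P: "(\<lambda>x. complex_of_real (\<phi> x)) \<in> L2 M" "(\<lambda>x. complex_of_real (deriv \<phi> x)) \<in> L2 M"
      using continuous_on_subset[OF test_cont[OF \<phi>], of "{l..r}"] continuous_on_subset[OF test_deriv_cont[OF \<phi>], of "{l..r}"]
      by (auto intro!: continuous_L2_ivl continuous_intros)
    have 1: "(\<lambda>n. l2_inner M (f n) (\<lambda>x. complex_of_real (deriv \<phi> x))) \<longlonglongrightarrow> l2_inner M u (\<lambda>x. complex_of_real (deriv \<phi> x))"
      using lim by (intro L.tendsto_ip P u) (simp_all add: H1_L2 f)
    have 2: "(\<lambda>n. l2_inner M (wd (f n)) (\<lambda>x. complex_of_real (\<phi> x))) \<longlonglongrightarrow> l2_inner M g (\<lambda>x. complex_of_real (\<phi> x))"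
      using g by (intro L.tendsto_ip P) (simp_all add: wd_L2 f)
    have "l2_inner M (f n) (\<lambda>x. complex_of_real (deriv \<phi> x)) = - l2_inner M (wd (f n)) (\<lambda>x. complex_of_real (\<phi> x))" for n
      using wd_weak[OF f[of n]] \<phi> unfolding is_weak_deriv_def eq by blast
    then have "(\<lambda>n. - l2_inner M (wd (f n)) (\<lambda>x. complex_of_real (\<phi> x))) \<longlonglongrightarrow> l2_inner M u (\<lambda>x. complex_of_real (deriv \<phi> x))"
      using 1 by simp
    from LIMSEQ_unique[OF this tendsto_minus[OF 2]]
    show "(LINT x|lebesgue_on \<Omega>. deriv \<phi> x *\<^sub>R u x) = - (LINT x|lebesgue_on \<Omega>. \<phi> x *\<^sub>R g x)"
      unfolding eq .
  qed
  show uH: "u \<in> H1 \<Omega>" by (rule H1_I[OF u g(1) w])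
  have "N (wd (f n - u)) = L.nrm (wd (f n) - g)" for n
  proof -
    have "is_weak_deriv \<Omega> (f n - u) (wd (f n) - g)"
      by (intro weak_deriv_diff wd_weak L2_integrable_\<Omega> w u g(1) H1_L2[OF f] wd_L2[OF f] f)
    then have "L.nrm (wd (f n - u) - (wd (f n) - g)) = 0"
      using f u g by (intro wd_eq_nrm) (simp_all add: H1_L2 wd_L2)
    then show ?thesis
      using L.nrm_cong[of "wd (f n - u)" "wd (f n) - g"] f uH g by (simp add: wd_L2)
  qed
  then show "(\<lambda>n. N (wd (f n - u))) \<longlonglongrightarrow> 0" using g(2) by simp
qed

section \<open>Poincare inequalities and the low eigenvalues of a cell\<close>

lemma poincare_pieces:
  assumes u: "u \<in> H1 \<Omega>" and m: "0 < m" and h: "h = d / (2 * real m)"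
  shows "(N u)\<^sup>2 \<le> (\<Sum>j<2 * m. (cmod (LINT x|lebesgue_on {l + real j * h<..<l + real (Suc j) * h}. u x))\<^sup>2) / h
    + h\<^sup>2 / 4 * (N (wd u))\<^sup>2"
proof -
  have uL: "u \<in> L2 M" and G: "wd u \<in> L2 M" using u by (auto intro: wd_L2 H1_L2)
  have h0: "0 < h" using m lcr(3) by (simp add: h)
  have end_eq: "l + real (2 * m) * h = r" using m by (simp add: h)
  \<comment> \<open>With an even number \<open>2 * m\<close> of pieces the midpoint is a division
    point, so no piece contains the jump.\<close>
  have mid_eq: "l + real m * h = c" using m by (simp add: h field_simps)
  let ?P = "\<lambda>j. {l + real j * h<..<l + real (Suc j) * h}"
  have sum: "(N v)\<^sup>2 = (\<Sum>j<2 * m. (l2_norm (lebesgue_on (?P j)) v)\<^sup>2)" if "v \<in> L2 M" for v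
    using integral_ivl_split_sum[of h l "2 * m" "\<lambda>x. (cmod (v x))\<^sup>2"] L2_integrable[OF that] h0
    unfolding l2_norm_power2 end_eq by simp
  obtain \<kappa> \<mu> where 1: "represents l c u (wd u) \<kappa>" "represents c r u (wd u) \<mu>"
    using represents_halves[OF uL G wd_weak[OF u]] by blast
  have piece: "(l2_norm (lebesgue_on (?P j)) u)\<^sup>2 \<le> (cmod (LINT x|lebesgue_on (?P j). u x))\<^sup>2 / h
      + h\<^sup>2 / 4 * (l2_norm (lebesgue_on (?P j)) (wd u))\<^sup>2" if j: "j < 2 * m" for j
  proof -
    have len: "l + real (Suc j) * h - (l + real j * h) = h" by (simp add: algebra_simps)
    have lt: "l + real j * h < l + real (Suc j) * h" using h0 by simp
    have ge: "l \<le> l + real j * h" using h0 by simp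
    have le: "l + real (Suc j) * h \<le> r"
      unfolding end_eq[symmetric] using j h0 by (intro add_left_mono mult_right_mono) simp_all
    have sub: "?P j \<subseteq> {l<..<r}" using ge le by auto
    have "\<exists>\<nu>. represents (l + real j * h) (l + real (Suc j) * h) u (wd u) \<nu>"
    proof (cases "j < m")
      case True
      have "l + real (Suc j) * h \<le> c"
        unfolding mid_eq[symmetric] using True h0 by (intro add_left_mono mult_right_mono) simp_all
      then show ?thesis using represents_subinterval[OF 1(1) L2_half(1)[OF G] ge] by blast
    next
      case False
      have "c \<le> l + real j * h"
        unfolding mid_eq[symmetric] using False h0 by (intro add_left_mono mult_right_mono) simp_all
      then show ?thesis using represents_subinterval[OF 1(2) L2_half(2)[OF G] _ le] by blast
    qed
    then obtain \<nu> where "represents (l + real j * h) (l + real (Suc j) * h) u (wd u) \<nu>" by blast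
    from represents_poincare[OF lt _ _ this] show ?thesis
      unfolding len using L2_lebesgue_on_subset[OF uL sub] L2_lebesgue_on_subset[OF G sub] by simp
  qed
  have "(N u)\<^sup>2 \<le> (\<Sum>j<2 * m. (cmod (LINT x|lebesgue_on (?P j). u x))\<^sup>2 / h
      + h\<^sup>2 / 4 * (l2_norm (lebesgue_on (?P j)) (wd u))\<^sup>2)"
    unfolding sum[OF uL] by (intro sum_mono piece) simp
  also have "\<dots> = (\<Sum>j<2 * m. (cmod (LINT x|lebesgue_on (?P j). u x))\<^sup>2) / h + h\<^sup>2 / 4 * (N (wd u))\<^sup>2"
    unfolding sum[OF G] by (simp add: sum.distrib sum_divide_distrib sum_distrib_left)
  finally show ?thesis .
qed

text \<open>A quantitative substitute for compact embedding: on pieces so short that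
  \<open>\<Lambda> * h^2 / 4 \<le> 1\<close>, Poincare's inequality bounds everything except the
  integrals over the pieces, which are finitely many functionals.\<close>

lemma compactness_estimate:
  obtains Q :: "(real \<times> real) set" and C where "finite Q" "0 \<le> C" "\<And>a b. (a, b) \<in> Q \<Longrightarrow> l \<le> a \<and> a < b \<and> b \<le> r"
    "\<And>u. u \<in> H1 \<Omega> \<Longrightarrow> \<Lambda> * (N u)\<^sup>2 \<le> Re (form u u) + C * (\<Sum>(a, b)\<in>Q. (cmod (LINT x|lebesgue_on {a<..<b}. u x))\<^sup>2)"
proof -
  \<comment> \<open>Enlarging \<open>\<Lambda>\<close> to at least \<open>1\<close> makes it safe to
    multiply inequalities by it and to take its root.\<close>
  define \<Lambda>' where "\<Lambda>' = max \<Lambda> 1"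
  obtain m0 :: nat where m0: "d * sqrt \<Lambda>' < real m0" using reals_Archimedean2 by blast
  define m where "m = Suc m0"
  define h where "h = d / (2 * real m)"
  have "0 < m" by (simp add: m_def)
  have h0: "0 < h" using lcr(3) \<open>0 < m\<close> by (simp add: h_def)
  have L: "\<Lambda>' * (h\<^sup>2 / 4) \<le> 1"
  proof -
    have "0 \<le> d * sqrt \<Lambda>'" using lcr(3) by (simp add: \<Lambda>'_def)
    moreover have "d * sqrt \<Lambda>' \<le> real m" using m0 by (simp add: m_def)
    ultimately have "(d * sqrt \<Lambda>')\<^sup>2 \<le> (real m)\<^sup>2" by (intro power_mono)
    then have "d\<^sup>2 * \<Lambda>' \<le> (real m)\<^sup>2" by (simp add: power_mult_distrib \<Lambda>'_def)
    then have "\<Lambda>' * (d\<^sup>2 / (real m)\<^sup>2) \<le> 1" using \<open>0 < m\<close> by (simp add: field_simps)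
    moreover have "h\<^sup>2 = d\<^sup>2 / (real m)\<^sup>2 / 4" by (simp add: h_def power_divide power_mult_distrib)
    moreover have "0 \<le> \<Lambda>' * (d\<^sup>2 / (real m)\<^sup>2)" by (simp add: \<Lambda>'_def)
    ultimately show ?thesis by simp
  qed
  let ?g = "\<lambda>j. (l + real j * h, l + real (Suc j) * h)"
  define Q where "Q = ?g ` {..<2 * m}"
  have inj: "inj_on ?g {..<2 * m}" using h0 by (auto simp: inj_on_def)
  have end_eq: "l + real (2 * m) * h = r" using \<open>0 < m\<close> by (simp add: h_def)
  show ?thesis
  proof (rule that[of Q "\<Lambda>' / h"])
    show "finite Q" by (simp add: Q_def)
    show "0 \<le> \<Lambda>' / h" using h0 by (simp add: \<Lambda>'_def)
    show "l \<le> a \<and> a < b \<and> b \<le> r" if ab: "(a, b) \<in> Q" for a b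
    proof -
      obtain j where j: "j < 2 * m" "a = l + real j * h" "b = l + real (Suc j) * h"
        using ab unfolding Q_def by blast
      have "real (Suc j) * h \<le> real (2 * m) * h" using j h0 by (intro mult_right_mono) simp_all
      moreover have "real j * h < real (Suc j) * h" "0 \<le> real j * h" using h0 by simp_all
      ultimately show ?thesis using j(2,3) end_eq by linarith
    qed
    fix u assume u: "u \<in> H1 \<Omega>"
    let ?S = "\<Sum>j<2 * m. (cmod (LINT x|lebesgue_on {l + real j * h<..<l + real (Suc j) * h}. u x))\<^sup>2"
    have S: "(\<Sum>(a, b)\<in>Q. (cmod (LINT x|lebesgue_on {a<..<b}. u x))\<^sup>2) = ?S"
      unfolding Q_def by (subst sum.reindex[OF inj]) simp
    have "\<Lambda> * (N u)\<^sup>2 \<le> \<Lambda>' * (N u)\<^sup>2" by (intro mult_right_mono) (simp_all add: \<Lambda>'_def)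
    also have "\<dots> \<le> \<Lambda>' * (?S / h + h\<^sup>2 / 4 * (N (wd u))\<^sup>2)"
      using poincare_pieces[OF u \<open>0 < m\<close> h_def] by (intro mult_left_mono) (simp_all add: \<Lambda>'_def)
    also have "\<dots> = \<Lambda>' / h * ?S + \<Lambda>' * (h\<^sup>2 / 4) * (N (wd u))\<^sup>2" by (simp add: algebra_simps)
    also have "\<dots> \<le> \<Lambda>' / h * ?S + 1 * (N (wd u))\<^sup>2" by (intro add_left_mono mult_right_mono L) simp
    also have "\<dots> \<le> \<Lambda>' / h * ?S + Re (form u u)" using wd_le_form[of u] by simp
    finally show "\<Lambda> * (N u)\<^sup>2 \<le> Re (form u u) + \<Lambda>' / h * (\<Sum>(a, b)\<in>Q. (cmod (LINT x|lebesgue_on {a<..<b}. u x))\<^sup>2)"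
      unfolding S by simp
  qed
qed

lemma eigenfunction_mean_zero:
  assumes \<phi>: "\<phi> \<in> H1 \<Omega>" "\<And>v. v \<in> H1 \<Omega> \<Longrightarrow> form \<phi> v = complex_of_real s * l2_inner M \<phi> v" and s: "s \<noteq> 0"
  shows "l2_inner M \<phi> (\<lambda>x. 1) = 0"
proof -
  have "complex_of_real s * l2_inner M \<phi> (\<lambda>x. 1) = form \<phi> (\<lambda>x. 1)" using \<phi>(2)[OF const_H1] by simp
  also have "\<dots> = cnj (form (\<lambda>x. 1) \<phi>)" using F.ip_cnj[OF const_H1 \<phi>(1)] by simp
  also have "\<dots> = 0" using form_const[OF \<phi>(1)] by simp
  finally show ?thesis using s by simp
qed

text \<open>
  A three-dimensional space contains a nonzero function with vanishing mean on both halves of the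
  interval, and on each half Poincare's inequality applies.
\<close>

lemma third_eigenvalue_bound:
  assumes \<phi>: "\<phi> \<in> H1 \<Omega>" "N \<phi> = 1" "\<And>v. v \<in> H1 \<Omega> \<Longrightarrow> form \<phi> v = complex_of_real s * l2_inner M \<phi> v"
    and s: "0 < s" "s < (pi / d)\<^sup>2"
    and w: "w \<in> H1 \<Omega>" "l2_inner M w (\<lambda>x. 1) = 0" "l2_inner M w \<phi> = 0"
  shows "16 / d\<^sup>2 * (N w)\<^sup>2 \<le> Re (form w w)"
proof -
  let ?K = "16 / d\<^sup>2"
  have sK: "s < ?K"
  proof -
    have "(pi / d)\<^sup>2 \<le> (4 / d)\<^sup>2"
      using lcr(3) pi_less_4 by (intro power_mono divide_right_mono) auto
    then show ?thesis using s by (simp add: power_divide)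
  qed
  have one: "(\<lambda>x. 1) \<in> H1 \<Omega>" by (rule const_H1)
  have L: "\<phi> \<in> L2 M" "w \<in> L2 M" "(\<lambda>x. 1) \<in> L2 M" using \<phi> w one by (auto intro: H1_L2)
  have \<phi>1: "l2_inner M \<phi> (\<lambda>x. 1) = 0" using s by (intro eigenfunction_mean_zero[OF \<phi>(1,3)]) auto
  define f where "f i = (if i = (0::nat) then (\<lambda>x. 1) else if i = 1 then \<phi> else w)" for i
  have fH: "f i \<in> H1 \<Omega>" for i using \<phi> w one by (simp add: f_def)
  have fI: "integrable (lebesgue_on {a<..<b}) (f i)" if "{a<..<b} \<subseteq> {l<..<r}" for a b i
    by (rule integrable_lebesgue_on_subset[OF L2_integrable_ivl[OF H1_L2[OF fH]] that]) auto
  define J where "J j = (if j = (0::nat) then {l<..<c} else {c<..<r})" for j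
  obtain b where b: "\<exists>i\<in>{..<3}. b i \<noteq> 0" "\<forall>j\<in>{..<2}. (\<Sum>i\<in>{..<3}. b i * (LINT x|lebesgue_on (J j). f i x)) = 0"
    using homogeneous_system_solution[of "{..<2::nat}" "{..<3::nat}" "\<lambda>i j. LINT x|lebesgue_on (J j). f i x"] by auto
  define y where "y = cscale (b 0) (\<lambda>x. 1) + (cscale (b 1) \<phi> + cscale (b 2) w)"
  have yH: "y \<in> H1 \<Omega>" unfolding y_def by (intro H1_add H1_scale one \<phi> w)
  have mean: "(LINT x|lebesgue_on {a<..<e}. y x) = (\<Sum>i\<in>{..<3}. b i * (LINT x|lebesgue_on {a<..<e}. f i x))"
    if "{a<..<e} \<subseteq> {l<..<r}" for a e
    using fI[OF that, of 0] fI[OF that, of 1] fI[OF that, of 2]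
    by (simp add: y_def f_def numeral_3_eq_3 numeral_2_eq_2 add.assoc integrable_const_ivl')
  have m1: "(LINT x|lebesgue_on {l<..<c}. y x) = 0"
    using b(2)[rule_format, of 0] unfolding mean[OF halves_subset(4)] J_def by simp
  have m2: "(LINT x|lebesgue_on {c<..<r}. y x) = 0"
    using b(2)[rule_format, of 1] unfolding mean[OF halves_subset(5)] J_def by simp
  \<comment> \<open>One piece per half has length \<open>h = d / 2\<close>, and the constant
    \<open>h^2 / 4\<close> becomes \<open>d^2 / 16\<close>; both means of \<open>y\<close>
    vanish.\<close>
  have "(N y)\<^sup>2 \<le> (d / 2)\<^sup>2 / 4 * (N (wd y))\<^sup>2"
    using poincare_pieces[OF yH, of 1 "d / 2"] m1 m2 by (simp add: numeral_2_eq_2 field_simps)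
  also have "\<dots> \<le> (d / 2)\<^sup>2 / 4 * Re (form y y)" by (intro mult_left_mono wd_le_form) simp
  finally have P: "?K * (N y)\<^sup>2 \<le> Re (form y y)" using lcr(3) by (simp add: field_simps power_divide)
  have Ny: "(N y)\<^sup>2 = (cmod (b 0))\<^sup>2 * d + (cmod (b 1))\<^sup>2 + (cmod (b 2))\<^sup>2 * (N w)\<^sup>2"
  proof -
    have o1: "l2_inner M \<phi> w = 0" using L.ip_cnj[OF L(2,1)] w(3) by simp
    have o2: "l2_inner M (\<lambda>x. 1) \<phi> = 0" using L.ip_cnj[OF L(1,3)] \<phi>1 by simp
    have o3: "l2_inner M (\<lambda>x. 1) w = 0" using L.ip_cnj[OF L(2,3)] w(2) by simp
    have "(L.nrm y)\<^sup>2 = (L.nrm (cscale (b 0) (\<lambda>x. 1)))\<^sup>2 + ((L.nrm (cscale (b 1) \<phi>))\<^sup>2 + (L.nrm (cscale (b 2) w))\<^sup>2)"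
      unfolding y_def using L o1 o2 o3
      by (subst L.nrm_add_power2, simp, simp, subst L.nrm_add_power2) (simp_all del: L_nrm add: L.ip_simps)
    moreover have "(N (\<lambda>x. 1))\<^sup>2 = d" using l2_norm_const[of l r 1] lr by simp
    ultimately show ?thesis using L \<phi>(2) L.nrm_scale by (simp add: power_mult_distrib)
  qed
  have Fy: "Re (form y y) = (cmod (b 1))\<^sup>2 * s + (cmod (b 2))\<^sup>2 * Re (form w w)"
  proof -
    have z: "form (\<lambda>x. 1) v = 0" "form v (\<lambda>x. 1) = 0" if "v \<in> H1 \<Omega>" for v
      using form_const[OF that] F.ip_cnj[OF one that] by auto
    have o1: "form \<phi> w = 0" using \<phi>(3)[OF w(1)] L.ip_cnj[OF L(2,1)] w(3) by simp
    then have o2: "form w \<phi> = 0" using F.ip_cnj[OF \<phi>(1) w(1)] by simp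
    have o3: "form \<phi> \<phi> = complex_of_real s" using \<phi>(3)[OF \<phi>(1)] L.ip_self[OF L(1)] \<phi>(2) by simp
    have "form y y = b 1 * cnj (b 1) * complex_of_real s + b 2 * cnj (b 2) * form w w"
      unfolding y_def using one \<phi>(1) w(1) z o1 o2 o3 by (simp add: F.ip_simps)
    also have "\<dots> = complex_of_real ((cmod (b 1))\<^sup>2 * s) + complex_of_real ((cmod (b 2))\<^sup>2) * form w w"
      by (simp only: complex_norm_square of_real_mult)
    finally show ?thesis by simp
  qed
  \<comment> \<open>The constant and \<open>\<phi>\<close> have Rayleigh quotients \<open>0\<close>
    and \<open>s\<close>, below \<open>?K\<close>, whereas \<open>y\<close> has at least
    \<open>?K\<close>. So the part of \<open>y\<close> along \<open>w\<close> must make up the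
    difference; if it were absent, all coefficients would vanish.\<close>
  have main: "?K * ((cmod (b 0))\<^sup>2 * d) + (?K - s) * (cmod (b 1))\<^sup>2
      \<le> (cmod (b 2))\<^sup>2 * (Re (form w w) - ?K * (N w)\<^sup>2)"
    using P unfolding Ny Fy by (simp add: algebra_simps)
  have pos: "0 < ?K" using lcr(3) by simp
  have nn: "0 \<le> ?K * ((cmod (b 0))\<^sup>2 * d)" "0 \<le> (?K - s) * (cmod (b 1))\<^sup>2"
    using pos lcr(3) sK by simp_all
  show ?thesis
  proof (cases "b 2 = 0")
    case True
    then have z0: "?K * ((cmod (b 0))\<^sup>2 * d) + (?K - s) * (cmod (b 1))\<^sup>2 \<le> 0"
      using main by (simp only: norm_zero power2_eq_square mult_zero_left)
    have "?K * ((cmod (b 0))\<^sup>2 * d) = 0" "(?K - s) * (cmod (b 1))\<^sup>2 = 0"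
      using add_nonneg_eq_0_iff[OF nn] order_antisym[OF z0 add_nonneg_nonneg[OF nn]] by blast+
    then have "b 0 = 0" "b 1 = 0" using pos lcr(3) sK by auto
    then have "b i = 0" if "i < 3" for i using True that by (auto simp: numeral_3_eq_3 numeral_2_eq_2 less_Suc_eq)
    then show ?thesis using b(1) by auto
  next
    case False
    then have "0 < (cmod (b 2))\<^sup>2" by simp
    moreover have "0 \<le> (cmod (b 2))\<^sup>2 * (Re (form w w) - ?K * (N w)\<^sup>2)" using main nn by linarith
    ultimately have "0 \<le> Re (form w w) - ?K * (N w)\<^sup>2" by (simp only: zero_le_mult_iff) linarith
    then show ?thesis by simp
  qed
qed

text \<open>\<open>lam 2 = s\<close> puts \<open>2\<close> into the set counted by the multiplicity
  of \<open>s\<close>. The multiplicity is then positive, the eigenspace contains a nonempty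
  independent family, and its first member can be normalised.\<close>

lemma eigenfunction_exists:
  assumes "is_nth_eigenvalue M (cell_operator q l r) 2 s"
  obtains \<phi> where "\<phi> \<in> H1 \<Omega>" "N \<phi> = 1" "\<And>v. v \<in> H1 \<Omega> \<Longrightarrow> form \<phi> v = complex_of_real s * l2_inner M \<phi> v"
proof -
  let ?A = "cell_operator q l r"
  obtain lam where lam: "eigenvalue_sequence M ?A lam" "lam 2 = s"
    using assms by (auto simp: is_nth_eigenvalue_def)
  let ?S = "{j. 1 \<le> j \<and> complex_of_real (lam j) = complex_of_real s}"
  have fin: "finite ?S" and mult: "multiplicity_eigval M ?A (complex_of_real s) = enat (card ?S)"
    using lam(1) unfolding eigenvalue_sequence_def by blast+
  have "2 \<in> ?S" using lam(2) by simp
  then have "0 < card ?S" using fin unfolding card_gt_0_iff by blast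
  have "\<not> ae_dim M (eigenspace ?A (complex_of_real s)) \<le> 0"
    using mult \<open>0 < card ?S\<close> by (simp add: multiplicity_eigval_def zero_enat_def)
  then obtain n e where ne: "\<not> enat n \<le> 0" "\<And>i. i < n \<Longrightarrow> e i \<in> eigenspace ?A (complex_of_real s)" "ae_independent M n e"
    unfolding ae_dim_def Sup_le_iff by blast
  then have n: "0 < n" by (cases n) (simp_all add: zero_enat_def)
  have e0: "e 0 \<in> H1 \<Omega>" "\<And>v. v \<in> H1 \<Omega> \<Longrightarrow> form (e 0) v = l2_inner M (\<lambda>x. complex_of_real s * e 0 x) v"
    using ne(2)[OF n] by (auto simp: eigenspace_def cell_operator_def form_operator_def)
  have "\<not> (AE x in M. e 0 x = 0)"
  proof
    assume ae: "AE x in M. e 0 x = 0"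
    \<comment> \<open>If \<open>e 0\<close> vanished almost everywhere, the coefficient vector
      \<open>(1, 0, ..., 0)\<close> would contradict independence.\<close>
    let ?b = "\<lambda>i. if i = 0 then 1 else (0::complex)"
    have "(\<Sum>i<n. ?b i * e i x) = e 0 x" for x
      using n by (cases n) (simp_all add: sum.lessThan_Suc_shift del: sum.lessThan_Suc)
    then have "AE x in M. (\<Sum>i<n. ?b i * e i x) = 0" using ae by simp
    with ne(3)[unfolded ae_independent_def, THEN spec[of _ ?b]] have "\<forall>i<n. ?b i = 0" by (rule mp)
    then show False using n by force
  qed
  then have N0: "N (e 0) \<noteq> 0" using l2_norm_eq_0_iff[OF H1_L2[OF e0(1)]] by blast
  then have Npos: "0 < N (e 0)" by (simp add: order_less_le)
  define z where "z = complex_of_real (1 / N (e 0))"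
  have zc: "cmod z = 1 / N (e 0)" using Npos by (simp add: z_def norm_divide)
  have e0L: "e 0 \<in> L2 M" by (rule H1_L2[OF e0(1)])
  show ?thesis
  proof (rule that[of "cscale z (e 0)"])
    show "cscale z (e 0) \<in> H1 \<Omega>" by (rule H1_scale[OF e0(1)])
    show "N (cscale z (e 0)) = 1" using L.nrm_scale[OF e0L, of z] zc Npos by simp
    fix v assume v: "v \<in> H1 \<Omega>"
    have "l2_inner M (\<lambda>x. complex_of_real s * e 0 x) v = complex_of_real s * l2_inner M (e 0) v"
      using L.ip_scale[OF e0L H1_L2[OF v], of "complex_of_real s"] by (simp add: cscale_def)
    then show "form (cscale z (e 0)) v = complex_of_real s * l2_inner M (cscale z (e 0)) v"
      using e0 v by (simp add: F.ip_scale L.ip_scale e0L H1_L2)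
  qed
qed

end

section \<open>Series of semi-inner products\<close>

text \<open>Summability on the diagonal is enough: Cauchy-Schwarz in each term makes the mixed
  series converge, and the parallelogram law closes the domain under addition.\<close>

lemma semi_inner_series:
  fixes F :: "nat \<Rightarrow> ('a \<Rightarrow> complex) \<Rightarrow> ('a \<Rightarrow> complex) \<Rightarrow> complex"
  assumes F: "\<And>k. semi_inner W (F k)"
  defines "D \<equiv> {u \<in> W. summable (\<lambda>k. F k u u)}"
  shows "\<And>u v. u \<in> D \<Longrightarrow> v \<in> D \<Longrightarrow> summable (\<lambda>k. F k u v)"
    and "semi_inner D (\<lambda>u v. \<Sum>k. F k u v)"
proof -
  interpret F: semi_inner W "F k" for k by (rule F)
  have W: "u \<in> W" if "u \<in> D" for u using that by (simp add: D_def)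
  have sq: "summable (\<lambda>k. (F.nrm k u)\<^sup>2)" if "u \<in> D" for u
  proof -
    have "summable (\<lambda>k. Re (F k u u))" using that by (simp add: D_def summable_Re)
    then show ?thesis using W[OF that] by (simp add: F.nrm_power2)
  qed
  have sqD: "u \<in> D" if "u \<in> W" "summable (\<lambda>k. (F.nrm k u)\<^sup>2)" for u
  proof -
    have "summable (\<lambda>k. complex_of_real ((F.nrm k u)\<^sup>2))" using that(2) by (simp only: summable_of_real)
    then show ?thesis using that(1) by (simp add: D_def F.ip_self)
  qed
  show s: "summable (\<lambda>k. F k u v)" if u: "u \<in> D" and v: "v \<in> D" for u v
  proof (rule summable_comparison_test')
    show "summable (\<lambda>k. (F.nrm k u)\<^sup>2 + (F.nrm k v)\<^sup>2)" by (intro summable_add sq u v)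
    fix k
    have "cmod (F k u v) \<le> F.nrm k u * F.nrm k v" using W[OF u] W[OF v] by (rule F.cauchy_schwarz)
    also have "\<dots> \<le> (F.nrm k u)\<^sup>2 + (F.nrm k v)\<^sup>2"
    proof -
      have "0 \<le> F.nrm k u * F.nrm k v" using W[OF u] W[OF v] by simp
      then show ?thesis using sum_squares_bound[of "F.nrm k u" "F.nrm k v"] by linarith
    qed
    finally show "norm (F k u v) \<le> (F.nrm k u)\<^sup>2 + (F.nrm k v)\<^sup>2" .
  qed
  have add: "u + v \<in> D" if u: "u \<in> D" and v: "v \<in> D" for u v
  proof (rule sqD)
    show "u + v \<in> W" using W[OF u] W[OF v] by (rule F.add_mem)
    show "summable (\<lambda>k. (F.nrm k (u + v))\<^sup>2)"
    proof (rule summable_comparison_test')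
      show "summable (\<lambda>k. 2 * (F.nrm k u)\<^sup>2 + 2 * (F.nrm k v)\<^sup>2)" by (intro summable_add summable_mult sq u v)
      fix k
      have "0 \<le> (F.nrm k (u - v))\<^sup>2" by simp
      then have "(F.nrm k (u + v))\<^sup>2 \<le> 2 * (F.nrm k u)\<^sup>2 + 2 * (F.nrm k v)\<^sup>2"
        using F.parallelogram[OF W[OF u] W[OF v], of k] by linarith
      then show "norm ((F.nrm k (u + v))\<^sup>2) \<le> 2 * (F.nrm k u)\<^sup>2 + 2 * (F.nrm k v)\<^sup>2" by simp
    qed
  qed
  show "semi_inner D (\<lambda>u v. \<Sum>k. F k u v)"
  proof (unfold_locales, goal_cases)
    case 1 then show ?case by (simp add: D_def)
  next
    case (2 u v) then show ?case by (rule add)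
  next
    case (3 u z)
    show ?case
    proof (rule sqD)
      show "summable (\<lambda>k. (F.nrm k (cscale z u))\<^sup>2)"
        using summable_mult[OF sq[OF 3], of "(cmod z)\<^sup>2"] W[OF 3] by (simp add: F.nrm_scale power_mult_distrib)
    qed (use W[OF 3] in simp)
  next
    case (4 u v w)
    then show ?case using s by (simp add: F.ip_add W suminf_add)
  next
    case (5 u w z)
    then show ?case using s by (simp add: F.ip_scale W suminf_mult)
  next
    case (6 u v)
    have "(\<lambda>k. cnj (F k u v)) sums cnj (\<Sum>k. F k u v)"
      using s[OF 6] by (simp add: sums_cnj summable_sums)
    then show ?case using 6 by (simp add: F.ip_cnj W sums_iff)
  next
    case (7 u)
    have "Re (\<Sum>k. F k u u) = (\<Sum>k. Re (F k u u))" using s[OF 7 7] by (rule Re_suminf)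
    then show ?case using s[OF 7 7] 7 by (simp add: suminf_nonneg summable_Re F.ip_pos W)
  qed
qed

section \<open>The coupled form\<close>

locale dprime =
  fixes d p q :: "nat \<Rightarrow> real"
  assumes d_pos: "0 < d k" and d_sum: "summable d" and q_pos: "0 < q k" and p_pos: "0 < p k"
    and rho_lim: "(\<lambda>k. max (1 / (p k * d k)) (1 / (p k * d (Suc k)))) \<longlonglongrightarrow> 0"
begin

abbreviation "x \<equiv> node d"
abbreviation "b \<equiv> right_end d"
abbreviation "M \<equiv> lebesgue_on {0<..<b}"
abbreviation "I k \<equiv> {x k<..<x (Suc k)}"
abbreviation "Mk k \<equiv> lebesgue_on (I k)"
abbreviation "Hk k \<equiv> H1 (punctured (x k) (x (Suc k)))"
abbreviation "wdk k \<equiv> weak_deriv (punctured (x k) (x (Suc k)))"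
abbreviation "Nk k \<equiv> l2_norm (Mk k)"
abbreviation "fk k \<equiv> cell_form (q k) (x k) (x (Suc k))"
abbreviation "rho k \<equiv> max (1 / (p k * d k)) (1 / (p k * d (Suc k)))"

definition jk :: "nat \<Rightarrow> (real \<Rightarrow> complex) \<Rightarrow> (real \<Rightarrow> complex) \<Rightarrow> complex" where
  "jk k u v = complex_of_real (1 / p k) * (trace_jump u (x (Suc k)) * cnj (trace_jump v (x (Suc k))))"

lemma x_Suc: "x (Suc k) = x k + d k"
  by (simp add: node_def)

lemma x_0 [simp]: "x 0 = 0"
  by (simp add: node_def)

lemma x_less: "x k < x (Suc k)"
  by (simp add: x_Suc d_pos)

lemma x_diff [simp]: "x (Suc k) - x k = d k"
  by (simp add: x_Suc)

lemma x_mono: "j \<le> k \<Longrightarrow> x j \<le> x k"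
  by (rule lift_Suc_mono_le[of x]) (auto simp: less_imp_le[OF x_less])

lemma x_lim: "x \<longlonglongrightarrow> b"
  using summable_LIMSEQ[OF d_sum] by (simp add: node_def[abs_def] right_end_def)

lemma x_nonneg: "0 \<le> x k"
  using x_mono[of 0 k] by simp

lemma x_le_b: "x k \<le> b"
  by (rule incseq_le[OF _ x_lim]) (simp add: incseq_def x_mono)

lemma d_le_b: "d k \<le> b"
  using x_le_b[of "Suc k"] x_nonneg[of k] by (simp add: x_Suc)

lemma d_lim: "d \<longlonglongrightarrow> 0"
  by (rule summable_LIMSEQ_zero[OF d_sum])

lemma I_subset: "I k \<subseteq> {0<..<b}"
  using x_nonneg[of k] x_le_b[of "Suc k"] by auto

lemma I_unique: assumes "y \<in> I j" "y \<in> I k" shows "j = k"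
proof (rule ccontr)
  assume "j \<noteq> k"
  then consider "Suc j \<le> k" | "Suc k \<le> j" by linarith
  then show False
    by cases (use assms x_mono[of "Suc j" k] x_mono[of "Suc k" j] in auto)
qed

sublocale C: cell "x k" "x (Suc k)" "q k" for k
  by unfold_locales (simp_all add: x_less q_pos)

sublocale L: semi_hilbert "L2 M" "l2_inner M"
  by (rule semi_hilbert_L2)

lemma L2_cell: "u \<in> L2 M \<Longrightarrow> u \<in> L2 (Mk k)"
  by (rule L2_lebesgue_on_subset[OF _ I_subset]) simp_all

lemma integral_cells_partial:
  fixes f :: "real \<Rightarrow> 'b::{banach, second_countable_topology}"
  assumes "integrable (lebesgue_on {0<..<x n}) f"
  shows "(\<Sum>k<n. integral\<^sup>L (Mk k) f) = integral\<^sup>L (lebesgue_on {0<..<x n}) f"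
  using assms
proof (induction n)
  case (Suc n)
  have "integrable (lebesgue_on {0<..<x n}) f"
    by (rule integrable_lebesgue_on_subset[OF Suc.prems]) (use x_less[of n] in auto)
  from Suc.IH[OF this] integral_ivl_split[OF Suc.prems x_nonneg less_imp_le[OF x_less]] show ?case by simp
qed simp

lemma indicator_lim: "(\<lambda>n. indicator {0<..<x n} y :: real) \<longlonglongrightarrow> indicator {0<..<b} y"
proof (cases "y \<in> {0<..<b}")
  case True
  then have "\<forall>\<^sub>F n in sequentially. y < x n" using order_tendstoD(1)[OF x_lim] by auto
  then have "\<forall>\<^sub>F n in sequentially. indicator {0<..<x n} y = (1::real)"
    by eventually_elim (use True in auto)
  then show ?thesis using True by (simp add: tendsto_eventually)
next
  case False
  have "y \<notin> {0<..<x n}" for n using False x_le_b[of n] by auto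
  then show ?thesis using False by simp
qed

text \<open>The intervals \<open>(0, x n)\<close> exhaust \<open>(0, b)\<close> and the nodes are
  null sets, so dominated convergence applies.\<close>

lemma integral_cells:
  fixes f :: "real \<Rightarrow> complex"
  assumes f: "integrable M f"
  shows "(\<lambda>k. integral\<^sup>L (Mk k) f) sums integral\<^sup>L M f"
  unfolding sums_def
proof -
  have [measurable]: "f \<in> borel_measurable M" using f by (rule borel_measurable_integrable)
  have sub: "{0<..<x n} \<subseteq> {0<..<b}" for n using x_le_b[of n] by auto
  have part: "(\<Sum>k<n. integral\<^sup>L (Mk k) f) = (LINT y|M. indicator {0<..<x n} y *\<^sub>R f y)" for n
  proof -
    have "integrable (lebesgue_on {0<..<x n}) f"
      by (rule integrable_lebesgue_on_subset[OF f sub]) auto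
    from integral_cells_partial[OF this] show ?thesis
      using integral_restrict[OF sub, of n f] by (simp add: indicator_scaleR_eq_if)
  qed
  have "(\<lambda>n. LINT y|M. indicator {0<..<x n} y *\<^sub>R f y) \<longlonglongrightarrow> (LINT y|M. indicator {0<..<b} y *\<^sub>R f y)"
  proof (rule integral_dominated_convergence[where w = "\<lambda>y. norm (f y)"])
    show "(\<lambda>y. indicator {0<..<x n} y *\<^sub>R f y) \<in> borel_measurable M" for n
      by (intro borel_measurable_scaleR borel_measurable_indicator) (simp_all add: sets_restrict_space_iff sub)
    show "(\<lambda>y. indicator {0<..<b} y *\<^sub>R f y) \<in> borel_measurable M"
      by (intro borel_measurable_scaleR borel_measurable_indicator) (simp_all add: sets_restrict_space_iff)
    show "AE y in M. (\<lambda>n. indicator {0<..<x n} y *\<^sub>R f y) \<longlonglongrightarrow> indicator {0<..<b} y *\<^sub>R f y"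
      by (intro AE_I2 tendsto_scaleR indicator_lim tendsto_const)
    show "AE y in M. norm (indicator {0<..<x n} y *\<^sub>R f y) \<le> norm (f y)" for n
      by (intro AE_I2) (simp add: indicator_def)
  qed (use f in simp)
  also have "(LINT y|M. indicator {0<..<b} y *\<^sub>R f y) = integral\<^sup>L M f"
    by (rule Bochner_Integration.integral_cong) auto
  finally show "(\<lambda>n. \<Sum>k<n. integral\<^sup>L (Mk k) f) \<longlonglongrightarrow> integral\<^sup>L M f"
    unfolding part .
qed

lemma inner_cells:
  "u \<in> L2 M \<Longrightarrow> v \<in> L2 M \<Longrightarrow> (\<lambda>k. l2_inner (Mk k) u v) sums l2_inner M u v"
  unfolding l2_inner_def by (rule integral_cells[OF L2_mult_integrable])

lemma norm_cells:
  assumes "u \<in> L2 M" shows "(\<lambda>k. (Nk k u)\<^sup>2) sums (l2_norm M u)\<^sup>2"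
  using sums_Re[OF inner_cells[OF assms assms]] by (simp add: l2_inner_self l2_norm_power2)

section \<open>Gluing functions given on the cells\<close>

definition glue :: "(nat \<Rightarrow> real \<Rightarrow> complex) \<Rightarrow> real \<Rightarrow> complex" where
  "glue h y = (if \<exists>k. y \<in> I k then h (THE k. y \<in> I k) y else 0)"

lemma glue_eq: "y \<in> I k \<Longrightarrow> glue h y = h k y"
proof -
  assume y: "y \<in> I k"
  then have "(THE k. y \<in> I k) = k" using I_unique[OF y] by (intro the_equality) blast+
  with y show ?thesis unfolding glue_def by auto
qed

lemma glue_measurable:
  assumes h: "\<And>k. h k \<in> borel_measurable (Mk k)"
  shows "glue h \<in> borel_measurable M"
proof (rule borel_measurable_LIMSEQ_metric)
  show "(\<lambda>y. \<Sum>k<n. if y \<in> I k then h k y else 0) \<in> borel_measurable M" for n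
  proof (rule borel_measurable_sum)
    fix k show "(\<lambda>y. if y \<in> I k then h k y else 0) \<in> borel_measurable M"
      using borel_measurable_if_lebesgue_on[of "I k" "{0<..<b}" "h k"] I_subset h by auto
  qed
  fix y
  show "(\<lambda>n. \<Sum>k<n. if y \<in> I k then h k y else 0) \<longlonglongrightarrow> glue h y"
  proof (cases "\<exists>k. y \<in> I k")
    case True
    then obtain k where k: "y \<in> I k" by blast
    have eq: "(if y \<in> I j then h j y else 0) = (if j = k then h k y else 0)" for j
      using I_unique[OF k, of j] k by (cases "j = k") auto
    have "(\<Sum>j<n. if y \<in> I j then h j y else 0) = glue h y" if "Suc k \<le> n" for n
    proof -
      have "(\<Sum>j<n. if y \<in> I j then h j y else 0) = (\<Sum>j<n. if j = k then h k y else 0)"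
        by (intro sum.cong refl eq)
      also have "\<dots> = h k y" using that by (simp add: sum.delta')
      finally show ?thesis by (simp only: glue_eq[OF k])
    qed
    then show ?thesis by (intro tendsto_eventually eventually_sequentiallyI[of "Suc k"])
  next
    case False
    then have "glue h y = 0" by (simp only: glue_def if_False)
    moreover have "(if y \<in> I k then h k y else 0) = 0" for k by (rule if_not_P) (use False in blast)
    ultimately show ?thesis by (simp only: sum.neutral_const tendsto_const)
  qed
qed

text \<open>Monotone convergence along the intervals \<open>(0, x n)\<close>, on which square
  integrability is built up by adding one cell at a time.\<close>

lemma glue_L2:
  assumes h: "\<And>k. h k \<in> L2 (Mk k)" and s: "summable (\<lambda>k. (Nk k (h k))\<^sup>2)"
  shows "glue h \<in> L2 M"
proof -
  have gm [measurable]: "glue h \<in> borel_measurable M" by (rule glue_measurable) (rule L2_measurable[OF h])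
  have gk: "glue h \<in> L2 (Mk k)" "(Nk k (glue h))\<^sup>2 = (Nk k (h k))\<^sup>2" for k
  proof -
    have eq: "\<And>y. y \<in> I k \<Longrightarrow> glue h y = h k y" by (rule glue_eq)
    show "glue h \<in> L2 (Mk k)" using h[of k] eq
      unfolding L2_def using measurable_lebesgue_cong[of "I k" "glue h" "h k"]
        Bochner_Integration.integrable_cong[of "Mk k" "Mk k" "\<lambda>x. (cmod (glue h x))\<^sup>2" "\<lambda>x. (cmod (h k x))\<^sup>2"] by simp
    show "(Nk k (glue h))\<^sup>2 = (Nk k (h k))\<^sup>2"
      unfolding l2_norm_power2 by (rule Bochner_Integration.integral_cong) (simp_all add: eq)
  qed
  let ?f = "\<lambda>y. (cmod (glue h y))\<^sup>2"
  have sub: "{0<..<x n} \<subseteq> {0<..<b}" for n using x_le_b[of n] by auto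
  have loc: "integrable (lebesgue_on {0<..<x n}) ?f" for n
  proof (induction n)
    case (Suc n)
    have "set_integrable lebesgue ({0<..<x n} \<union> I n) ?f"
      using Suc L2_integrable[OF gk(1)] by (intro set_integrable_Un) (simp_all add: integrable_lebesgue_on)
    then have "integrable (lebesgue_on ({0<..<x n} \<union> I n)) ?f" by (simp add: integrable_lebesgue_on)
    moreover have "({0<..<x (Suc n)} - {x n}) \<subseteq> {0<..<x n} \<union> I n" by auto
    ultimately have "integrable (lebesgue_on ({0<..<x (Suc n)} - {x n})) ?f"
      by (rule integrable_lebesgue_on_subset) auto
    then show ?case by (simp add: integral_delete_point(2))
  qed simp
  have "integrable M ?f"
  proof (rule integrable_monotone_convergence[where f = "\<lambda>n y. indicator {0<..<x n} y * ?f y"])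
    show "integrable M (\<lambda>y. indicator {0<..<x n} y * ?f y)" for n
    proof -
      have "integrable lebesgue (\<lambda>y. indicator {0<..<x n} y *\<^sub>R ?f y)"
        using loc[of n] by (simp add: integrable_restrict_space)
      moreover have "(\<lambda>y. indicator {0<..<b} y *\<^sub>R (indicator {0<..<x n} y * ?f y)) = (\<lambda>y. indicator {0<..<x n} y *\<^sub>R ?f y)"
        using sub[of n] by (auto simp: indicator_def fun_eq_iff)
      ultimately show ?thesis by (simp add: integrable_restrict_space)
    qed
    show "AE y in M. mono (\<lambda>n. indicator {0<..<x n} y * ?f y :: real)"
    proof (rule AE_I2, rule monoI)
      fix y :: real and m n :: nat assume "m \<le> n"
      then show "indicator {0<..<x m} y * ?f y \<le> indicator {0<..<x n} y * ?f y"
        using x_mono[of m n] by (intro mult_right_mono) (auto simp: indicator_def)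
    qed
    show "AE y in M. (\<lambda>n. indicator {0<..<x n} y * ?f y) \<longlonglongrightarrow> ?f y"
    proof (rule AE_I2)
      fix y assume "y \<in> space M"
      then show "(\<lambda>n. indicator {0<..<x n} y * ?f y) \<longlonglongrightarrow> ?f y"
        using tendsto_mult_right[OF indicator_lim[of y], of "?f y"] by simp
    qed
    have "(LINT y|M. indicator {0<..<x n} y * ?f y) = (\<Sum>k<n. (Nk k (h k))\<^sup>2)" for n
    proof -
      have "(\<Sum>k<n. (Nk k (h k))\<^sup>2) = (LINT y|lebesgue_on {0<..<x n}. ?f y)"
        using integral_cells_partial[OF loc[of n]] gk(2) by (simp add: l2_norm_power2)
      also have "\<dots> = (LINT y|M. (if y \<in> {0<..<x n} then ?f y else 0))"
        by (rule integral_restrict[symmetric]) (use sub in auto)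
      also have "\<dots> = (LINT y|M. indicator {0<..<x n} y * ?f y)"
        by (rule Bochner_Integration.integral_cong) (auto simp: indicator_def)
      finally show ?thesis by simp
    qed
    then show "(\<lambda>n. LINT y|M. indicator {0<..<x n} y * ?f y) \<longlonglongrightarrow> (\<Sum>k. (Nk k (h k))\<^sup>2)"
      using summable_LIMSEQ[OF s] by simp
  qed measurable
  then show ?thesis using gm by (simp add: L2_def)
qed

section \<open>The form domain and the sums of cell forms and jump forms\<close>

definition W :: "(real \<Rightarrow> complex) set" where
  "W = {u \<in> L2 M. \<forall>k. u \<in> Hk k}"

lemma W_D: "u \<in> W \<Longrightarrow> u \<in> L2 M" "u \<in> W \<Longrightarrow> u \<in> Hk k"
  by (auto simp: W_def)

lemma W_zero: "0 \<in> W" and W_add: "u \<in> W \<Longrightarrow> v \<in> W \<Longrightarrow> u + v \<in> W" and W_scale: "u \<in> W \<Longrightarrow> cscale z u \<in> W"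
  by (auto simp: W_def C.H1_zero C.H1_add C.H1_scale)

lemma semi_inner_fk: "semi_inner W (fk k)"
  by (rule semi_inner_subset[OF C.semi_inner_form]) (auto simp: W_zero W_add W_scale W_D)

lemma trace_jump_node_add:
  assumes "u \<in> Hk k" "u \<in> Hk (Suc k)" "v \<in> Hk k" "v \<in> Hk (Suc k)"
  shows "trace_jump (u + v) (x (Suc k)) = trace_jump u (x (Suc k)) + trace_jump v (x (Suc k))"
  using assms by (simp add: trace_jump_def C.trace_add)

lemma trace_jump_node_scale:
  assumes "u \<in> Hk k" "u \<in> Hk (Suc k)"
  shows "trace_jump (cscale z u) (x (Suc k)) = z * trace_jump u (x (Suc k))"
  using assms by (simp add: trace_jump_def C.trace_scale right_diff_distrib)

lemma semi_inner_jk: "semi_inner W (jk k)"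
proof -
  have "semi_inner W (\<lambda>u v. trace_jump u (x (Suc k)) * cnj (trace_jump v (x (Suc k))))"
    by unfold_locales (auto simp: W_zero W_add W_scale W_D trace_jump_node_add trace_jump_node_scale algebra_simps)
  then have "semi_inner W (\<lambda>u v. complex_of_real (1 / p k) * (trace_jump u (x (Suc k)) * cnj (trace_jump v (x (Suc k)))))"
    by (rule semi_inner_scale) (use p_pos[of k] in simp)
  then show ?thesis by (simp only: jk_def[abs_def])
qed

sublocale F: semi_inner W "fk k" for k by (rule semi_inner_fk)
sublocale J: semi_inner W "jk k" for k by (rule semi_inner_jk)

abbreviation "D \<equiv> dprime_form_dom d p q"
abbreviation "a \<equiv> dprime_form d p q"

lemma D_eq: "D = {u \<in> W. summable (\<lambda>k. fk k u u)} \<inter> {u \<in> W. summable (\<lambda>k. jk k u u)}"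
  by (auto simp: dprime_form_dom_def W_def jk_def)

lemma a_eq: "a u v = (\<Sum>k. fk k u v) + (\<Sum>k. jk k u v)"
  by (simp add: dprime_form_def jk_def)

lemma summable_fk: assumes "u \<in> D" "v \<in> D" shows "summable (\<lambda>k. fk k u v)"
proof -
  have "u \<in> {u \<in> W. summable (\<lambda>k. fk k u u)}" "v \<in> {u \<in> W. summable (\<lambda>k. fk k u u)}"
    using assms by (auto simp: D_eq)
  from semi_inner_series(1)[OF semi_inner_fk this] show ?thesis .
qed

lemma summable_jk: assumes "u \<in> D" "v \<in> D" shows "summable (\<lambda>k. jk k u v)"
proof -
  have "u \<in> {u \<in> W. summable (\<lambda>k. jk k u u)}" "v \<in> {u \<in> W. summable (\<lambda>k. jk k u u)}"
    using assms by (auto simp: D_eq)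
  from semi_inner_series(1)[OF semi_inner_jk this] show ?thesis .
qed

lemma semi_inner_a: "semi_inner D a"
proof -
  note 1 = semi_inner_series(2)[OF semi_inner_fk] and 2 = semi_inner_series(2)[OF semi_inner_jk]
  interpret S1: semi_inner "{u \<in> W. summable (\<lambda>k. fk k u u)}" "\<lambda>u v. \<Sum>k. fk k u v" by (rule 1)
  interpret S2: semi_inner "{u \<in> W. summable (\<lambda>k. jk k u u)}" "\<lambda>u v. \<Sum>k. jk k u v" by (rule 2)
  have z: "0 \<in> D" unfolding D_eq using S1.zero_mem S2.zero_mem by (rule IntI)
  have add: "u + v \<in> D" if "u \<in> D" "v \<in> D" for u v
    unfolding D_eq using that[unfolded D_eq]
    by (intro IntI S1.add_mem S2.add_mem) (erule IntD1 IntD2)+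
  have scale: "cscale c u \<in> D" if "u \<in> D" for c u
    unfolding D_eq using that[unfolded D_eq]
    by (intro IntI S1.scale_mem S2.scale_mem) (erule IntD1 IntD2)+
  have "semi_inner D (\<lambda>u v. \<Sum>k. fk k u v)"
    by (rule semi_inner_subset[OF 1 _ z add scale]) (simp_all only: D_eq Int_lower1)
  moreover have "semi_inner D (\<lambda>u v. \<Sum>k. jk k u v)"
    by (rule semi_inner_subset[OF 2 _ z add scale]) (simp_all only: D_eq Int_lower2)
  ultimately have "semi_inner D (\<lambda>u v. (\<Sum>k. fk k u v) + (\<Sum>k. jk k u v))" by (rule semi_inner_add)
  then show ?thesis by (simp only: a_eq[abs_def])
qed

sublocale A: semi_inner D a by (rule semi_inner_a)

lemma D_W: "u \<in> D \<Longrightarrow> u \<in> W"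
  by (simp add: D_eq)

lemma D_L2: "u \<in> D \<Longrightarrow> u \<in> L2 M"
  by (simp add: D_W W_D)

lemma semi_inner_D1: "semi_inner D (\<lambda>u v. a u v + l2_inner M u v)"
proof (rule semi_inner_add[OF semi_inner_a])
  show "semi_inner D (l2_inner M)"
    by (rule semi_inner_subset[OF semi_inner_L2]) (auto simp: D_L2)
qed

sublocale D1: semi_inner D "\<lambda>u v. a u v + l2_inner M u v" by (rule semi_inner_D1)

section \<open>Cell energies, control of the coupling, and closedness\<close>

definition trace_size :: "nat \<Rightarrow> (real \<Rightarrow> complex) \<Rightarrow> real" where
  "trace_size k u = 4 * (Nk k u)\<^sup>2 + (d k)\<^sup>2 * (Nk k (wdk k u))\<^sup>2"

definition En :: "nat \<Rightarrow> (real \<Rightarrow> complex) \<Rightarrow> real" where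
  "En k u = Re (fk k u u) + (Nk k u)\<^sup>2"

text \<open>A common bound for the coefficients \<open>4\<close> and \<open>(d k)^2\<close> of
  \<open>trace_size\<close>, since every \<open>d k\<close> is at most \<open>b\<close>.\<close>

definition Kb :: real where "Kb = 4 + b\<^sup>2"

lemma Kb_pos: "0 < Kb"
  by (simp add: Kb_def add_pos_nonneg)

lemma rho_pos: "0 < rho k"
  using p_pos[of k] d_pos[of k] by (simp add: less_max_iff_disj)

lemma trace_size_nonneg: "0 \<le> trace_size k u"
  by (simp add: trace_size_def)

lemma fk_nonneg: "0 \<le> Re (fk k u u)"
  using C.wd_le_form[of k u] zero_le_power2[of "Nk k (wdk k u)"] by linarith

lemma En_nonneg: "0 \<le> En k u"
  by (simp add: En_def fk_nonneg)

lemma trace_size_le: "trace_size k u \<le> Kb * En k u"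
proof -
  have "(d k)\<^sup>2 \<le> b\<^sup>2" using d_le_b d_pos[of k] by (intro power_mono) auto
  then have "(d k)\<^sup>2 * (Nk k (wdk k u))\<^sup>2 \<le> Kb * Re (fk k u u)"
    using C.wd_le_form[of k u] by (intro mult_mono) (auto simp: Kb_def)
  moreover have "4 * (Nk k u)\<^sup>2 \<le> Kb * (Nk k u)\<^sup>2" by (intro mult_right_mono) (auto simp: Kb_def)
  ultimately show ?thesis by (simp add: trace_size_def En_def distrib_left)
qed

text \<open>\<open>trace_size k\<close> is the bound of \<open>trace_bound\<close> multiplied by
  \<open>d k\<close>. Dividing by \<open>p k\<close> leaves \<open>1 / (p k * d k)\<close> for the
  trace from the left and \<open>1 / (p k * d (Suc k))\<close> for the one from the right, whence
  the maximum in \<open>rho\<close>.\<close>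

lemma jump_bound:
  assumes "u \<in> Hk k" "u \<in> Hk (Suc k)"
  shows "Re (jk k u u) \<le> 2 * rho k * (trace_size k u + trace_size (Suc k) u)"
proof -
  let ?R = "trace_right u (x (Suc k))" and ?L = "trace_left u (x (Suc k))"
  have "jk k u u = complex_of_real ((cmod (trace_jump u (x (Suc k))))\<^sup>2 / p k)"
    by (simp add: jk_def complex_norm_square[symmetric] del: of_real_power)
  then have 0: "Re (jk k u u) = (cmod (trace_jump u (x (Suc k))))\<^sup>2 / p k" by simp
  have "cmod (trace_jump u (x (Suc k))) \<le> cmod ?R + cmod ?L"
    unfolding trace_jump_def by (rule norm_triangle_ineq4)
  then have "(cmod (trace_jump u (x (Suc k))))\<^sup>2 \<le> (cmod ?R + cmod ?L)\<^sup>2" by (rule power_mono) simp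
  also have "\<dots> \<le> 2 * (cmod ?R)\<^sup>2 + 2 * (cmod ?L)\<^sup>2"
    using sum_squares_bound[of "cmod ?R" "cmod ?L"] by (simp add: power2_sum)
  finally have 1: "(cmod (trace_jump u (x (Suc k))))\<^sup>2 / p k \<le> 2 * ((cmod ?R)\<^sup>2 / p k) + 2 * ((cmod ?L)\<^sup>2 / p k)"
    using p_pos[of k] by (simp add: divide_right_mono field_simps)
  have t: "(4 / d j * A + d j * B) / p k = 1 / (p k * d j) * (4 * A + (d j)\<^sup>2 * B)" for j A B
    using p_pos[of k] d_pos[of j] by (simp add: field_simps power2_eq_square)
  have "(cmod ?L)\<^sup>2 / p k \<le> rho k * trace_size k u"
  proof -
    have "(cmod ?L)\<^sup>2 \<le> 4 / d k * (Nk k u)\<^sup>2 + d k * (Nk k (wdk k u))\<^sup>2"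
      using C.trace_bound[OF assms(1), of ?L] by (simp add: C.traces_def)
    then have "(cmod ?L)\<^sup>2 / p k \<le> (4 / d k * (Nk k u)\<^sup>2 + d k * (Nk k (wdk k u))\<^sup>2) / p k"
      using p_pos[of k] by (intro divide_right_mono) auto
    also have "\<dots> = 1 / (p k * d k) * trace_size k u" by (simp only: t trace_size_def)
    also have "\<dots> \<le> rho k * trace_size k u"
      using trace_size_nonneg by (intro mult_right_mono) auto
    finally show ?thesis .
  qed
  moreover have "(cmod ?R)\<^sup>2 / p k \<le> rho k * trace_size (Suc k) u"
  proof -
    have "(cmod ?R)\<^sup>2 \<le> 4 / d (Suc k) * (Nk (Suc k) u)\<^sup>2 + d (Suc k) * (Nk (Suc k) (wdk (Suc k) u))\<^sup>2"
      using C.trace_bound[OF assms(2), of ?R] by (simp add: C.traces_def)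
    then have "(cmod ?R)\<^sup>2 / p k \<le> (4 / d (Suc k) * (Nk (Suc k) u)\<^sup>2 + d (Suc k) * (Nk (Suc k) (wdk (Suc k) u))\<^sup>2) / p k"
      using p_pos[of k] by (intro divide_right_mono) auto
    also have "\<dots> = 1 / (p k * d (Suc k)) * trace_size (Suc k) u" by (simp only: t trace_size_def)
    also have "\<dots> \<le> rho k * trace_size (Suc k) u"
      using trace_size_nonneg by (intro mult_right_mono) auto
    finally show ?thesis .
  qed
  ultimately show ?thesis unfolding 0 using 1 by (simp add: distrib_left)
qed

lemma jump_bound_En:
  assumes "u \<in> Hk k" "u \<in> Hk (Suc k)"
  shows "Re (jk k u u) \<le> 2 * Kb * rho k * (En k u + En (Suc k) u)"
proof -
  have "2 * rho k * (trace_size k u + trace_size (Suc k) u) \<le> 2 * rho k * (Kb * En k u + Kb * En (Suc k) u)"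
    using rho_pos[of k] by (intro mult_left_mono add_mono trace_size_le) simp
  then show ?thesis using jump_bound[OF assms] by (simp add: algebra_simps)
qed

lemma rho_bounded: obtains R where "0 < R" "\<And>k. rho k \<le> R"
proof -
  have "Bseq rho" using rho_lim convergent_imp_Bseq convergentI by blast
  then obtain R where R: "0 < R" "\<forall>k. norm (rho k) \<le> R" unfolding Bseq_def by blast
  show ?thesis
  proof (rule that[OF R(1)])
    fix k show "rho k \<le> R" using R(2)[rule_format, of k] unfolding real_norm_def by (rule order_trans[OF abs_ge_self])
  qed
qed

text \<open>The ratio between the squared form norm and the sum of the cell energies: each energy
  enters two jump bounds, each with the factor \<open>2 * Kb * rho k\<close>.\<close>

definition K1 :: real where
  "K1 = (SOME K. 1 \<le> K \<and> (\<forall>k. 4 * Kb * rho k \<le> K - 1))"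

lemma K1: "1 \<le> K1" "4 * Kb * rho k \<le> K1 - 1"
proof -
  obtain R where R: "0 < R" "\<And>k. rho k \<le> R" using rho_bounded by blast
  have "1 \<le> 1 + 4 * Kb * R \<and> (\<forall>k. 4 * Kb * rho k \<le> (1 + 4 * Kb * R) - 1)"
    using R Kb_pos by (auto intro!: mult_left_mono)
  from someI[of "\<lambda>K. 1 \<le> K \<and> (\<forall>k. 4 * Kb * rho k \<le> K - 1)", OF this]
  show "1 \<le> K1" "4 * Kb * rho k \<le> K1 - 1" by (auto simp: K1_def)
qed

text \<open>Since \<open>rho\<close> is bounded, finite total cell energy forces finite jump energy.
  This is what allows cells to be modified independently of each other without leaving the form
  domain.\<close>

lemma D_I:
  assumes "u \<in> W" "summable (\<lambda>k. En k u)" shows "u \<in> D"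
proof -
  have u: "u \<in> Hk k" for k using assms(1) by (rule W_D)
  have "summable (\<lambda>k. Re (fk k u u))"
    by (rule summable_comparison_test'[OF assms(2), of 0]) (simp add: En_def fk_nonneg)
  then have "summable (\<lambda>k. complex_of_real (Re (fk k u u)))" by (simp only: summable_of_real)
  moreover have "complex_of_real (Re (fk k u u)) = fk k u u" for k
    using F.ip_Im[OF assms(1)] by (simp add: complex_eq_iff)
  ultimately have 1: "summable (\<lambda>k. fk k u u)" by simp
  have "summable (\<lambda>k. K1 * (En k u + En (Suc k) u))"
    using assms(2) summable_Suc_iff[of "\<lambda>k. En k u"] by (intro summable_mult summable_add) simp_all
  then have "summable (\<lambda>k. Re (jk k u u))"
  proof (rule summable_comparison_test'[of _ 0])
    fix k
    have "2 * Kb * rho k \<le> K1" using K1(2)[of k] Kb_pos rho_pos[of k] mult_pos_pos[OF Kb_pos rho_pos[of k]] by linarith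
    then have "2 * Kb * rho k * (En k u + En (Suc k) u) \<le> K1 * (En k u + En (Suc k) u)"
      using En_nonneg by (intro mult_right_mono add_nonneg_nonneg) auto
    then show "norm (Re (jk k u u)) \<le> K1 * (En k u + En (Suc k) u)"
      using jump_bound_En[OF u u, of k] J.ip_pos[OF assms(1), of k] by simp
  qed
  then have "summable (\<lambda>k. complex_of_real (Re (jk k u u)))" by (simp only: summable_of_real)
  moreover have "complex_of_real (Re (jk k u u)) = jk k u u" for k
    using J.ip_Im[OF assms(1)] by (simp add: complex_eq_iff)
  ultimately have 2: "summable (\<lambda>k. jk k u u)" by simp
  show ?thesis using assms(1) 1 2 by (simp add: D_eq)
qed

lemma En_sums: assumes "u \<in> D" shows "summable (\<lambda>k. En k u)"
  unfolding En_def using summable_Re[OF summable_fk[OF assms assms]] sums_summable[OF norm_cells[OF D_L2[OF assms]]]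
  by (rule summable_add)

lemma D1_nrm_power2:
  assumes "u \<in> D" shows "(D1.nrm u)\<^sup>2 = (\<Sum>k. En k u) + (\<Sum>k. Re (jk k u u))"
proof -
  have "(D1.nrm u)\<^sup>2 = Re (a u u) + (l2_norm M u)\<^sup>2"
    using assms by (simp add: D1.nrm_power2 l2_inner_self l2_norm_power2)
  also have "Re (a u u) = (\<Sum>k. Re (fk k u u)) + (\<Sum>k. Re (jk k u u))"
    using summable_fk[OF assms assms] summable_jk[OF assms assms] by (simp add: a_eq Re_suminf)
  also have "(l2_norm M u)\<^sup>2 = (\<Sum>k. (Nk k u)\<^sup>2)"
    using norm_cells[OF D_L2[OF assms]] by (simp add: sums_iff)
  finally show ?thesis
    using suminf_add[OF summable_Re[OF summable_fk[OF assms assms]] sums_summable[OF norm_cells[OF D_L2[OF assms]]]]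
    by (simp add: En_def)
qed

lemma jk_sum_le:
  assumes "u \<in> D" shows "0 \<le> (\<Sum>k. Re (jk k u u))" "(\<Sum>k. Re (jk k u u)) \<le> (K1 - 1) * (\<Sum>k. En k u)"
proof -
  have uW: "u \<in> W" using assms by (rule D_W)
  have u: "u \<in> Hk k" for k using uW by (rule W_D)
  have s: "summable (\<lambda>k. En k u)" "summable (\<lambda>k. En (Suc k) u)"
    using En_sums[OF assms] summable_Suc_iff[of "\<lambda>k. En k u"] by simp_all
  have sj: "summable (\<lambda>k. Re (jk k u u))" using summable_jk[OF assms assms] by (rule summable_Re)
  show "0 \<le> (\<Sum>k. Re (jk k u u))" using sj J.ip_pos[OF uW] by (rule suminf_nonneg)
  have "(\<Sum>k. Re (jk k u u)) \<le> (\<Sum>k. (K1 - 1) / 2 * (En k u + En (Suc k) u))"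
  proof (rule suminf_le[OF _ sj])
    fix k
    have "2 * Kb * rho k \<le> (K1 - 1) / 2" using K1(2)[of k] by simp
    then have "2 * Kb * rho k * (En k u + En (Suc k) u) \<le> (K1 - 1) / 2 * (En k u + En (Suc k) u)"
      using En_nonneg by (intro mult_right_mono add_nonneg_nonneg) auto
    then show "Re (jk k u u) \<le> (K1 - 1) / 2 * (En k u + En (Suc k) u)"
      using jump_bound_En[OF u u, of k] by linarith
  qed (intro summable_mult summable_add s)
  also have "\<dots> = (K1 - 1) / 2 * ((\<Sum>k. En k u) + (\<Sum>k. En (Suc k) u))"
    by (subst suminf_mult[OF summable_add[OF s]]) (simp add: suminf_add[OF s])
  also have "\<dots> \<le> (K1 - 1) / 2 * ((\<Sum>k. En k u) + (\<Sum>k. En k u))"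
  proof (intro mult_left_mono add_left_mono)
    show "(\<Sum>k. En (Suc k) u) \<le> (\<Sum>k. En k u)"
      using suminf_split_head[OF s(1)] En_nonneg[of 0 u] by simp
  qed (use K1(1) in simp)
  finally show "(\<Sum>k. Re (jk k u u)) \<le> (K1 - 1) * (\<Sum>k. En k u)" by simp
qed

lemma En_le_nrm: assumes "u \<in> D" shows "(\<Sum>k. En k u) \<le> (D1.nrm u)\<^sup>2"
  using D1_nrm_power2[OF assms] jk_sum_le(1)[OF assms] by linarith

lemma nrm_le_En: assumes "u \<in> D" shows "(D1.nrm u)\<^sup>2 \<le> K1 * (\<Sum>k. En k u)"
  using D1_nrm_power2[OF assms] jk_sum_le(2)[OF assms] by (simp add: algebra_simps)

lemma En_single_le: assumes "u \<in> D" shows "En k u \<le> (D1.nrm u)\<^sup>2"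
proof -
  have "En k u \<le> (\<Sum>k. En k u)"
    using sum_le_suminf[OF En_sums[OF assms], of "{k}"] En_nonneg by simp
  then show ?thesis using En_le_nrm[OF assms] by linarith
qed

lemma semi_inner_En: "semi_inner W (\<lambda>u v. fk k u v + l2_inner (Mk k) u v)"
proof (rule semi_inner_add[OF semi_inner_fk])
  show "semi_inner W (l2_inner (Mk k))"
    by (rule semi_inner_subset[OF semi_inner_L2]) (auto simp: W_zero W_add W_scale W_D L2_cell)
qed

sublocale E: semi_inner W "\<lambda>u v. fk k u v + l2_inner (Mk k) u v" for k by (rule semi_inner_En)

lemma E_nrm_power2: "u \<in> W \<Longrightarrow> (E.nrm k u)\<^sup>2 = En k u"
  by (simp add: E.nrm_power2 En_def l2_inner_self l2_norm_power2)

text \<open>The limit exists in \<open>L2\<close>, and by closedness in every single cell it is a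
  limit in each cell energy. The uniform bound over all cells follows by lower semicontinuity, and
  the jump part of the norm is dominated by the cell part.\<close>

lemma semi_hilbert_D1: "semi_hilbert D (\<lambda>u v. a u v + l2_inner M u v)"
proof
  fix f assume f: "\<And>n. f n \<in> D" and cau: "D1.cauchy_seq f"
  have fW: "f n \<in> W" for n using f by (rule D_W)
  have fL: "f n \<in> L2 M" for n using f by (rule D_L2)
  have cauchy_le: "\<exists>K. \<forall>m\<ge>K. \<forall>n\<ge>K. g (f m - f n) < e"
    if e: "0 < e" and g: "\<And>w. w \<in> D \<Longrightarrow> g w \<le> D1.nrm w" for g :: "(real \<Rightarrow> complex) \<Rightarrow> real" and e :: real
  proof -
    obtain K where K: "\<forall>m\<ge>K. \<forall>n\<ge>K. D1.nrm (f m - f n) < e" using cau e unfolding D1.cauchy_seq_def by blast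
    have "g (f m - f n) \<le> D1.nrm (f m - f n)" for m n using f by (intro g) simp
    then show ?thesis using K by (meson le_less_trans)
  qed
  have l2le: "l2_norm M w \<le> D1.nrm w" if "w \<in> D" for w
  proof -
    have "(l2_norm M w)\<^sup>2 \<le> (D1.nrm w)\<^sup>2"
      using A.ip_pos[OF that] that by (simp add: D1.nrm_power2 l2_inner_self l2_norm_power2)
    then show ?thesis using that by (intro power2_le_imp_le[of "l2_norm M w"]) simp_all
  qed
  have "L.cauchy_seq f" unfolding L.cauchy_seq_def nrm_L2 using cauchy_le[OF _ l2le] by blast
  then obtain u where u: "u \<in> L2 M" "(\<lambda>n. L.nrm (f n - u)) \<longlonglongrightarrow> 0" using L.complete[of f] fL by blast
  have Nlim: "(\<lambda>n. Nk k (f n - u)) \<longlonglongrightarrow> 0" for k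
  proof (rule Lim_null_comparison[OF _ u(2)])
    show "\<forall>\<^sub>F n in sequentially. norm (Nk k (f n - u)) \<le> L.nrm (f n - u)"
    proof (intro always_eventually allI)
      fix n
      have "f n - u \<in> L2 M" using fL u by simp
      from l2_norm_subset[OF this I_subset] have "(Nk k (f n - u))\<^sup>2 \<le> (l2_norm M (f n - u))\<^sup>2" by simp
      then have "Nk k (f n - u) \<le> l2_norm M (f n - u)" by (rule power2_le_imp_le) simp
      then show "norm (Nk k (f n - u)) \<le> L.nrm (f n - u)" by (simp add: nrm_L2)
    qed
  qed
  have wcau: "\<exists>K. \<forall>m\<ge>K. \<forall>n\<ge>K. Nk k (wdk k (f m - f n)) < e" if "0 < e" for k e
  proof (rule cauchy_le[OF that])
    fix w assume w: "w \<in> D"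
    have "(Nk k (wdk k w))\<^sup>2 \<le> En k w" using C.wd_le_form[of k w] by (simp add: En_def add_increasing2)
    also have "\<dots> \<le> (D1.nrm w)\<^sup>2" by (rule En_single_le[OF w])
    finally show "Nk k (wdk k w) \<le> D1.nrm w" using w by (intro power2_le_imp_le[of "Nk k (wdk k w)"]) simp_all
  qed
  have uk: "u \<in> Hk k" "(\<lambda>n. Nk k (wdk k (f n - u))) \<longlonglongrightarrow> 0" for k
    using C.H1_closed[of f k u, OF W_D(2)[OF fW] L2_cell[OF u(1)] Nlim wcau] by auto
  have uW: "u \<in> W" using u(1) uk(1) by (simp add: W_def)
  have Elim: "(\<lambda>n. E.nrm k (f n - u)) \<longlonglongrightarrow> 0" for k
  proof -
    let ?g = "\<lambda>n. (1 + 4 * d k / q k) * (Nk k (wdk k (f n - u)))\<^sup>2 + (16 / (d k * q k) + 1) * (Nk k (f n - u))\<^sup>2"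
    have "?g \<longlonglongrightarrow> (1 + 4 * d k / q k) * 0\<^sup>2 + (16 / (d k * q k) + 1) * 0\<^sup>2"
      by (intro tendsto_intros uk Nlim)
    then have "?g \<longlonglongrightarrow> 0" by simp
    moreover have "(E.nrm k (f n - u))\<^sup>2 \<le> ?g n" for n
    proof -
      have "f n - u \<in> W" using fW uW by (rule F.diff_mem)
      from C.form_le[OF W_D(2)[OF this], of k] E_nrm_power2[OF this, of k] show ?thesis
        by (simp add: En_def algebra_simps)
    qed
    ultimately have "(\<lambda>n. (E.nrm k (f n - u))\<^sup>2) \<longlonglongrightarrow> 0"
      by (intro Lim_null_comparison[of "\<lambda>n. (E.nrm k (f n - u))\<^sup>2" ?g] always_eventually) simp_all
    from tendsto_real_sqrt[OF this] show ?thesis using fW uW F.diff_mem by simp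
  qed
  \<comment> \<open>With finitely many cells the limit in \<open>m\<close> may be taken inside the
    sum; as the bound does not depend on \<open>K\<close>, it holds for the whole series.\<close>
  have tail: "(\<Sum>k<K. En k (f n - u)) \<le> e\<^sup>2" if n: "\<And>m. m \<ge> n0 \<Longrightarrow> D1.nrm (f n - f m) < e" for n n0 K e
  proof -
    have "(\<lambda>m. \<Sum>k<K. (E.nrm k (f n - f m))\<^sup>2) \<longlonglongrightarrow> (\<Sum>k<K. (E.nrm k (f n - u))\<^sup>2)"
    proof (intro tendsto_sum tendsto_power E.tendsto_nrm)
      fix k
      have "E.nrm k (f n - f m - (f n - u)) = E.nrm k (f m - u)" for m
        using E.nrm_minus_commute[of u "f m" k] uW fW by simp
      then show "(\<lambda>m. E.nrm k (f n - f m - (f n - u))) \<longlonglongrightarrow> 0" using Elim[of k] by simp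
    qed (use fW uW in simp_all)
    moreover have "(\<Sum>k<K. (E.nrm k (f n - f m))\<^sup>2) \<le> e\<^sup>2" if "m \<ge> n0" for m
    proof -
      have D: "f n - f m \<in> D" using f by simp
      have "(\<Sum>k<K. (E.nrm k (f n - f m))\<^sup>2) = (\<Sum>k<K. En k (f n - f m))" using D_W[OF D] by (simp add: E_nrm_power2)
      also have "\<dots> \<le> (\<Sum>k. En k (f n - f m))" by (intro sum_le_suminf En_sums[OF D]) (auto simp: En_nonneg)
      also have "\<dots> \<le> (D1.nrm (f n - f m))\<^sup>2" by (rule En_le_nrm[OF D])
      also have "\<dots> \<le> e\<^sup>2" using n[OF that] D by (intro power_mono) auto
      finally show ?thesis .
    qed
    ultimately have "(\<Sum>k<K. (E.nrm k (f n - u))\<^sup>2) \<le> e\<^sup>2"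
      by (intro LIMSEQ_le_const2) auto
    then show ?thesis using F.diff_mem[OF fW uW] by (simp add: E_nrm_power2)
  qed
  have main: "f n - u \<in> D \<and> (D1.nrm (f n - u))\<^sup>2 \<le> K1 * e\<^sup>2" if n: "\<And>m. m \<ge> n0 \<Longrightarrow> D1.nrm (f n - f m) < e" for n n0 e
  proof -
    have W: "f n - u \<in> W" using fW uW by (rule F.diff_mem)
    have tl: "(\<Sum>k<K. En k (f n - u)) \<le> e\<^sup>2" for K by (rule tail[OF n])
    have s: "summable (\<lambda>k. En k (f n - u))"
      by (rule bounded_imp_summable[of _ "e\<^sup>2"]) (simp_all only: En_nonneg tl flip: lessThan_Suc_atMost)
    have D: "f n - u \<in> D" by (rule D_I[OF W s])
    have "(\<Sum>k. En k (f n - u)) \<le> e\<^sup>2" by (rule suminf_le_const[OF s tl])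
    then have "K1 * (\<Sum>k. En k (f n - u)) \<le> K1 * e\<^sup>2" using K1(1) by (intro mult_left_mono) auto
    with nrm_le_En[OF D] D show ?thesis by linarith
  qed
  obtain n1 where n1: "\<And>m n. m \<ge> n1 \<Longrightarrow> n \<ge> n1 \<Longrightarrow> D1.nrm (f m - f n) < 1"
    using cau unfolding D1.cauchy_seq_def by (metis zero_less_one)
  \<comment> \<open>One index suffices to place \<open>u\<close> in the form domain:
    \<open>u\<close> is the difference of \<open>f n1\<close> and \<open>f n1 - u\<close>.\<close>
  have "f n1 - u \<in> D" using main[of n1 n1 1] n1 by simp
  then have "f n1 - (f n1 - u) \<in> D" using A.diff_mem[OF f] by blast
  moreover have "f n1 - (f n1 - u) = u" by (simp add: fun_eq_iff)
  ultimately have uD: "u \<in> D" by metis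
  have "(\<lambda>n. D1.nrm (f n - u)) \<longlonglongrightarrow> 0"
  proof (rule LIMSEQ_I)
    fix e :: real assume e: "0 < e"
    define e' where "e' = e / (2 * sqrt K1)"
    have K: "0 < sqrt K1" using K1(1) by simp
    have "0 < e'" using e K by (simp add: e'_def)
    then obtain n0 where n0: "\<forall>m\<ge>n0. \<forall>n\<ge>n0. D1.nrm (f m - f n) < e'" using cau unfolding D1.cauchy_seq_def by blast
    have "norm (D1.nrm (f n - u) - 0) < e" if "n \<ge> n0" for n
    proof -
      have D: "f n - u \<in> D" using f uD by simp
      have "(D1.nrm (f n - u))\<^sup>2 \<le> K1 * e'\<^sup>2" using main[of n0 n e'] n0 that by blast
      also have "\<dots> = (sqrt K1 * e')\<^sup>2" using K1(1) by (simp add: power_mult_distrib)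
      finally have "D1.nrm (f n - u) \<le> sqrt K1 * e'"
        using K \<open>0 < e'\<close> by (intro power2_le_imp_le[of "D1.nrm (f n - u)"]) simp_all
      also have "\<dots> < e" using K e by (simp add: e'_def)
      finally show ?thesis using D by simp
    qed
    then show "\<exists>no. \<forall>n\<ge>no. norm (D1.nrm (f n - u) - 0) < e" by blast
  qed
  with uD show "\<exists>u\<in>D. (\<lambda>n. D1.nrm (f n - u)) \<longlonglongrightarrow> 0" by blast
qed

sublocale S: L2_form M D a
proof -
  interpret H: semi_hilbert D "\<lambda>u v. a u v + l2_inner M u v" by (rule semi_hilbert_D1)
  show "L2_form M D a"
    by unfold_locales (simp_all add: D_L2 A.ip_pos)
qed

end

section \<open>Garding's inequality away from the accumulation points\<close>

text \<open>Decompose \<open>u\<close> into a constant, a multiple of \<open>\<phi>\<close> and a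
  rest \<open>w\<close>. The test function \<open>v\<close> changes the sign of the constant, whose
  energy \<open>0\<close> is below \<open>lam\<close>, and of \<open>\<phi>\<close> if
  \<open>s < lam\<close>; the rest lies above \<open>lam\<close> by
  \<open>third_eigenvalue_bound\<close>. Then all three parts contribute positively, and norm and
  energy of \<open>v\<close> equal those of \<open>u\<close>.\<close>

lemma (in cell) inf_sup_function:
  assumes \<phi>: "\<phi> \<in> H1 \<Omega>" "N \<phi> = 1" "\<And>v. v \<in> H1 \<Omega> \<Longrightarrow> form \<phi> v = complex_of_real s * l2_inner M \<phi> v"
    and s: "0 < s" "s < (pi / d)\<^sup>2"
    and l: "0 < lam" "0 < \<delta>" "\<delta> \<le> \<bar>s - lam\<bar>" "lam + \<delta> \<le> 16 / d\<^sup>2"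
    and u: "u \<in> H1 \<Omega>"
  obtains v where "v \<in> H1 \<Omega>" "N v = N u" "Re (form v v) = Re (form u u)"
    "min lam (\<delta> / (lam + \<delta> + 1)) * (Re (form u u) + (N u)\<^sup>2)
      \<le> Re (form u v - complex_of_real lam * l2_inner M u v)"
proof -
  let ?o = "\<lambda>x::real. 1::complex"
  have oH: "?o \<in> H1 \<Omega>" by (rule const_H1)
  have L: "\<phi> \<in> L2 M" "u \<in> L2 M" "?o \<in> L2 M" using \<phi> u oH by (auto intro: H1_L2)
  have \<phi>o: "l2_inner M \<phi> ?o = 0" using s by (intro eigenfunction_mean_zero[OF \<phi>(1,3)]) auto
  have o\<phi>: "l2_inner M ?o \<phi> = 0" using L.ip_cnj[OF L(1,3)] \<phi>o by simp
  have oo: "l2_inner M ?o ?o = complex_of_real d"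
    using l2_norm_const[of l r 1] lr by (simp add: l2_inner_self l2_norm_power2[symmetric] del: of_real_diff)
  have \<phi>\<phi>: "l2_inner M \<phi> \<phi> = 1" using L.ip_self[OF L(1)] \<phi>(2) by simp
  \<comment> \<open>The constant \<open>1\<close> has squared norm \<open>d\<close>, hence the
    division; \<open>\<phi>\<close> is normalised.\<close>
  define \<alpha> where "\<alpha> = l2_inner M u ?o / complex_of_real d"
  define \<beta> where "\<beta> = l2_inner M u \<phi>"
  define w where "w = u - (cscale \<alpha> ?o + cscale \<beta> \<phi>)"
  have wH: "w \<in> H1 \<Omega>" unfolding w_def by (intro F.diff_mem H1_add H1_scale u oH \<phi>)
  have wL: "w \<in> L2 M" by (rule H1_L2[OF wH])
  have d0: "complex_of_real d \<noteq> 0" using lr by (simp del: of_real_diff)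
  have wo: "l2_inner M w ?o = 0" using L d0 by (simp add: w_def L.ip_simps oo \<phi>o \<alpha>_def)
  have w\<phi>: "l2_inner M w \<phi> = 0" using L by (simp add: w_def L.ip_simps o\<phi> \<phi>\<phi> \<beta>_def)
  have ow: "l2_inner M ?o w = 0" using L.ip_cnj[OF wL L(3)] wo by simp
  have \<phi>w: "l2_inner M \<phi> w = 0" using L.ip_cnj[OF wL L(1)] w\<phi> by simp
  have third: "16 / d\<^sup>2 * (N w)\<^sup>2 \<le> Re (form w w)"
    by (rule third_eigenvalue_bound[OF \<phi> s wH wo w\<phi>])
  have fo: "form ?o v = 0" "form v ?o = 0" if "v \<in> H1 \<Omega>" for v
    using form_const[OF that] F.ip_cnj[OF oH that] by auto
  have f\<phi>w: "form \<phi> w = 0" using \<phi>(3)[OF wH] \<phi>w by simp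
  have fw\<phi>: "form w \<phi> = 0" using F.ip_cnj[OF \<phi>(1) wH] f\<phi>w by simp
  have f\<phi>\<phi>: "form \<phi> \<phi> = complex_of_real s" using \<phi>(3)[OF \<phi>(1)] \<phi>\<phi> by simp
  define y where "y c0 c1 = cscale c0 ?o + (cscale c1 \<phi> + w)" for c0 c1
  have yH: "y c0 c1 \<in> H1 \<Omega>" for c0 c1 unfolding y_def by (intro H1_add H1_scale oH \<phi> wH)
  have yi: "l2_inner M (y c0 c1) (y e0 e1) = c0 * cnj e0 * complex_of_real d + c1 * cnj e1 + complex_of_real ((N w)\<^sup>2)" for c0 c1 e0 e1
    using L wL L.ip_self[OF wL] unfolding y_def by (simp add: L.ip_simps oo o\<phi> \<phi>o \<phi>\<phi> wo w\<phi> ow \<phi>w)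
  have yf: "form (y c0 c1) (y e0 e1) = c1 * cnj e1 * complex_of_real s + form w w" for c0 c1 e0 e1
    using oH \<phi>(1) wH unfolding y_def by (simp add: F.ip_simps fo f\<phi>w fw\<phi> f\<phi>\<phi>)
  have yu: "u = y \<alpha> \<beta>" by (simp add: y_def w_def fun_eq_iff)
  define e :: real where "e = (if s < lam then -1 else 1)"
  define v where "v = y (- \<alpha>) (complex_of_real e * \<beta>)"
  have e2: "complex_of_real e * complex_of_real e = 1" by (simp add: e_def)
  have e_abs: "e * (s - lam) = \<bar>s - lam\<bar>" by (simp add: e_def)
  have N2: "(N z)\<^sup>2 = Re (l2_inner M z z)" for z by (simp add: l2_inner_self l2_norm_power2)
  have e\<beta>: "complex_of_real e * \<beta> * cnj (complex_of_real e * \<beta>) = \<beta> * cnj \<beta>"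
  proof -
    have "complex_of_real e * \<beta> * cnj (complex_of_real e * \<beta>) = (complex_of_real e * complex_of_real e) * (\<beta> * cnj \<beta>)"
      by (simp add: mult_ac)
    then show ?thesis unfolding e2 by simp
  qed
  have vN: "(N v)\<^sup>2 = (N u)\<^sup>2"
    unfolding N2 v_def yi yu e\<beta> by simp
  have vF: "form v v = form u u"
    unfolding v_def yf yu e\<beta> ..
  define A where "A = (cmod \<alpha>)\<^sup>2 * d"
  define B where "B = (cmod \<beta>)\<^sup>2"
  define P where "P = Re (form w w)"
  define Q where "Q = (N w)\<^sup>2"
  have ABPQ: "0 \<le> A" "0 \<le> B" "0 \<le> Q" "16 / d\<^sup>2 * Q \<le> P"
    using lr third by (simp_all add: A_def B_def P_def Q_def)
  have Bc: "\<beta> * cnj \<beta> = complex_of_real B" and Ac: "\<alpha> * cnj \<alpha> * complex_of_real d = complex_of_real A"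
    by (simp_all only: A_def B_def complex_norm_square of_real_mult)
  have Nu: "(N u)\<^sup>2 = A + B + Q"
    unfolding N2[of u] unfolding yu yi Ac Bc by (simp add: Q_def)
  have Fu: "Re (form u u) = B * s + P"
    unfolding yu yf Bc by (simp add: P_def)
  have iuv: "l2_inner M u v = complex_of_real (- A + e * B + Q)"
  proof -
    have "\<alpha> * cnj (- \<alpha>) * complex_of_real d = - complex_of_real A" using Ac by simp
    moreover have "\<beta> * cnj (complex_of_real e * \<beta>) = complex_of_real e * complex_of_real B" using Bc by (simp add: mult_ac)
    ultimately show ?thesis unfolding v_def yu yi by (simp add: Q_def)
  qed
  have fuv: "Re (form u v) = e * B * s + P"
  proof -
    have "\<beta> * cnj (complex_of_real e * \<beta>) = complex_of_real (e * B)" using Bc by (simp add: mult_ac)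
    then show ?thesis unfolding v_def yu yf by (simp only: of_real_mult[symmetric] plus_complex.sel Re_complex_of_real P_def)
  qed
  \<comment> \<open>A part of energy \<open>t\<close> contributes
    \<open>\<bar>t - lam\<bar> / (t + 1)\<close> relative to its form norm. This is
    \<open>lam\<close> at \<open>t = 0\<close>, and at least
    \<open>\<delta> / (lam + \<delta> + 1)\<close> whenever \<open>t\<close> has distance at least
    \<open>\<delta>\<close> from \<open>lam\<close>.\<close>
  define c0 where "c0 = min lam (\<delta> / (lam + \<delta> + 1))"
  have k: "0 < lam + \<delta> + 1" using l by simp
  have c0: "c0 \<le> lam" "c0 * (lam + \<delta> + 1) \<le> \<delta>" "0 < c0"
  proof -
    have "c0 * (lam + \<delta> + 1) \<le> \<delta> / (lam + \<delta> + 1) * (lam + \<delta> + 1)"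
      using k by (intro mult_right_mono) (simp_all add: c0_def)
    then show "c0 * (lam + \<delta> + 1) \<le> \<delta>" using k by simp
    show "c0 \<le> lam" by (simp add: c0_def)
    show "0 < c0" using l k by (simp add: c0_def)
  qed
  have c01: "c0 \<le> 1"
  proof (rule ccontr)
    assume "\<not> c0 \<le> 1"
    then have "1 * (lam + \<delta> + 1) \<le> c0 * (lam + \<delta> + 1)" using k by (intro mult_right_mono) auto
    then have "1 * (lam + \<delta> + 1) \<le> \<delta>" using c0(2) by (rule order_trans)
    then show False using l(1) by simp
  qed
  have 1: "c0 * A \<le> lam * A" using c0 ABPQ by (intro mult_right_mono) auto
  have 2: "c0 * (s + 1) \<le> \<bar>s - lam\<bar>"
  proof (cases "s < lam")
    case True
    then have "s \<le> lam - \<delta>" using l by simp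
    then have "c0 * (s + 1) \<le> c0 * (lam + \<delta> + 1)" using c0 l by (intro mult_left_mono) auto
    then show ?thesis using c0(2) l(3) by linarith
  next
    case False
    define t where "t = s - lam - \<delta>"
    have t: "0 \<le> t" "s = lam + \<delta> + t" using False l by (auto simp: t_def)
    have "c0 * (s + 1) = c0 * (lam + \<delta> + 1) + c0 * t" by (simp add: t(2) algebra_simps)
    also have "\<dots> \<le> \<delta> + 1 * t" using c0 c01 t by (intro add_mono mult_right_mono) auto
    finally show ?thesis using t l by simp
  qed
  have 3: "c0 * (P + Q) \<le> P - lam * Q"
  proof -
    have "(lam + \<delta>) * Q \<le> 16 / d\<^sup>2 * Q" using l ABPQ by (intro mult_right_mono) auto
    then have "(lam + \<delta>) * Q \<le> P" using ABPQ by linarith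
    then have "(1 - c0) * ((lam + \<delta>) * Q) \<le> (1 - c0) * P" using c01 by (intro mult_left_mono) auto
    moreover have "(c0 + lam) * Q \<le> (1 - c0) * (lam + \<delta>) * Q"
      using c0(2) ABPQ by (intro mult_right_mono) (auto simp: algebra_simps)
    ultimately show ?thesis by (simp add: algebra_simps)
  qed
  have "c0 * (Re (form u u) + (N u)\<^sup>2) = c0 * A + c0 * (s + 1) * B + c0 * (P + Q)"
    by (simp add: Nu Fu algebra_simps)
  also have "\<dots> \<le> lam * A + \<bar>s - lam\<bar> * B + (P - lam * Q)"
    using 1 mult_right_mono[OF 2 ABPQ(2)] 3 by (intro add_mono)
  also have "\<dots> = Re (form u v - complex_of_real lam * l2_inner M u v)"
    unfolding iuv e_abs[symmetric] using fuv by (simp add: algebra_simps)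
  finally have "c0 * (Re (form u u) + (N u)\<^sup>2) \<le> Re (form u v - complex_of_real lam * l2_inner M u v)" .
  moreover have "v \<in> H1 \<Omega>" unfolding v_def by (rule yH)
  moreover have "N v = N u" using vN by simp
  ultimately show ?thesis using that[of v] vF unfolding c0_def by simp
qed

context dprime
begin

lemma cell_norm_cong: "(\<And>y. y \<in> I k \<Longrightarrow> u y = v y) \<Longrightarrow> Nk k u = Nk k v"
  unfolding l2_norm_def by (intro arg_cong[where f = sqrt] Bochner_Integration.integral_cong) auto

lemma cell_inner_cong:
  "(\<And>y. y \<in> I k \<Longrightarrow> u y = u' y) \<Longrightarrow> (\<And>y. y \<in> I k \<Longrightarrow> v y = v' y) \<Longrightarrow> l2_inner (Mk k) u v = l2_inner (Mk k) u' v'"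
  unfolding l2_inner_def by (intro Bochner_Integration.integral_cong) auto

lemma glue_Hk: assumes "h k \<in> Hk k" shows "glue h \<in> Hk k"
  using C.H1_cong(1)[of k "glue h" "h k"] glue_eq assms by blast

lemma glue_En: assumes "h k \<in> Hk k" shows "En k (glue h) = En k (h k)"
proof -
  have "fk k (glue h) (glue h) = fk k (h k) (h k)"
    using glue_Hk[of h k] assms by (intro C.form_cong) (simp_all only: glue_eq)
  moreover have "Nk k (glue h) = Nk k (h k)" by (rule cell_norm_cong) (rule glue_eq)
  ultimately show ?thesis by (simp add: En_def)
qed

lemma glue_D:
  assumes h: "\<And>k. h k \<in> Hk k" and s: "summable (\<lambda>k. En k (h k))"
  shows "glue h \<in> D"
proof (rule D_I)
  have "summable (\<lambda>k. (Nk k (h k))\<^sup>2)"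
    by (rule summable_comparison_test'[OF s, of 0]) (simp add: En_def fk_nonneg)
  then have "glue h \<in> L2 M" by (intro glue_L2 C.H1_L2 h)
  then show "glue h \<in> W" using glue_Hk h by (simp add: W_def)
  show "summable (\<lambda>k. En k (glue h))" using s by (simp add: glue_En h)
qed

lemma jk_cs:
  assumes "u \<in> W" "v \<in> W"
  shows "\<bar>Re (jk k u v)\<bar> \<le> Kb * rho k * ((En k u + En (Suc k) u) + (En k v + En (Suc k) v))"
proof -
  have "\<bar>Re (jk k u v)\<bar> \<le> J.nrm k u * J.nrm k v" using assms by (rule J.cauchy_schwarz_Re)
  moreover have "2 * (J.nrm k u * J.nrm k v) \<le> (J.nrm k u)\<^sup>2 + (J.nrm k v)\<^sup>2"
    using sum_squares_bound[of "J.nrm k u" "J.nrm k v"] by simp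
  moreover have "(J.nrm k u)\<^sup>2 \<le> 2 * Kb * rho k * (En k u + En (Suc k) u)"
    using jump_bound_En[OF W_D(2)[OF assms(1)] W_D(2)[OF assms(1)]] assms(1) by (simp add: J.nrm_power2)
  moreover have "(J.nrm k v)\<^sup>2 \<le> 2 * Kb * rho k * (En k v + En (Suc k) v)"
    using jump_bound_En[OF W_D(2)[OF assms(2)] W_D(2)[OF assms(2)]] assms(2) by (simp add: J.nrm_power2)
  ultimately have "2 * \<bar>Re (jk k u v)\<bar> \<le> 2 * Kb * rho k * (En k u + En (Suc k) u) + 2 * Kb * rho k * (En k v + En (Suc k) v)"
    by linarith
  then show ?thesis by (simp add: algebra_simps)
qed

text \<open>In the finitely many near cells \<open>v = u\<close>, and the functionals compensate for
  the low part of \<open>u\<close>; in the far cells \<open>v\<close> comes from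
  \<open>inf_sup_function\<close>. A jump between near cells contributes with the good sign, and any
  other jump lies where \<open>rho\<close> is small compared with \<open>c0\<close>.\<close>

lemma garding_exists:
  assumes \<phi>: "\<And>k. \<phi> k \<in> Hk k" "\<And>k. Nk k (\<phi> k) = 1"
      "\<And>k v. v \<in> Hk k \<Longrightarrow> fk k (\<phi> k) v = complex_of_real (s k) * l2_inner (Mk k) (\<phi> k) v"
    and s: "\<And>k. 0 < s k" "\<And>k. s k < (pi / d k)\<^sup>2"
    and l: "0 < lam" "0 < \<delta>" "\<And>k. K0 \<le> k \<Longrightarrow> \<delta> \<le> \<bar>s k - lam\<bar>"
  shows "\<exists>(A :: (nat \<times> real \<times> real) set) \<psi> c C. S.garding lam A \<psi> c C"
proof -
  \<comment> \<open>\<open>1 / 2\<close> is the coercivity available in the near cells, the other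
    entry the one in the far cells.\<close>
  define c0 where "c0 = min (1 / 2) (min lam (\<delta> / (lam + \<delta> + 1)))"
  have c0: "0 < c0" "c0 \<le> 1 / 2" "c0 \<le> min lam (\<delta> / (lam + \<delta> + 1))"
    unfolding c0_def using l by (simp_all only: min.cobounded1 min.cobounded2) simp
  have "\<forall>\<^sub>F k in sequentially. rho k < c0 / (8 * Kb)"
    using order_tendstoD(2)[OF rho_lim, of "c0 / (8 * Kb)"] c0 Kb_pos by simp
  then obtain K2 where K2: "\<And>k. K2 \<le> k \<Longrightarrow> rho k < c0 / (8 * Kb)" by (auto simp only: eventually_sequentially)
  have "\<forall>\<^sub>F k in sequentially. d k < 4 / sqrt (lam + \<delta>)"
    using order_tendstoD(2)[OF d_lim, of "4 / sqrt (lam + \<delta>)"] l by simp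
  then obtain K3 where K3: "\<And>k. K3 \<le> k \<Longrightarrow> d k < 4 / sqrt (lam + \<delta>)" by (auto simp only: eventually_sequentially)
  \<comment> \<open>The additional \<open>1\<close> matters: the jump between the last near cell
    \<open>n - 1\<close> and the first far cell must already satisfy the smallness condition on
    \<open>rho\<close>.\<close>
  define n where "n = Suc (K0 + K2 + K3)"
  have tail_d: "lam + \<delta> \<le> 16 / (d k)\<^sup>2" if "n \<le> k" for k
  proof -
    have sq: "0 < sqrt (lam + \<delta>)" using l by simp
    have "d k < 4 / sqrt (lam + \<delta>)" using K3 that by (simp add: n_def)
    then have "sqrt (lam + \<delta>) * d k < 4" using sq by (simp add: field_simps)
    then have "(sqrt (lam + \<delta>) * d k)\<^sup>2 \<le> 4\<^sup>2" using sq d_pos[of k] by (intro power_mono) auto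
    then show ?thesis using l d_pos[of k] by (simp add: power_mult_distrib pos_le_divide_eq)
  qed
  \<comment> \<open>The factor \<open>2 * (lam + 1)\<close> lets half of the energy absorb
    \<open>lam * N^2\<close> and still leaves half of the full cell norm.\<close>
  have "\<exists>Q C. finite (Q :: (real \<times> real) set) \<and> 0 \<le> C \<and> (\<forall>a b. (a, b) \<in> Q \<longrightarrow> x k \<le> a \<and> a < b \<and> b \<le> x (Suc k)) \<and>
      (\<forall>u\<in>Hk k. 2 * (lam + 1) * (Nk k u)\<^sup>2 \<le> Re (fk k u u) + C * (\<Sum>(a, b)\<in>Q. (cmod (LINT y|lebesgue_on {a<..<b}. u y))\<^sup>2))" for k
    using C.compactness_estimate[of k "2 * (lam + 1)"] by metis
  then obtain Q Ck where Q: "\<And>k. finite (Q k :: (real \<times> real) set)" "\<And>k. 0 \<le> Ck k"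
      "\<And>k a b. (a, b) \<in> Q k \<Longrightarrow> x k \<le> a \<and> a < b \<and> b \<le> x (Suc k)"
      "\<And>k u. u \<in> Hk k \<Longrightarrow> 2 * (lam + 1) * (Nk k u)\<^sup>2 \<le> Re (fk k u u) + Ck k * (\<Sum>(a, b)\<in>Q k. (cmod (LINT y|lebesgue_on {a<..<b}. u y))\<^sup>2)"
    by metis
  define Cm where "Cm = (\<Sum>k<n. Ck k)"
  have Cm: "Ck k \<le> Cm" if "k < n" for k
    unfolding Cm_def by (rule member_le_sum) (use Q(2) that in auto)
  have Cm0: "0 \<le> Cm" unfolding Cm_def by (intro sum_nonneg Q)
  define Sk where "Sk k u = (if k < n then Cm * (\<Sum>(a, b)\<in>Q k. (cmod (LINT y|lebesgue_on {a<..<b}. u y))\<^sup>2) else 0)"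
    for k and u :: "real \<Rightarrow> complex"
  define A where "A = Sigma {..<n} Q"
  \<comment> \<open>The inner product with the indicator of a piece is the integral over that piece,
    so the functionals are of the form required by \<open>garding\<close>.\<close>
  define \<psi> where "\<psi> i = (\<lambda>y. if y \<in> {fst (snd i)<..<snd (snd i)} then 1 else 0 :: complex)" for i :: "nat \<times> real \<times> real"
  have finA: "finite A" using Q(1) by (simp add: A_def)
  have A_sub: "{a<..<b'} \<subseteq> {0<..<b}" if "(k, a, b') \<in> A" for k a b'
    using that Q(3)[of a b' k] x_nonneg[of k] x_le_b[of "Suc k"] by (auto simp: A_def)
  have \<psi>L: "\<psi> i \<in> L2 M" for i
  proof -
    have m: "\<psi> i \<in> borel_measurable M" unfolding \<psi>_def
      by (intro measurable_restrict_space1 borel_measurable_if_I) simp_all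
    have "integrable M (\<lambda>y. (cmod (\<psi> i y))\<^sup>2)"
      by (rule finite_measure.integrable_const_bound[OF finite_measure_ivl, of _ 1]) (use m in \<open>auto simp: \<psi>_def\<close>)
    with m show ?thesis by (simp add: L2_def)
  qed
  have \<psi>i: "l2_inner M u (\<psi> (k, a, b')) = (LINT y|lebesgue_on {a<..<b'}. u y)" if "(k, a, b') \<in> A" for u k a b'
  proof -
    have "l2_inner M u (\<psi> (k, a, b')) = (LINT y|M. (if y \<in> {a<..<b'} then u y else 0))"
      unfolding l2_inner_def \<psi>_def by (intro Bochner_Integration.integral_cong) auto
    also have "\<dots> = (LINT y|lebesgue_on {a<..<b'}. u y)"
      using A_sub[OF that] by (intro integral_restrict) auto
    finally show ?thesis .
  qed
  have sumS: "(\<Sum>k<n. Sk k u) = Cm * (\<Sum>i\<in>A. (cmod (l2_inner M u (\<psi> i)))\<^sup>2)" for u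
  proof -
    have "(\<Sum>i\<in>A. (cmod (l2_inner M u (\<psi> i)))\<^sup>2) = (\<Sum>(k, a, b')\<in>A. (cmod (LINT y|lebesgue_on {a<..<b'}. u y))\<^sup>2)"
      by (intro sum.cong) (auto simp: \<psi>i)
    also have "\<dots> = (\<Sum>k<n. \<Sum>(a, b')\<in>Q k. (cmod (LINT y|lebesgue_on {a<..<b'}. u y))\<^sup>2)"
      unfolding A_def using Q(1) by (subst sum.Sigma[symmetric]) (auto simp: case_prod_beta)
    finally show ?thesis by (simp add: Sk_def sum_distrib_left)
  qed
  have Sk0: "0 \<le> Sk k u" for k u
    unfolding Sk_def using Cm0 by (auto intro!: mult_nonneg_nonneg sum_nonneg)
  have cellwise: "\<exists>v. v \<in> Hk k \<and> Nk k v = Nk k u \<and> Re (fk k v v) = Re (fk k u u) \<and> (k < n \<longrightarrow> v = u) \<and>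
      c0 * En k u \<le> Re (fk k u v - complex_of_real lam * l2_inner (Mk k) u v) + Sk k u" if u: "u \<in> Hk k" for k u
  proof (cases "k < n")
    case True
    let ?T = "\<Sum>(a, b)\<in>Q k. (cmod (LINT y|lebesgue_on {a<..<b}. u y))\<^sup>2"
    have T0: "0 \<le> ?T" by (intro sum_nonneg) auto
    have "Ck k * ?T \<le> Cm * ?T" using Cm[OF True] T0 by (intro mult_right_mono)
    then have "2 * (lam + 1) * (Nk k u)\<^sup>2 \<le> Re (fk k u u) + Sk k u"
      using Q(4)[OF u] True by (simp add: Sk_def)
    moreover have "c0 * En k u \<le> 1 / 2 * En k u" using c0 En_nonneg by (intro mult_right_mono) auto
    moreover have "En k u = Re (fk k u u) + (Nk k u)\<^sup>2" by (simp add: En_def)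
    moreover have "Re (complex_of_real lam * l2_inner (Mk k) u u) = lam * (Nk k u)\<^sup>2"
      by (simp add: l2_inner_self l2_norm_power2)
    moreover have "2 * (lam + 1) * (Nk k u)\<^sup>2 = 2 * (lam * (Nk k u)\<^sup>2) + 2 * (Nk k u)\<^sup>2" by (simp add: algebra_simps)
    ultimately have "c0 * En k u \<le> Re (fk k u u - complex_of_real lam * l2_inner (Mk k) u u) + Sk k u"
      using Sk0[of k u] zero_le_power2[of "Nk k u"] unfolding minus_complex.sel by linarith
    then show ?thesis using u by blast
  next
    case False
    then have k: "n \<le> k" by simp
    then have "K0 \<le> k" by (simp add: n_def)
    obtain v where v: "v \<in> Hk k" "Nk k v = Nk k u" "Re (fk k v v) = Re (fk k u u)"
      "min lam (\<delta> / (lam + \<delta> + 1)) * (Re (fk k u u) + (Nk k u)\<^sup>2) \<le> Re (fk k u v - complex_of_real lam * l2_inner (Mk k) u v)"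
      using C.inf_sup_function[OF \<phi>(1)[of k] \<phi>(2)[of k] \<phi>(3)[of _ k] s(1)[of k] _ l(1,2) l(3)[OF \<open>K0 \<le> k\<close>] _ u] s(2)[of k] tail_d[OF k]
      unfolding x_diff by blast
    have "c0 * En k u \<le> min lam (\<delta> / (lam + \<delta> + 1)) * En k u" using c0(3) En_nonneg by (rule mult_right_mono)
    then have "c0 * En k u \<le> Re (fk k u v - complex_of_real lam * l2_inner (Mk k) u v) + Sk k u"
      using v(4) False by (simp add: En_def Sk_def)
    then show ?thesis using v False by blast
  qed
  have "S.garding lam A \<psi> (c0 / (2 * K1)) Cm"
    unfolding S.garding_def
  proof (intro conjI ballI)
    show "finite A" by (rule finA)
    show "0 < c0 / (2 * K1)" using c0 K1(1) by simp
    show "\<psi> i \<in> L2 M" for i by (rule \<psi>L)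
    fix u assume uD: "u \<in> D"
    have uW: "u \<in> W" by (rule D_W[OF uD])
    have uk: "u \<in> Hk k" for k by (rule W_D(2)[OF uW])
    have "\<forall>k. \<exists>v. v \<in> Hk k \<and> Nk k v = Nk k u \<and> Re (fk k v v) = Re (fk k u u) \<and> (k < n \<longrightarrow> v = u) \<and>
      c0 * En k u \<le> Re (fk k u v - complex_of_real lam * l2_inner (Mk k) u v) + Sk k u"
      using cellwise[OF uk] by blast
    then obtain h where h: "\<And>k. h k \<in> Hk k" "\<And>k. Nk k (h k) = Nk k u" "\<And>k. Re (fk k (h k) (h k)) = Re (fk k u u)"
      "\<And>k. k < n \<Longrightarrow> h k = u"
      "\<And>k. c0 * En k u \<le> Re (fk k u (h k) - complex_of_real lam * l2_inner (Mk k) u (h k)) + Sk k u" by metis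
    define v where "v = glue h"
    have Enh: "En k (h k) = En k u" for k using h(2,3)[of k] by (simp add: En_def)
    have vD: "v \<in> D" unfolding v_def by (rule glue_D[OF h(1)]) (simp add: Enh En_sums[OF uD])
    have vW: "v \<in> W" by (rule D_W[OF vD])
    have Env: "En k v = En k u" for k unfolding v_def using glue_En[of h k, OF h(1)] Enh[of k] by simp
    have fkv: "fk k u v = fk k u (h k)" for k
      unfolding v_def using glue_Hk[of h k] h(1) uk by (intro C.form_cong) (simp_all only: glue_eq)
    have ikv: "l2_inner (Mk k) u v = l2_inner (Mk k) u (h k)" for k
      unfolding v_def by (rule cell_inner_cong) (simp_all only: glue_eq)
    have Nv: "l2_norm M v = l2_norm M u"
    proof -
      have "Nk k v = Nk k u" for k
        unfolding v_def using cell_norm_cong[of k "glue h" "h k"] glue_eq h(2)[of k] by metis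
      then have "(l2_norm M v)\<^sup>2 = (l2_norm M u)\<^sup>2"
        using norm_cells[OF D_L2[OF vD]] norm_cells[OF D_L2[OF uD]] by (simp add: sums_unique2)
      then show ?thesis by simp
    qed
    \<comment> \<open>A coupling costs at most \<open>c0 / 4\<close> of the energy of either
      neighbouring cell. For equal traces the term is nonnegative; otherwise
      \<open>rho k < c0 / (8 * Kb)\<close> and the equality of the energies of \<open>u\<close> and
      \<open>v\<close> give the bound.\<close>
    have jump: "- (c0 / 4) * (En k u + En (Suc k) u) \<le> Re (jk k u v)" for k
    proof (cases "Suc k < n")
      case True
      have "v y = u y" if "y \<in> I k" for y unfolding v_def using glue_eq[OF that] h(4)[of k] True by simp
      then have "trace_left v (x (Suc k)) = trace_left u (x (Suc k))"
        using C.trace_cong(4)[of k v u] W_D(2)[OF vW] by blast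
      moreover have "v y = u y" if "y \<in> I (Suc k)" for y unfolding v_def using glue_eq[OF that] h(4)[of "Suc k"] True by simp
      then have "trace_right v (x (Suc k)) = trace_right u (x (Suc k))"
        using C.trace_cong(1)[of "Suc k" v u] W_D(2)[OF vW] by blast
      ultimately have "jk k u v = jk k u u" by (simp add: jk_def trace_jump_def)
      then have "0 \<le> Re (jk k u v)" using J.ip_pos[OF uW, of k] by simp
      moreover have "0 \<le> (c0 / 4) * (En k u + En (Suc k) u)" using c0 En_nonneg by (intro mult_nonneg_nonneg add_nonneg_nonneg) auto
      ultimately show ?thesis by linarith
    next
      case False
      then have "K2 \<le> k" by (simp add: n_def)
      then have "rho k \<le> c0 / (8 * Kb)" using K2[of k] less_imp_le by blast
      then have "Kb * rho k \<le> Kb * (c0 / (8 * Kb))" using Kb_pos by (intro mult_left_mono) auto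
      also have "Kb * (c0 / (8 * Kb)) = c0 / 8" using Kb_pos by simp
      finally have "Kb * rho k \<le> c0 / 8" .
      then have "Kb * rho k * ((En k u + En (Suc k) u) + (En k v + En (Suc k) v)) \<le> c0 / 8 * ((En k u + En (Suc k) u) + (En k v + En (Suc k) v))"
        using En_nonneg by (intro mult_right_mono add_nonneg_nonneg) auto
      also have "\<dots> = c0 / 4 * (En k u + En (Suc k) u)" by (simp add: Env)
      finally show ?thesis using jk_cs[OF uW vW, of k] by linarith
    qed
    have sE: "summable (\<lambda>k. En k u)" "summable (\<lambda>k. En (Suc k) u)"
      using En_sums[OF uD] summable_Suc_iff[of "\<lambda>k. En k u"] by simp_all
    let ?EE = "\<Sum>k. En k u"
    have shift: "(\<Sum>k. En (Suc k) u) \<le> ?EE"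
      using suminf_split_head[OF sE(1)] En_nonneg[of 0 u] by simp
    have sS: "summable (\<lambda>k. Sk k u)" by (rule summable_finite[of "{..<n}"]) (auto simp: Sk_def)
    have sumSk: "(\<Sum>k. Sk k u) = (\<Sum>k<n. Sk k u)" by (rule suminf_finite) (auto simp: Sk_def)
    define T where "T k = Re (fk k u v - complex_of_real lam * l2_inner (Mk k) u v) + Re (jk k u v)" for k
    have s1: "(\<lambda>k. fk k u v) sums (\<Sum>k. fk k u v)" by (rule summable_sums[OF summable_fk[OF uD vD]])
    have s2: "(\<lambda>k. jk k u v) sums (\<Sum>k. jk k u v)" by (rule summable_sums[OF summable_jk[OF uD vD]])
    have s3: "(\<lambda>k. l2_inner (Mk k) u v) sums l2_inner M u v" by (rule inner_cells[OF D_L2[OF uD] D_L2[OF vD]])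
    have "(\<lambda>k. Re ((fk k u v - complex_of_real lam * l2_inner (Mk k) u v) + jk k u v)) sums
        Re (((\<Sum>k. fk k u v) - complex_of_real lam * l2_inner M u v) + (\<Sum>k. jk k u v))"
      by (intro sums_Re sums_add sums_diff sums_mult s1 s2 s3)
    then have T: "T sums Re (a u v - complex_of_real lam * l2_inner M u v)"
      unfolding T_def[abs_def] a_eq by (simp add: algebra_simps)
    \<comment> \<open>Every cell has at most two neighbours, so the jumps take away at most
      \<open>c0 / 2\<close>, and half of the cellwise coercivity survives.\<close>
    define G where "G k = c0 * En k u - Sk k u + (- (c0 / 4)) * (En k u + En (Suc k) u)" for k
    have Gs: "summable G" unfolding G_def by (intro summable_add summable_diff summable_mult sE sS)
    have "(\<Sum>k. G k) = c0 * ?EE - (\<Sum>k. Sk k u) + (- (c0 / 4)) * (?EE + (\<Sum>k. En (Suc k) u))"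
      unfolding G_def
      by (simp only: suminf_add[symmetric] suminf_diff[symmetric] suminf_mult summable_add summable_diff summable_mult sE sS)
    moreover have "(c0 / 4) * (?EE + (\<Sum>k. En (Suc k) u)) \<le> (c0 / 4) * (?EE + ?EE)"
      using c0 shift by (intro mult_left_mono) auto
    ultimately have "c0 / 2 * ?EE - (\<Sum>k. Sk k u) \<le> (\<Sum>k. G k)" by (simp add: algebra_simps)
    also have "\<dots> \<le> (\<Sum>k. T k)"
    proof (rule suminf_le[OF _ Gs sums_summable[OF T]])
      fix k
      show "G k \<le> T k" using h(5)[of k] jump[of k] unfolding G_def T_def fkv ikv by linarith
    qed
    also have "\<dots> = Re (a u v - complex_of_real lam * l2_inner M u v)" using T by (simp add: sums_iff)
    finally have main: "c0 / 2 * ?EE \<le> Re (a u v - complex_of_real lam * l2_inner M u v) + Cm * (\<Sum>i\<in>A. (cmod (l2_inner M u (\<psi> i)))\<^sup>2)"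
      using sumSk sumS[of u] by linarith
    have "c0 / (2 * K1) * (D1.nrm u)\<^sup>2 \<le> c0 / (2 * K1) * (K1 * ?EE)"
      using nrm_le_En[OF uD] c0 K1(1) by (intro mult_left_mono) auto
    also have "\<dots> = c0 / 2 * ?EE" using K1(1) by simp
    finally show "\<exists>v\<in>D. L.nrm v \<le> L.nrm u \<and> c0 / (2 * K1) * (D1.nrm u)\<^sup>2
        \<le> Re (a u v - complex_of_real lam * l2_inner M u v) + Cm * (\<Sum>i\<in>A. (cmod (l2_inner M u (\<psi> i)))\<^sup>2)"
      using main vD Nv by (intro bexI[of _ v]) (simp_all add: nrm_L2)
  qed
  then show ?thesis by blast
qed

section \<open>Singular sequences at the accumulation points\<close>

text \<open>Tested with a form-domain function, an eigenfunction extended by zero leaves only the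
  error \<open>t k - lam\<close> and the jump terms at the ends of its cell. Cauchy-Schwarz for
  \<open>jk\<close> bounds each of these by a multiple of \<open>rho\<close> at the node: one factor
  \<open>sqrt (rho j)\<close> from either argument.\<close>

lemma essential_spectrum_accumulation:
  assumes \<psi>: "\<And>k. \<psi> k \<in> Hk k" "\<And>k. Nk k (\<psi> k) = 1"
      "\<And>k v. v \<in> Hk k \<Longrightarrow> fk k (\<psi> k) v = complex_of_real (t k) * l2_inner (Mk k) (\<psi> k) v"
    and t: "\<And>k. t k \<le> 16 / (d k)\<^sup>2" and l: "0 \<le> lam"
    and r: "strict_mono r" "(\<lambda>n. t (r n)) \<longlonglongrightarrow> lam"
  shows "complex_of_real lam \<in> essential_spectrum M (form_operator M D a)"
proof -
  define U where "U k = glue (\<lambda>j. if j = k then \<psi> k else 0)" for k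
  have U_same: "U k y = \<psi> k y" if "y \<in> I k" for k y using glue_eq[OF that] by (simp add: U_def)
  have U_other: "U k y = (0 :: real \<Rightarrow> complex) y" if "y \<in> I j" "j \<noteq> k" for j k y using glue_eq[OF that(1)] that(2) by (simp add: U_def)
  have pieces: "(if j = k then \<psi> k else 0) \<in> Hk j" for j k using \<psi>(1) C.H1_zero by auto
  have En0: "En j 0 = 0" for j using F.ip_zero[OF F.zero_mem] by (simp add: En_def l2_norm_def)
  have UD: "U k \<in> D" for k
    unfolding U_def
  proof (rule glue_D[OF pieces])
    show "summable (\<lambda>j. En j (if j = k then \<psi> k else 0))"
      by (rule summable_finite[of "{k}"]) (auto simp: En0)
  qed
  have UW: "U k \<in> W" for k by (rule D_W[OF UD])
  have UH: "U k \<in> Hk j" for j k by (rule W_D(2)[OF UW])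
  have fkU: "fk j (U k) v = (if j = k then complex_of_real (t k) * l2_inner (Mk k) (\<psi> k) v else 0)" if v: "v \<in> Hk j" for j k v
  proof (cases "j = k")
    case True
    then show ?thesis using C.form_cong[of k "U k" "\<psi> k" v v] U_same UH v \<psi>(3)[of v k] by simp
  next
    case False
    then have "fk j (U k) v = fk j 0 v" using U_other UH v by (intro C.form_cong) auto
    also have "\<dots> = 0" using C.F.ip_zero[OF v] .
    finally show ?thesis using False by simp
  qed
  have ikU: "l2_inner (Mk j) (U k) v = (if j = k then l2_inner (Mk k) (\<psi> k) v else 0)" if v: "v \<in> L2 (Mk j)" for j k v
  proof (cases "j = k")
    case True
    then show ?thesis using cell_inner_cong[of k "U k" "\<psi> k" v v] U_same by simp
  next
    case False
    then have "l2_inner (Mk j) (U k) v = l2_inner (Mk j) 0 v" using U_other by (intro cell_inner_cong) auto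
    also have "\<dots> = 0" by (simp add: l2_inner_def)
    finally show ?thesis using False by simp
  qed
  have iU: "l2_inner M (U k) v = l2_inner (Mk k) (\<psi> k) v" if v: "v \<in> D" for k v
  proof -
    have "(\<lambda>j. if j = k then l2_inner (Mk k) (\<psi> k) v else 0) sums l2_inner M (U k) v"
      using inner_cells[OF D_L2[OF UD] D_L2[OF v], of k] ikU L2_cell[OF D_L2[OF v]] by simp
    then show ?thesis using sums_single[of k "\<lambda>_. l2_inner (Mk k) (\<psi> k) v"] sums_unique2 by blast
  qed
  have aU: "(\<Sum>j. fk j (U k) v) = complex_of_real (t k) * l2_inner M (U k) v" if v: "v \<in> D" for k v
  proof -
    have "(\<lambda>j. fk j (U k) v) sums (complex_of_real (t k) * l2_inner (Mk k) (\<psi> k) v)"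
      using sums_single[of k "\<lambda>_. complex_of_real (t k) * l2_inner (Mk k) (\<psi> k) v"] fkU W_D(2)[OF D_W[OF v]] by simp
    then show ?thesis using iU[OF v] by (simp add: sums_iff)
  qed
  have orth: "l2_inner M (U i) (U j) = (if i = j then 1 else 0)" for i j
  proof (cases "i = j")
    case True
    have "l2_inner M (U i) (U i) = l2_inner (Mk i) (\<psi> i) (U i)" by (rule iU[OF UD])
    also have "\<dots> = l2_inner (Mk i) (\<psi> i) (\<psi> i)" by (rule cell_inner_cong) (simp_all add: U_same)
    also have "\<dots> = complex_of_real ((Nk i (\<psi> i))\<^sup>2)" unfolding l2_inner_self l2_norm_power2 ..
    finally show ?thesis using True \<psi>(2) by simp
  next
    case False
    have "l2_inner M (U i) (U j) = l2_inner (Mk i) (\<psi> i) (U j)" by (rule iU[OF UD])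
    also have "\<dots> = l2_inner (Mk i) (\<psi> i) 0" by (rule cell_inner_cong) (use U_other False in auto)
    finally show ?thesis using False by (simp add: l2_inner_def)
  qed
  \<comment> \<open>\<open>20 = 4 + 16\<close>: the norm is \<open>1\<close>, and the derivative
    part is at most \<open>(d k)^2 * t k \<le> 16\<close>.\<close>
  have tsU: "trace_size j (U k) \<le> (if j = k then 20 else 0)" for j k
  proof (cases "j = k")
    case True
    have N1: "Nk k (U k) = 1" using cell_norm_cong[of k "U k" "\<psi> k"] U_same \<psi>(2) by simp
    have "(Nk k (wdk k (U k)))\<^sup>2 \<le> Re (fk k (U k) (U k))" by (rule C.wd_le_form)
    also have "\<dots> = t k"
    proof -
      have "l2_inner (Mk k) (\<psi> k) (U k) = 1" using iU[OF UD, of k k] orth[of k k] by simp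
      then show ?thesis using fkU[OF UH, of k k] by simp
    qed
    finally have "(d k)\<^sup>2 * (Nk k (wdk k (U k)))\<^sup>2 \<le> (d k)\<^sup>2 * (16 / (d k)\<^sup>2)"
      using t[of k] by (intro mult_left_mono) auto
    then show ?thesis using True N1 d_pos[of k] by (simp add: trace_size_def)
  next
    case False
    have "Nk j (U k) = Nk j 0" using U_other False by (intro cell_norm_cong) auto
    then have N0: "Nk j (U k) = 0" by (simp add: l2_norm_def)
    have "(Nk j (wdk j (U k)))\<^sup>2 \<le> Re (fk j (U k) (U k))" by (rule C.wd_le_form)
    also have "\<dots> = 0" using fkU[OF UH, of j k] False by simp
    finally show ?thesis using False N0 by (simp add: trace_size_def)
  qed
  have JU: "(J.nrm j (U k))\<^sup>2 \<le> (if j = k \<or> Suc j = k then 40 * rho j else 0)" for j k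
  proof -
    have "(J.nrm j (U k))\<^sup>2 \<le> 2 * rho j * (trace_size j (U k) + trace_size (Suc j) (U k))"
      using jump_bound[OF UH UH] UW by (simp add: J.nrm_power2)
    also have "\<dots> \<le> 2 * rho j * ((if j = k then 20 else 0) + (if Suc j = k then 20 else 0))"
      using rho_pos[of j] by (intro mult_left_mono add_mono tsU) auto
    also have "\<dots> = (if j = k \<or> Suc j = k then 40 * rho j else 0)" by auto
    finally show ?thesis .
  qed
  \<comment> \<open>\<open>160 * Kb\<close> is the product of \<open>40\<close> from the bound for
    \<open>U k\<close> and \<open>4 * Kb\<close> from the bound for \<open>v\<close>.\<close>
  define C1 where "C1 = sqrt (160 * Kb)"
  have C1: "0 \<le> C1" using Kb_pos by (simp add: C1_def)
  have jU: "cmod (jk j (U k) v) \<le> C1 * rho j * D1.nrm v" if v: "v \<in> D" for j k v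
  proof -
    have vW: "v \<in> W" by (rule D_W[OF v])
    have "(J.nrm j v)\<^sup>2 \<le> 2 * Kb * rho j * (En j v + En (Suc j) v)"
      using jump_bound_En[OF W_D(2)[OF vW] W_D(2)[OF vW]] vW by (simp add: J.nrm_power2)
    also have "\<dots> \<le> 2 * Kb * rho j * ((D1.nrm v)\<^sup>2 + (D1.nrm v)\<^sup>2)"
      using Kb_pos rho_pos[of j] En_single_le[OF v] by (intro mult_left_mono add_mono) auto
    finally have 1: "(J.nrm j v)\<^sup>2 \<le> 4 * Kb * rho j * (D1.nrm v)\<^sup>2" by simp
    have 2: "(J.nrm j (U k))\<^sup>2 \<le> 40 * rho j" using JU[of j k] rho_pos[of j] by (auto split: if_splits)
    have "(J.nrm j (U k) * J.nrm j v)\<^sup>2 \<le> (40 * rho j) * (4 * Kb * rho j * (D1.nrm v)\<^sup>2)"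
      unfolding power_mult_distrib using 1 2 rho_pos[of j] by (intro mult_mono) auto
    also have "\<dots> = (C1 * rho j * D1.nrm v)\<^sup>2"
      using Kb_pos by (simp add: C1_def power_mult_distrib power2_eq_square)
    finally have "J.nrm j (U k) * J.nrm j v \<le> C1 * rho j * D1.nrm v"
      using C1 rho_pos[of j] v by (intro power2_le_imp_le[of "J.nrm j (U k) * J.nrm j v"] mult_nonneg_nonneg) auto
    then show ?thesis using J.cauchy_schwarz[OF UW vW, of j k] by linarith
  qed
  \<comment> \<open>\<open>jk j\<close> lives at the right end of cell \<open>j\<close>, so cell
    \<open>k\<close> meets only the indices \<open>k - 1\<close> and \<open>k\<close>.\<close>
  have jU0: "jk j (U k) v = 0" if v: "v \<in> D" and j: "j \<notin> {k - 1, k}" for j k v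
  proof -
    have "j \<noteq> k" "Suc j \<noteq> k" using j by auto
    then have "(J.nrm j (U k))\<^sup>2 \<le> 0" using JU[of j k] by simp
    then have "J.nrm j (U k) = 0" by simp
    then show ?thesis using J.cauchy_schwarz[OF UW D_W[OF v], of j k] by simp
  qed
  have est: "cmod (a (U k) v - complex_of_real lam * l2_inner M (U k) v)
      \<le> (\<bar>t k - lam\<bar> + C1 * (rho (k - 1) + rho k)) * D1.nrm v" if v: "v \<in> D" for k v
  proof -
    have "(\<Sum>j. jk j (U k) v) = (\<Sum>j\<in>{k - 1, k}. jk j (U k) v)"
      using jU0[OF v] by (intro suminf_finite) auto
    then have "cmod (\<Sum>j. jk j (U k) v) \<le> (\<Sum>j\<in>{k - 1, k}. cmod (jk j (U k) v))" by (simp only: norm_sum)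
    also have "\<dots> \<le> (\<Sum>j\<in>{k - 1, k}. C1 * rho j * D1.nrm v)" by (intro sum_mono jU v)
    also have "\<dots> \<le> C1 * rho (k - 1) * D1.nrm v + C1 * rho k * D1.nrm v"
    proof -
      have nn: "0 \<le> C1 * rho k * D1.nrm v" using C1 rho_pos[of k] v by (intro mult_nonneg_nonneg) auto
      show ?thesis
      proof (cases "k - 1 = k")
        \<comment> \<open>This is \<open>k = 0\<close>: truncated subtraction merges the two
          indices, because no interaction sits at the left end \<open>0\<close>.\<close>
        case True
        have "{k - 1, k} = {k}" using True by simp
        then have "(\<Sum>j\<in>{k - 1, k}. C1 * rho j * D1.nrm v) = C1 * rho k * D1.nrm v" by (simp only: sum.insert finite.emptyI empty_iff not_False_eq_True sum.empty add_0_right)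
        then show ?thesis using nn True by (simp only: le_add_same_cancel1)
      next
        case False
        then have "(\<Sum>j\<in>{k - 1, k}. C1 * rho j * D1.nrm v) = C1 * rho (k - 1) * D1.nrm v + C1 * rho k * D1.nrm v"
          by (subst sum.insert) (simp_all only: finite.intros singleton_iff not_False_eq_True sum.insert empty_iff sum.empty add_0_right)
        then show ?thesis by (simp only: order_refl)
      qed
    qed
    finally have 1: "cmod (\<Sum>j. jk j (U k) v) \<le> C1 * (rho (k - 1) + rho k) * D1.nrm v" by (simp add: algebra_simps)
    have "cmod (l2_inner M (U k) v) \<le> L.nrm (U k) * L.nrm v"
      using D_L2[OF UD] D_L2[OF v] by (rule L.cauchy_schwarz)
    also have "L.nrm (U k) = 1" using orth[of k k] by (simp add: L.nrm_def)
    also have "1 * L.nrm v \<le> D1.nrm v"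
    proof -
      have "(L.nrm v)\<^sup>2 \<le> (D1.nrm v)\<^sup>2"
        using A.ip_pos[OF v] v D_L2[OF v] by (simp add: D1.nrm_power2 L.nrm_power2)
      then have "L.nrm v \<le> D1.nrm v" using v by (intro power2_le_imp_le[of "L.nrm v"]) simp_all
      then show ?thesis by simp
    qed
    finally have 2: "cmod (l2_inner M (U k) v) \<le> D1.nrm v" .
    have "a (U k) v - complex_of_real lam * l2_inner M (U k) v
        = complex_of_real (t k - lam) * l2_inner M (U k) v + (\<Sum>j. jk j (U k) v)"
      using aU[OF v, of k] by (simp add: a_eq algebra_simps)
    then have "cmod (a (U k) v - complex_of_real lam * l2_inner M (U k) v)
        \<le> \<bar>t k - lam\<bar> * cmod (l2_inner M (U k) v) + cmod (\<Sum>j. jk j (U k) v)"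
      using norm_triangle_ineq[of "complex_of_real (t k - lam) * l2_inner M (U k) v" "\<Sum>j. jk j (U k) v"]
      by (simp only: norm_mult norm_of_real)
    moreover have "\<bar>t k - lam\<bar> * cmod (l2_inner M (U k) v) \<le> \<bar>t k - lam\<bar> * D1.nrm v"
      using 2 by (rule mult_left_mono) simp
    ultimately show ?thesis using 1 by (simp add: distrib_right)
  qed
  let ?\<epsilon> = "\<lambda>n. \<bar>t (r n) - lam\<bar> + C1 * (rho (r n - 1) + rho (r n))"
  show ?thesis
  proof (rule S.essential_spectrum_singular_sequence[of "\<lambda>n. U (r n)" lam ?\<epsilon>])
    show "U (r n) \<in> D" for n by (rule UD)
    show "l2_inner M (U (r m)) (U (r n)) = (if m = n then 1 else 0)" for m n
      using orth strict_mono_eq[OF r(1)] by simp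
    show "0 \<le> lam" by (rule l)
    show "cmod (a (U (r n)) v - complex_of_real lam * l2_inner M (U (r n)) v) \<le> ?\<epsilon> n * D1.nrm v" if "v \<in> D" for n v
      by (rule est[OF that])
    show "0 \<le> ?\<epsilon> n" for n
      using C1 rho_pos[of "r n"] rho_pos[of "r n - 1"] by (intro add_nonneg_nonneg mult_nonneg_nonneg) auto
    have rt: "filterlim r sequentially sequentially" by (rule filterlim_subseq[OF r(1)])
    have rt1: "filterlim (\<lambda>n. r n - 1) sequentially sequentially"
      using filterlim_compose[OF filterlim_minus_const_nat_at_top rt] by simp
    have "(\<lambda>n. rho (r n)) \<longlonglongrightarrow> 0" "(\<lambda>n. rho (r n - 1)) \<longlonglongrightarrow> 0"
      using filterlim_compose[OF rho_lim rt] filterlim_compose[OF rho_lim rt1] by simp_all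
    then have "?\<epsilon> \<longlonglongrightarrow> \<bar>lam - lam\<bar> + C1 * (0 + 0)"
      by (intro tendsto_intros r)
    then show "?\<epsilon> \<longlonglongrightarrow> 0" by simp
  qed
qed

end

section \<open>From accumulation points to the essential spectrum\<close>

lemma not_accumulation_point:
  assumes "l \<notin> accumulation_points s"
  obtains \<delta> n where "0 < \<delta>" "\<And>k. n \<le> k \<Longrightarrow> \<delta> \<le> \<bar>s k - l\<bar>"
proof (rule ccontr)
  note witness = that
  assume neg: "\<not> thesis"
  have *: "\<exists>k\<ge>n. \<bar>s k - l\<bar> < e" if "0 < e" for e n
  proof (rule ccontr)
    assume "\<not> (\<exists>k\<ge>n. \<bar>s k - l\<bar> < e)"
    then have "\<And>k. n \<le> k \<Longrightarrow> e \<le> \<bar>s k - l\<bar>" by (meson not_le)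
    with witness[OF \<open>0 < e\<close>] neg show False by blast
  qed
  \<comment> \<open>Otherwise terms arbitrarily close to \<open>l\<close> occur arbitrarily late,
    and dependent choice assembles them into a subsequence converging to \<open>l\<close>.\<close>
  have "\<exists>r. \<forall>n. \<bar>s (r n) - l\<bar> < 1 / real (Suc n) \<and> r n < r (Suc n)"
  proof (rule dependent_nat_choice)
    show "\<exists>k. \<bar>s k - l\<bar> < 1 / real (Suc 0)" using *[of 1 0] by auto
    show "\<exists>k. \<bar>s k - l\<bar> < 1 / real (Suc (Suc n)) \<and> m < k" for m n
      using *[of "1 / real (Suc (Suc n))" "Suc m"] by (auto simp: Suc_le_eq)
  qed
  then obtain r where r: "\<And>n. \<bar>s (r n) - l\<bar> < 1 / real (Suc n)" "\<And>n. r n < r (Suc n)" by blast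
  have "strict_mono r" using r(2) by (simp add: strict_mono_Suc_iff)
  moreover have "(s \<circ> r) \<longlonglongrightarrow> l"
  proof -
    have "(\<lambda>n. s (r n) - l) \<longlonglongrightarrow> 0"
    proof (rule Lim_null_comparison)
      show "\<forall>\<^sub>F n in sequentially. norm (s (r n) - l) \<le> 1 / real (Suc n)"
        using r(1) by (intro always_eventually) (simp add: less_imp_le)
      show "(\<lambda>n. 1 / real (Suc n)) \<longlonglongrightarrow> 0" by (intro LIMSEQ_Suc lim_1_over_n)
    qed
    then show ?thesis by (simp add: LIM_zero_iff o_def)
  qed
  ultimately show False using assms by (auto simp: accumulation_points_def)
qed

theorem theorem3p3:
  fixes S :: "real set" and s d p q :: "nat \<Rightarrow> real"
  assumes "closed S" and "S \<subseteq> {0..}" and "0 \<in> S"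
    and "\<And>k. 0 < s k"
    and "accumulation_points s = (if 0 isolated_in S then S - {0} else S)"
    and "\<And>k. 0 < d k"
    and "\<And>k. s k < (pi / d k)\<^sup>2"
    and "summable d"
    and "\<And>k. 0 < q k"
    and "\<And>k. is_nth_eigenvalue (lebesgue_on {node d k<..<node d (Suc k)})
               (cell_operator (q k) (node d k) (node d (Suc k))) 2 (s k)"
    and "\<And>k. 0 < p k"
    and "(\<lambda>k. max (1 / (p k * d k)) (1 / (p k * d (Suc k)))) \<longlonglongrightarrow> 0"
  shows "essential_spectrum (lebesgue_on {0<..<right_end d}) (dprime_operator d p q)
           = complex_of_real ` S"
proof -
  interpret dprime d p q
    by unfold_locales (fact assms)+
  have "\<exists>\<phi>. \<phi> \<in> Hk k \<and> Nk k \<phi> = 1 \<and> (\<forall>v\<in>Hk k. fk k \<phi> v = complex_of_real (s k) * l2_inner (Mk k) \<phi> v)" for k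
    using C.eigenfunction_exists[OF assms(10)[of k]] by metis
  then obtain \<phi> where \<phi>: "\<And>k. \<phi> k \<in> Hk k" "\<And>k. Nk k (\<phi> k) = 1"
    "\<And>k v. v \<in> Hk k \<Longrightarrow> fk k (\<phi> k) v = complex_of_real (s k) * l2_inner (Mk k) (\<phi> k) v" by metis
  have acc: "accumulation_points s \<subseteq> S" using assms(5) by (auto split: if_splits)
  show ?thesis
    unfolding dprime_operator_def
  proof (intro equalityI subsetI)
    fix z assume z: "z \<in> essential_spectrum M (form_operator M D a)"
    then have "\<not> (Im z \<noteq> 0 \<or> Re z < 0)" using S.not_essential_spectrum_outside by blast
    then have zr: "z = complex_of_real (Re z)" "0 \<le> Re z" by (auto simp: complex_eq_iff)
    have "Re z \<in> S"
    proof (rule ccontr)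
      assume nS: "Re z \<notin> S"
      \<comment> \<open>Because \<open>0\<close> belongs to \<open>S\<close>, a point outside
        \<open>S\<close> is strictly positive, as the sign reversal on the constants
        demands.\<close>
      then have "0 < Re z" using zr(2) assms(3) by (cases "Re z = 0") auto
      have "Re z \<notin> accumulation_points s" using nS acc by blast
      then obtain \<delta> n where \<delta>: "0 < \<delta>" "\<And>k. n \<le> k \<Longrightarrow> \<delta> \<le> \<bar>s k - Re z\<bar>"
        using not_accumulation_point by metis
      obtain A :: "(nat \<times> real \<times> real) set" and \<psi> c C where "S.garding (Re z) A \<psi> c C"
        using garding_exists[OF \<phi> assms(4,7) \<open>0 < Re z\<close> \<delta>] by blast
      from S.not_essential_spectrum_garding[OF this] z zr(1) show False by simp
    qed
    then show "z \<in> complex_of_real ` S" using zr(1) by blast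
  next
    fix z assume "z \<in> complex_of_real ` S"
    then obtain l where l: "l \<in> S" "z = complex_of_real l" by blast
    have l0: "0 \<le> l" using l(1) assms(2) by auto
    show "z \<in> essential_spectrum M (form_operator M D a)"
    proof (cases "l = 0")
      case True
      \<comment> \<open>The normalised constants are eigenfunctions of all cells for the eigenvalue
        \<open>0\<close>, so every cell contributes and the whole sequence is singular.\<close>
      define \<psi> where "\<psi> k = cscale (complex_of_real (1 / sqrt (d k))) (\<lambda>x::real. 1)" for k
      have H: "(\<lambda>x. 1) \<in> Hk k" for k by (rule C.const_H1)
      have "complex_of_real 0 \<in> essential_spectrum M (form_operator M D a)"
      proof (rule essential_spectrum_accumulation[of \<psi> "\<lambda>_. 0" 0 id])
        show "\<psi> k \<in> Hk k" for k unfolding \<psi>_def by (intro C.H1_scale H)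
        show "Nk k (\<psi> k) = 1" for k
        proof -
          have "(Nk k (\<lambda>x. 1))\<^sup>2 = d k" using l2_norm_const[of "x k" "x (Suc k)" 1] x_less[of k] by simp
          then have "Nk k (\<lambda>x. 1) = sqrt (d k)" by (metis l2_norm_nonneg real_sqrt_unique)
          moreover have "cmod (complex_of_real (1 / sqrt (d k))) = 1 / sqrt (d k)"
            unfolding norm_of_real using d_pos[of k] by simp
          ultimately show ?thesis
            using C.L.nrm_scale[OF C.H1_L2[OF H], of k "complex_of_real (1 / sqrt (d k))"] d_pos[of k]
            unfolding \<psi>_def nrm_L2 by simp
        qed
        show "fk k (\<psi> k) v = complex_of_real 0 * l2_inner (Mk k) (\<psi> k) v" if "v \<in> Hk k" for k v
          unfolding \<psi>_def using C.F.ip_scale[OF H that] C.form_const[OF that] by simp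
        show "0 \<le> 16 / (d k)\<^sup>2" for k by simp
      qed (simp_all add: strict_mono_def)
      then show ?thesis using True l(2) by simp
    next
      case False
      \<comment> \<open>For \<open>l\<close> different from \<open>0\<close> both cases of the
        hypothesis on the accumulation points agree.\<close>
      then have "l \<in> accumulation_points s" using l(1) assms(5) by (auto split: if_splits)
      then obtain r where r: "strict_mono r" "(s \<circ> r) \<longlonglongrightarrow> l" by (auto simp: accumulation_points_def)
      have "s k \<le> 16 / (d k)\<^sup>2" for k
      proof -
        have "(pi / d k)\<^sup>2 \<le> (4 / d k)\<^sup>2"
          using d_pos[of k] pi_less_4 by (intro power_mono divide_right_mono) auto
        then show ?thesis using assms(7)[of k] by (simp add: power_divide)
      qed
      then show ?thesis
        unfolding l(2) using essential_spectrum_accumulation[OF \<phi> _ l0 r(1)] r(2) by (simp add: o_def)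
    qed
  qed
qed

end
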